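(* Let $\mathcal{L}\subset\operatorname{Lip}_1(\mathbb{R})$ be a monoidal family with $\mathcal{TB}\subset\mathcal{L}$. Then the closure of $\Pi^{\mathcal{L}}_\circ:=\{\mathcal{P}_{\mathcal{D}^{\mathcal{L}}_\circ(X)}: X\in\mathcal{X}\}$ in $(\Pi_{\mathcal{L}},\rho)$ provides a compactification (via the map $Y\mapsto\mathcal{P}_Y$) of $(\mathcal{D}^{\mathcal{L}}_\circ(\mathcal{X}),d_{\mathrm{conc}})$, where $\mathcal{D}^{\mathcal{L}}_\circ(\mathcal{X}):=\{\mathcal{D}^{\mathcal{L}}_\circ(X): X\in\mathcal{X}\}$.
   Context: mm-spaces: an mm-space is a triple $(X,d_X,\mu_X)$ with $(X,d_X)$ a complete separable metric space and $\mu_X$ a Borel probability measure with full support; $\mathcal{X}$ is the set of isomorphism classes of mm-spaces. For an mm-space $X$, $\mathcal{D}^{\mathcal{L}}_\circ(X):=(X,\{x\mapsto p(d_X(x,y)): p\in\mathcal{L},\ y\in X\},\mu_X)$, which is an $\mathcal{L}$-compact geometric data set. A compactification of a metric space $A$ is a compact space together with a topological embedding of $A$ with dense image. Geometric data sets: a geometric data set is a triple $X=(X,F_X,\mu_X)$ where $F_X$ is a nonempty set of real-valued functions on $X$ such that $d_X(x,y):=\sup_{f\in F_X}|f(x)-f(y)|$ is a complete separable metric on $X$, and $\mu_X$ is a Borel probability measure with full support on $(X,d_X)$. $\overline{F_X}$ denotes the closure of $F_X$ under pointwise convergence. $X$ and $Y$ are isomorphic if there is a bijection $\varphi:X\to Y$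 with $\varphi_*\mu_X=\mu_Y$ and $\overline{F_Y}\circ\varphi=\overline{F_X}$; $\mathcal{D}$ is the set of isomorphism classes. Domination: $Y\preceq X$ if there is a domination $f:X\to Y$, i.e. a Borel measurable map with $f_*\mu_X=\mu_Y$ and $F_Y\circ f\subset\overline{F_X}$. Ky Fan metric: $d_{\mathrm{KF}}^\mu(f,g):=\inf\{\epsilon\ge 0: \mu(\{|f-g|>\epsilon\})\le\epsilon\}$; $d_{\mathrm{KF}}^X:=d_{\mathrm{KF}}^{\mu_X}$. $U(A,\epsilon;d)$ is the open $\epsilon$-neighborhood of $A$; $d_{\mathrm{H}}$ is the Hausdorff distance induced by $d$. Observable distance: $d_{\mathrm{conc}}(X,Y):=\inf (d_{\mathrm{KF}}^\lambda)_{\mathrm{H}}(F_X\circ\varphi,F_Y\circ\psi)$, where $\lambda$ is Lebesgue measure on $[0,1]$ and $\varphi:[0,1]\to X$, $\psi:[0,1]\to Y$ run over Borel maps with $\varphi_*\lambda=\mu_X$, $\psi_*\lambda=\mu_Y$. Box distance: $\Pi(\mu_X,\mu_Y)$ is the set of couplings; $d_\infty^S(f,g):=\sup_{S}|f-g|$; $$\Box(X,Y)=\min_{\pi\in\Pi(\mu_X,\mu_Y),\ S}\max\{1-\pi(S),\,2(d_\infty^S)_{\mathrm{H}}(\overline{F_X}\circ\mathrm{pr}_1,\overline{F_Y}\circ\mathrm{pr}_2)\},$$ where $S$ runs over nonempty closed subsets of $X\times Y$. $\Box_{\mathrm{H}}$ is the Hausdorff distance on subsets of $(\mathcal{D},\Box)$.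 Monoidal and $\mathcal{L}$-compact: $\operatorname{Lip}_1(\mathbb{R})$ is the set of 1-Lipschitz functions $\mathbb{R}\to\mathbb{R}$. $\mathcal{L}$ is monoidal if it contains $\mathrm{id}_{\mathbb{R}}$ and is closed under composition and pointwise convergence on $\mathbb{R}$. $\mathcal{TB}:=\{x\mapsto \max\{l,\min\{x+c,u\}\}: c\in\mathbb{R},\ l\in[-\infty,+\infty),\ u\in(-\infty,+\infty],\ l\le u\}$. $\mathcal{L}\circ F:=\{p\circ f: p\in\mathcal{L}, f\in F\}$. $\operatorname{Cov}(F,\epsilon;\mathcal{L}):=\inf\{\#\mathcal{N}: \mathcal{N}\subset F\text{ finite}, F\subset U(\mathcal{L}\circ\mathcal{N},\epsilon;d_{\mathrm{KF}}^X)\}$ for $F\subset\overline{F_X}$. $X$ is $\mathcal{L}$-compact if $\mathcal{L}\circ\overline{F_X}\subset\overline{F_X}$ and $\operatorname{Cov}(\overline{F_X},\epsilon;\mathcal{L})<\infty$ for every $\epsilon>0$. $\mathcal{D}/\mathcal{L}$ is the set of isomorphism classes of $\mathcal{L}$-compact geometric data sets. $\mathcal{L}$-pyramids: $\mathcal{P}\subset\mathcal{D}/\mathcal{L}$ is an $\mathcal{L}$-pyramid if (1) for $X\in\mathcal{D}/\mathcal{L}$ and $Y\in\mathcal{P}$, $X\preceq Y$ implies $X\in\mathcal{P}$; (2) for $X,Y\in\mathcal{P}$ there is $Z\in\mathcal{P}$ with $X\preceq Z$, $Y\preceq Z$; (3) $\mathcal{P}$ is nonempty and $\Box$-closed. $\Pi_{\mathcal{L}}$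 is the set of all $\mathcal{L}$-pyramids; for $X\in\mathcal{D}/\mathcal{L}$, $\mathcal{P}_X:=\{Y\in\mathcal{D}/\mathcal{L}:Y\preceq X\}\in\Pi_{\mathcal{L}}$. Quotients and truncation: for $G\subset\overline{F_X}$ nonempty, the quotient $X/G$ is the geometric data set $Y$, unique up to isomorphism, admitting a domination $\phi:X\to Y$ with $F_Y\circ\phi=G$ such that for any domination $\psi:X\to Z$ with $F_Z\circ\psi\subset\overline{G}$ there is a unique domination $\psi':Y\to Z$ with $\psi'\circ\phi=\psi$. For $p\in\operatorname{Lip}_1(\mathbb{R})$, $p\circ X:=(X,\operatorname{Lip}_1(X,d_X),\mu_X)/(p\circ F_X)$, where $\operatorname{Lip}_1(X,d_X)$ is the set of 1-Lipschitz functions $X\to\mathbb{R}$. $b_R(x):=\max\{-R,\min\{x,R\}\}$. Measurements and $\rho$: $\mathcal{DM}(N):=\{X\in\mathcal{D}:\#F_X\le N\}$; $\mathcal{DM}(X;N):=\{Y\in\mathcal{DM}(N):Y\preceq X\}$; $\mathcal{DM}(X;N,R):=\{b_R\circ Y:Y\in\mathcal{DM}(X;N)\}$; $\mathcal{DM}(\mathcal{E};N,R):=\bigcup_{X\in\mathcal{E}}\mathcal{DM}(X;N,R)$. The metric $\rho$ on $\Pi_{\mathcal{L}}$ is $\rho(\mathcal{P},\mathcal{Q}):=\sum_{N=1}^\infty\frac{1}{2N\cdot2^N}\Box_{\mathrm{H}}(\mathcal{DM}(\mathcal{P};N,N),\mathcal{DM}(\mathcal{Q};N,N))$. *)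

theory Defs
  imports "HOL-Probability.Probability"
begin

section \<open>Metrics, closures, distances between functions\<close>

text \<open>
  Functions on a carrier \<open>X\<close> are represented by their unique extension in
  \<^term>\<open>extensional X\<close>, so that equality and cardinality of sets of functions are the intended ones.
\<close>

definition pw_closure :: "'a set \<Rightarrow> ('a \<Rightarrow> real) set \<Rightarrow> ('a \<Rightarrow> real) set" where
  "pw_closure X F = (product_topology (\<lambda>_. euclideanreal) X) closure_of F"

definition pullback :: "'a set \<Rightarrow> ('b \<Rightarrow> real) set \<Rightarrow> ('a \<Rightarrow> 'b) \<Rightarrow> ('a \<Rightarrow> real) set" where
  "pullback A F h = (\<lambda>f. compose A f h) ` F"

definition postcomp :: "'a set \<Rightarrow> (real \<Rightarrow> real) set \<Rightarrow> ('a \<Rightarrow> real) set \<Rightarrow> ('a \<Rightarrow> real) set" where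
  "postcomp X L F = {compose X p f | p f. p \<in> L \<and> f \<in> F}"

definition Lip1_on :: "'a set \<Rightarrow> ('a \<Rightarrow> 'a \<Rightarrow> real) \<Rightarrow> ('a \<Rightarrow> real) set" where
  "Lip1_on X d = {f \<in> extensional X. \<forall>x\<in>X. \<forall>y\<in>X. \<bar>f x - f y\<bar> \<le> d x y}"

definition d_KF :: "'a measure \<Rightarrow> ('a \<Rightarrow> real) \<Rightarrow> ('a \<Rightarrow> real) \<Rightarrow> real" where
  "d_KF M f g = Inf {\<epsilon>. 0 \<le> \<epsilon> \<and> measure M {x \<in> space M. \<bar>f x - g x\<bar> > \<epsilon>} \<le> \<epsilon>}"

definition d_sup :: "'a set \<Rightarrow> ('a \<Rightarrow> real) \<Rightarrow> ('a \<Rightarrow> real) \<Rightarrow> ennreal" where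
  "d_sup S f g = (SUP x\<in>S. ennreal \<bar>f x - g x\<bar>)"

definition open_nbhd :: "('a \<Rightarrow> 'a \<Rightarrow> real) \<Rightarrow> 'a set \<Rightarrow> real \<Rightarrow> 'a set" where
  "open_nbhd d A \<epsilon> = {x. \<exists>a\<in>A. d x a < \<epsilon>}"

text \<open>
  The Hausdorff distance takes values in \<open>[0,\<infinity>]\<close>: the distance
  \<^const>\<open>d_sup\<close> may be infinite, and so may be the box distance of two geometric data sets.
\<close>

definition hausdorff_dist :: "('a \<Rightarrow> 'a \<Rightarrow> ennreal) \<Rightarrow> 'a set \<Rightarrow> 'a set \<Rightarrow> ennreal" where
  "hausdorff_dist d A B = max (SUP a\<in>A. INF b\<in>B. d a b) (SUP b\<in>B. INF a\<in>A. d a b)"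


section \<open>mm-spaces\<close>

datatype 'a mmspace = MM (mm_pts: "'a set") (mm_dist: "'a \<Rightarrow> 'a \<Rightarrow> real") (mm_meas: "'a measure")

text \<open>
  The locale \<^locale>\<open>Metric_space\<close> asks for nonnegativity and symmetry of \<open>d\<close> on the
  whole type; off the carrier this is only a convention about irrelevant values.
\<close>

definition is_mm :: "'a mmspace \<Rightarrow> bool" where
  "is_mm X \<longleftrightarrow> (case X of MM P d M \<Rightarrow>
     Metric_space P d \<and> Metric_space.mcomplete P d \<and>
     separable_space (Metric_space.mtopology P d) \<and>
     space M = P \<and> sets M = sigma_sets P {U. openin (Metric_space.mtopology P d) U} \<and>
     prob_space M \<and>
     (\<forall>U. openin (Metric_space.mtopology P d) U \<and> U \<noteq> {} \<longrightarrow> measure M U > 0))"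


section \<open>Geometric data sets\<close>

datatype 'a gds = GDS (pts: "'a set") (feat: "('a \<Rightarrow> real) set") (meas: "'a measure")

text \<open>
  The value \<open>0\<close> off the carrier is needed for \<^const>\<open>Metric_space\<close>, which requires
  nonnegativity everywhere.
\<close>

definition feat_dist :: "'a set \<Rightarrow> ('a \<Rightarrow> real) set \<Rightarrow> 'a \<Rightarrow> 'a \<Rightarrow> real" where
  "feat_dist P F x y = (if x \<in> P \<and> y \<in> P then (SUP f\<in>F. \<bar>f x - f y\<bar>) else 0)"

abbreviation gdist :: "'a gds \<Rightarrow> 'a \<Rightarrow> 'a \<Rightarrow> real" where
  "gdist X \<equiv> feat_dist (pts X) (feat X)"

abbreviation gtop :: "'a gds \<Rightarrow> 'a topology" where
  "gtop X \<equiv> Metric_space.mtopology (pts X) (gdist X)"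

abbreviation feat_cl :: "'a gds \<Rightarrow> ('a \<Rightarrow> real) set" where
  "feat_cl X \<equiv> pw_closure (pts X) (feat X)"

definition is_gds :: "'a gds \<Rightarrow> bool" where
  "is_gds X \<longleftrightarrow>
     feat X \<noteq> {} \<and> feat X \<subseteq> extensional (pts X) \<and>
     (\<forall>x\<in>pts X. \<forall>y\<in>pts X. bdd_above ((\<lambda>f. \<bar>f x - f y\<bar>) ` feat X)) \<and>
     is_mm (MM (pts X) (gdist X) (meas X))"

definition iso_gds :: "'a gds \<Rightarrow> 'b gds \<Rightarrow> bool" where
  "iso_gds X Y \<longleftrightarrow> (\<exists>\<phi>. bij_betw \<phi> (pts X) (pts Y) \<and> \<phi> \<in> measurable (meas X) (meas Y) \<and>
     distr (meas X) (meas Y) \<phi> = meas Y \<and> pullback (pts X) (feat_cl Y) \<phi> = feat_cl X)"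

definition domination :: "'a gds \<Rightarrow> 'b gds \<Rightarrow> ('a \<Rightarrow> 'b) \<Rightarrow> bool" where
  "domination X Y f \<longleftrightarrow> f \<in> extensional (pts X) \<and> f \<in> measurable (meas X) (meas Y) \<and>
     distr (meas X) (meas Y) f = meas Y \<and> pullback (pts X) (feat Y) f \<subseteq> feat_cl X"

definition dominated :: "'b gds \<Rightarrow> 'a gds \<Rightarrow> bool" where
  "dominated Y X \<longleftrightarrow> (\<exists>f. domination X Y f)"

definition unit_leb :: "real measure" where
  "unit_leb = restrict_space lborel {0..1}"

definition params :: "'a gds \<Rightarrow> (real \<Rightarrow> 'a) set" where
  "params X = {\<phi> \<in> measurable unit_leb (meas X). distr unit_leb (meas X) \<phi> = meas X}"

definition d_conc :: "'a gds \<Rightarrow> 'b gds \<Rightarrow> real" where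
  "d_conc X Y = enn2real (INF \<phi>\<in>params X. INF \<psi>\<in>params Y.
     hausdorff_dist (\<lambda>f g. ennreal (d_KF unit_leb f g))
       (pullback {0..1} (feat X) \<phi>) (pullback {0..1} (feat Y) \<psi>))"

definition couplings :: "'a measure \<Rightarrow> 'b measure \<Rightarrow> ('a \<times> 'b) measure set" where
  "couplings M N = {\<pi>. sets \<pi> = sets (M \<Otimes>\<^sub>M N) \<and> distr \<pi> M fst = M \<and> distr \<pi> N snd = N}"

definition box_dist :: "'a gds \<Rightarrow> 'b gds \<Rightarrow> ennreal" where
  "box_dist X Y = (INF \<pi>\<in>couplings (meas X) (meas Y).
     INF S\<in>{S. S \<noteq> {} \<and> closedin (prod_topology (gtop X) (gtop Y)) S}.
       max (ennreal (1 - measure \<pi> S))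
           (2 * hausdorff_dist (d_sup S)
              (pullback (pts X \<times> pts Y) (feat_cl X) fst)
              (pullback (pts X \<times> pts Y) (feat_cl Y) snd)))"


section \<open>Isomorphism classes\<close>

text \<open>
  A complete separable metric space has at most the cardinality of the continuum, so every
  geometric data set and every mm-space is isomorphic to one whose points are real numbers
  (with an arbitrary metric, unrelated to the one of the real line). The set of isomorphism
  classes is therefore formed from data sets over the type \<^typ>\<open>real\<close>.
\<close>

lemma separable_metric_inj_real:
  fixes M :: "'a set" and d :: "'a \<Rightarrow> 'a \<Rightarrow> real"
  assumes "Metric_space M d" and "separable_space (Metric_space.mtopology M d)"
  shows "\<exists>f::'a \<Rightarrow> real. inj_on f M"
proof -
  interpret Metric_space M d by fact
  obtain C where C: "countable C" "C \<subseteq> M" "mtopology closure_of C = M"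
    using assms(2) unfolding separable_space_def by auto
  define g where "g x = {prod_encode (i, n) | i n. from_nat_into C i \<in> C \<and>
    d x (from_nat_into C i) < 1 / real (Suc n)}" for x
  have "inj_on g M"
  proof (rule inj_onI, rule ccontr)
    fix x y assume xy: "x \<in> M" "y \<in> M" "g x = g y" "x \<noteq> y"
    then have "d x y > 0" by simp
    then obtain n where n: "1 / real (Suc n) < d x y / 2"
      by (meson half_gt_zero nat_approx_posE)
    have "x \<in> mtopology closure_of C" using C xy by simp
    then have "\<forall>r>0. \<exists>c\<in>C. c \<in> mball x r"
      by (simp add: metric_closure_of)
    then have "\<exists>c\<in>C. c \<in> mball x (1 / real (Suc n))"
      by (rule allE[of _ "1 / real (Suc n)"]) simp
    then obtain c where c: "c \<in> C" "d x c < 1 / real (Suc n)"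
      by auto
    obtain i where i: "from_nat_into C i = c"
      using from_nat_into_surj[OF C(1) c(1)] by blast
    have "prod_encode (i, n) \<in> g x" using c i unfolding g_def by fastforce
    then have "prod_encode (i, n) \<in> g y" using xy by simp
    then have "d y c < 1 / real (Suc n)" using i unfolding g_def by auto
    moreover have "d x y \<le> d x c + d c y" using c C xy by (intro triangle) auto
    ultimately show False using n c commute[of y c] by linarith
  qed
  moreover obtain h :: "nat set \<Rightarrow> real" where "inj h"
    using nat_sets_eqpoll_reals by (auto simp: eqpoll_def bij_betw_def)
  ultimately have "inj_on (h \<circ> g) M"
    by (meson comp_inj_on inj_on_subset subset_UNIV)
  then show ?thesis by blast
qed

type_synonym gds_class = "real gds set"

definition iso_class :: "'a gds \<Rightarrow> gds_class" where
  "iso_class X = {Y. is_gds Y \<and> iso_gds X Y}"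

text \<open>
  Notions on classes are evaluated on a representative; domination, the box distance and the
  observable distance do not depend on its choice.
\<close>

definition rep :: "gds_class \<Rightarrow> real gds" where
  "rep A = (SOME X. X \<in> A)"

definition DD :: "gds_class set" where
  "DD = iso_class ` {X :: real gds. is_gds X}"

definition dom_cls :: "gds_class \<Rightarrow> gds_class \<Rightarrow> bool" (infix \<open>\<preceq>\<close> 50) where
  "B \<preceq> A \<longleftrightarrow> dominated (rep B) (rep A)"

definition box_cls :: "gds_class \<Rightarrow> gds_class \<Rightarrow> ennreal" where
  "box_cls A B = box_dist (rep A) (rep B)"

definition d_conc_cls :: "gds_class \<Rightarrow> gds_class \<Rightarrow> real" where
  "d_conc_cls A B = d_conc (rep A) (rep B)"


section \<open>Monoidal families and \<open>L\<close>-compactness\<close>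

definition Lip1_real :: "(real \<Rightarrow> real) set" where
  "Lip1_real = {p. 1-lipschitz_on UNIV p}"

text \<open>The topology of the type \<^typ>\<open>real \<Rightarrow> real\<close> is that of pointwise convergence.\<close>

definition monoidal :: "(real \<Rightarrow> real) set \<Rightarrow> bool" where
  "monoidal L \<longleftrightarrow> (\<lambda>x. x) \<in> L \<and> (\<forall>p\<in>L. \<forall>q\<in>L. p \<circ> q \<in> L) \<and> closed L"

definition TB :: "(real \<Rightarrow> real) set" where
  "TB = {\<lambda>x. real_of_ereal (max l (min (ereal (x + c)) u)) | c l u. l < \<infinity> \<and> - \<infinity> < u \<and> l \<le> u}"

definition Cov :: "'a gds \<Rightarrow> ('a \<Rightarrow> real) set \<Rightarrow> real \<Rightarrow> (real \<Rightarrow> real) set \<Rightarrow> enat" where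
  "Cov X F \<epsilon> L = (INF N\<in>{N. finite N \<and> N \<subseteq> F \<and>
      F \<subseteq> open_nbhd (d_KF (meas X)) (postcomp (pts X) L N) \<epsilon>}. enat (card N))"

definition L_compact :: "(real \<Rightarrow> real) set \<Rightarrow> 'a gds \<Rightarrow> bool" where
  "L_compact L X \<longleftrightarrow> postcomp (pts X) L (feat_cl X) \<subseteq> feat_cl X \<and>
     (\<forall>\<epsilon>>0. Cov X (feat_cl X) \<epsilon> L < \<infinity>)"

definition DL :: "(real \<Rightarrow> real) set \<Rightarrow> gds_class set" where
  "DL L = iso_class ` {X :: real gds. is_gds X \<and> L_compact L X}"

definition mm_gds :: "(real \<Rightarrow> real) set \<Rightarrow> 'a mmspace \<Rightarrow> 'a gds" where
  "mm_gds L X = GDS (mm_pts X)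
     {\<lambda>x\<in>mm_pts X. p (mm_dist X x y) | p y. p \<in> L \<and> y \<in> mm_pts X} (mm_meas X)"

definition Dcirc :: "(real \<Rightarrow> real) set \<Rightarrow> gds_class set" where
  "Dcirc L = {iso_class (mm_gds L X) | X :: real mmspace. is_mm X}"


section \<open>Pyramids\<close>

definition box_closed :: "gds_class set \<Rightarrow> bool" where
  "box_closed P \<longleftrightarrow> (\<forall>A\<in>DD. (\<forall>\<epsilon>>0. \<exists>B\<in>P. box_cls A B < \<epsilon>) \<longrightarrow> A \<in> P)"

definition is_pyramid :: "(real \<Rightarrow> real) set \<Rightarrow> gds_class set \<Rightarrow> bool" where
  "is_pyramid L P \<longleftrightarrow> P \<subseteq> DL L \<and>
     (\<forall>A\<in>DL L. \<forall>B\<in>P. A \<preceq> B \<longrightarrow> A \<in> P) \<and>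
     (\<forall>A\<in>P. \<forall>B\<in>P. \<exists>C\<in>P. A \<preceq> C \<and> B \<preceq> C) \<and>
     P \<noteq> {} \<and> box_closed P"

definition pyramids :: "(real \<Rightarrow> real) set \<Rightarrow> gds_class set set" where
  "pyramids L = {P. is_pyramid L P}"

definition pyramid_of :: "(real \<Rightarrow> real) set \<Rightarrow> gds_class \<Rightarrow> gds_class set" where
  "pyramid_of L A = {B \<in> DL L. B \<preceq> A}"


section \<open>Quotients, measurements and the metric on pyramids\<close>

definition is_quotient :: "real gds \<Rightarrow> (real \<Rightarrow> real) set \<Rightarrow> real gds \<Rightarrow> bool" where
  "is_quotient X G Y \<longleftrightarrow> is_gds Y \<and>
     (\<exists>\<phi>. domination X Y \<phi> \<and> pullback (pts X) (feat Y) \<phi> = G \<and>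
        (\<forall>(Z :: real gds) \<psi>. is_gds Z \<and> domination X Z \<psi> \<and>
             pullback (pts X) (feat Z) \<psi> \<subseteq> pw_closure (pts X) G \<longrightarrow>
           (\<exists>!\<psi>'. domination Y Z \<psi>' \<and> compose (pts X) \<psi>' \<phi> = \<psi>)))"

definition quotient_gds :: "real gds \<Rightarrow> (real \<Rightarrow> real) set \<Rightarrow> gds_class" where
  "quotient_gds X G = iso_class (SOME Y. is_quotient X G Y)"

definition comp_cls :: "(real \<Rightarrow> real) \<Rightarrow> gds_class \<Rightarrow> gds_class" where
  "comp_cls p A = (let X = rep A in
     quotient_gds (GDS (pts X) (Lip1_on (pts X) (gdist X)) (meas X)) (postcomp (pts X) {p} (feat X)))"

definition trunc :: "real \<Rightarrow> real \<Rightarrow> real" where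
  "trunc R x = max (- R) (min x R)"

definition DM :: "nat \<Rightarrow> gds_class set" where
  "DM N = {A \<in> DD. finite (feat (rep A)) \<and> card (feat (rep A)) \<le> N}"

definition DM_of :: "gds_class \<Rightarrow> nat \<Rightarrow> gds_class set" where
  "DM_of A N = {B \<in> DM N. B \<preceq> A}"

definition DM_trunc :: "gds_class set \<Rightarrow> nat \<Rightarrow> real \<Rightarrow> gds_class set" where
  "DM_trunc E N R = (\<Union>A\<in>E. comp_cls (trunc R) ` DM_of A N)"

definition rho :: "gds_class set \<Rightarrow> gds_class set \<Rightarrow> real" where
  "rho P Q = enn2real (\<Sum>n. let N = Suc n in
     ennreal (1 / (2 * real N * 2 ^ N)) *
       hausdorff_dist box_cls (DM_trunc P N (real N)) (DM_trunc Q N (real N)))"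


section \<open>Compactifications\<close>

definition compactification :: "'a set \<Rightarrow> ('a \<Rightarrow> 'a \<Rightarrow> real) \<Rightarrow> 'b topology \<Rightarrow> ('a \<Rightarrow> 'b) \<Rightarrow> bool" where
  "compactification A d T e \<longleftrightarrow> Metric_space A d \<and> compact_space T \<and>
     embedding_map (Metric_space.mtopology A d) T e \<and> T closure_of (e ` A) = topspace T"

end

theory Submission
 imports Defs "HOL-Library.Diagonal_Subsequence"
begin

text \<open>A data set is encoded by the set of all sequences of random variables on the unit interval
having the law of a sequence of its features; a pyramid is encoded by the union of these sets over its
members. For pyramids, closeness in \<open>rho\<close> means that each sequence of one is, after truncation and a
measure preserving rearrangement of the interval, close in measure on finitely many coordinates to a
sequence of the other. Quantising the truncated coordinates leaves finitely many types of laws at each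
level, so a diagonal argument yields limits, and the data sets all of whose feature sequences are limits
form a pyramid: hence \<open>pyramids L\<close> is compact. Convergence of \<open>pyramid_of L A\<close> to \<open>pyramid_of L B\<close>
turns into mutual approximation of finitely many features; a maximal packing of the bounded features
then shows that this amounts to convergence in the observable distance.\<close>


section \<open>The unit interval as a standard probability space\<close>

text \<open>Joint laws take the place of couplings and of maps between data sets: in a complete data
  set the points are recovered from the values of a dense sequence of features, so domination,
  quotients and realisation reduce to equality of laws. Equal laws on the interval can be rearranged
  into each other only approximately, hence every comparison is of the form \<open>apx N e\<close>.
  The delicate point is to control all features by finitely many. Translations and truncations lie
  in \<open>L\<close> because \<open>TB <= L\<close>: a feature, centred at a base point and
  truncated, falls into a set totally bounded in measure, and the centring constant is restored
  afterwards. This yields the finite nets behind box-closedness and behind the observable distance.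
  For the latter the packing is chosen in the fixed data set, and its maximal cardinality is what
  carries over to a nearby one; no compactness estimate for the varying data set enters.
  Directedness of the limit has an obstacle of its own: two limit sequences have no joint law. One
  is produced by compactness from approximants that live in a common member.\<close>

abbreviation "leb \<equiv> unit_leb"

lemma space_unit_leb [simp]: "space leb = {0..1}"
 by (simp add: unit_leb_def space_restrict_space)

lemma sets_unit_leb: "sets leb = sets (restrict_space borel {0..1})"
 by (simp add: unit_leb_def sets_restrict_space)

lemma sets_unit_lebI [intro]: "A : sets borel ==> A <= {0..1} ==> A : sets leb"
 by (auto simp: sets_unit_leb sets_restrict_space)

lemma emeasure_unit_leb: "A : sets borel ==> A <= {0..1} ==> emeasure leb A = emeasure lborel A"
 unfolding unit_leb_def by (rule emeasure_restrict_space) auto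

lemma measure_unit_leb: "A : sets borel ==> A <= {0..1} ==> measure leb A = measure lborel A"
 by (simp add: measure_def emeasure_unit_leb)

interpretation leb: prob_space leb
proof
 show "emeasure leb (space leb) = 1"
  by (subst emeasure_unit_leb) auto
qed

lemma borel_measurable_ident_unit [intro, simp]: "(%x. x) : borel_measurable leb"
 unfolding unit_leb_def by (rule measurable_restrict_space1) auto

text \<open>Invertibility is not asked for: alignments below always rearrange only the second of two
  sequences.\<close>

definition unit_mp :: "(real => real) => bool" where
 "unit_mp \<tau> \<longleftrightarrow> \<tau> : measurable leb leb & distr leb leb \<tau> = leb"

lemma unit_mp_measurable: "unit_mp \<tau> ==> \<tau> : measurable leb leb"
 by (simp add: unit_mp_def)

lemma unit_mp_space: "unit_mp \<tau> ==> t : {0..1} ==> \<tau> t : {0..1}"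
 using measurable_space[OF unit_mp_measurable, of \<tau> t] by simp

lemma unit_mp_id: "unit_mp (%x. x)"
 unfolding unit_mp_def by (simp add: distr_id2)

lemma unit_mp_comp:
 assumes "unit_mp \<tau>" "unit_mp \<sigma>" shows "unit_mp (%x. \<tau> (\<sigma> x))"
proof -
 have "distr (distr leb leb \<sigma>) leb \<tau> = distr leb leb (\<tau> \<circ> \<sigma>)"
  using assms by (intro distr_distr) (auto simp: unit_mp_def)
 then show ?thesis using assms by (auto simp: unit_mp_def comp_def)
qed

lemma unit_mp_AE: "unit_mp \<tau> ==> AE t in leb. Q t ==> AE t in leb. Q (\<tau> t)"
 using AE_distrD[of \<tau> leb leb Q] unfolding unit_mp_def by metis

lemma unit_mp_measure:
 assumes "unit_mp \<tau>" "{t:{0..1}. Q t} : sets leb"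
 shows "measure leb {t:{0..1}. Q (\<tau> t)} = measure leb {t:{0..1}. Q t}"
proof -
 have "measure leb {t:{0..1}. Q t} = measure (distr leb leb \<tau>) {t:{0..1}. Q t}"
  using assms by (simp add: unit_mp_def)
 also have "... = measure leb (\<tau> -` {t:{0..1}. Q t} Int space leb)"
  using assms by (intro measure_distr) (auto simp: unit_mp_def)
 also have "\<tau> -` {t:{0..1}. Q t} Int space leb = {t:{0..1}. Q (\<tau> t)}"
  unfolding space_unit_leb using unit_mp_space[OF assms(1)] by blast
 finally show ?thesis ..
qed

lemma measure_unit_atMost: "0 <= y ==> y <= 1 ==> measure leb {t:{0..1}. t <= y} = y"
proof -
 assume "0 <= y" "y <= 1"
 then have "{t:{0..1}. t <= y} = {0..y}" by auto
 then show ?thesis using `0 <= y` `y <= 1` by (simp add: measure_unit_leb)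
qed

lemma measure_unit_interval: "measure leb {t:{0..1}. a <= t & t <= b} <= abs (a - b)"
proof -
 have "measure leb {t:{0..1}. a <= t & t <= b} = measure lborel {t:{0..1}. a <= t & t <= b}"
  by (intro measure_unit_leb) auto
 moreover have "{t:{0..1}. a <= t & t <= b} = {max 0 a..min 1 b}" by auto
 ultimately have *: "measure leb {t:{0..1}. a <= t & t <= b} = measure lborel {max 0 a..min 1 b}" by simp
 have "measure lborel {max 0 a..min 1 b} <= abs (a - b)"
  by (cases "max 0 a <= min 1 b") auto
 then show ?thesis unfolding * .
qed

section \<open>Distribution and quantile transforms on the interval\<close>

lemma real_distribution_unit:
 assumes "W : borel_measurable leb" shows "real_distribution (distr leb borel W)"
 unfolding real_distribution_def real_distribution_axioms_def
 using leb.prob_space_distr[OF assms] by simp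

lemma cdf_distr_unit:
 assumes "W : borel_measurable leb"
 shows "cdf (distr leb borel W) x = measure leb {t:{0..1}. W t <= x}"
 unfolding cdf_def using assms by (subst measure_distr) (auto intro!: arg_cong[where f="measure leb"])

text \<open>The probability integral transform. Without atoms the distribution function
  \<open>F\<close> is continuous, so each sublevel set \<open>F x <= y\<close> with
  \<open>0 <= y < 1\<close> is a half-line ending at its supremum, where \<open>F\<close> equals
  \<open>y\<close>; hence \<open>F (W t)\<close> is uniformly distributed.\<close>

lemma cdf_transform_uniform:
 assumes W: "W : borel_measurable leb" and nn: "!!t. t : {0..1} ==> 0 <= W t"
  and no_atom: "!!x. measure leb {t:{0..1}. W t = x} = 0"
 shows "unit_mp (%t. cdf (distr leb borel W) (W t))"
proof -
 define M where "M = distr leb borel W"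
 interpret M: real_distribution M unfolding M_def by (rule real_distribution_unit[OF W])
 define F where "F = cdf M"
 have F: "F x = measure leb {t:{0..1}. W t <= x}" for x
  unfolding F_def M_def by (rule cdf_distr_unit[OF W])
 have mono: "x <= y ==> F x <= F y" for x y unfolding F_def by (rule M.cdf_nondecreasing)
 have cont: "isCont F x" for x
 proof -
  have "measure M {x} = measure leb {t:{0..1}. W t = x}"
   unfolding M_def using W by (subst measure_distr) (auto intro!: arg_cong[where f="measure leb"])
  then show ?thesis unfolding F_def using no_atom by (simp add: M.isCont_cdf)
 qed
 have Fm: "F : borel_measurable borel"
  by (intro borel_measurable_continuous_onI continuous_at_imp_continuous_on ballI cont)
 have F01: "0 <= F x" "F x <= 1" for x by (auto simp: F)
 have T: "(%t. F (W t)) : measurable leb leb"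
 proof -
  have "(%t. F (W t)) : borel_measurable leb" using measurable_comp[OF W Fm] by (simp add: comp_def)
  then have "(%t. F (W t)) : measurable leb (restrict_space borel {0..1})"
   using F01 by (intro measurable_restrict_space2) auto
  then show ?thesis by (simp add: measurable_cong_sets[OF refl sets_unit_leb])
 qed
 have level: "measure leb {t:{0..1}. F (W t) <= y} = measure leb {t:{0..1}. t <= y}" for y
 proof -
  consider "y < 0" | "1 <= y" | "0 <= y" "y < 1" by linarith
  then show ?thesis
  proof cases
   case 1
   then have "{t:{0..1}. F (W t) <= y} = {}" "{t:{0..1::real}. t <= y} = {}"
    using F01 by (auto simp: not_le intro: less_le_trans)
   then show ?thesis by (metis)
  next
   case 2
   then have "{t:{0..1}. F (W t) <= y} = {t:{0..1}. t <= y}"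
    using F01(2) by (auto intro: order_trans)
   then show ?thesis by simp
  next
   case 3
   define S where "S = {x. F x <= y}"
   \<comment> \<open>Nonnegativity of \<open>W\<close> makes \<open>F\<close> vanish at -1, which
     serves as the left end for the intermediate value theorem.\<close>
   have "{t:{0..1}. W t <= -1} = {}" using nn by force
   then have Fm1: "F (-1) = 0" unfolding F by (metis measure_empty)
   have "(F \<longlongrightarrow> 1) at_top" unfolding F_def by (rule M.cdf_lim_at_top_prob)
   then have "eventually (%x. F x > y) at_top" using 3 by (intro order_tendstoD(1)) auto
   then obtain b where b: "F b > y" using eventually_happens by force
   have bb: "x : S ==> x <= b" for x using b mono[of b x] unfolding S_def by force
   then have bdd: "bdd_above S" by (auto simp: bdd_above_def)
   have "-1 <= b" using bb[of "-1"] Fm1 3 by (simp add: S_def)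
   obtain z where z: "F z = y"
    using IVT[of F "-1" y b] Fm1 3 b `-1 <= b` cont by auto
   have "closed S" unfolding S_def
    by (intro closed_Collect_le continuous_at_imp_continuous_on ballI cont continuous_intros)
   then have SS: "Sup S : S" using z bdd by (intro closed_contains_Sup) (auto simp: S_def)
   then have eq: "F (Sup S) = y"
    using mono[of z "Sup S"] cSup_upper[of z S] z bdd by (auto simp: S_def)
   have "F x <= y \<longleftrightarrow> x <= Sup S" for x
    using mono[of x "Sup S"] eq cSup_upper[of x S] bdd by (auto simp: S_def)
   then have "measure leb {t:{0..1}. F (W t) <= y} = y" using F[of "Sup S"] eq by simp
   then show ?thesis using 3 measure_unit_atMost by simp
  qed
 qed
 have "distr leb borel (%t. F (W t)) = distr leb borel (%t. t)"
 proof (rule cdf_unique)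
  have Tb: "(%t. F (W t)) : borel_measurable leb" using measurable_comp[OF W Fm] by (simp add: comp_def)
  show "real_distribution (distr leb borel (%t. F (W t)))" by (rule real_distribution_unit[OF Tb])
  show "real_distribution (distr leb borel (%t. t))" by (rule real_distribution_unit) auto
  show "cdf (distr leb borel (%t. F (W t))) = cdf (distr leb borel (%t. t))"
   using level by (simp add: fun_eq_iff cdf_distr_unit[OF Tb] cdf_distr_unit)
 qed
 note eq = this
 have "distr leb leb (%t. F (W t)) = leb"
 proof (rule measure_eqI)
  fix A assume "A : sets (distr leb leb (%t. F (W t)))"
  then have A: "A : sets leb" by simp
  then have Ab: "A : sets borel" "A <= {0..1}"
   using sets.sets_into_space[OF A] by (auto simp: sets_unit_leb sets_restrict_space)
  have "emeasure (distr leb leb (%t. F (W t))) A = emeasure (distr leb borel (%t. F (W t))) A"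
   using A Ab T measurable_comp[OF W Fm] by (simp add: emeasure_distr comp_def)
  also have "... = emeasure leb A"
   unfolding eq using Ab A sets.sets_into_space[OF A]
   by (subst emeasure_distr) (auto intro!: arg_cong[where f="emeasure leb"])
  finally show "emeasure (distr leb leb (%t. F (W t))) A = emeasure leb A" .
 qed simp
 then show ?thesis using T unfolding unit_mp_def F_def M_def by simp
qed

text \<open>The quantile function of \<open>M\<close> on the open interval, extended by 0 at the two
  endpoints, which form a null set. The Galois connection with the distribution function is kept
  because it locates discrete labels by their cumulative masses.\<close>

lemma unit_interval_quantile:
 assumes "real_distribution M"
 obtains I where "I : borel_measurable leb" "distr leb borel I = M"
  and "!!\<omega> x. 0 < \<omega> ==> \<omega> < 1 ==> \<omega> <= cdf M x \<longleftrightarrow> I \<omega> <= x"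
proof -
 interpret M: cdf_distribution M unfolding cdf_distribution_def by (rule assms)
 define J where "J \<omega> = (if \<omega> : {0<..<1} then M.I \<omega> else 0)" for \<omega>
 have "J : borel_measurable borel" unfolding J_def
  using M.measurable_CI
  by (intro measurable_If_restrict_space_iff[THEN iffD2]) (auto simp: greaterThanLessThan_eq greaterThan_def lessThan_def Int_def)
 then have Jm: "J : borel_measurable leb" unfolding unit_leb_def
  by (intro measurable_restrict_space1) auto
 have "distr leb borel J = distr (restrict_space lborel {0<..<1::real}) borel M.I"
 proof (rule measure_eqI)
  fix A assume "A : sets (distr leb borel J)"
  then have A: "A : sets borel" by simp
  have JA: "J -` A : sets borel" using `J : borel_measurable borel` A by (simp add: in_borel_measurable_borel)
  have "emeasure (distr leb borel J) A = emeasure lborel (J -` A Int {0..1})"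
   using A Jm JA by (simp add: emeasure_distr emeasure_unit_leb)
  also have "... = emeasure lborel (J -` A Int {0<..<1})"
  proof (rule emeasure_eq_AE)
   show "AE x in lborel. (x : J -` A Int {0..1}) = (x : J -` A Int {0<..<1})"
    using AE_lborel_singleton[of 0] AE_lborel_singleton[of 1] by eventually_elim auto
  qed (use JA in auto)
  also have "J -` A Int {0<..<1} = M.I -` A Int {0<..<1}" by (auto simp: J_def)
  also have "emeasure lborel ... = emeasure (distr (restrict_space lborel {0<..<1::real}) borel M.I) A"
  proof -
   have "M.I : borel_measurable (restrict_space lborel {0<..<1})"
    using M.measurable_CI by (simp cong: measurable_cong_sets)
   then have "emeasure (distr (restrict_space lborel {0<..<1::real}) borel M.I) A
     = emeasure (restrict_space lborel {0<..<1}) (M.I -` A Int {0<..<1})"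
    using A by (simp add: emeasure_distr space_restrict_space)
   also have "... = emeasure lborel (M.I -` A Int {0<..<1})"
    by (rule emeasure_restrict_space) auto
   finally show ?thesis ..
  qed
  finally show "emeasure (distr leb borel J) A = emeasure (distr (restrict_space lborel {0<..<1::real}) borel M.I) A" .
 qed simp
 then have "distr leb borel J = M" using M.distr_I_eq_M by simp
 moreover have "\<omega> <= cdf M x \<longleftrightarrow> J \<omega> <= x" if "0 < \<omega>" "\<omega> < 1" for \<omega> x
 proof -
  have "J \<omega> = M.I \<omega>" using that unfolding J_def by (subst if_P) auto
  then show ?thesis using M.pseudoinverse[OF that] by metis
 qed
 ultimately show ?thesis using that Jm by blast
qed

lemma AE_distr_transfer:
 assumes "f : measurable M N" "g : measurable M' N" "distr M N f = distr M' N g"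
  and "{x:space N. Q x} : sets N" "AE x in M. Q (f x)"
 shows "AE x in M'. Q (g x)"
 using assms(3,5) AE_distr_iff[OF assms(1,4)] AE_distr_iff[OF assms(2,4)] by metis

text \<open>Appending a continuous tie-breaker \<open>t / 2\<close> to a discrete label makes the
 distribution function continuous, so that the distribution and quantile transforms of the labels are
 measure preserving and match equal cumulative masses.\<close>

lemma unit_align:
 fixes \<kappa> \<kappa>' :: "real => nat"
 assumes k: "\<kappa> : measurable leb (count_space UNIV)" and k': "\<kappa>' : measurable leb (count_space UNIV)"
  and K: "!!t. t : {0..1} ==> \<kappa> t < K" and K': "!!t. t : {0..1} ==> \<kappa>' t < K"
 obtains \<tau> where "unit_mp \<tau>"
  and "measure leb {t:{0..1}. \<kappa> t ~= \<kappa>' (\<tau> t)}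
   <= (\<Sum>k<K. abs (measure leb {t:{0..1}. \<kappa> t <= k} - measure leb {t:{0..1}. \<kappa>' t <= k}))"
proof -
 define lab where "lab \<kappa> t = real (\<kappa> t) + t / 2" for \<kappa> :: "real => nat" and t
 have labm: "lab \<kappa> : borel_measurable leb" if "\<kappa> : measurable leb (count_space UNIV)" for \<kappa>
 proof -
  have "(%t. real (\<kappa> t)) : borel_measurable leb" by (rule measurable_compose[OF that]) simp
  then show ?thesis unfolding lab_def by (intro borel_measurable_add borel_measurable_divide) auto
 qed
 have lab_floor: "nat \<lfloor>lab \<kappa> t\<rfloor> = \<kappa> t" "lab \<kappa> t - of_int \<lfloor>lab \<kappa> t\<rfloor> = t / 2" if "t : {0..1}" for \<kappa> t
 proof -
  have "\<lfloor>lab \<kappa> t\<rfloor> = int (\<kappa> t)" using that unfolding lab_def by (intro floor_unique) auto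
  then show "nat \<lfloor>lab \<kappa> t\<rfloor> = \<kappa> t" "lab \<kappa> t - of_int \<lfloor>lab \<kappa> t\<rfloor> = t / 2" by (auto simp: lab_def)
 qed
 \<comment> \<open>The values of \<open>lab\<close> with label \<open>k\<close> lie in
   \<open>[k, k + 1/2]\<close>, so the threshold \<open>k + 3/4\<close> separates label
   \<open>k\<close> from label \<open>k + 1\<close>.\<close>
 have lab_le: "lab \<kappa> t <= real k + 3 / 4 \<longleftrightarrow> \<kappa> t <= k" if "t : {0..1}" for \<kappa> t k
 proof (cases "\<kappa> t <= k")
  case False
  then have "real (\<kappa> t) >= real k + 1" by simp
  then show ?thesis using that False unfolding lab_def by auto
 qed (use that in \<open>auto simp: lab_def\<close>)
 define G where "G \<kappa> k = measure leb {t:{0..1}. \<kappa> t <= (k::nat)}" for \<kappa> :: "real => nat" and k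
 have cdf_lab: "cdf (distr leb borel (lab \<kappa>)) (real k + 3 / 4) = G \<kappa> k"
  if "\<kappa> : measurable leb (count_space UNIV)" for \<kappa> k
  unfolding cdf_distr_unit[OF labm[OF that]] G_def
  by (intro arg_cong[where f="measure leb"]) (use lab_le in auto)
 define T where "T t = cdf (distr leb borel (lab \<kappa>)) (lab \<kappa> t)" for t
 interpret D: real_distribution "distr leb borel (lab \<kappa>)" by (rule real_distribution_unit[OF labm[OF k]])
 have T: "unit_mp T" unfolding T_def
 proof (rule cdf_transform_uniform[OF labm[OF k]])
  fix x
  have "{t:{0..1}. lab \<kappa> t = x} <= {2 * (x - of_int (floor (x)))} Int {0..1}"
  proof
   fix t assume "t : {t:{0..1}. lab \<kappa> t = x}"
   then have t: "t : {0..1}" "lab \<kappa> t = x" by blast+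
   then have "t = 2 * (x - of_int (floor (x)))" using lab_floor(2)[OF t(1), of \<kappa>] by simp
   then show "t : {2 * (x - of_int (floor (x)))} Int {0..1}" using t(1) by blast
  qed
  then have "measure leb {t:{0..1}. lab \<kappa> t = x} <= measure leb ({2 * (x - of_int (floor (x)))} Int {0..1})"
   by (intro leb.finite_measure_mono) auto
  also have "... = measure lborel ({2 * (x - of_int (floor (x)))} Int {0..1})" by (rule measure_unit_leb) auto
  also have "... <= measure lborel {2 * (x - of_int (floor (x)))}"
   by (cases "2 * (x - of_int (floor (x))) : {0..1}") auto
  also have "... = 0" by simp
  finally show "measure leb {t:{0..1}. lab \<kappa> t = x} = 0" by (simp add: measure_le_0_iff)
 qed (simp add: lab_def)
 obtain I where I: "I : borel_measurable leb" "distr leb borel I = distr leb borel (lab \<kappa>')"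
  and II: "!!\<omega> x. 0 < \<omega> ==> \<omega> < 1 ==> \<omega> <= cdf (distr leb borel (lab \<kappa>')) x \<longleftrightarrow> I \<omega> <= x"
  using unit_interval_quantile[OF real_distribution_unit[OF labm[OF k']]] by metis
 \<comment> \<open>Reads the tie-breaker back as twice the fractional part. Clamping only serves to
   give every real argument a value in the unit interval.\<close>
 define g where "g x = max 0 (min 1 (2 * (x - of_int (floor (x)))))" for x :: real
 have gm: "g : measurable borel leb"
 proof -
  have "g : borel_measurable borel" unfolding g_def by measurable
  then have "g : measurable borel (restrict_space borel {0..1})"
   by (intro measurable_restrict_space2) (auto simp: g_def)
  then show ?thesis by (simp add: measurable_cong_sets[OF refl sets_unit_leb])
 qed
 have glab: "g (lab \<kappa>' t) = t" if "t : {0..1}" for t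
  using lab_floor(2)[OF that, of \<kappa>'] that unfolding g_def by auto
 define Q where "Q \<omega> = g (I \<omega>)" for \<omega>
 have Q: "unit_mp Q"
 proof -
  have "distr leb leb Q = distr (distr leb borel I) leb g"
   unfolding Q_def using distr_distr[OF gm I(1)] by (simp add: comp_def)
  also have "... = distr leb leb (%t. g (lab \<kappa>' t))"
   unfolding I(2) using distr_distr[OF gm labm[OF k']] by (simp add: comp_def)
  also have "... = distr leb leb (%t. t)" by (rule distr_cong) (auto simp: glab)
  finally show ?thesis unfolding unit_mp_def using measurable_comp[OF I(1) gm]
   by (simp add: distr_id2 comp_def Q_def[abs_def])
 qed
 have kg: "(%x. \<kappa>' (g x)) : measurable borel (count_space UNIV)"
  using measurable_comp[OF gm k'] by (simp add: comp_def)
 \<comment> \<open>The relations between label, tie-breaker and thresholds are clear for values of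
   \<open>lab \<kappa>'\<close>. Stating them as a Borel property of the value alone lets them pass
   to the quantile \<open>I\<close>, which has the same law.\<close>
 define ok where "ok x \<longleftrightarrow> \<kappa>' (g x) = nat (floor (x)) & (ALL k::nat. x <= real k + 3/4 \<longleftrightarrow> nat (floor (x)) <= k)" for x
 have nf: "(%x::real. nat (floor (x))) : measurable borel (count_space UNIV)"
  by (rule measurable_compose[OF measurable_real_floor]) simp
 have nfk: "{x:space borel. (x <= real k + 3/4 \<longleftrightarrow> nat (floor (x)) <= k)} : sets borel" for k
 proof -
  have "{x::real. nat (floor (x)) <= k} : sets borel" using measurable_sets[OF nf, of "{..k}"] by (simp add: vimage_def)
  moreover have "{x. (x <= real k + 3/4 \<longleftrightarrow> nat (floor (x)) <= k)}
   = ({..real k + 3/4} Int {x. nat (floor (x)) <= k}) Un (- {..real k + 3/4} Int - {x. nat (floor (x)) <= k})" by auto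
  ultimately show ?thesis by (simp add: sets.Int sets.Un sets.compl_sets borel_comp)
 qed
 have okm: "{x:space borel. ok x} : sets borel"
 proof -
  have "{x:space borel. ok x} = (\<Union>n. ((%x. \<kappa>' (g x)) -` {n}) Int ((%x. nat (floor (x))) -` {n}))
   Int (\<Inter>k. {x:space borel. (x <= real k + 3/4 \<longleftrightarrow> nat (floor (x)) <= k)})"
   by (auto simp: ok_def)
  also have "... : sets borel"
   using nfk measurable_sets[OF kg, of "{_}"] measurable_sets[OF nf, of "{_}"]
   by (intro sets.Int sets.countable_UN sets.countable_INT) (auto simp: image_subset_iff)
  finally show ?thesis .
 qed
 have "AE t in leb. ok (I t)"
 proof (rule AE_distr_transfer[OF labm[OF k'] I(1) I(2)[symmetric] okm])
  show "AE t in leb. ok (lab \<kappa>' t)"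
   by (rule AE_I2) (auto simp: ok_def glab lab_floor lab_le)
 qed
 then have okT: "AE t in leb. ok (I (T t))" by (rule unit_mp_AE[OF T])
 have "AE t in leb. t ~= 0 & t ~= 1"
 proof -
  have "{t:space leb. ~ (t ~= 0 & t ~= 1)} = {0,1}" by auto
  moreover have "{0,1::real} : null_sets leb" by (intro null_setsI) (auto simp: emeasure_unit_leb emeasure_lborel_countable)
  ultimately show ?thesis by (auto intro!: AE_I[of _ _ "{0,1}"] simp: null_sets_def)
 qed
 from unit_mp_AE[OF T this] have T01: "AE t in leb. T t ~= 0 & T t ~= 1" .
 define \<tau> where "\<tau> t = Q (T t)" for t
 have tau: "unit_mp \<tau>" unfolding \<tau>_def using unit_mp_comp[OF Q T] .
 \<comment> \<open>The band between the two cumulative masses at level \<open>k\<close>. Since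
   \<open>T\<close> preserves measure, its mass is at most their difference.\<close>
 define B where "B k = {t:{0..1}. min (G \<kappa> k) (G \<kappa>' k) <= T t & T t <= max (G \<kappa> k) (G \<kappa>' k)}" for k
 have Bs: "B k : sets leb" for k
 proof -
  have "B k = T -` {t:{0..1}. min (G \<kappa> k) (G \<kappa>' k) <= t & t <= max (G \<kappa> k) (G \<kappa>' k)} Int space leb"
   unfolding space_unit_leb B_def using unit_mp_space[OF T] by blast
  moreover have "{t:{0..1}. min (G \<kappa> k) (G \<kappa>' k) <= t & t <= max (G \<kappa> k) (G \<kappa>' k)} : sets leb"
   by (intro sets_unit_lebI) auto
  ultimately show ?thesis using measurable_sets[OF unit_mp_measurable[OF T]] by metis
 qed
 have Bm: "measure leb (B k) <= abs (G \<kappa> k - G \<kappa>' k)" for k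
 proof -
  have "measure leb (B k) = measure leb {t:{0..1}. min (G \<kappa> k) (G \<kappa>' k) <= t & t <= max (G \<kappa> k) (G \<kappa>' k)}"
   unfolding B_def by (rule unit_mp_measure[OF T]) auto
  also have "... <= abs (min (G \<kappa> k) (G \<kappa>' k) - max (G \<kappa> k) (G \<kappa>' k))" by (rule measure_unit_interval)
  finally show ?thesis by (simp add: min_def max_def split: if_splits)
 qed
 \<comment> \<open>If the label \<open>\<kappa> t\<close> is smaller than the matched label
   \<open>b\<close>, then \<open>T t\<close> lies below the cumulative mass of
   \<open>\<kappa>\<close> at \<open>\<kappa> t\<close> but above that of \<open>\<kappa>'\<close>;
   the other case is symmetric at level \<open>b\<close>. So every mismatch falls into some
   band.\<close>
 have AEB: "AE t in leb. \<kappa> t ~= \<kappa>' (\<tau> t) --> t : (\<Union>k<K. B k)"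
  using okT T01 AE_space
 proof eventually_elim
  case (elim t)
  then have t: "t : {0..1}" and Tt: "0 < T t" "T t < 1" using unit_mp_space[OF T, of t] by auto
  define b where "b = nat (floor (I (T t)))"
  have b: "\<kappa>' (\<tau> t) = b" "!!k::nat. I (T t) <= real k + 3/4 \<longleftrightarrow> b <= k"
   using elim(1) unfolding ok_def b_def \<tau>_def Q_def by auto
  have TG': "T t <= G \<kappa>' k \<longleftrightarrow> b <= k" for k
   using II[OF Tt, of "real k + 3/4"] b(2) cdf_lab[OF k'] by simp
  show ?case
  proof
   assume "\<kappa> t ~= \<kappa>' (\<tau> t)"
   then consider "\<kappa> t < b" | "b < \<kappa> t" using b(1) by linarith
   then show "t : (\<Union>k<K. B k)"
   proof cases
    case 1
    have "lab \<kappa> t <= real (\<kappa> t) + 3/4" using lab_le[OF t, of \<kappa> "\<kappa> t"] by simp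
    then have "T t <= G \<kappa> (\<kappa> t)" unfolding T_def cdf_lab[OF k, symmetric] by (rule D.cdf_nondecreasing)
    moreover have "~ T t <= G \<kappa>' (\<kappa> t)" using TG' 1 by simp
    ultimately have "t : B (\<kappa> t)" using t by (auto simp: B_def)
    then show ?thesis using K[OF t] by blast
   next
    case 2
    have "real b + 3/4 <= lab \<kappa> t" using lab_le[OF t, of \<kappa> b] 2 by linarith
    then have "G \<kappa> b <= T t" unfolding T_def cdf_lab[OF k, symmetric] by (rule D.cdf_nondecreasing)
    moreover have "T t <= G \<kappa>' b" using TG' by simp
    ultimately have "t : B b" using t by (auto simp: B_def)
    then show ?thesis using K[OF t] 2 by (meson UN_I lessThan_iff less_trans)
   qed
  qed
 qed
 have "measure leb {t:{0..1}. \<kappa> t ~= \<kappa>' (\<tau> t)} <= measure leb (\<Union>k<K. B k)"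
 proof (rule leb.finite_measure_mono_AE)
  show "AE x in leb. x : {t : {0..1}. \<kappa> t ~= \<kappa>' (\<tau> t)} --> x : (\<Union>k<K. B k)"
   using AEB by eventually_elim auto
 qed (use Bs in auto)
 also have "... <= (\<Sum>k<K. measure leb (B k))"
  using Bs by (intro leb.finite_measure_subadditive_finite) auto
 also have "... <= (\<Sum>k<K. abs (G \<kappa> k - G \<kappa>' k))" by (intro sum_mono Bm)
 finally show ?thesis using that[OF tau] unfolding G_def by simp
qed


section \<open>Joint laws of sequences of random variables\<close>

definition law :: "'a measure => (nat => 'a => real) => (nat => real) measure" where
 "law M f = distr M borel (%x i. f i x)"

lemma measurable_seq: "(!!i. f i : borel_measurable M) ==> (%x i. f i x) : borel_measurable (M :: 'a measure)"
 for f :: "nat => 'a => real"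
 by (rule measurable_coordinatewise_then_product) auto

lemma law_measure:
 assumes "!!i. f i : borel_measurable M" "B : sets borel"
 shows "measure (law M f) B = measure M {x:space M. (%i. f i x) : B}"
proof -
 have "measure (law M f) B = measure M ((%x i. f i x) -` B Int space M)"
  unfolding law_def by (rule measure_distr[OF measurable_seq]) (use assms in auto)
 also have "(%x i. f i x) -` B Int space M = {x:space M. (%i. f i x) : B}" by auto
 finally show ?thesis .
qed

lemma law_map:
 assumes "!!i. f i : borel_measurable M" "!!i. g i : borel_measurable M'" "law M f = law M' g"
  and h: "!!i. h i : borel_measurable borel"
 shows "law M (%i x. h i (%j. f j x)) = law M' (%i x. h i (%j. g j x))"
proof -
 have hm: "(%x i. h i x) : measurable borel borel" by (rule measurable_seq[OF h])
 have 1: "law M (%i x. h i (%j. f j x)) = distr (law M f) borel (%x i. h i x)"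
  unfolding law_def by (subst distr_distr[OF hm measurable_seq]) (use assms(1) in \<open>auto simp: comp_def\<close>)
 have 2: "law M' (%i x. h i (%j. g j x)) = distr (law M' g) borel (%x i. h i x)"
  unfolding law_def by (subst distr_distr[OF hm measurable_seq]) (use assms(2) in \<open>auto simp: comp_def\<close>)
 show ?thesis unfolding 1 2 assms(3) ..
qed

lemma law_reindex:
 assumes "!!i. f i : borel_measurable M" "!!i. g i : borel_measurable M'" "law M f = law M' g"
  and "!!i. p i : borel_measurable borel"
 shows "law M (%i x. p i (f (k i) x)) = law M' (%i x. p i (g (k i) x))"
 by (rule law_map[OF assms(1-3), of "%i x. p i (x (k i))"])
  (auto intro!: measurable_compose[OF measurable_product_coordinates assms(4)])

lemma law_distr:
 assumes "phi : measurable M N" "distr M N phi = N" "!!i. f i : borel_measurable N"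
 shows "law M (%i x. f i (phi x)) = law N f"
proof -
 have "law N f = distr (distr M N phi) borel (%x i. f i x)" unfolding law_def assms(2) ..
 also have "... = law M (%i x. f i (phi x))"
  unfolding law_def by (subst distr_distr[OF measurable_seq]) (use assms in \<open>auto simp: comp_def\<close>)
 finally show ?thesis ..
qed

lemma law_mp: "unit_mp \<tau> ==> (!!i. u i : borel_measurable leb) ==>
  law leb (%i t. u i (\<tau> t)) = law leb u"
 by (rule law_distr) (auto simp: unit_mp_def)

lemma law_cong: "(!!i x. x : space M ==> f i x = g i x) ==> law M f = law M g"
 unfolding law_def by (rule distr_cong) auto

lemma law_cong_AE:
 assumes "!!i. f i : borel_measurable M" "!!i. g i : borel_measurable M" "!!i. AE x in M. f i x = g i x"
 shows "law M f = law M g"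
proof -
 have "AE x in M. ALL i. f i x = g i x" using assms(3) by (simp add: AE_all_countable)
 then have "AE x in M. (%i. f i x) = (%i. g i x)" by eventually_elim auto
 then show ?thesis unfolding law_def by (intro distr_cong_AE measurable_seq) (use assms in auto)
qed

lemma prob_space_law: "prob_space M ==> (!!i. f i : borel_measurable M) ==> prob_space (law M f)"
 unfolding law_def by (rule prob_space.prob_space_distr[OF _ measurable_seq])

lemma sets_law [simp]: "sets (law M f) = sets borel" by (simp add: law_def)

section \<open>Laws on sequence space are determined by lower boxes\<close>

definition lower_box :: "nat => (nat => real) => (nat => real) set" where
 "lower_box n c = {x. ALL i<n. x i <= c i}"

lemma lower_box_sets [simp, measurable]: "lower_box n c : sets borel"
proof -
 have "closed (lower_box n c)" unfolding lower_box_def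
  by (intro closed_Collect_all closed_Collect_imp closed_Collect_le continuous_intros) auto
 then show ?thesis by (rule borel_closed)
qed

lemma sets_borel_lower_boxes:
 "sets (borel :: (nat => real) measure) = sigma_sets UNIV {lower_box n c |n c. True}" (is "_ = sigma_sets _ ?E")
proof
 show "sigma_sets UNIV ?E <= sets borel"
  using sets.sigma_sets_subset[of ?E borel] by (force simp: space_borel)
 let ?S = "sigma UNIV ?E"
 have "(%x. x i) : borel_measurable ?S" for i
 proof (rule borel_measurable_iff_le[THEN iffD2], rule allI)
  fix a
  \<comment> \<open>A half-space in coordinate \<open>i\<close> is an increasing union of lower
    boxes: the earlier coordinates receive the bound \<open>k\<close>, which exhausts them.\<close>
  have eq: "{x. x i <= a} = (\<Union>k::nat. lower_box (Suc i) (%j. if j = i then a else real k))"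
  proof (intro set_eqI iffI)
   fix x :: "nat => real" assume "x : {x. x i <= a}"
   moreover obtain k :: nat where "Max ((%j. abs (x j)) ` {..i}) <= real k" using real_arch_simple by blast
   ultimately show "x : (\<Union>k::nat. lower_box (Suc i) (%j. if j = i then a else real k))"
    unfolding lower_box_def by (intro UN_I[of k]) (auto simp: less_Suc_eq intro: order_trans[OF abs_ge_self])
  qed (auto simp: lower_box_def)
  have "lower_box (Suc i) (%j. if j = i then a else real k) : sets ?S" for k :: nat
   by (auto simp: sets_measure_of)
  then have "(\<Union>k::nat. lower_box (Suc i) (%j. if j = i then a else real k)) : sets ?S"
   by (intro sets.countable_UN image_subsetI)
  moreover have "{w : space ?S. w i <= a} = {x. x i <= a}" by (simp add: space_measure_of)
  ultimately show "{w : space ?S. w i <= a} : sets ?S" by (simp only: eq)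
 qed
 then have "(%x. x) : measurable ?S borel" by (rule measurable_coordinatewise_then_product)
 then show "sets borel <= sigma_sets UNIV ?E"
  using measurable_sets[of "%x. x" ?S borel] by (auto simp: sets_measure_of)
qed

lemma seq_measure_eqI:
 fixes \<mu> \<nu> :: "(nat => real) measure"
 assumes "prob_space \<mu>" "prob_space \<nu>" "sets \<mu> = sets borel" "sets \<nu> = sets borel"
  and "!!n c. measure \<mu> (lower_box n c) = measure \<nu> (lower_box n c)"
 shows "\<mu> = \<nu>"
proof (rule measure_eqI_generator_eq[where E="{lower_box n c |n c. True}" and \<Omega>=UNIV and A="%_. UNIV"])
 interpret \<mu>: prob_space \<mu> by fact
 interpret \<nu>: prob_space \<nu> by fact
 show "Int_stable {lower_box n c |n c. True}"
 proof (rule Int_stableI)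
  fix a b assume "a : {lower_box n c |n c. True}" "b : {lower_box n c |n c. True}"
  then obtain n c m d where ab: "a = lower_box n c" "b = lower_box m d" by auto
  define e where "e i = (if i < n & i < m then min (c i) (d i) else if i < n then c i else d i)" for i
  have "(i < n --> y <= c i) & (i < m --> y <= d i) \<longleftrightarrow> (i < max n m --> y <= e i)" for i y
   unfolding e_def by auto
  then have "a Int b = lower_box (max n m) e" unfolding ab lower_box_def by blast
  then show "a Int b : {lower_box n c |n c. True}" by blast
 qed
 show "emeasure \<mu> X = emeasure \<nu> X" if "X : {lower_box n c |n c. True}" for X
  using that assms(5) by (auto simp: \<mu>.emeasure_eq_measure \<nu>.emeasure_eq_measure)
 have "UNIV = lower_box 0 (%_. 0)" by (auto simp: lower_box_def)
 then show "range (%_. UNIV) <= {lower_box n c |n c. True}" by auto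
 show "emeasure \<mu> UNIV ~= \<infinity>" for i :: nat using \<mu>.emeasure_finite[of UNIV] by simp
 show "sets \<mu> = sigma_sets UNIV {lower_box n c |n c. True}" "sets \<nu> = sigma_sets UNIV {lower_box n c |n c. True}"
  using assms(3,4) sets_borel_lower_boxes by auto
qed auto

text \<open>Boxes with thresholds \<open>c i + 1 / Suc k\<close> decrease to the closed box, so
  continuity from above removes both the slack in the thresholds and that in the mass.\<close>

lemma lower_box_slack:
 fixes \<mu> \<nu> :: "(nat => real) measure"
 assumes "prob_space \<nu>" "sets \<nu> = sets borel"
  and "!!e. e > 0 ==> measure \<mu> (lower_box n c) <= measure \<nu> (lower_box n (%i. c i + e)) + e"
 shows "measure \<mu> (lower_box n c) <= measure \<nu> (lower_box n c)"
proof -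
 interpret \<nu>: prob_space \<nu> by fact
 have "(%k. measure \<nu> (lower_box n (%i. c i + 1 / Suc k))) \<longlonglongrightarrow> measure \<nu> (\<Inter>k. lower_box n (%i. c i + 1 / Suc k))"
 proof (rule \<nu>.finite_Lim_measure_decseq)
  show "range (%k. lower_box n (%i. c i + 1 / Suc k)) <= sets \<nu>" unfolding assms(2) by (intro image_subsetI lower_box_sets)
  show "decseq (%k. lower_box n (%i. c i + 1 / Suc k))" unfolding decseq_def
  proof (intro allI impI subsetI)
   fix j k :: nat and x assume "j <= k" "x : lower_box n (%i. c i + 1 / Suc k)"
   moreover have "1 / real (Suc k) <= 1 / Suc j" using `j <= k` by (intro frac_le) auto
   ultimately show "x : lower_box n (%i. c i + 1 / Suc j)"
    unfolding lower_box_def by (smt (verit) mem_Collect_eq)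
  qed
 qed
 moreover have "(\<Inter>k. lower_box n (%i. c i + 1 / Suc k)) = lower_box n c"
 proof -
  have a: "y <= z" if *: "!!k. y <= z + 1 / Suc k" for y z :: real
  proof (rule field_le_epsilon)
   fix e :: real assume "0 < e"
   then obtain k where "1 / Suc k < e" using nat_approx_posE by blast
   then show "y <= z + e" using *[of k] by simp
  qed
  have b: "y <= z ==> y <= z + 1 / Suc k" for y z :: real and k by (simp add: add_increasing2)
  have "x : lower_box n c \<longleftrightarrow> (ALL k. x : lower_box n (%i. c i + 1 / Suc k))" for x
  proof
   assume "x : lower_box n c"
   then show "ALL k. x : lower_box n (%i. c i + 1 / Suc k)" unfolding lower_box_def mem_Collect_eq using b by metis
  next
   assume *: "ALL k. x : lower_box n (%i. c i + 1 / Suc k)"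
   show "x : lower_box n c" unfolding lower_box_def mem_Collect_eq
   proof (intro allI impI, rule a)
    fix i k assume "i < n"
    then show "x i <= c i + 1 / Suc k" using *[rule_format, of k] unfolding lower_box_def by simp
   qed
  qed
  then show ?thesis by (simp add: set_eq_iff)
 qed
 ultimately have "(%k. measure \<nu> (lower_box n (%i. c i + 1 / Suc k)) + 1 / Suc k) \<longlonglongrightarrow> measure \<nu> (lower_box n c) + 0"
  using LIMSEQ_inverse_real_of_nat by (intro tendsto_add) (simp_all add: inverse_eq_divide)
 then have "(%k. measure \<nu> (lower_box n (%i. c i + 1 / Suc k)) + 1 / Suc k) \<longlonglongrightarrow> measure \<nu> (lower_box n c)" by simp
 then show ?thesis
  by (rule LIMSEQ_le_const) (intro exI allI impI assms(3), simp)
qed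

text \<open>A comparison in the manner of the Levy metric: slack is permitted in thresholds and mass
  simultaneously, which is exactly what closeness in measure of two sequences provides.\<close>

lemma law_eqI:
 fixes \<mu> \<nu> :: "(nat => real) measure"
 assumes "prob_space \<mu>" "prob_space \<nu>" "sets \<mu> = sets borel" "sets \<nu> = sets borel"
  and "!!n c e. e > 0 ==> measure \<mu> (lower_box n c) <= measure \<nu> (lower_box n (%i. c i + e)) + e"
  and "!!n c e. e > 0 ==> measure \<nu> (lower_box n c) <= measure \<mu> (lower_box n (%i. c i + e)) + e"
 shows "\<mu> = \<nu>"
 using assms by (intro seq_measure_eqI antisym lower_box_slack) auto

section \<open>Every law is realised on the unit interval\<close>

text \<open>The point of the Cantor set with ternary digits \<open>2 * b k\<close>. Without the
  digit 1 the leading digit can be read off by comparing \<open>3 * y\<close> with 2.\<close>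

definition bit_code :: "(nat => bool) => real" where
 "bit_code b = (\<Sum>k. of_bool (b k) * 2 / 3 ^ Suc k)"

text \<open>Deletes the leading ternary digit of a point of the Cantor set; the total definition by
  cases is Borel.\<close>

definition bit_shift :: "real => real" where
 "bit_shift y = 3 * y - (if 3 * y >= 2 then 2 else 0)"

lemma bit_code_summable: "summable (%k. of_bool (b k) * 2 / 3 ^ Suc k :: real)"
proof (rule summable_comparison_test')
 show "summable (%k. 2 / 3 * (1 / 3) ^ k :: real)" by (intro summable_mult summable_geometric) auto
qed (auto simp: power_divide)

lemma bit_code_bounds: "0 <= bit_code b" "bit_code b <= 1"
proof -
 show "0 <= bit_code b" unfolding bit_code_def by (intro suminf_nonneg bit_code_summable) auto
 have "bit_code b <= (\<Sum>k. 2 / 3 * (1 / 3) ^ k)" unfolding bit_code_def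
  by (intro suminf_le bit_code_summable summable_mult summable_geometric) (auto simp: power_divide)
 also have "... = 2 / 3 * (\<Sum>k. (1 / 3) ^ k)" by (intro suminf_mult summable_geometric) auto
 also have "... = 1" by (subst suminf_geometric) auto
 finally show "bit_code b <= 1" .
qed

lemma bit_code_Suc: "3 * bit_code b = of_bool (b 0) * 2 + bit_code (%k. b (Suc k))"
proof -
 have "bit_code b = of_bool (b 0) * 2 / 3 + (\<Sum>k. of_bool (b (Suc k)) * 2 / 3 ^ Suc (Suc k))"
  unfolding bit_code_def using suminf_split_head[OF bit_code_summable[of b]] by simp
 also have "(\<Sum>k. of_bool (b (Suc k)) * 2 / 3 ^ Suc (Suc k) :: real) = (\<Sum>k. (1/3) * (of_bool (b (Suc k)) * 2 / 3 ^ Suc k))"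
  by (intro arg_cong[where f=suminf] ext) auto
 also have "... = (1/3) * bit_code (%k. b (Suc k))"
  unfolding bit_code_def by (rule suminf_mult) (rule bit_code_summable)
 finally show ?thesis by simp
qed

lemma bit_code_decode: "3 * (bit_shift ^^ k) (bit_code b) >= 2 \<longleftrightarrow> b k"
proof -
 have head: "3 * bit_code b >= 2 \<longleftrightarrow> b 0" for b
  using bit_code_Suc[of b] bit_code_bounds[of "%k. b (Suc k)"] by (cases "b 0") auto
 have shift: "bit_shift (bit_code b) = bit_code (%k. b (Suc k))" for b
  unfolding bit_shift_def head using bit_code_Suc[of b] by auto
 have "(bit_shift ^^ k) (bit_code b) = bit_code (%j. b (j + k))" for k
  by (induction k) (auto simp: shift)
 then show ?thesis using head[of "%j. b (j + k)"] by simp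
qed

text \<open>A real sequence is determined by the countably many bits \<open>x i < q\<close> with
  \<open>q\<close> rational. \<open>dec\<close> is a left inverse only, defined and Borel on all
  reals. The coding both reduces laws of sequences to laws of reals and turns points of data sets
  into real numbers.\<close>

lemma seq_real_coding:
 obtains enc :: "(nat => real) => real" and dec :: "nat => real => real"
 where "enc : borel_measurable borel" "!!i. dec i : borel_measurable borel" "!!i x. dec i (enc x) = x i"
proof -
 define cut where "cut k x \<longleftrightarrow> x (fst (prod_decode k)) < real_of_rat (from_nat (snd (prod_decode k)))"
  for k and x :: "nat => real"
 define enc where "enc x = bit_code (%k. cut k x)" for x
 \<comment> \<open>The infimum of the rationals above \<open>x i\<close>. It is taken in the
   extended reals because arbitrary \<open>y\<close> may encode an empty or unbounded set of
   rationals.\<close>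
 define dec where "dec i y = real_of_ereal (INF j. if 3 * (bit_shift ^^ prod_encode (i, j)) y >= 2
  then ereal (real_of_rat (from_nat j)) else \<infinity>)" for i and y :: real
 have dec_enc: "dec i (enc x) = x i" for i x
 proof -
  have "(INF j. if 3 * (bit_shift ^^ prod_encode (i, j)) (enc x) >= 2 then ereal (real_of_rat (from_nat j)) else \<infinity>)
   = (INF j. if x i < real_of_rat (from_nat j) then ereal (real_of_rat (from_nat j)) else \<infinity>)"
   unfolding enc_def bit_code_decode cut_def by simp
  also have "... = ereal (x i)"
  proof (rule antisym)
   show "ereal (x i) <= (INF j. if x i < real_of_rat (from_nat j) then ereal (real_of_rat (from_nat j)) else \<infinity>)"
    by (rule INF_greatest) auto
   show "(INF j. if x i < real_of_rat (from_nat j) then ereal (real_of_rat (from_nat j)) else \<infinity>) <= ereal (x i)"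
   proof (rule ereal_le_epsilon2)
    fix e :: real assume "0 < e"
    then obtain q where q: "x i < real_of_rat q" "real_of_rat q < x i + e" using of_rat_dense[of "x i" "x i + e"] by auto
    have "(INF j. if x i < real_of_rat (from_nat j) then ereal (real_of_rat (from_nat j)) else \<infinity>) <= ereal (real_of_rat q)"
     by (rule INF_lower2[of "to_nat q"]) (use q in auto)
    also have "... <= ereal (x i) + ereal e" using q by simp
    finally show "(INF j. if x i < real_of_rat (from_nat j) then ereal (real_of_rat (from_nat j)) else \<infinity>) <= ereal (x i) + ereal e" .
   qed
  qed
  finally show ?thesis unfolding dec_def by simp
 qed
 have cutm: "{x. cut k x} : sets borel" for k
 proof -
  have "open {x. cut k x}" unfolding cut_def by (intro open_Collect_less continuous_on_const continuous_on_product_coordinates)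
  then show ?thesis by simp
 qed
 have encm: "enc : borel_measurable borel"
 proof -
  have "(%x. of_bool (cut k x) :: real) = indicator {x. cut k x}" for k by (auto simp: indicator_def)
  then have "(%x. of_bool (cut k x) :: real) : borel_measurable borel" for k using cutm[of k] by simp
  then show ?thesis unfolding enc_def[abs_def] bit_code_def
   by (intro borel_measurable_suminf borel_measurable_divide borel_measurable_times) auto
 qed
 have shm: "bit_shift : borel_measurable borel" unfolding bit_shift_def by measurable
 have itm: "(bit_shift ^^ k) : borel_measurable borel" for k
 proof (induction k)
  case (Suc k)
  then show ?case using measurable_compose[OF Suc shm] by (simp add: comp_def)
 qed simp
 have decm: "dec i : borel_measurable borel" for i
  unfolding dec_def
  by (intro borel_measurable_real_of_ereal borel_measurable_INF measurable_If borel_measurable_le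
    borel_measurable_times itm measurable_const countableI_type) simp_all
 show ?thesis by (rule that[OF encm decm dec_enc])
qed

text \<open>Encode the law as one on the reals, realise that by its quantile function, and decode
  coordinatewise.\<close>

lemma law_realize:
 assumes "prob_space \<mu>" "sets \<mu> = sets (borel :: (nat => real) measure)"
 obtains u where "!!i. u i : borel_measurable leb" "law leb u = \<mu>"
proof -
 obtain enc :: "(nat => real) => real" and dec :: "nat => real => real"
  where encm: "enc : borel_measurable borel" and decm: "!!i. dec i : borel_measurable borel"
   and dec_enc: "!!i x. dec i (enc x) = x i"
  using seq_real_coding by metis
 interpret \<mu>: prob_space \<mu> by fact
 have encm': "enc : borel_measurable \<mu>" using encm assms(2) by (simp cong: measurable_cong_sets)
 have "real_distribution (distr \<mu> borel enc)" using encm' by (rule \<mu>.real_distribution_distr)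
 then obtain I where I: "I : borel_measurable leb" "distr leb borel I = distr \<mu> borel enc"
  by (rule unit_interval_quantile)
 define u where "u i t = dec i (I t)" for i t
 have um: "u i : borel_measurable leb" for i
  unfolding u_def by (rule measurable_compose[OF I(1) decm])
 have dm: "(%y i. dec i y) : measurable borel borel" by (rule measurable_seq[OF decm])
 have "law leb u = distr (distr leb borel I) borel (%y i. dec i y)"
  unfolding law_def u_def using distr_distr[OF dm I(1)] by (simp add: comp_def)
 also have "... = distr \<mu> borel (%x i. dec i (enc x))"
  unfolding I(2) using distr_distr[OF dm encm'] by (simp add: comp_def)
 also have "... = \<mu>" unfolding dec_enc using assms(2) by (simp add: distr_id2)
 finally show ?thesis using um that by blast
qed


section \<open>Approximation of truncated random sequences\<close>

lemma abs_greater_sets: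
 fixes f :: "'a => real"
 assumes "f : borel_measurable M" shows "{x:space M. c < abs (f x)} : sets M"
 by (rule borel_measurable_less[OF borel_measurable_const borel_measurable_abs[OF assms]])

lemma trunc_bounds: "0 <= R ==> - R <= trunc R x" "0 <= R ==> trunc R x <= R" "0 <= R ==> abs (trunc R x) <= R"
 by (auto simp: trunc_def)

lemma trunc_id: "abs x <= R ==> trunc R x = x"
 by (simp add: trunc_def abs_le_iff)

lemma trunc_lipschitz: "abs (trunc R x - trunc R y) <= abs (x - y)"
 unfolding trunc_def by (auto simp: min_def max_def abs_if)

lemma trunc_trunc: "0 <= R ==> R <= S ==> trunc R (trunc S x) = trunc R x"
 unfolding trunc_def by (auto simp: min_def max_def)

lemma trunc_mono_diff: "0 <= R ==> R <= S ==> abs (trunc R x - trunc R y) <= abs (trunc S x - trunc S y)"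
 using trunc_lipschitz[of R "trunc S x" "trunc S y"] by (simp add: trunc_trunc)

lemma trunc_measurable [measurable]: "trunc R : borel_measurable borel"
 unfolding trunc_def[abs_def] by (intro borel_measurable_max borel_measurable_min) auto

definition rvs :: "(nat => real => real) => bool" where
 "rvs u \<longleftrightarrow> (ALL i. u i : borel_measurable leb)"

lemma rvsD: "rvs u ==> u i : borel_measurable leb"
 by (simp add: rvs_def)

lemma rvs_mp: "rvs u ==> unit_mp \<tau> ==> rvs (%i t. u i (\<tau> t))"
 unfolding rvs_def by (intro allI, rule measurable_compose[OF unit_mp_measurable]) auto

text \<open>\<open>N\<close> is both the number of coordinates compared and the truncation level.
  The deviation \<open>e / 2\<close> set against the mass \<open>e\<close> in \<open>apx\<close>
  mirrors the factor 2 in the box distance.\<close>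

definition apx_set :: "nat => real => (nat => real => real) => (nat => real => real) => real set" where
 "apx_set N e u v = {t:{0..1}. EX i<N. abs (trunc (real N) (u i t) - trunc (real N) (v i t)) > e / 2}"

definition apx :: "nat => real => (nat => real => real) => (nat => real => real) => bool" where
 "apx N e u v \<longleftrightarrow> measure leb (apx_set N e u v) <= e"

lemma sets_unit_Collect: "Measurable.pred leb P ==> {t:{0..1}. P t} : sets leb"
 by (simp add: pred_def)

lemma apx_set_sets [intro, simp]: "rvs u ==> rvs v ==> apx_set N e u v : sets leb"
proof -
 assume "rvs u" "rvs v"
 have "apx_set N e u v = (UN i:{..<N}. {t:space leb. e / 2 < abs (trunc (real N) (u i t) - trunc (real N) (v i t))})"
  by (auto simp: apx_set_def)
 also have "... : sets leb"
  by (intro sets.finite_UN borel_measurable_less borel_measurable_const borel_measurable_abs borel_measurable_diff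
    measurable_compose[OF rvsD trunc_measurable] finite_lessThan `rvs u` `rvs v`)
 finally show ?thesis .
qed

lemma apx_sym: "apx N e u v ==> apx N e v u"
 unfolding apx_def apx_set_def by (simp add: abs_minus_commute)

lemma apx_refl: "0 <= e ==> apx N e u u"
 unfolding apx_def apx_set_def by simp

lemma apx_trans:
 assumes "rvs u" "rvs v" "rvs w" "apx N e u v" "apx N e' v w"
 shows "apx N (e + e') u w"
proof -
 have "apx_set N (e + e') u w <= apx_set N e u v Un apx_set N e' v w"
 proof
  fix t assume "t : apx_set N (e + e') u w"
  then obtain i where i: "i < N" "abs (trunc N (u i t) - trunc N (w i t)) > (e + e') / 2" and t: "t : {0..1}"
   unfolding apx_set_def by blast
  then have "abs (trunc N (u i t) - trunc N (v i t)) > e / 2 | abs (trunc N (v i t) - trunc N (w i t)) > e' / 2"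
   by (simp add: abs_if split: if_splits) argo+
  then show "t : apx_set N e u v Un apx_set N e' v w" using i t unfolding apx_set_def by blast
 qed
 then have "measure leb (apx_set N (e + e') u w) <= measure leb (apx_set N e u v Un apx_set N e' v w)"
  by (intro leb.finite_measure_mono) (use assms in auto)
 also have "... <= measure leb (apx_set N e u v) + measure leb (apx_set N e' v w)"
  by (rule measure_Un_le) (use assms in auto)
 finally show ?thesis using assms(4,5) unfolding apx_def by simp
qed

text \<open>Truncation at \<open>N'\<close> factors through truncation at \<open>N\<close> and is
  1-Lipschitz, so raising the level can only enlarge the exceptional set.\<close>

lemma apx_set_mono: "N' <= N ==> e <= e' ==> apx_set N' e' u v <= apx_set N e u v"
proof
 fix t assume *: "N' <= N" "e <= e'" "t : apx_set N' e' u v"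
 then obtain i where i: "i < N'" "abs (trunc N' (u i t) - trunc N' (v i t)) > e' / 2" and t: "t : {0..1}"
  unfolding apx_set_def by blast
 have "abs (trunc N (u i t) - trunc N (v i t)) > e / 2"
  using trunc_mono_diff[of "real N'" "real N" "u i t" "v i t"] i(2) * by simp
 moreover have "i < N" using i * by simp
 ultimately show "t : apx_set N e u v" using t unfolding apx_set_def by blast
qed

lemma apx_mono:
 assumes "apx N e u v" "N' <= N" "e <= e'" "rvs u" "rvs v" shows "apx N' e' u v"
 using leb.finite_measure_mono[OF apx_set_mono[OF assms(2,3), of u v]] assms unfolding apx_def by force

lemma apx_mp:
 assumes "apx N e u v" "unit_mp \<tau>" "rvs u" "rvs v"
 shows "apx N e (%i t. u i (\<tau> t)) (%i t. v i (\<tau> t))"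
proof -
 have "measure leb (apx_set N e (%i t. u i (\<tau> t)) (%i t. v i (\<tau> t))) = measure leb (apx_set N e u v)"
  using unit_mp_measure[OF assms(2), of "%t. EX i<N. abs (trunc N (u i t) - trunc N (v i t)) > e / 2"]
   apx_set_sets[OF assms(3,4), of N e] unfolding apx_set_def by simp
 then show ?thesis using assms(1) unfolding apx_def by simp
qed

lemma apx_cong:
 assumes "!!i t. i < N ==> t : {0..1} ==> abs (trunc N (u i t) - trunc N (v i t)) <= abs (trunc N (u' i t) - trunc N (v' i t))"
  and "rvs u'" "rvs v'" "apx N e u' v'"
 shows "apx N e u v"
proof -
 have "apx_set N e u v <= apx_set N e u' v'" unfolding apx_set_def using assms(1) by (blast intro: less_le_trans)
 then have "measure leb (apx_set N e u v) <= measure leb (apx_set N e u' v')"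
  by (intro leb.finite_measure_mono) (use assms in auto)
 then show ?thesis using assms(4) unfolding apx_def by simp
qed

section \<open>Quantised types of laws\<close>

text \<open>The grid cell of side \<open>1 / 2 ^ n\<close> containing the first \<open>n\<close>
  coordinates truncated at \<open>n\<close>, numbered by a natural number so that
  \<open>unit_align\<close> applies to it.\<close>

definition cell :: "nat => (nat => real) => nat" where
 "cell n x = to_nat (map (%i. (floor (trunc (real n) (x i) * 2 ^ n))) [0..<n])"

lemma finite_range_cell: "finite (range (cell n))"
proof -
 have "range (cell n) <= to_nat ` {xs :: int list. set xs <= {- (int n * 2 ^ n)..int n * 2 ^ n} & length xs = n}"
 proof (intro image_subsetI)
  fix x :: "nat => real"
  have "(floor (trunc (real n) y * 2 ^ n)) : {- (int n * 2 ^ n)..int n * 2 ^ n}" for y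
  proof -
   have "trunc (real n) y * 2 ^ n <= of_int (int n * 2 ^ n)" "of_int (- (int n * 2 ^ n)) <= trunc (real n) y * 2 ^ n"
    using mult_right_mono[OF trunc_bounds(2), of "real n" "2 ^ n" y] mult_right_mono[OF trunc_bounds(1), of "real n" "2 ^ n" y]
    by simp_all
   then have "(floor (trunc (real n) y * 2 ^ n)) <= (floor (of_int (int n * 2 ^ n) :: real))"
    "(floor (of_int (- (int n * 2 ^ n)) :: real)) <= (floor (trunc (real n) y * 2 ^ n))" by (auto intro!: floor_mono simp del: floor_of_int)
   then show ?thesis unfolding floor_of_int by simp
  qed
  then show "cell n x : to_nat ` {xs :: int list. set xs <= {- (int n * 2 ^ n)..int n * 2 ^ n} & length xs = n}"
   unfolding cell_def by (intro imageI) auto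
 qed
 moreover have "finite {xs :: int list. set xs <= {- (int n * 2 ^ n)..int n * 2 ^ n} & length xs = n}"
  by (rule finite_lists_length_eq) simp
 ultimately show ?thesis by (meson finite_imageI finite_subset)
qed

definition cells :: "nat => nat" where "cells n = Suc (Max (range (cell n)))"

lemma cell_less: "cell n x < cells n"
 unfolding cells_def using Max_ge[OF finite_range_cell, of "cell n x" n] by auto

lemma cell_measurable: "cell n : measurable borel (count_space UNIV)"
proof -
 have "cell n -` {k} : sets borel" for k
 proof (cases "EX xs::int list. length xs = n & to_nat xs = k")
  case True
  then obtain xs :: "int list" where xs: "length xs = n" "to_nat xs = k" by blast
  have "cell n -` {k} = {x:space borel. ALL i:{..<n}. (floor (trunc (real n) (x i) * 2 ^ n)) = xs ! i}"
  proof -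
   have "cell n x = k \<longleftrightarrow> (ALL i:{..<n}. (floor (trunc (real n) (x i) * 2 ^ n)) = xs ! i)" for x
    unfolding cell_def xs(2)[symmetric] inj_eq[OF inj_to_nat]
    by (simp add: list_eq_iff_nth_eq xs(1)) blast
   then show ?thesis by (simp add: set_eq_iff)
  qed
  also have "... : sets borel"
  proof (rule sets.sets_Collect_finite_All)
   fix i
   have 1: "(%x::nat => real. trunc (real n) (x i)) : borel_measurable borel"
    by (rule measurable_compose[OF measurable_product_coordinates trunc_measurable])
   have 2: "(%x::nat => real. trunc (real n) (x i) * 2 ^ n) : borel_measurable borel"
    by (rule borel_measurable_times[OF 1 borel_measurable_const])
   have "(%x::nat => real. (floor (trunc (real n) (x i) * 2 ^ n))) : measurable borel (count_space UNIV)"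
    by (rule measurable_compose[OF 2 measurable_real_floor])
   from measurable_sets[OF this, of "{xs ! i}"]
   show "{x:space borel. (floor (trunc (real n) (x i) * 2 ^ n)) = xs ! i} : sets borel" by (simp add: vimage_def)
  qed simp
  finally show ?thesis .
 next
  case False
  then have "cell n -` {k} = {}" by (auto simp: cell_def) (metis diff_zero length_map length_upt)
  then show ?thesis by (metis sets.empty_sets)
 qed
 then show ?thesis by (intro measurable_count_space_eq_countable[THEN iffD2]) (auto simp: countableI_type)
qed

lemma cell_eq_close:
 assumes "cell n x = cell n y" "i < n" shows "abs (trunc (real n) (x i) - trunc (real n) (y i)) <= 1 / 2 ^ n"
proof -
 define a b where "a = trunc (real n) (x i) * 2 ^ n" and "b = trunc (real n) (y i) * 2 ^ n"
 have "(floor (a)) = (floor (b))" using assms by (auto simp: cell_def list_eq_iff_nth_eq a_def b_def)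
 then have "abs (a - b) <= 1" by linarith
 moreover have "abs (a - b) = abs (trunc (real n) (x i) - trunc (real n) (y i)) * 2 ^ n"
  unfolding a_def b_def by (simp add: abs_mult left_diff_distrib[symmetric])
 ultimately show ?thesis by (simp add: pos_le_divide_eq)
qed

lemma neq_label_sets:
 fixes f g :: "'a => nat"
 assumes "f : measurable M (count_space UNIV)" "g : measurable M (count_space UNIV)"
 shows "{x:space M. f x ~= g x} : sets M"
proof -
 have "{x:space M. f x ~= g x} = (\<Union>k. (f -` {k} Int space M) - (g -` {k} Int space M))" by auto
 also have "... : sets M"
  using measurable_sets[OF assms(1)] measurable_sets[OF assms(2)] by (intro sets.countable_UN image_subsetI sets.Diff) auto
 finally show ?thesis .
qed

text \<open>Cumulative masses of the cells, rounded down to multiples of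
  \<open>1 / (2 ^ n * cells n)\<close>. Cumulative masses are what \<open>unit_align\<close>
  compares, and the resolution is chosen so that the rounding errors of all cells together amount to
  at most \<open>1 / 2 ^ n\<close>.\<close>

definition law_type :: "nat => (nat => real) measure => nat list" where
 "law_type n \<mu> = map (%k. nat \<lfloor>measure \<mu> (cell n -` {..k}) * (2 ^ n * real (cells n))\<rfloor>) [0..<cells n]"

lemma finite_law_types: "finite (law_type n ` {\<mu>. prob_space \<mu>})"
proof -
 have "law_type n ` {\<mu>. prob_space \<mu>} <= {xs. set xs <= {..2 ^ n * cells n} & length xs = cells n}"
 proof (rule image_subsetI, safe)
  fix \<mu> :: "(nat => real) measure" and y assume "prob_space \<mu>" "y : set (law_type n \<mu>)"
  then obtain k where y: "y = nat \<lfloor>measure \<mu> (cell n -` {..k}) * (2 ^ n * real (cells n))\<rfloor>"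
   by (auto simp: law_type_def)
  have "measure \<mu> (cell n -` {..k}) * (2 ^ n * real (cells n)) <= 1 * (2 ^ n * real (cells n))"
   using `prob_space \<mu>` by (intro mult_right_mono prob_space.prob_le_1) auto
  then have "\<lfloor>measure \<mu> (cell n -` {..k}) * (2 ^ n * real (cells n))\<rfloor> <= (floor (real (2 ^ n * cells n)))"
   by (intro floor_mono) simp
  then show "y <= 2 ^ n * cells n" unfolding y floor_of_nat by linarith
 qed (simp add: law_type_def)
 then show ?thesis by (rule finite_subset) (rule finite_lists_length_eq, simp)
qed

text \<open>Equal types have cumulative cell masses with total difference at most
  \<open>1 / 2 ^ n\<close>, so the cells can be matched outside a set of that mass. In a common cell
  the truncated coordinates differ by at most \<open>1 / 2 ^ n\<close>, half of the tolerance
  \<open>2 / 2 ^ n\<close>.\<close>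

lemma law_type_align:
 assumes u: "rvs u" and w: "rvs w" and eq: "law_type n (law leb u) = law_type n (law leb w)"
 obtains \<tau> where "unit_mp \<tau>" "apx n (2 / 2 ^ n) u (%i t. w i (\<tau> t))"
proof -
 define \<kappa> where "\<kappa> u t = cell n (%i. u i t)" for u :: "nat => real => real" and t
 have km: "\<kappa> u : measurable leb (count_space UNIV)" if "rvs u" for u
  unfolding \<kappa>_def by (rule measurable_compose[OF measurable_seq cell_measurable]) (use that in \<open>simp add: rvs_def\<close>)
 define G where "G u k = measure leb {t:{0..1}. \<kappa> u t <= (k::nat)}" for u k
 have G: "G u k = measure (law leb u) (cell n -` {..k})" if "rvs u" for u k
  unfolding G_def \<kappa>_def using that measurable_sets[OF cell_measurable, of "{..k}" n]
  by (subst law_measure) (auto simp: rvs_def)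
 have "!!k. k < cells n ==> abs (G u k - G w k) <= 1 / (2 ^ n * real (cells n))"
 proof -
  fix k assume k: "k < cells n"
  define m where "m = 2 ^ n * real (cells n)"
  have m: "m > 0" unfolding m_def using k by simp
  have "nat (floor (G u k * m)) = nat (floor (G w k * m))"
   using eq k unfolding law_type_def G[OF u] G[OF w] m_def by (auto simp: list_eq_iff_nth_eq)
  moreover have "0 <= G u k * m" "0 <= G w k * m" using m by (auto simp: G_def)
  ultimately have "abs (G u k * m - G w k * m) <= 1" by linarith
  then have "abs (G u k - G w k) * m <= 1" using m by (simp add: abs_mult left_diff_distrib[symmetric])
  then show "abs (G u k - G w k) <= 1 / (2 ^ n * real (cells n))"
   unfolding m_def[symmetric] using m by (simp add: field_simps)
 qed
 note Gd = this
 have kl: "\<kappa> u t < cells n" for u t by (simp add: \<kappa>_def cell_less)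
 obtain \<tau> where t: "unit_mp \<tau>" and
  le: "measure leb {t:{0..1}. \<kappa> u t ~= \<kappa> w (\<tau> t)} <= (\<Sum>k<cells n. abs (G u k - G w k))"
  unfolding G_def by (rule unit_align[OF km[OF u] km[OF w] kl kl])
 note le
 also have "(\<Sum>k<cells n. abs (G u k - G w k)) <= (\<Sum>k<cells n. 1 / (2 ^ n * real (cells n)))"
  by (intro sum_mono Gd) auto
 also have "... = 1 / 2 ^ n" by (simp add: cells_def)
 finally have le': "measure leb {t:{0..1}. \<kappa> u t ~= \<kappa> w (\<tau> t)} <= 1 / 2 ^ n" .
 have sub: "apx_set n (2 / 2 ^ n) u (%i t. w i (\<tau> t)) <= {t:{0..1}. \<kappa> u t ~= \<kappa> w (\<tau> t)}"
  using cell_eq_close[of n] unfolding apx_set_def \<kappa>_def by force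
 have wt: "rvs (%i t. w i (\<tau> t))" by (rule rvs_mp[OF w t])
 have "{t:{0..1}. \<kappa> u t ~= \<kappa> w (\<tau> t)} : sets leb"
 proof -
  have 1: "\<kappa> u : measurable leb (count_space UNIV)" by (rule km[OF u])
  have 2: "(%t. \<kappa> w (\<tau> t)) : measurable leb (count_space UNIV)"
   using km[OF wt] by (simp add: \<kappa>_def[abs_def])
  show ?thesis using neq_label_sets[OF 1 2] by simp
 qed
 then have "measure leb (apx_set n (2 / 2 ^ n) u (%i t. w i (\<tau> t))) <= measure leb {t:{0..1}. \<kappa> u t ~= \<kappa> w (\<tau> t)}"
  by (intro leb.finite_measure_mono sub)
 also have "... <= 2 / 2 ^ n" by (rule order_trans[OF le']) (simp add: field_simps)
 finally show ?thesis using that[OF t] unfolding apx_def by blast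
qed

lemma pow2_small: "0 < e ==> EX n>=N. c / 2 ^ n <= (e :: real)"
proof -
 assume e: "0 < e"
 have "(%n. c * (1 / 2) ^ n) \<longlonglongrightarrow> c * 0" by (intro tendsto_mult tendsto_const LIMSEQ_power_zero) auto
 then have "\<forall>\<^sub>F n in sequentially. c * (1 / 2) ^ n < e" using e by (intro order_tendstoD(2)) auto
 then obtain M where "!!n. n >= M ==> c * (1 / 2) ^ n < e" by (auto simp: eventually_sequentially)
 then show ?thesis by (intro exI[of _ "max M N"]) (auto simp: power_divide intro: less_imp_le)
qed

text \<open>Equal laws have equal types at every level. The error \<open>e\<close> cannot be
  dispensed with: for \<open>u i t = t\<close> and \<open>w i t = 2 * t\<close> modulo 1 the laws
  agree, but a \<open>\<tau>\<close> with \<open>w i (\<tau> t) = u i t\<close> selects one of two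
  preimages and is not measure preserving.\<close>

lemma law_align:
 assumes u: "rvs u" and w: "rvs w" and eq: "law leb u = law leb w" and e: "0 < e"
 obtains \<tau> where "unit_mp \<tau>" "apx N e u (%i t. w i (\<tau> t))"
proof -
 obtain n where n: "n >= N" "2 / 2 ^ n <= e" using pow2_small[OF e] by blast
 obtain \<tau> where t: "unit_mp \<tau>" "apx n (2 / 2 ^ n) u (%i t. w i (\<tau> t))"
  using law_type_align[OF u w, of n] eq by metis
 then show ?thesis using that apx_mono[OF t(2) n u rvs_mp[OF w t(1)]] by blast
qed

section \<open>Diagonal subsequences and limits\<close>

lemma diagonal_stabilize:
 fixes f :: "nat => nat => 'c"
 assumes "!!n. finite (range (f n))"
 obtains r :: "nat => nat" where "strict_mono r" "!!n l. n <= l ==> f n (r l) = f n (r n)"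
proof -
 define P where "P n s \<longleftrightarrow> (ALL l. f n (s l) = f n (s 0))" for n and s :: "nat => nat"
 have stab: "P n s ==> f n (s l) = f n (s 0)" for n s l by (simp add: P_def)
 interpret subseqs P
 proof
  fix n and s :: "nat => nat" assume s: "strict_mono s"
  have "finite ((f n \<circ> s) ` UNIV)" using assms[of n] by (rule finite_subset[rotated]) auto
  then obtain c where inf: "infinite {l. f n (s l) = c}"
   using pigeonhole_infinite[of UNIV "f n \<circ> s"] by auto
  define r where "r = enumerate {l. f n (s l) = c}"
  have "f n (s (r l)) = c" for l using enumerate_in_set[OF inf] by (simp add: r_def)
  then have "P n (s \<circ> r)" by (simp add: P_def)
  then show "EX r. strict_mono r & P n (s \<circ> r)" using strict_mono_enumerate[OF inf] r_def by blast
 qed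
 have P: "P n (diagseq \<circ> (+) (Suc n))" for n
  by (rule diagseq_holds) (unfold P_def comp_def, metis)
 \<comment> \<open>Constancy of \<open>f n\<close> is secured from index \<open>Suc n\<close> of the
   diagonal sequence on, so the subsequence returned is the diagonal one shifted by one.\<close>
 have "f n (diagseq (Suc l)) = f n (diagseq (Suc n))" if "n <= l" for n l
  using stab[OF P[of n], of "l - n"] that by simp
 moreover have "strict_mono (%l. diagseq (Suc l))"
  using subseq_diagseq by (simp add: strict_mono_def)
 ultimately show ?thesis using that by blast
qed

text \<open>Only truncated increments are controlled. Once some value stays below the truncation
  level by the margin 1, that margin absorbs the sum of all later increments: the truncations act as
  identities from \<open>m\<close> on and the increments are summable.\<close>

lemma trunc_chain_convergent:
 fixes x :: "nat => real"
 assumes step: "!!l. l >= L ==> abs (trunc (real l) (x l) - trunc (real l) (x (Suc l))) <= 1 / 2 ^ l"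
  and m: "L <= m" "2 <= m" "abs (x m) < real m - 1"
 shows "convergent x"
proof -
 have bnd: "abs (x (m + k)) <= abs (x m) + (1 - 1 / 2 ^ k) & abs (x (m + k) - x (Suc (m + k))) <= 1 / 2 ^ (m + k)" for k
 proof (induction k)
  case 0
  have 1: "trunc (real m) (x m) = x m" using m by (auto simp: trunc_def)
  have p: "1 / 2 ^ m <= (1 :: real)" by simp
  have s: "abs (x m - trunc (real m) (x (Suc m))) <= 1 / 2 ^ m" using step[of m] m 1 by simp
  then have "abs (trunc (real m) (x (Suc m))) < m" using m p by linarith
  then have "trunc (real m) (x (Suc m)) = x (Suc m)" by (auto simp: trunc_def min_def max_def split: if_splits)
  then show ?case using s by simp
 next
  case (Suc k)
  have "1 / 2 ^ (m + k) <= 1 / (2 ^ Suc k :: real)" using m by (intro divide_left_mono power_increasing) auto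
  then have b: "abs (x (m + Suc k)) <= abs (x m) + (1 - 1 / 2 ^ Suc k)" 
  proof -
   have "(1 / 2 ^ k :: real) = 1 / 2 ^ Suc k + 1 / 2 ^ Suc k" by (simp add: field_simps)
   then show ?thesis using Suc `1 / 2 ^ (m + k) <= 1 / (2 ^ Suc k :: real)` by (smt (verit) add_Suc_right)
  qed
  let ?l = "m + Suc k"
  have p: "1 / 2 ^ ?l <= (1 / 2 ^ Suc k :: real)" by (intro divide_left_mono power_increasing) auto
  have lt: "abs (x ?l) + 1 / 2 ^ ?l < real ?l" using b p m(3) by simp
  moreover have "0 < (1 / 2 ^ ?l :: real)" by simp
  ultimately have "abs (x ?l) < real ?l" by linarith
  then have "trunc (real ?l) (x ?l) = x ?l" by (auto simp: trunc_def)
  then have s: "abs (x ?l - trunc (real ?l) (x (Suc ?l))) <= 1 / 2 ^ ?l" using step[of ?l] m by simp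
  then have "abs (trunc (real ?l) (x (Suc ?l))) < ?l" using lt by linarith
  then have "trunc (real ?l) (x (Suc ?l)) = x (Suc ?l)" by (auto simp: trunc_def min_def max_def split: if_splits)
  then show ?case using s b by simp
 qed
 have "summable (%l. x (Suc l) - x l)"
 proof (rule summable_comparison_test'[where N=m])
  show "summable (%l. (1 / 2) ^ l :: real)" by (intro summable_geometric) auto
  show "norm (x (Suc l) - x l) <= (1 / 2) ^ l" if "m <= l" for l
   using bnd[of "l - m"] that by (simp add: power_divide abs_minus_commute)
 qed
 then have "convergent (%n. \<Sum>l<n. x (Suc l) - x l)" by (simp add: summable_iff_convergent)
 then have "convergent (%n. (x n - x 0) + x 0)" unfolding sum_lessThan_telescope by (intro convergent_add convergent_const)
 then show ?thesis by simp
qed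

text \<open>By Borel-Cantelli almost every \<open>t\<close> is eventually outside the exceptional
  sets, and tightness supplies a late index at which the value is well below the truncation level;
  from there \<open>trunc_chain_convergent\<close> applies.\<close>

lemma chain_limit:
 assumes w: "!!l. rvs (w l)" and step: "!!l. apx l (2 / 2 ^ l) (w l) (w (Suc l))"
  and tight: "!!i e. 0 < e ==> EX R. ALL l. measure leb {t:{0..1}. abs (w l i t) > R} <= e"
 obtains v where "rvs v" "!!i. AE t in leb. (%l. w l i t) \<longlonglongrightarrow> v i t"
proof -
 have [measurable]: "w l i : borel_measurable leb" for l i using w by (simp add: rvs_def)
 define A where "A l = apx_set l (2 / 2 ^ l) (w l) (w (Suc l))" for l
 have A: "A l : sets leb" for l unfolding A_def using w by auto
 have "AE t in leb. \<forall>\<^sub>F l in sequentially. t : space leb - A l"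
 proof (rule borel_cantelli_AE1)
  show "summable (%l. measure leb (A l))"
  proof (rule summable_comparison_test')
   show "summable (%l. 2 * (1 / 2) ^ l :: real)" by (intro summable_mult summable_geometric) auto
   show "norm (measure leb (A l)) <= 2 * (1 / 2) ^ l" for l
    using step[of l] unfolding apx_def A_def by (simp add: power_divide)
  qed
 qed (use A in \<open>auto simp: leb.emeasure_finite less_top[symmetric]\<close>)
 then have bc: "AE t in leb. EX L. ALL l>=L. t ~: A l"
  by eventually_elim (auto simp: eventually_sequentially)
 \<comment> \<open>If the values stayed above \<open>real l - 1\<close> for all large
   \<open>l\<close> on a set \<open>B\<close>, then for each bound \<open>R\<close> a single large
   \<open>l\<close> would give \<open>B\<close> at most the tail mass beyond \<open>R\<close>, which
   tightness makes arbitrarily small.\<close>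
 have small: "AE t in leb. ALL L. EX l>=L. abs (w l i t) < real l - 1" for i
 proof -
  have "AE t in leb. EX l>=L. abs (w l i t) < real l - 1" for L
  proof -
   define B where "B = {t:{0..1}. ALL l>=L. ~ abs (w l i t) < real l - 1}"
   have B: "B : sets leb" unfolding B_def by (intro sets_unit_Collect) measurable
   have "measure leb B <= e" if e: "0 < e" for e
   proof -
    obtain R where R: "!!l. measure leb {t:{0..1}. abs (w l i t) > R} <= e" using tight[OF e] by blast
    obtain l where l: "l >= L" "real l > R + 1" by (metis max.strict_boundedE less_imp_le nat_le_linear reals_Archimedean2 le_less_trans of_nat_le_iff order_trans not_le)
    have "measure leb B <= measure leb {t:{0..1}. abs (w l i t) > R}"
     by (intro leb.finite_measure_mono sets_unit_Collect) (use l in \<open>force simp: B_def, measurable\<close>)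
    then show ?thesis using R[of l] by linarith
   qed
   then have "measure leb B = 0" by (meson field_le_epsilon add.left_neutral measure_nonneg order_antisym le_less_linear dense not_le)
   then have "emeasure leb B = 0" by (simp add: leb.emeasure_eq_measure)
   then have "AE t in leb. t ~: B" using B by (intro AE_not_in) (auto simp: null_sets_def)
   then show ?thesis using AE_space by eventually_elim (auto simp: B_def)
  qed
  then show ?thesis by (simp add: AE_all_countable)
 qed
 have conv: "AE t in leb. convergent (%l. w l i t)" for i
  using bc small[of i] AE_space
 proof eventually_elim
  case (elim t)
  then obtain L where L: "!!l. l >= L ==> t ~: A l" by blast
  obtain m where m: "m >= max (Suc i) (max L 2)" "abs (w m i t) < real m - 1" using elim by blast
  show ?case
  proof (rule trunc_chain_convergent[where L="max L (Suc i)" and m=m])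
   show "abs (trunc (real l) (w l i t) - trunc (real l) (w (Suc l) i t)) <= 1 / 2 ^ l" if "l >= max L (Suc i)" for l
   proof (rule ccontr)
    assume "~ ?thesis"
    then have "t : A l" unfolding A_def apx_set_def using that elim(3) by (intro CollectI conjI exI[of _ i]) auto
    then show False using L[of l] that by simp
   qed
  qed (use m in auto)
 qed
 define v where "v i t = lim (%l. w l i t)" for i t
 have "rvs v" unfolding rvs_def v_def by (intro allI borel_measurable_lim_metric) auto
 moreover have "AE t in leb. (%l. w l i t) \<longlonglongrightarrow> v i t" for i
  using conv[of i] by eventually_elim (auto simp: v_def convergent_LIMSEQ_iff)
 ultimately show ?thesis using that by blast
qed

lemma (in prob_space) measure_tendsto_0_AE:
 assumes "!!l. A l : sets M" "AE t in M. EX L::nat. ALL l>=L. t ~: A l"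
 shows "(%l. prob (A l)) \<longlonglongrightarrow> 0"
proof -
 have "(%l. integral\<^sup>L M (indicator (A l) :: 'a => real)) \<longlonglongrightarrow> integral\<^sup>L M (%_. 0 :: real)"
 proof (rule integral_dominated_convergence[where w="%_. 1"])
  show "AE x in M. (%l. indicator (A l) x :: real) \<longlonglongrightarrow> 0"
   using assms(2)
  proof eventually_elim
   case (elim x)
   then obtain L where "!!l. l >= L ==> x ~: A l" by blast
   then show ?case by (intro tendsto_eventually) (auto simp: eventually_sequentially intro!: exI[of _ L])
  qed
 qed (use assms(1) in \<open>auto simp: indicator_def\<close>)
 then show ?thesis using assms(1) sets.sets_into_space[OF assms(1)] by (simp add: Int_absorb2)
qed

lemma AE_limit_apx:
 assumes w: "!!l. rvs (w l)" and v: "rvs v" and "!!i. AE t in leb. (%l. w l i t) \<longlonglongrightarrow> v i t" and e: "0 < e"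
 shows "EX L. ALL l>=L. apx N e v (w l)"
proof -
 have "(%l. measure leb (apx_set N e v (w l))) \<longlonglongrightarrow> 0"
 proof (rule leb.measure_tendsto_0_AE)
  show "apx_set N e v (w l) : sets leb" for l using w v by auto
  have "AE t in leb. ALL i. (%l. w l i t) \<longlonglongrightarrow> v i t" using assms(3) by (simp add: AE_all_countable)
  then show "AE t in leb. EX L. ALL l>=L. t ~: apx_set N e v (w l)"
  proof eventually_elim
   case (elim t)
   have "\<forall>\<^sub>F l in sequentially. ALL i:{..<N}. abs (w l i t - v i t) < e / 2"
   proof (rule eventually_ball_finite[OF finite_lessThan], rule ballI)
    show "\<forall>\<^sub>F l in sequentially. abs (w l i t - v i t) < e / 2" for i
     using elim e tendstoD[of "%l. w l i t" "v i t" sequentially "e / 2"] by (simp add: dist_real_def)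
   qed
   then obtain L where L: "!!l i. l >= L ==> i < N ==> abs (w l i t - v i t) < e / 2" by (auto simp: eventually_sequentially)
   have "t ~: apx_set N e v (w l)" if "l >= L" for l
   proof
    assume "t : apx_set N e v (w l)"
    then obtain i where "i < N" "abs (trunc (real N) (v i t) - trunc (real N) (w l i t)) > e / 2" unfolding apx_set_def by blast
    then show False using L[OF that, of i] trunc_lipschitz[of "real N" "v i t" "w l i t"] by linarith
   qed
   then show ?case by blast
  qed
 qed
 then have "\<forall>\<^sub>F l in sequentially. measure leb (apx_set N e v (w l)) < e" using e by (rule order_tendstoD(2))
 then show ?thesis unfolding apx_def by (auto simp: eventually_sequentially intro: less_imp_le)
qed

text \<open>A theorem of Prokhorov and Skorokhod kind. Along a subsequence the types stabilise at
  every level; the rearrangements are then chosen recursively, each aligning the next term with the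
  previous one as already rearranged, which produces a chain for \<open>chain_limit\<close>.\<close>

lemma tight_subsequence:
 assumes u: "!!l. rvs (u l)"
  and tight: "!!i e. 0 < e ==> EX R. ALL l. measure leb {t:{0..1}. abs (u l i t) > R} <= e"
 obtains r \<tau> v where "strict_mono (r :: nat => nat)" "!!l. unit_mp (\<tau> l)" "rvs v"
  "!!i. AE t in leb. (%l. u (r l) i (\<tau> l t)) \<longlonglongrightarrow> v i t"
proof -
 have "finite (range (%l. law_type n (law leb (u l))))" for n
  by (rule finite_subset[OF _ finite_law_types[of n]])
   (use u in \<open>auto simp: rvs_def intro!: prob_space_law leb.prob_space_axioms\<close>)
 then obtain r where r: "strict_mono r"
  and ty: "!!n l. n <= l ==> law_type n (law leb (u (r l))) = law_type n (law leb (u (r n)))"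
  using diagonal_stabilize[of "%n l. law_type n (law leb (u l))"] by metis
 have um: "u l i : borel_measurable leb" for l i using u by (simp add: rvs_def)
 have ex: "EX \<sigma>. unit_mp \<sigma> & apx l (2 / 2 ^ l) (%i t. u (r l) i (\<tau> t)) (%i t. u (r (Suc l)) i (\<sigma> t))"
  if "unit_mp \<tau>" for l \<tau>
 proof -
  have "law leb (%i t. u (r l) i (\<tau> t)) = law leb (u (r l))" by (rule law_mp[OF that um])
  then have "law_type l (law leb (%i t. u (r l) i (\<tau> t))) = law_type l (law leb (u (r (Suc l))))"
   using ty[of l "Suc l"] by simp
  then show ?thesis using law_type_align[OF rvs_mp[OF u that] u] by metis
 qed
 obtain \<tau> where t: "!!l. unit_mp (\<tau> l) &
   apx l (2 / 2 ^ l) (%i t. u (r l) i (\<tau> l t)) (%i t. u (r (Suc l)) i (\<tau> (Suc l) t))"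
 proof -
  have "EX f. ALL n. unit_mp (f n) &
   apx n (2 / 2 ^ n) (%i t. u (r n) i (f n t)) (%i t. u (r (Suc n)) i (f (Suc n) t))"
   by (rule dependent_nat_choice[where P="%_. unit_mp"]) (use ex unit_mp_id in auto)
  then show ?thesis using that by blast
 qed
 then have tm: "!!l. unit_mp (\<tau> l)" by blast
 have "EX v. rvs v & (ALL i. AE t in leb. (%l. u (r l) i (\<tau> l t)) \<longlonglongrightarrow> v i t)"
 proof (rule chain_limit[where w="%l i t. u (r l) i (\<tau> l t)"])
  fix i and e :: real assume "0 < e"
  then obtain R where R: "!!l. measure leb {t:{0..1}. abs (u l i t) > R} <= e" using tight by blast
  have "measure leb {t:{0..1}. abs (u (r l) i (\<tau> l t)) > R} = measure leb {t:{0..1}. abs (u (r l) i t) > R}" for l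
   using unit_mp_measure[OF tm, of "%t. R < abs (u (r l) i t)" l]
    borel_measurable_less[OF borel_measurable_const borel_measurable_abs[OF um], of R "r l" i] by simp
  then show "EX R. ALL l. measure leb {t:{0..1}. abs (u (r l) i (\<tau> l t)) > R} <= e" using R by (intro exI[of _ R]) simp
 qed (use t rvs_mp[OF u] in auto)
 then show ?thesis using that r tm by blast
qed

lemma tight_rv:
 fixes f :: "'a => real"
 assumes "prob_space M" "f : borel_measurable M" "0 < (e::real)"
 obtains R where "measure M {x:space M. abs (f x) > R} <= e"
proof -
 interpret prob_space M by fact
 define A where "A n = {x:space M. real n < abs (f x)}" for n :: nat
 have A: "A n : sets M" for n
  unfolding A_def by (rule abs_greater_sets[OF assms(2)])
 have "(%n. measure M (A n)) \<longlonglongrightarrow> measure M (\<Inter>n. A n)"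
 proof (rule finite_Lim_measure_decseq)
  show "decseq A" unfolding decseq_def A_def by (auto intro: le_less_trans[OF of_nat_mono])
 qed (use A in auto)
 moreover have "(\<Inter>n. A n) = {}"
 proof -
  have "EX n::nat. ~ real n < abs (f x)" for x using real_arch_simple[of "abs (f x)"] by (auto simp: not_less)
  then show ?thesis unfolding A_def by blast
 qed
 ultimately have "(%n. measure M (A n)) \<longlonglongrightarrow> 0" by simp
 then have "\<forall>\<^sub>F n in sequentially. measure M (A n) < e" using assms(3) by (rule order_tendstoD(2))
 then obtain n where "measure M (A n) < e" by (auto simp: eventually_sequentially)
 then show ?thesis using that[of "real n"] unfolding A_def by simp
qed


section \<open>Geometric data sets\<close>

lemma extensional_eq_PiE: "extensional A = PiE A (%_. UNIV)"
 by (auto simp: PiE_def)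

lemma pw_closure_iff:
 assumes "F <= extensional A"
 shows "f : pw_closure A F \<longleftrightarrow> f : extensional A &
  (ALL K e. finite K & K <= A & 0 < e --> (EX g:F. ALL x:K. abs (f x - g x) < e))"
  (is "_ \<longleftrightarrow> _ & ?R")
proof -
 let ?T = "product_topology (%_. euclideanreal) A"
 have top: "topspace ?T = extensional A" by (simp add: extensional_eq_PiE)
 have "?R" if f: "f : extensional A" and cl: "!!T. f : T ==> openin ?T T ==> EX y. y : F & y : T"
 proof (intro allI impI)
  fix K and e :: real assume K: "finite K & K <= A & 0 < e"
  define S where "S x = (if x : K then ball (f x) e else UNIV)" for x
  have "openin ?T (PiE A S)"
  proof -
   have "{i:A. S i ~= topspace euclideanreal} <= K" by (auto simp: S_def)
   then show ?thesis using K by (auto simp: openin_PiE_gen S_def intro: finite_subset)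
  qed
  moreover have "f : PiE A S" using f K by (auto simp: S_def PiE_def)
  ultimately obtain g where "g : F" "g : PiE A S" using cl by blast
  then show "EX g:F. ALL x:K. abs (f x - g x) < e"
   using K by (intro bexI[of _ g]) (auto simp: S_def PiE_def Pi_def dist_real_def)
 qed
 moreover have "EX y. y : F & y : T" if R: ?R and T: "f : T" "openin ?T T" for T
 proof -
  obtain U where U: "finite {i:A. U i ~= topspace euclideanreal}" "ALL i:A. openin euclideanreal (U i)"
   "f : PiE A U" "PiE A U <= T"
   using T(2)[unfolded openin_product_topology_alt, rule_format, OF T(1)] by (elim exE conjE) assumption
  define K where "K = {i:A. U i ~= UNIV}"
  have K: "finite K" "K <= A" using U(1) by (auto simp: K_def)
  have "EX e>0. ball (f i) e <= U i" if "i : A" for i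
   using U(2)[rule_format, OF that] U(3) that by (auto simp: open_contains_ball PiE_def Pi_def)
  then obtain e where e: "!!i. i : A ==> e i > 0 & ball (f i) (e i) <= U i" by metis
  define e0 where "e0 = Min (insert 1 (e ` K))"
  have e0: "e0 > 0" "!!i. i : K ==> e0 <= e i" using K e by (auto simp: e0_def)
  obtain g where g: "g : F" "!!x. x : K ==> abs (f x - g x) < e0"
  proof -
   have "EX g:F. ALL x:K. abs (f x - g x) < e0" using R[rule_format, of K e0] K e0(1) by blast
   then show ?thesis using that by blast
  qed
  have "g x : U x" if "x : A" for x
  proof (cases "x : K")
   case True
   then have "g x : ball (f x) (e x)" using g(2)[OF True] e0(2)[OF True] by (simp add: dist_real_def)
   then show ?thesis using e[OF that] by blast
  qed (use that in \<open>simp add: K_def\<close>)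
  then have "g : PiE A U" using g(1) assms by (auto simp: PiE_def Pi_def)
  then show ?thesis using g(1) U(4) by blast
 qed
 ultimately show ?thesis unfolding pw_closure_def in_closure_of top by (intro iffI conjI) (elim conjE; simp)+
qed

lemma pw_closureI:
 assumes "F <= extensional A" "f : extensional A"
  and "!!K e. finite K ==> K <= A ==> 0 < e ==> EX g:F. ALL x:K. abs (f x - g x) < e"
 shows "f : pw_closure A F"
 using assms by (simp add: pw_closure_iff)

lemma pw_closureD:
 assumes "F <= extensional A" "f : pw_closure A F" "finite K" "K <= A" "0 < e"
 obtains g where "g : F" "!!x. x : K ==> abs (f x - g x) < e"
proof -
 have "EX g:F. ALL x:K. abs (f x - g x) < e" using assms by (simp add: pw_closure_iff)
 then show ?thesis using that by blast
qed

lemma pw_closure_extensional: "pw_closure A F <= extensional A"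
 unfolding pw_closure_def using closure_of_subset_topspace[of "product_topology (%_. euclideanreal) A" F]
 by (simp add: extensional_eq_PiE)

lemma pw_closure_subset: "F <= extensional A ==> F <= pw_closure A F"
 unfolding pw_closure_def by (rule closure_of_subset) (simp add: extensional_eq_PiE)

lemma pw_closure_mono: "F <= G ==> pw_closure A F <= pw_closure A G"
 unfolding pw_closure_def by (rule closure_of_mono)

lemma pw_closure_idem: "pw_closure A (pw_closure A F) = pw_closure A F"
 unfolding pw_closure_def by simp

lemma pw_closure_least: "F <= pw_closure A G ==> pw_closure A F <= pw_closure A G"
 using pw_closure_mono[of F "pw_closure A G" A] by (simp add: pw_closure_idem)

lemma pw_closure_finite: "finite F ==> F <= extensional A ==> pw_closure A F = F"
proof -
 assume F: "finite F" "F <= extensional A"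
 have "Hausdorff_space (product_topology (%_. euclideanreal) A)"
  by (auto simp: Hausdorff_space_product_topology Hausdorff_space_euclidean)
 then have "closedin (product_topology (%_. euclideanreal) A) F"
  using F by (intro closedin_Hausdorff_finite) (auto simp: extensional_eq_PiE)
 then show ?thesis unfolding pw_closure_def by (simp add: closure_of_eq)
qed

lemma Lip1_on_extensional: "Lip1_on A d <= extensional A" by (auto simp: Lip1_on_def)

lemma Lip1_onD: "f : Lip1_on A d ==> x : A ==> y : A ==> abs (f x - f y) <= d x y"
 by (auto simp: Lip1_on_def)

lemma pw_closure_Lip1: "pw_closure A (Lip1_on A d) = Lip1_on A d"
proof
 show "pw_closure A (Lip1_on A d) <= Lip1_on A d"
 proof
  fix f assume f: "f : pw_closure A (Lip1_on A d)"
  have "abs (f x - f y) <= d x y" if "x : A" "y : A" for x y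
  proof (rule field_le_epsilon)
   fix e :: real assume "0 < e"
   then obtain g where g: "g : Lip1_on A d" "!!z. z : {x,y} ==> abs (f z - g z) < e / 2"
    using pw_closureD[OF Lip1_on_extensional f, of "{x,y}" "e/2"] `x : A` `y : A` by auto
   then show "abs (f x - f y) <= d x y + e"
    using g(2)[of x, OF insertI1] g(2)[of y, OF insertI2[OF insertI1]] Lip1_onD[OF g(1) that] by linarith
  qed
  moreover have "f : extensional A" using f pw_closure_extensional[of A] by blast
  ultimately show "f : Lip1_on A d" by (simp add: Lip1_on_def)
 qed
qed (rule pw_closure_subset[OF Lip1_on_extensional])

locale gds =
 fixes X :: "'a gds"
 assumes is_gds: "is_gds X"

declare gds.intro [intro!]

sublocale gds \<subseteq> Metric_space "pts X" "gdist X"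
 using is_gds by (simp add: is_gds_def is_mm_def)

sublocale gds \<subseteq> prob_space "meas X"
 using is_gds by (simp add: is_gds_def is_mm_def)

lemma separable_real_seq:
 fixes S :: "(nat => real) set"
 obtains T where "countable T" "T <= S" "S <= closure T"
 using separable[of S] by blast

context gds
begin

lemma complete: "mcomplete" and separable: "separable_space mtopology"
 and space_meas [simp]: "space (meas X) = pts X"
 and sets_meas: "sets (meas X) = sigma_sets (pts X) {U. openin mtopology U}"
 and full_support: "openin mtopology U ==> U ~= {} ==> 0 < prob U"
 using is_gds by (auto simp: is_gds_def is_mm_def)

lemma feat_ext: "feat X <= extensional (pts X)" and feat_nonempty: "feat X ~= {}"
 using is_gds by (auto simp: is_gds_def)

lemma pts_nonempty: "pts X ~= {}" using not_empty by simp

lemma openin_sets: "openin mtopology U ==> U : sets (meas X)"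
 unfolding sets_meas by auto

lemma closedin_sets: "closedin mtopology C ==> C : sets (meas X)"
 using openin_sets[of "pts X - C"] sets.compl_sets[of "pts X - C" "meas X"] closedin_subset[of mtopology C]
 by (simp add: closedin_def double_diff)

lemma mball_sets [simp]: "mball x r : sets (meas X)" by (rule openin_sets) simp

lemma mball_pos: "x : pts X ==> 0 < r ==> 0 < prob (mball x r)"
 by (rule full_support) auto

lemma gdist_leI: "x : pts X ==> y : pts X ==> (!!f. f : feat X ==> abs (f x - f y) <= c) ==> gdist X x y <= c"
 unfolding feat_dist_def using feat_nonempty by (auto intro: cSUP_least)

lemma feat_Lip: "feat X <= Lip1_on (pts X) (gdist X)"
proof
 fix f assume f: "f : feat X"
 have "abs (f x - f y) <= gdist X x y" if "x : pts X" "y : pts X" for x y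
  using is_gds that f unfolding feat_dist_def is_gds_def by (auto intro: cSUP_upper)
 then show "f : Lip1_on (pts X) (gdist X)" using f feat_ext by (auto simp: Lip1_on_def)
qed

lemma feat_cl_Lip: "feat_cl X <= Lip1_on (pts X) (gdist X)"
 using pw_closure_mono[OF feat_Lip, of "pts X"] by (simp add: pw_closure_Lip1)

lemma feat_clD: "f : feat_cl X ==> x : pts X ==> y : pts X ==> abs (f x - f y) <= gdist X x y"
 by (rule Lip1_onD[OF subsetD[OF feat_cl_Lip]])

lemma feat_subset_cl: "feat X <= feat_cl X" by (rule pw_closure_subset[OF feat_ext])

lemma Lip1_measurable: assumes "f : Lip1_on (pts X) (gdist X)" shows "f : borel_measurable (meas X)"
proof (rule borel_measurable_iff_less[THEN iffD2], rule allI)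
 fix a
 have "openin mtopology {w:pts X. f w < a}"
  unfolding openin_mtopology
 proof (intro conjI allI impI)
  fix x assume x: "x : {w:pts X. f w < a}"
  have "mball x (a - f x) <= {w:pts X. f w < a}"
   using Lip1_onD[OF assms] by (fastforce simp: abs_diff_le_iff)
  then show "EX r>0. mball x r <= {w:pts X. f w < a}" using x by (intro exI[of _ "a - f x"]) auto
 qed auto
 then show "{w : space (meas X). f w < a} : sets (meas X)" using openin_sets by simp
qed

lemma feat_cl_measurable: "f : feat_cl X ==> f : borel_measurable (meas X)"
 using Lip1_measurable feat_cl_Lip by blast

lemma dense_points: obtains c :: "nat => 'a" where "range c <= pts X"
 "ALL x:pts X. ALL e>0. EX n. gdist X x (c n) < e"
proof -
 obtain C where C: "countable C" "C <= pts X" "mtopology closure_of C = pts X"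
  using separable unfolding separable_space_def by auto
 have "C ~= {}" using C(3) pts_nonempty by auto
 have "EX n. gdist X x (from_nat_into C n) < e" if "x : pts X" "0 < e" for x e
 proof -
  have "EX y:C. y : mball x e" using C(3) that unfolding metric_closure_of by blast
  then obtain y where "y : C" "gdist X x y < e" by auto
  then show ?thesis using from_nat_into_surj[OF C(1)] by metis
 qed
 moreover have "range (from_nat_into C) <= pts X" using C(2) range_from_nat_into[OF `C ~= {}` C(1)] by simp
 ultimately show ?thesis using that by blast
qed

text \<open>Finite unions of balls of a fixed small radius take the role of compact sets of nearly
  full mass.\<close>

lemma finite_ball_cover:
 assumes "0 < e" "0 < \<delta>"
 obtains K where "finite K" "K <= pts X" "K ~= {}" "1 - \<delta> < prob (UN x:K. mball x e)"
proof -
 obtain c :: "nat => 'a" where c: "range c <= pts X" "ALL x:pts X. ALL e>0. EX n. gdist X x (c n) < e"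
  by (rule dense_points)
 define A where "A n = (\<Union>x\<in>c ` {..n}. mball x e)" for n :: nat
 have A: "A n : sets (meas X)" for n unfolding A_def by (intro sets.finite_UN) auto
 have "(%n. prob (A n)) \<longlonglongrightarrow> prob (\<Union>n. A n)"
 proof (rule finite_Lim_measure_incseq)
  show "incseq A" unfolding incseq_def A_def by (intro allI impI UN_mono image_mono) auto
 qed (use A in auto)
 moreover have "(\<Union>n. A n) = pts X"
 proof
  show "pts X <= (\<Union>n. A n)"
  proof
   fix x assume x: "x : pts X"
   then obtain n where "gdist X x (c n) < e" using c(2) assms by blast
   then have "x : mball (c n) e" using x c(1) commute[of x] by auto
   then show "x : (\<Union>n. A n)" unfolding A_def by blast
  qed
 qed (auto simp: A_def)
 ultimately have "(%n. prob (A n)) \<longlonglongrightarrow> 1" using prob_space by simp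
 then have "\<forall>\<^sub>F n in sequentially. 1 - \<delta> < prob (A n)" using assms by (intro order_tendstoD(1)) auto
 then obtain n where "1 - \<delta> < prob (A n)" by (auto simp: eventually_sequentially)
 then show ?thesis using that[of "c ` {..n}"] c(1) unfolding A_def by auto
qed

lemma bounded_ball:
 assumes "0 < \<delta>"
 obtains x0 r where "x0 : pts X" "0 < r" "1 - \<delta> < prob (mball x0 r)"
proof -
 obtain K where K: "finite K" "K <= pts X" "K ~= {}" "1 - \<delta> < prob (UN x:K. mball x 1)"
  by (rule finite_ball_cover[of 1 \<delta>]) (use assms in auto)
 then obtain x0 where x0: "x0 : K" by blast
 define r where "r = Max (gdist X x0 ` K) + 1"
 have le: "gdist X x0 x <= r - 1" if "x : K" for x using K(1) that unfolding r_def by simp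
 have "(UN x:K. mball x 1) <= mball x0 r"
 proof
  fix y assume "y : (UN x:K. mball x 1)"
  then obtain x where x: "x : K" "y : pts X" "gdist X x y < 1" by auto
  have p: "x0 : pts X" "x : pts X" using K(2) x0 x(1) by auto
  then show "y : mball x0 r" using le[OF x(1)] triangle[OF p x(2)] x by simp
 qed
 then have "prob (UN x:K. mball x 1) <= prob (mball x0 r)" by (intro finite_measure_mono) auto
 moreover have "0 < r" using le[OF x0] nonneg[of x0 x0] by linarith
 ultimately show ?thesis using that[of x0 r] K x0 by auto
qed

end

section \<open>Ky Fan closeness of features compared with pointwise closure\<close>

definition near :: "'a measure => real => ('a => real) => ('a => real) => bool" where
 "near M e f g \<longleftrightarrow> measure M {x:space M. abs (f x - g x) > e} <= e"

lemma near_sym: "near M e f g ==> near M e g f"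
 unfolding near_def by (simp add: abs_minus_commute)

lemma near_sets:
 fixes f g :: "'a => real"
 assumes "f : borel_measurable M" "g : borel_measurable M"
 shows "{x:space M. e < abs (f x - g x)} : sets M"
 by (rule abs_greater_sets[OF borel_measurable_diff[OF assms]])

lemma (in prob_space) near_trans:
 assumes "f : borel_measurable M" "g : borel_measurable M" "h : borel_measurable M"
  and "near M e f g" "near M e' g h"
 shows "near M (e + e') f h"
proof -
 let ?A = "%e f g. {x:space M. abs (f x - g x) > (e::real)}"
 have "?A (e + e') f h <= ?A e f g Un ?A e' g h" by auto
 then have "prob (?A (e + e') f h) <= prob (?A e f g Un ?A e' g h)"
  by (intro finite_measure_mono sets.Un near_sets assms)
 also have "... <= prob (?A e f g) + prob (?A e' g h)"
  by (intro measure_Un_le near_sets assms)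
 finally show ?thesis using assms(4,5) unfolding near_def by simp
qed

lemma (in prob_space) near_mono:
 assumes "f : borel_measurable M" "g : borel_measurable M" "near M e f g" "e <= e'"
 shows "near M e' f g"
proof -
 have "prob {x:space M. abs (f x - g x) > e'} <= prob {x:space M. abs (f x - g x) > e}"
  using assms by (intro finite_measure_mono near_sets) auto
 then show ?thesis using assms(3,4) unfolding near_def by linarith
qed

lemma (in prob_space) nearI_subset:
 assumes "S : sets M" "1 - prob S <= e" "!!x. x : S ==> abs (f x - g x) <= e"
 shows "near M e f g"
proof -
 have "{x:space M. abs (f x - g x) > e} <= space M - S" using assms(3) by force
 then have "prob {x:space M. abs (f x - g x) > e} <= prob (space M - S)"
  by (intro finite_measure_mono) (use assms in auto)
 also have "... = 1 - prob S" using assms(1) by (rule prob_compl)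
 finally show ?thesis using assms(2) unfolding near_def by simp
qed

lemma near_distr:
 assumes "phi : measurable M N" "distr M N phi = N" "f : borel_measurable N" "g : borel_measurable N"
 shows "near M e (%x. f (phi x)) (%x. g (phi x)) \<longleftrightarrow> near N e f g"
proof -
 have "measure N {x:space N. abs (f x - g x) > e} = measure (distr M N phi) {x:space N. abs (f x - g x) > e}"
  using assms(2) by simp
 also have "... = measure M (phi -` {x:space N. abs (f x - g x) > e} Int space M)"
  by (rule measure_distr[OF assms(1)]) (simp add: near_sets assms)
 also have "phi -` {x:space N. abs (f x - g x) > e} Int space M = {x:space M. abs (f (phi x) - g (phi x)) > e}"
  using measurable_space[OF assms(1)] by auto
 finally show ?thesis unfolding near_def by simp
qed

context gds
begin

text \<open>For Lipschitz functions and a measure of full support, closeness in measure implies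
  closeness at given points: the balls around finitely many points have a common positive lower mass
  bound, and a deviation on a set of smaller mass cannot fill a ball. Together with
  \<open>pw_closure_near\<close> this identifies pointwise closure with Ky Fan closure.\<close>

lemma kf_closed:
 assumes f: "f : Lip1_on (pts X) (gdist X)" and G: "G <= Lip1_on (pts X) (gdist X)"
  and ap: "!!e. 0 < e ==> EX g:G. near (meas X) e f g"
 shows "f : pw_closure (pts X) G"
proof (rule pw_closureI)
 fix K and e :: real assume K: "finite K" "K <= pts X" "0 < e"
 define m where "m = Min (insert 1 ((%x. prob (mball x (e / 4))) ` K))"
 have m: "0 < m" "!!x. x : K ==> m <= prob (mball x (e / 4))"
  using K mball_pos by (auto simp: m_def subset_iff)
 define e' where "e' = min (m / 2) (e / 4)"
 have e': "0 < e'" "e' < m" "e' <= e / 4" using m K by (auto simp: e'_def)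
 obtain g where g: "g : G" "near (meas X) e' f g" using ap e' by blast
 have gL: "g : Lip1_on (pts X) (gdist X)" using g G by blast
 have "abs (f x - g x) < e" if x: "x : K" for x
 proof -
  have "EX y:mball x (e / 4). abs (f y - g y) <= e'"
  proof (rule ccontr)
   assume "~ ?thesis"
   then have "mball x (e / 4) <= {y:pts X. abs (f y - g y) > e'}" by auto
   then have "prob (mball x (e / 4)) <= prob {y:space (meas X). abs (f y - g y) > e'}"
    using f gL by (intro finite_measure_mono near_sets Lip1_measurable) auto
   then show False using g(2) m(2)[OF x] e' unfolding near_def by linarith
  qed
  then obtain y where y: "y : pts X" "gdist X x y < e / 4" "abs (f y - g y) <= e'" by auto
  have "x : pts X" using x K by blast
  then show ?thesis using Lip1_onD[OF f `x : pts X` y(1)] Lip1_onD[OF gL `x : pts X` y(1)] y e' by linarith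
 qed
 then show "EX g:G. ALL x:K. abs (f x - g x) < e" using g by blast
qed (use f G Lip1_on_extensional in auto)

lemma near_from_cover:
 assumes f: "f : Lip1_on (pts X) (gdist X)" and g: "g : Lip1_on (pts X) (gdist X)"
  and K: "K <= pts X" "finite K" "1 - e < prob (UN x:K. mball x (e / 3))"
  and le: "!!x. x : K ==> abs (f x - g x) <= e / 3"
 shows "near (meas X) e f g"
proof (rule nearI_subset)
 show "(UN x:K. mball x (e / 3)) : sets (meas X)" using K by (intro sets.finite_UN) auto
 fix y assume "y : (UN x:K. mball x (e / 3))"
 then obtain x where x: "x : K" "x : pts X" "y : pts X" "gdist X x y < e / 3" by auto
 then show "abs (f y - g y) <= e"
  using Lip1_onD[OF f x(2,3)] Lip1_onD[OF g x(2,3)] le[OF x(1)] by linarith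
qed (use K in simp)

text \<open>Agreement up to \<open>e / 3\<close> at the centres of a finite ball cover spreads to
  the balls by the Lipschitz property.\<close>

lemma pw_closure_near:
 assumes G: "G <= Lip1_on (pts X) (gdist X)" and f: "f : pw_closure (pts X) G" and e: "0 < e"
 obtains g where "g : G" "near (meas X) e f g"
proof -
 obtain K where K: "finite K" "K <= pts X" "1 - e < prob (UN x:K. mball x (e / 3))"
  by (rule finite_ball_cover[of "e/3" e]) (use e in auto)
 obtain g where g: "g : G" "!!x. x : K ==> abs (f x - g x) < e / 3"
  by (rule pw_closureD[OF order_trans[OF G Lip1_on_extensional] f K(1,2), of "e/3"]) (use e in auto)
 have "f : Lip1_on (pts X) (gdist X)" using f pw_closure_mono[OF G, of "pts X"] unfolding pw_closure_Lip1 by blast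
 then have "near (meas X) e f g" using g G K by (intro near_from_cover[of f g K e]) (auto intro: less_imp_le)
 then show ?thesis using that g by blast
qed

text \<open>Total boundedness of the bounded 1-Lipschitz functions in measure: rounding the values
  at the centres of a finite ball cover to multiples of \<open>e / 3\<close> leaves finitely many
  patterns, and two functions with the same pattern are near.\<close>

lemma packing_bound:
 assumes e: "0 < e" and R: "0 <= R"
 obtains n where "!!H. finite H ==> H <= {f : Lip1_on (pts X) (gdist X). ALL x:pts X. abs (f x) <= R} ==>
  (!!f g. f : H ==> g : H ==> f ~= g ==> ~ near (meas X) e f g) ==> card H <= n"
proof -
 obtain K where K: "finite K" "K <= pts X" "1 - e < prob (UN x:K. mball x (e / 3))"
  by (rule finite_ball_cover[of "e/3" e]) (use e in auto)
 define q where "q f = (\<lambda>x\<in>K. (floor (f x * (3 / e))))" for f :: "'a => real"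
 define B where "B = \<lceil>R * (3 / e)\<rceil> + 1"
 define Q where "Q = PiE K (%_. {- B..B})"
 have Q: "finite Q" unfolding Q_def using K by (intro finite_PiE) auto
 have qQ: "q f : Q" if "ALL x:pts X. abs (f x) <= R" for f
 proof -
  have "(floor (f x * (3 / e))) : {- B..B}" if "x : K" for x
  proof -
   have "abs (f x) <= R" using `ALL x:pts X. abs (f x) <= R` K that by blast
   then have "abs (f x) * (3 / e) <= R * (3 / e)" using e by (intro mult_right_mono) auto
   moreover have "abs (f x * (3 / e)) = abs (f x) * (3 / e)" using e by (simp add: abs_mult)
   ultimately have "abs (f x * (3 / e)) <= R * (3 / e)" by simp
   then show ?thesis unfolding B_def atLeastAtMost_iff by linarith
  qed
  then show ?thesis unfolding Q_def q_def by auto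
 qed
 show ?thesis
 proof (rule that[of "card Q"])
  fix H assume H: "finite H" "H <= {f : Lip1_on (pts X) (gdist X). ALL x:pts X. abs (f x) <= R}"
   and sep: "!!f g. f : H ==> g : H ==> f ~= g ==> ~ near (meas X) e f g"
  have "inj_on q H"
  proof (rule inj_onI, rule ccontr)
   fix f g assume fg: "f : H" "g : H" "q f = q g" "f ~= g"
   have "abs (f x - g x) <= e / 3" if "x : K" for x
   proof -
    have "(floor (f x * (3 / e))) = (floor (g x * (3 / e)))" using fun_cong[OF fg(3), of x] that unfolding q_def by simp
    then have "abs (f x * (3 / e) - g x * (3 / e)) <= 1" by linarith
    moreover have "abs (f x * (3 / e) - g x * (3 / e)) = abs (f x - g x) * (3 / e)"
     using e abs_mult[of "f x - g x" "3 / e"] by (simp add: left_diff_distrib diff_divide_distrib)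
    ultimately have "abs (f x - g x) * (3 / e) <= 1" by simp
    then show ?thesis using e by (simp add: field_simps)
   qed
   then have "near (meas X) e f g" using fg H K by (intro near_from_cover[of f g K]) auto
   then show False using sep fg by blast
  qed
  then show "card H <= card Q" using H qQ Q by (intro card_inj_on_le[of q]) auto
 qed
qed

section \<open>Countable dense families of features\<close>

definition dense_seq :: "(nat => 'a => real) => bool" where
 "dense_seq a \<longleftrightarrow> range a <= feat_cl X & feat X <= pw_closure (pts X) (range a)"

text \<open>Restricted to a countable dense set of points, the features lie in a separable sequence
  space and have a countable dense subset there. The Lipschitz property carries density from these
  points to all points.\<close>

lemma dense_seq_exists: obtains a where "dense_seq a" "range a <= feat X"
proof -
 obtain c :: "nat => 'a" where c: "range c <= pts X" "ALL x:pts X. ALL e>0. EX n. gdist X x (c n) < e"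
  by (rule dense_points)
 define r where "r f = (%n. f (c n) :: real)" for f :: "'a => real"
 obtain T where T: "countable T" "T <= r ` feat X" "r ` feat X <= closure T"
  by (rule separable_real_seq[of "r ` feat X"])
 obtain D where D: "countable D" "D <= feat X" "T = r ` D"
  using T(1,2) countable_subset_image[of T r "feat X"] by metis
 have "D ~= {}" using feat_nonempty T(3) D(3) by auto
 define a where "a = from_nat_into D"
 have ra: "range a = D" unfolding a_def using D(1) `D ~= {}` by (rule range_from_nat_into[rotated])
 have "f : pw_closure (pts X) D" if f: "f : feat X" for f
 proof (rule pw_closureI)
  show "D <= extensional (pts X)" "f : extensional (pts X)" using D(2) feat_ext f by auto
  fix K and e :: real assume K: "finite K" "K <= pts X" "0 < e"
  have "ALL x:K. EX n. gdist X x (c n) < e / 3" using c(2)[rule_format, of _ "e / 3"] K by (auto simp: subset_iff)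
  then obtain n where n: "!!x. x : K ==> gdist X x (c (n x)) < e / 3" by metis
  define U where "U = {y :: nat => real. ALL x:K. abs (y (n x) - r f (n x)) < e / 3}"
  have "U = (\<Inter>x\<in>K. {y. abs (y (n x) - r f (n x)) < e / 3})" by (auto simp: U_def)
  also have "open ..."
   by (intro open_INT[OF K(1)] ballI open_Collect_less continuous_intros continuous_on_product_coordinates)
  finally have "open U" .
  moreover have "r f : U" "r f : closure T" using K T(3) f by (auto simp: U_def)
  ultimately have "U Int T ~= {}" using open_Int_closure_eq_empty[of U T] by blast
  then obtain g where g: "g : D" "r g : U" using D(3) by blast
  have "abs (f x - g x) < e" if x: "x : K" for x
  proof -
   have xp: "x : pts X" "c (n x) : pts X" using x K c(1) by auto
   have gf: "g : feat_cl X" "f : feat_cl X" using g D f feat_subset_cl by auto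
   have "abs (g (c (n x)) - f (c (n x))) < e / 3" using g(2) x by (simp add: U_def r_def)
   then show ?thesis using n[OF x] feat_clD[OF gf(1) xp] feat_clD[OF gf(2) xp] by linarith
  qed
  then show "EX g:D. ALL x:K. abs (f x - g x) < e" using g by blast
 qed
 then have "dense_seq a" unfolding dense_seq_def ra using D(2) feat_subset_cl by auto
 then show ?thesis using that ra D by blast
qed

lemma dense_seq_ext: "dense_seq a ==> range a <= extensional (pts X)"
 unfolding dense_seq_def using pw_closure_extensional by blast

lemma dense_seq_gdist:
 assumes a: "dense_seq a" and x: "x : pts X" "y : pts X" and le: "!!i. abs (a i x - a i y) <= c"
 shows "gdist X x y <= c"
proof (rule gdist_leI[OF x])
 fix f assume "f : feat X"
 then have f: "f : pw_closure (pts X) (range a)" using a by (auto simp: dense_seq_def)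
 show "abs (f x - f y) <= c"
 proof (rule field_le_epsilon)
  fix e :: real assume "0 < e"
  then obtain i where i: "!!z. z : {x,y} ==> abs (f z - a i z) < e / 2"
  proof -
   show ?thesis by (rule pw_closureD[OF dense_seq_ext[OF a] f, of "{x,y}" "e/2"]) (use x `0 < e` that in auto)
  qed
  then show "abs (f x - f y) <= c + e" using i[of x, OF insertI1] i[of y, OF insertI2[OF insertI1]] le[of i] by linarith
 qed
qed

lemma dense_seq_measurable: "dense_seq a ==> a i : borel_measurable (meas X)"
 unfolding dense_seq_def using feat_cl_measurable by blast

lemma dense_seq_Lip: "dense_seq a ==> x : pts X ==> y : pts X ==> abs (a i x - a i y) <= gdist X x y"
 unfolding dense_seq_def using feat_clD by blast

lemma gdist_eq0: "dense_seq a ==> x : pts X ==> y : pts X ==> (!!i. a i x = a i y) ==> x = y"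
 using dense_seq_gdist[of a x y 0] nonneg[of x y] by simp

end


section \<open>Lifting laws of features to maps\<close>

context gds
begin

text \<open>\<open>gdist\<close> is the supremum of the coordinate differences over a dense
  sequence, so points approximating \<open>y\<close> uniformly in \<open>i\<close> form a Cauchy
  sequence. Thus the image of \<open>X\<close> in sequence space is closed for the supremum
  distance.\<close>

lemma limit_point_exists:
 assumes a: "dense_seq a" and ap: "!!e. 0 < e ==> EX z:pts X. ALL i. abs (a i z - y i) <= e"
 obtains x where "x : pts X" "!!i. a i x = y i"
proof -
 have "ALL k. EX z:pts X. ALL i. abs (a i z - y i) <= 1 / Suc k" using ap by simp
 then obtain z where z: "!!k. z k : pts X" "!!k i. abs (a i (z k) - y i) <= 1 / Suc k" by metis
 have dz: "gdist X (z k) (z l) <= 1 / Suc k + 1 / Suc l" for k l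
 proof (rule dense_seq_gdist[OF a z(1) z(1)])
  fix i show "abs (a i (z k) - a i (z l)) <= 1 / Suc k + 1 / Suc l"
   using z(2)[of i k] z(2)[of i l] by linarith
 qed
 have "MCauchy z" unfolding MCauchy_def
 proof (intro conjI allI impI)
  fix e :: real assume "0 < e"
  then obtain N where N: "1 / Suc N < e / 2" using nat_approx_posE[of "e / 2"] by auto
  have "gdist X (z k) (z l) < e" if "N <= k" "N <= l" for k l
  proof -
   have "1 / real (Suc k) <= 1 / Suc N" "1 / real (Suc l) <= 1 / Suc N" using that by (auto intro!: divide_left_mono)
   then show ?thesis using dz[of k l] N by linarith
  qed
  then show "EX N. ALL k l. N <= k --> N <= l --> gdist X (z k) (z l) < e" by blast
 qed (use z in auto)
 then obtain x where x: "limitin mtopology z x sequentially" using complete unfolding mcomplete_def by blast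
 then have xp: "x : pts X" by (simp add: limit_metric_sequentially)
 have "abs (a i x - y i) <= 0" for i
 proof (rule field_le_epsilon)
  fix e :: real assume e: "0 < e"
  then obtain N where N: "!!n. n >= N ==> gdist X (z n) x < e / 2"
   using x unfolding limit_metric_sequentially by (meson half_gt_zero)
  obtain M where M: "1 / Suc M < e / 2" using nat_approx_posE[of "e / 2"] e by auto
  define n where "n = max N M"
  have "1 / real (Suc n) <= 1 / Suc M" unfolding n_def by (auto intro!: divide_left_mono)
  moreover have "abs (a i (z n) - a i x) <= gdist X (z n) x" by (rule dense_seq_Lip[OF a z(1) xp])
  moreover have "gdist X (z n) x < e / 2" using N[of n] by (simp add: n_def)
  ultimately show "abs (a i x - y i) <= 0 + e" using z(2)[of i n] M by linarith
 qed
 then show ?thesis using that[OF xp] by simp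
qed

text \<open>Each open set is the union of the countably many supremum balls \<open>D n k\<close>
  inside it, with centres in a dense sequence and radii \<open>1 / Suc k\<close>; these balls are
  preimages of closed sets of sequences.\<close>

lemma sets_dense_seq:
 assumes a: "dense_seq a" and A: "A : sets (meas X)"
 obtains B where "B : sets borel" "A = {x:pts X. (%i. a i x) : B}"
proof -
 define \<alpha> where "\<alpha> x = (%i. a i x)" for x
 obtain c :: "nat => 'a" where c: "range c <= pts X" "ALL x:pts X. ALL e>0. EX n. gdist X x (c n) < e"
  by (rule dense_points)
 define V where "V = vimage_algebra (pts X) \<alpha> (borel :: (nat => real) measure)"
 have sV: "sets V = {\<alpha> -` B Int pts X | B. B : sets borel}" unfolding V_def by (rule sets_vimage_algebra2) auto
 define D where "D n k = {x:pts X. ALL i. abs (a i x - a i (c n)) <= 1 / Suc k}" for n k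
 have D: "D n k : sets V" for n k
 proof -
  have "closed {y :: nat => real. ALL i. abs (y i - a i (c n)) <= 1 / Suc k}"
   by (intro closed_Collect_all closed_Collect_le continuous_intros continuous_on_product_coordinates)
  moreover have "D n k = \<alpha> -` {y. ALL i. abs (y i - a i (c n)) <= 1 / Suc k} Int pts X"
   unfolding D_def \<alpha>_def by auto
  ultimately show ?thesis unfolding sV using borel_closed by blast
 qed
 have "{U. openin mtopology U} <= sets V"
 proof safe
  fix U assume U: "openin mtopology U"
  have "U = (\<Union>(n,k)\<in>{(n,k). D n k <= U}. D n k)"
  proof
   show "U <= (\<Union>(n,k)\<in>{(n,k). D n k <= U}. D n k)"
   proof
    fix x assume x: "x : U"
    then obtain r where r: "0 < r" "mball x r <= U" using U unfolding openin_mtopology by blast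
    have xp: "x : pts X" using x U unfolding openin_mtopology by blast
    obtain k where k: "1 / Suc k < r / 2" using nat_approx_posE[of "r / 2"] r by auto
    obtain n where n: "gdist X x (c n) < 1 / Suc k" using c(2) xp by (metis of_nat_0_less_iff zero_less_Suc zero_less_divide_1_iff)
    have cn: "c n : pts X" using c(1) by auto
    have "y : U" if y: "y : D n k" for y
    proof -
     have yp: "y : pts X" using y by (simp add: D_def)
     have "gdist X y (c n) <= 1 / Suc k" using y by (intro dense_seq_gdist[OF a yp cn]) (simp add: D_def)
     then have "gdist X x y < r" using triangle[OF xp cn yp] n k commute[of y "c n"] by linarith
     then show ?thesis using r(2) xp yp by auto
    qed
    moreover have "x : D n k" unfolding D_def
     using dense_seq_Lip[OF a xp cn] n xp by (force intro: order_trans less_imp_le)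
    ultimately show "x : (\<Union>(n,k)\<in>{(n,k). D n k <= U}. D n k)" by blast
   qed
  qed blast
  also have "... : sets V"
   using D by (intro sets.countable_UN') (auto intro!: countableI_type countable_subset[OF subset_UNIV])
  finally show "U : sets V" .
 qed
 then have "sets (meas X) <= sets V"
  unfolding sets_meas using sets.sigma_sets_subset[of "{U. openin mtopology U}" V] by (simp add: V_def)
 then show ?thesis using A that unfolding sV \<alpha>_def by (force simp: vimage_def Int_def conj_commute)
qed

text \<open>The coordinate map embeds \<open>X\<close> as a Borel subset of sequence space, so a
  random sequence with the law of \<open>a\<close> lies almost surely in the image and can be pulled
  back to points. The last conclusion holds everywhere rather than almost everywhere;
  \<open>domination_by_law\<close> relies on that.\<close>

lemma lift:
 assumes a: "dense_seq a" and Om: "prob_space Om" and w: "!!i. w i : borel_measurable Om"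
  and eq: "law Om w = law (meas X) a"
 obtains phi where "phi : measurable Om (meas X)" "distr Om (meas X) phi = meas X"
  "AE t in Om. ALL i. a i (phi t) = w i t"
  "!!t x. t : space Om ==> x : pts X ==> (!!i. a i x = w i t) ==> phi t = x"
proof -
 interpret Om: prob_space Om by fact
 obtain c :: "nat => 'a" where c: "range c <= pts X" "ALL x:pts X. ALL e>0. EX n. gdist X x (c n) < e"
  by (rule dense_points)
 have cp: "c n : pts X" for n using c(1) by auto
 obtain x0 where x0: "x0 : pts X" using pts_nonempty by blast
 \<comment> \<open>The image of \<open>X\<close>, written with countably many centres so that it is
   visibly Borel; completeness shows in \<open>B0_iff\<close> that nothing is added.\<close>
 define B0 where "B0 = (\<Inter>k. \<Union>n. {y :: nat => real. ALL i. abs (a i (c n) - y i) <= 1 / Suc k})"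
 have B0: "B0 : sets borel"
 proof -
  have "closed {y :: nat => real. ALL i. abs (a i (c n) - y i) <= 1 / Suc k}" for n k
   by (intro closed_Collect_all closed_Collect_le continuous_intros continuous_on_product_coordinates)
  then show ?thesis unfolding B0_def by (intro sets.countable_INT sets.countable_UN image_subsetI borel_closed) auto
 qed
 have B0_iff: "y : B0 \<longleftrightarrow> (EX x:pts X. ALL i. a i x = y i)" for y
 proof
  assume y: "y : B0"
  have "EX z:pts X. ALL i. abs (a i z - y i) <= e" if e: "0 < e" for e
  proof -
   obtain k where k: "1 / Suc k < e" using nat_approx_posE[OF e] by auto
   obtain n where "!!i. abs (a i (c n) - y i) <= 1 / Suc k" using y unfolding B0_def by blast
   then show ?thesis using k cp[of n] by (intro bexI[of _ "c n"]) (auto intro: order_trans less_imp_le)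
  qed
  then show "EX x:pts X. ALL i. a i x = y i" using limit_point_exists[OF a, of y] by metis
 next
  assume "EX x:pts X. ALL i. a i x = y i"
  then obtain x where x: "x : pts X" "!!i. a i x = y i" by blast
  show "y : B0" unfolding B0_def
  proof (intro INT_I)
   fix k
   obtain n where n: "gdist X x (c n) < 1 / Suc k" using c(2) x(1) by (metis of_nat_0_less_iff zero_less_Suc zero_less_divide_1_iff)
   have "abs (a i (c n) - y i) <= 1 / Suc k" for i
    using dense_seq_Lip[OF a x(1) cp, of i n] n x(2)[of i] by linarith
   then show "y : (\<Union>n. {y :: nat => real. ALL i. abs (a i (c n) - y i) <= 1 / Suc k})" by blast
  qed
 qed
 \<comment> \<open>The inverse of the coordinate map on \<open>B0\<close>; the default
   \<open>x0\<close> is used on a null set only.\<close>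
 define phi where "phi t = (if (%i. w i t) : B0 then (SOME x. x : pts X & (ALL i. a i x = w i t)) else x0)" for t
 have phi: "phi t : pts X & (ALL i. a i (phi t) = w i t)" if "(%i. w i t) : B0" for t
  unfolding phi_def using that B0_iff[of "%i. w i t"] someI_ex[of "%x. x : pts X & (ALL i. a i x = w i t)"] by auto
 have phi': "phi t = x0" if "(%i. w i t) ~: B0" for t using that by (simp add: phi_def)
 define G where "G = {t:space Om. (%i. w i t) : B0}"
 have wB: "{t:space Om. (%i. w i t) : B} : sets Om" if "B : sets borel" for B
  using measurable_sets[OF measurable_seq[OF w] that] by (simp add: vimage_def Int_def conj_commute)
 have mB: "measure Om {t:space Om. (%i. w i t) : B} = prob {x:pts X. (%i. a i x) : B}" if "B : sets borel" for B
  using law_measure[of w Om, OF w that] law_measure[of a "meas X", OF dense_seq_measurable[OF a] that] unfolding eq by simp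
 have G: "G : sets Om" unfolding G_def by (rule wB[OF B0])
 have "{x:pts X. (%i. a i x) : B0} = space (meas X)" using B0_iff by auto
 then have "measure Om G = 1" using mB[OF B0] prob_space unfolding G_def by simp
 then have AEG: "AE t in Om. t : G" using Om.prob_eq_1[OF G] by simp
 have pre: "EX B:sets borel. A = {x:pts X. (%i. a i x) : B}
   & (phi -` A Int space Om) = (G Int {t:space Om. (%i. w i t) : B}) Un (if x0 : A then space Om - G else {})"
  if A: "A : sets (meas X)" for A
 proof -
  obtain B where B: "B : sets borel" "A = {x:pts X. (%i. a i x) : B}" by (rule sets_dense_seq[OF a A])
  have "phi t : A \<longleftrightarrow> (%i. w i t) : B" if "t : G" for t
   using phi[of t] that unfolding B(2) G_def by auto
  moreover have "phi t : A \<longleftrightarrow> x0 : A" if "t : space Om - G" for t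
   using phi'[of t] that unfolding G_def by auto
  ultimately show ?thesis using B G sets.sets_into_space[OF G] by (intro bexI[of _ B]) auto
 qed
 have m: "phi : measurable Om (meas X)"
 proof (rule measurableI)
  show "phi t : space (meas X)" for t using phi[of t] phi'[of t] x0 by (cases "(%i. w i t) : B0") auto
  fix A assume "A : sets (meas X)"
  from pre[OF this] show "phi -` A Int space Om : sets Om" using G wB by auto
 qed
 moreover have "distr Om (meas X) phi = meas X"
 proof (rule measure_eqI)
  fix A assume "A : sets (distr Om (meas X) phi)"
  then have A: "A : sets (meas X)" by simp
  from pre[OF A] obtain B where B: "B : sets borel" "A = {x:pts X. (%i. a i x) : B}"
   and pB: "(phi -` A Int space Om) = (G Int {t:space Om. (%i. w i t) : B}) Un (if x0 : A then space Om - G else {})" by blast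
  have "emeasure (distr Om (meas X) phi) A = emeasure Om (phi -` A Int space Om)" using m A by (simp add: emeasure_distr)
  also have "... = emeasure Om {t:space Om. (%i. w i t) : B}"
  proof (rule emeasure_eq_AE)
   show "AE t in Om. (t : phi -` A Int space Om) = (t : {t:space Om. (%i. w i t) : B})"
    unfolding pB using AEG by eventually_elim (auto simp: G_def)
  qed (use measurable_sets[OF m A] wB[OF B(1)] in auto)
  also have "... = emeasure (meas X) A"
   using mB[OF B(1)] unfolding B(2)[symmetric] Om.emeasure_eq_measure emeasure_eq_measure by simp
  finally show "emeasure (distr Om (meas X) phi) A = emeasure (meas X) A" .
 qed simp
 moreover have "AE t in Om. ALL i. a i (phi t) = w i t"
  using AEG by eventually_elim (use phi in \<open>auto simp: G_def\<close>)
 moreover have "phi t = x" if "t : space Om" "x : pts X" "!!i. a i x = w i t" for t x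
 proof -
  have "(%i. w i t) : B0" using that B0_iff by auto
  then show ?thesis using phi[of t] that by (intro gdist_eq0[OF a]) auto
 qed
 ultimately show ?thesis using that by blast
qed

lemma Lip1_range_measurable:
 assumes "!!y. y : space M ==> h y : pts X" and "Metric_space (space M) d"
  and "!!y y'. y : space M ==> y' : space M ==> gdist X (h y) (h y') <= d y y'"
  and "!!U. openin (Metric_space.mtopology (space M) d) U ==> U : sets M"
 shows "h : measurable M (meas X)"
proof (rule measurable_sigma_sets[OF sets_meas])
 interpret Y: Metric_space "space M" d by fact
 show "{U. openin mtopology U} <= Pow (pts X)" by (auto simp: openin_mtopology)
 show "h : space M \<rightarrow> pts X" using assms(1) by blast
 fix U assume "U : {U. openin mtopology U}"
 then have U: "openin mtopology U" by simp
 have "openin Y.mtopology (h -` U Int space M)" unfolding Y.openin_mtopology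
 proof (intro conjI allI impI)
  fix y assume y: "y : h -` U Int space M"
  then obtain r where r: "0 < r" "mball (h y) r <= U" using U unfolding openin_mtopology by blast
  have "Y.mball y r <= h -` U Int space M"
  proof
   fix y' assume "y' : Y.mball y r"
   then have y': "y : space M" "y' : space M" "d y y' < r" by auto
   then have "h y' : mball (h y) r" using assms(1)[OF y'(1)] assms(1)[OF y'(2)] assms(3)[OF y'(1,2)] by simp
   then show "y' : h -` U Int space M" using subsetD[OF r(2)] y'(2) by simp
  qed
  then show "EX r>0. Y.mball y r <= h -` U Int space M" using r(1) by blast
 qed blast
 then show "h -` U Int space M : sets M" by (rule assms(4))
qed

lemma params_nonempty: obtains phi where "phi : params X"
proof -
 obtain a where a: "dense_seq a" by (rule dense_seq_exists)
 have am: "a i : borel_measurable (meas X)" for i by (rule dense_seq_measurable[OF a])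
 obtain u where u: "!!i. u i : borel_measurable leb" "law leb u = law (meas X) a"
  by (rule law_realize[OF prob_space_law[of _ a, OF prob_space_axioms am] sets_law]) blast
 obtain phi where "phi : measurable leb (meas X)" "distr leb (meas X) phi = meas X"
  by (rule lift[OF a leb.prob_space_axioms u])
 then show ?thesis using that by (simp add: params_def)
qed

end

section \<open>Domination and isomorphism\<close>

lemma pullback_pw_closure:
 assumes "!!x. x : A ==> phi x : B" "G <= extensional B" "g : pw_closure B G"
 shows "compose A g phi : pw_closure A (pullback A G phi)"
proof (rule pw_closureI)
 show "pullback A G phi <= extensional A" by (auto simp: pullback_def compose_def)
 fix K and e :: real assume K: "finite K" "K <= A" "0 < e"
 have K': "finite (phi ` K)" "phi ` K <= B" using K assms(1) by auto
 obtain h where h: "h : G" "!!y. y : phi ` K ==> abs (g y - h y) < e"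
  by (rule pw_closureD[OF assms(2,3) K' K(3)]) blast
 then show "EX f:pullback A G phi. ALL x:K. abs (compose A g phi x - f x) < e"
  using K(2) by (intro bexI[of _ "compose A h phi"]) (auto simp: pullback_def compose_def)
qed (simp add: compose_def)

lemma domination_measurable: "domination X Y phi ==> phi : measurable (meas X) (meas Y)"
 and domination_distr: "domination X Y phi ==> distr (meas X) (meas Y) phi = meas Y"
 and domination_feat: "domination X Y phi ==> pullback (pts X) (feat Y) phi <= feat_cl X"
 by (auto simp: domination_def)

lemma domination_space:
 assumes "is_gds X" "is_gds Y" "domination X Y phi" "x : pts X" shows "phi x : pts Y"
proof -
 interpret X: gds X by rule fact
 interpret Y: gds Y by rule fact
 show ?thesis using measurable_space[OF domination_measurable[OF assms(3)], of x] assms(4) by simp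
qed

lemma domination_feat_cl:
 assumes "is_gds X" "is_gds Y" "domination X Y phi" "g : feat_cl Y"
 shows "compose (pts X) g phi : feat_cl X"
proof -
 interpret Y: gds Y by rule fact
 have "compose (pts X) g phi : pw_closure (pts X) (pullback (pts X) (feat Y) phi)"
  by (rule pullback_pw_closure[OF _ Y.feat_ext assms(4)]) (rule domination_space[OF assms(1-3)])
 also have "... <= feat_cl X" by (rule pw_closure_least[OF domination_feat[OF assms(3)]])
 finally show ?thesis .
qed

lemma domination_law:
 assumes "is_gds X" "is_gds Y" "domination X Y phi" "!!i. g i : feat_cl Y"
 shows "law (meas X) (%i. compose (pts X) (g i) phi) = law (meas Y) g"
proof -
 interpret X: gds X by rule fact
 interpret Y: gds Y by rule fact
 have "law (meas X) (%i. compose (pts X) (g i) phi) = law (meas X) (%i x. g i (phi x))"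
  by (rule law_cong) (simp add: compose_def)
 also have "... = law (meas Y) g"
  by (rule law_distr[OF domination_measurable[OF assms(3)] domination_distr[OF assms(3)]]) (rule Y.feat_cl_measurable[OF assms(4)])
 finally show ?thesis .
qed

lemma domination_trans:
 assumes g: "is_gds X" "is_gds Y" "is_gds Z" and XY: "domination X Y phi" and YZ: "domination Y Z psi"
 shows "domination X Z (compose (pts X) psi phi)"
proof -
 interpret X: gds X by rule fact
 have m: "(%x. psi (phi x)) : measurable (meas X) (meas Z)"
  by (rule measurable_compose[OF domination_measurable[OF XY] domination_measurable[OF YZ]])
 then have m': "compose (pts X) psi phi : measurable (meas X) (meas Z)"
  by (rule measurable_cong[THEN iffD1, rotated]) (simp add: compose_def)
 have "distr (meas X) (meas Z) (compose (pts X) psi phi) = distr (meas X) (meas Z) (psi \<circ> phi)"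
  by (rule distr_cong) (auto simp: compose_def)
 also have "... = distr (distr (meas X) (meas Y) phi) (meas Z) psi"
  by (rule distr_distr[symmetric, OF domination_measurable[OF YZ] domination_measurable[OF XY]])
 also have "... = meas Z" using domination_distr[OF XY] domination_distr[OF YZ] by simp
 moreover have "pullback (pts X) (feat Z) (compose (pts X) psi phi) <= feat_cl X"
 proof
  fix h assume "h : pullback (pts X) (feat Z) (compose (pts X) psi phi)"
  then obtain f where f: "f : feat Z" "h = compose (pts X) f (compose (pts X) psi phi)" by (auto simp: pullback_def)
  have "compose (pts Y) f psi : feat_cl Y" using domination_feat[OF YZ] f(1) by (auto simp: pullback_def)
  then have "compose (pts X) (compose (pts Y) f psi) phi : feat_cl X" by (rule domination_feat_cl[OF g(1,2) XY])
  moreover have "compose (pts X) (compose (pts Y) f psi) phi = h"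
   unfolding f(2) using domination_space[OF g(1,2) XY] by (auto simp: compose_def fun_eq_iff)
  ultimately show "h : feat_cl X" by simp
 qed
 ultimately show ?thesis using m' by (simp add: domination_def compose_extensional)
qed

lemma domination_Lip:
 assumes "is_gds X" "is_gds Y" "domination X Y phi" "x : pts X" "y : pts X"
 shows "gdist Y (phi x) (phi y) <= gdist X x y"
proof -
 interpret X: gds X by rule fact
 interpret Y: gds Y by rule fact
 show ?thesis
 proof (rule Y.gdist_leI[OF domination_space[OF assms(1-4)] domination_space[OF assms(1-3,5)]])
  fix f assume "f : feat Y"
  then have "compose (pts X) f phi : feat_cl X" using domination_feat[OF assms(3)] by (auto simp: pullback_def)
  from X.feat_clD[OF this assms(4,5)] show "abs (f (phi x) - f (phi y)) <= gdist X x y"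
   using assms(4,5) by (simp add: compose_def)
 qed
qed

text \<open>The map comes from lifting the features \<open>f\<close> along the dense sequence of
  \<open>A\<close>. The equations hold almost everywhere at first and then at every point, as
  domination demands.\<close>

lemma domination_by_law:
 assumes X: "is_gds X" and A: "is_gds A" and a: "gds.dense_seq A a"
  and f: "!!i. f i : feat_cl X" and eq: "law (meas X) f = law (meas A) a"
 obtains psi where "domination X A psi" "!!i x. x : pts X ==> a i (psi x) = f i x"
proof -
 interpret X: gds X by rule fact
 interpret A: gds A by rule fact
 have fm: "f i : borel_measurable (meas X)" for i by (rule X.feat_cl_measurable[OF f])
 obtain phi where phi: "phi : measurable (meas X) (meas A)" "distr (meas X) (meas A) phi = meas A"
  and AE: "AE t in meas X. ALL i. a i (phi t) = f i t"
  and uniq: "!!t x. t : space (meas X) ==> x : pts A ==> (!!i. a i x = f i t) ==> phi t = x"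
  by (rule A.lift[OF a X.prob_space_axioms fm eq]) blast
 have phip: "phi x : pts A" if "x : pts X" for x using measurable_space[OF phi(1), of x] that by simp
 \<comment> \<open>By full support every ball around \<open>x\<close> contains a point where the
   equations hold. As the \<open>f i\<close> are 1-Lipschitz, the values at \<open>x\<close> are
   uniformly approximated by coordinates of points of \<open>A\<close>, so completeness provides an
   exact point, and uniqueness in the lifting identifies it with \<open>phi x\<close>.\<close>
 have all: "a i (phi x) = f i x" if x: "x : pts X" for i x
 proof -
  have "EX z:pts A. ALL i. abs (a i z - f i x) <= e" if e: "0 < e" for e
  proof -
   have "EX t:X.mball x e. ALL i. a i (phi t) = f i t"
   proof (rule ccontr)
    assume n: "~ ?thesis"
    have "AE t in meas X. t ~: X.mball x e" using AE by eventually_elim (use n in blast)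
    then have "X.prob (X.mball x e) = 0" using X.prob_eq_0[OF X.mball_sets] by simp
    then show False using X.mball_pos[OF x e] by simp
   qed
   then obtain t where t: "t : pts X" "gdist X x t < e" "!!i. a i (phi t) = f i t" by auto
   have "abs (a i (phi t) - f i x) <= e" for i using X.feat_clD[OF f x t(1), of i] t(2) t(3)[of i] by linarith
   then show ?thesis using phip[OF t(1)] by blast
  qed
  then obtain z where z: "z : pts A" "!!i. a i z = f i x" using A.limit_point_exists[OF a, of "%i. f i x"] by metis
  then have "phi x = z" using x by (intro uniq) auto
  then show ?thesis using z by simp
 qed
 define psi where "psi = restrict phi (pts X)"
 have psi: "psi x = phi x" if "x : pts X" for x using that by (simp add: psi_def)
 have m: "psi : measurable (meas X) (meas A)"
  by (rule measurable_cong[THEN iffD1, OF _ phi(1)]) (simp add: psi)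
 have "distr (meas X) (meas A) psi = meas A"
  using distr_cong[of "meas X" "meas X" "meas A" "meas A" psi phi] psi phi(2) by simp
 moreover have "pullback (pts X) (feat A) psi <= feat_cl X"
 proof
  fix h assume "h : pullback (pts X) (feat A) psi"
  then obtain g where g: "g : feat A" "h = compose (pts X) g psi" by (auto simp: pullback_def)
  have "g : pw_closure (pts A) (range a)" using g(1) a by (auto simp: A.dense_seq_def)
  then have "h : pw_closure (pts X) (pullback (pts X) (range a) psi)"
   unfolding g(2) using phip psi by (intro pullback_pw_closure[OF _ A.dense_seq_ext[OF a]]) auto
  also have "pullback (pts X) (range a) psi = range f"
  proof -
   have "compose (pts X) (a i) psi = f i" for i
   proof
    fix x
    show "compose (pts X) (a i) psi x = f i x"
     using all[of x i] psi[of x] subsetD[OF pw_closure_extensional f[of i]]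
     by (cases "x : pts X") (auto simp: compose_def extensional_def)
   qed
   then show ?thesis unfolding pullback_def by (simp add: image_image)
  qed
  also have "pw_closure (pts X) (range f) <= feat_cl X" using f by (intro pw_closure_least) auto
  finally show "h : feat_cl X" .
 qed
 ultimately have "domination X A psi" using m by (simp add: domination_def psi_def)
 then show ?thesis using that all psi by auto
qed

lemma iso_gds_inverse:
 assumes gX: "is_gds X" and gY: "is_gds Y" and iso: "iso_gds X Y"
 obtains phi psi where "domination X Y phi" "domination Y X psi"
  "pullback (pts X) (feat_cl Y) phi = feat_cl X" "pullback (pts Y) (feat_cl X) psi = feat_cl Y"
  "bij_betw psi (pts Y) (pts X)" "!!x. x : pts X ==> psi (phi x) = x"
proof -
 interpret X: gds X by rule fact
 interpret Y: gds Y by rule fact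
 obtain phi where b: "bij_betw phi (pts X) (pts Y)" and m: "phi : measurable (meas X) (meas Y)"
  and d: "distr (meas X) (meas Y) phi = meas Y" and pb: "pullback (pts X) (feat_cl Y) phi = feat_cl X"
  using iso unfolding iso_gds_def by blast
 define psi where "psi = restrict (inv_into (pts X) phi) (pts Y)"
 have psi: "psi y : pts X" "phi (psi y) = y" if "y : pts Y" for y
  using b that by (auto simp: psi_def bij_betw_def inv_into_into f_inv_into_f)
 have psiphi: "psi (phi x) = x" and phip: "phi x : pts Y" if "x : pts X" for x
  using b that by (auto simp: psi_def bij_betw_def inv_into_f_f)
 have pull: "compose (pts Y) f psi : feat_cl Y" if f: "f : feat_cl X" for f
 proof -
  obtain g where g: "g : feat_cl Y" "f = compose (pts X) g phi" using f pb unfolding pullback_def by blast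
  have "compose (pts Y) f psi = g"
  proof
   fix y show "compose (pts Y) f psi y = g y"
    using psi[of y] subsetD[OF pw_closure_extensional g(1)] unfolding g(2)
    by (cases "y : pts Y") (auto simp: compose_def extensional_def)
  qed
  then show ?thesis using g(1) by simp
 qed
 have pb': "pullback (pts Y) (feat_cl X) psi = feat_cl Y"
 proof
  show "feat_cl Y <= pullback (pts Y) (feat_cl X) psi"
  proof
   fix g assume g: "g : feat_cl Y"
   have "compose (pts X) g phi : feat_cl X" using pb g by (auto simp: pullback_def)
   moreover have "g = compose (pts Y) (compose (pts X) g phi) psi"
   proof
    fix y show "g y = compose (pts Y) (compose (pts X) g phi) psi y"
     using psi[of y] subsetD[OF pw_closure_extensional g] by (cases "y : pts Y") (auto simp: compose_def extensional_def)
   qed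
   ultimately show "g : pullback (pts Y) (feat_cl X) psi" unfolding pullback_def by blast
  qed
 qed (use pull in \<open>auto simp: pullback_def\<close>)
 \<comment> \<open>Features pull back to features, so the inverse is 1-Lipschitz; this is where its
   measurability comes from.\<close>
 have Lip: "gdist X (psi y) (psi y') <= gdist Y y y'" if y: "y : pts Y" "y' : pts Y" for y y'
 proof (rule X.gdist_leI[OF psi(1)[OF y(1)] psi(1)[OF y(2)]])
  fix f assume "f : feat X"
  then have "compose (pts Y) f psi : feat_cl Y" using pull X.feat_subset_cl by blast
  from Y.feat_clD[OF this y] show "abs (f (psi y) - f (psi y')) <= gdist Y y y'" using y by (simp add: compose_def)
 qed
 have m': "psi : measurable (meas Y) (meas X)"
  by (rule X.Lip1_range_measurable[where d="gdist Y"])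
   (use psi Lip Y.Metric_space_axioms Y.openin_sets in auto)
 have "distr (meas Y) (meas X) psi = distr (distr (meas X) (meas Y) phi) (meas X) psi" by (simp add: d)
 also have "... = distr (meas X) (meas X) (psi \<circ> phi)" by (rule distr_distr[OF m' m])
 also have "... = distr (meas X) (meas X) (%x. x)" by (rule distr_cong) (auto simp: psiphi)
 finally have d': "distr (meas Y) (meas X) psi = meas X" by (simp add: distr_id2)
 have D2: "domination Y X psi"
  using m' d' pull X.feat_subset_cl by (auto simp: domination_def psi_def[symmetric] pullback_def) (auto simp: psi_def)
 define phi' where "phi' = restrict phi (pts X)"
 have c: "compose (pts X) g phi' = compose (pts X) g phi" for g :: "'b => real" by (auto simp: compose_def phi'_def)
 have m1: "phi' : measurable (meas X) (meas Y)"
  by (rule measurable_cong[THEN iffD1, OF _ m]) (simp add: phi'_def)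
 have "distr (meas X) (meas Y) phi' = meas Y"
  using distr_cong[of "meas X" "meas X" "meas Y" "meas Y" phi' phi] d by (simp add: phi'_def)
 moreover have "pullback (pts X) (feat_cl Y) phi' = feat_cl X" using pb by (simp add: pullback_def c)
 moreover have "pullback (pts X) (feat Y) phi' <= feat_cl X"
  using calculation(2) Y.feat_subset_cl by (auto simp: pullback_def)
 ultimately have D1: "domination X Y phi'" using m1 by (simp add: domination_def phi'_def)
 have "bij_betw psi (pts Y) (pts X)"
  by (rule bij_betw_byWitness[where f'=phi]) (use psi psiphi phip in auto)
 moreover have "psi (phi' x) = x" if "x : pts X" for x using psiphi that by (simp add: phi'_def)
 ultimately show ?thesis using that D1 D2 pb' `pullback (pts X) (feat_cl Y) phi' = feat_cl X` by blast
qed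

lemma iso_gds_refl: "is_gds X ==> iso_gds X X"
proof -
 assume "is_gds X"
 then interpret X: gds X by (rule gds.intro)
 have "pullback (pts X) (feat_cl X) (%x. x) = (%f. f) ` feat_cl X"
  unfolding pullback_def using pw_closure_extensional[of "pts X" "feat X"]
  by (intro image_cong) (auto simp: compose_def restrict_def extensional_def fun_eq_iff)
 then show ?thesis unfolding iso_gds_def by (intro exI[of _ "%x. x"]) (auto simp: distr_id2 bij_betw_def)
qed

lemma iso_gds_sym:
 assumes "is_gds X" "is_gds Y" "iso_gds X Y" shows "iso_gds Y X"
 by (rule iso_gds_inverse[OF assms]) (auto simp: iso_gds_def dest: domination_measurable domination_distr)

lemma iso_gds_trans:
 assumes "iso_gds X Y" "iso_gds Y Z" "is_gds X" "is_gds Y" "is_gds Z" shows "iso_gds X Z"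
proof -
 interpret X: gds X by rule fact
 obtain phi where 1: "bij_betw phi (pts X) (pts Y)" "phi : measurable (meas X) (meas Y)"
  "distr (meas X) (meas Y) phi = meas Y" "pullback (pts X) (feat_cl Y) phi = feat_cl X"
  using assms(1) unfolding iso_gds_def by blast
 obtain psi where 2: "bij_betw psi (pts Y) (pts Z)" "psi : measurable (meas Y) (meas Z)"
  "distr (meas Y) (meas Z) psi = meas Z" "pullback (pts Y) (feat_cl Z) psi = feat_cl Y"
  using assms(2) unfolding iso_gds_def by blast
 have "phi x : pts Y" if "x : pts X" for x using 1(1) that by (auto simp: bij_betw_def)
 then have "compose (pts X) f (psi \<circ> phi) = compose (pts X) (compose (pts Y) f psi) phi" for f :: "'c => real"
  by (auto simp: compose_def fun_eq_iff)
 then have "pullback (pts X) (feat_cl Z) (psi \<circ> phi) = pullback (pts X) (pullback (pts Y) (feat_cl Z) psi) phi"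
  unfolding pullback_def by (simp add: image_image)
 moreover have "distr (meas X) (meas Z) (psi \<circ> phi) = meas Z"
  using distr_distr[OF 2(2) 1(2)] 1(3) 2(3) by simp
 ultimately show ?thesis unfolding iso_gds_def
  using bij_betw_trans[OF 1(1) 2(1)] measurable_comp[OF 1(2) 2(2)] 1(4) 2(4) by (intro exI[of _ "psi \<circ> phi"]) auto
qed


section \<open>Realising random sequences by geometric data sets\<close>

lemma feat_dist_sym: "feat_dist P F x y = feat_dist P F y x"
 unfolding feat_dist_def by (simp add: abs_minus_commute)

text \<open>The points are the sequences in the support of the law of \<open>z\<close> with respect to the
 supremum distance (which need not be finite off the support), coded as real numbers.\<close>

locale realization = Om: prob_space Om for Om :: "'a measure" +
 fixes z :: "nat => 'a => real" and D :: "(nat => real) set" and L :: "(real => real) set"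
  and enc :: "(nat => real) => real" and dec :: "nat => real => real"
 assumes zm: "!!i. z i : borel_measurable Om" and D: "countable D"
  and D_bdd: "!!x y. x : D ==> y : D ==> EX c. ALL i. abs (x i - y i) <= c"
  and D_dense: "AE t in Om. ALL e>0. EX x:D. ALL i. abs (z i t - x i) <= e"
  and L: "L <= Lip1_real" "(%x. x) : L"
  and dec_enc: "!!i x. dec i (enc x) = x i"
begin

text \<open>The event that \<open>z\<close> lies in the closed supremum ball of radius
  \<open>e\<close> around \<open>x\<close>. Countably many coordinate conditions make it measurable
  although the supremum distance may be infinite.\<close>

definition tube :: "real => (nat => real) => 'a set" where
 "tube e x = {t:space Om. ALL i. abs (z i t - x i) <= e}"

lemma tube_sets [simp]: "tube e x : sets Om"
proof -
 have "tube e x = {t:space Om. ALL i:UNIV. abs (z i t - x i) <= e}" by (simp add: tube_def)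
 also have "... : sets Om"
  by (intro sets.sets_Collect_countable_All' borel_measurable_le borel_measurable_abs borel_measurable_diff zm borel_measurable_const) auto
 finally show ?thesis .
qed

definition supp :: "(nat => real) set" where
 "supp = {x. ALL e>0. 0 < Om.prob (tube e x)}"

definition "P = enc ` supp"
definition "coord i = restrict (dec i) P"
definition "F = {compose P p (coord i) | p i. p : L}"
abbreviation "\<delta> \<equiv> feat_dist P F"

lemma tube_mono: "(!!i. abs (x i - y i) <= e') ==> tube e x <= tube (e + e') y"
proof
 fix t assume *: "!!i. abs (x i - y i) <= e'" "t : tube e x"
 have "abs (z i t - y i) <= e + e'" for i using *(1)[of i] *(2) unfolding tube_def by (smt (verit) mem_Collect_eq)
 then show "t : tube (e + e') y" using *(2) by (simp add: tube_def)
qed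

lemma tube_le: "e <= e' ==> tube e x <= tube e' x"
 unfolding tube_def by (auto intro: order_trans)

lemma tube_dist: "t : tube e x ==> t : tube e' y ==> abs (x i - y i) <= e + e'"
proof -
 assume "t : tube e x" "t : tube e' y"
 then have "abs (z i t - x i) <= e" "abs (z i t - y i) <= e'" by (auto simp: tube_def)
 then show ?thesis by linarith
qed

lemma supp_near: "x : supp ==> 0 < e ==> (AE t in Om. Q t) ==> EX t:tube e x. Q t"
proof (rule ccontr)
 assume *: "x : supp" "0 < e" "AE t in Om. Q t" "~ (EX t:tube e x. Q t)"
 have "AE t in Om. t ~: tube e x" using *(3) by eventually_elim (use *(4) in blast)
 then have "Om.prob (tube e x) = 0" using Om.prob_eq_0[of "tube e x"] by simp
 moreover have "0 < Om.prob (tube e x)" using *(1,2) unfolding supp_def by blast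
 ultimately show False by simp
qed

lemma supp_D_near: "x : supp ==> 0 < e ==> EX d:D. ALL i. abs (x i - d i) <= e"
proof -
 assume x: "x : supp" and e: "0 < e"
 obtain t where t: "t : tube (e / 2) x" "ALL e>0. EX d:D. ALL i. abs (z i t - d i) <= e"
  using supp_near[OF x _ D_dense, of "e / 2"] e by auto
 obtain d where d: "d : D" "ALL i. abs (z i t - d i) <= e / 2" using t(2)[rule_format, of "e / 2"] e by auto
 have "t : tube (e / 2) d" using d(2) t(1) by (simp add: tube_def)
 then show ?thesis using tube_dist[OF t(1), of "e / 2" d] d(1) by auto
qed

lemma supp_bdd: assumes "x : supp" "y : supp" shows "EX c. ALL i. abs (x i - y i) <= c"
proof -
 obtain d d' where d: "d : D" "!!i. abs (x i - d i) <= 1" "d' : D" "!!i. abs (y i - d' i) <= 1"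
  using supp_D_near[OF assms(1), of 1] supp_D_near[OF assms(2), of 1] by auto
 obtain c where c: "!!i. abs (d i - d' i) <= c" using D_bdd[OF d(1,3)] by blast
 have "abs (x i - y i) <= c + 2" for i using d(2)[of i] d(4)[of i] c[of i] by linarith
 then show ?thesis by blast
qed

lemma enc_P: "x : supp ==> enc x : P" by (simp add: P_def)

lemma dec_supp: "p : P ==> (%i. dec i p) : supp"
 by (auto simp: P_def dec_enc)

lemma dec_inj: "p : P ==> q : P ==> (!!i. dec i p = dec i q) ==> p = q"
 unfolding P_def by (auto simp: dec_enc intro!: arg_cong[where f=enc])

lemma L_Lip: "p : L ==> abs (p x - p y) <= abs (x - y)"
 using L(1) by (auto simp: Lip1_real_def lipschitz_on_def dist_real_def)

text \<open>Functions in \<open>L\<close> are 1-Lipschitz, so adding their composites with the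
  coordinates does not enlarge the supremum distance of the coordinates.\<close>

lemma F_le: "f : F ==> p : P ==> q : P ==> (!!i. abs (dec i p - dec i q) <= c) ==> abs (f p - f q) <= c"
 unfolding F_def coord_def by (auto simp: compose_def) (rule order_trans[OF L_Lip])

lemma coord_F: "coord i : F"
proof -
 have "coord i = compose P (%x. x) (coord i)" by (auto simp: coord_def compose_def)
 then show ?thesis unfolding F_def using L(2) by blast
qed

lemma F_bdd: "p : P ==> q : P ==> bdd_above ((%f. abs (f p - f q)) ` F)"
proof -
 assume pq: "p : P" "q : P"
 then obtain c where "!!i. abs (dec i p - dec i q) <= c" using supp_bdd[OF dec_supp dec_supp] by blast
 then show ?thesis by (intro bdd_aboveI2[where M=c]) (rule F_le[OF _ pq])
qed

lemma dist_leI: "p : P ==> q : P ==> (!!i. abs (dec i p - dec i q) <= c) ==> \<delta> p q <= c"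
proof -
 assume *: "p : P" "q : P" "!!i. abs (dec i p - dec i q) <= c"
 have "(SUP f\<in>F. abs (f p - f q)) <= c"
 proof (rule cSUP_least)
  show "F ~= {}" using coord_F by blast
 qed (rule F_le[OF _ *])
 then show ?thesis using *(1,2) by (simp add: feat_dist_def)
qed

lemma dist_ge: assumes "p : P" "q : P" shows "abs (dec i p - dec i q) <= \<delta> p q"
proof -
 have "abs (coord i p - coord i q) <= \<delta> p q"
  using cSUP_upper[OF coord_F F_bdd[OF assms]] assms by (simp add: feat_dist_def)
 then show ?thesis using assms by (simp add: coord_def)
qed

sublocale Metric_space P \<delta>
proof
 show nn: "0 <= \<delta> p q" for p q
 proof (cases "p : P & q : P")
  case True
  then show ?thesis using dist_ge[of p q 0] by linarith
 qed (auto simp: feat_dist_def)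
 show "\<delta> p q = \<delta> q p" for p q by (rule feat_dist_sym)
 show "(\<delta> p q = 0) = (p = q)" if pq: "p : P" "q : P" for p q
 proof
  assume "\<delta> p q = 0"
  then have "dec i p = dec i q" for i using dist_ge[OF pq, of i] by simp
  then show "p = q" by (rule dec_inj[OF pq])
 next
  assume "p = q"
  then show "\<delta> p q = 0" using dist_leI[of p q 0] pq nn[of p q] by simp
 qed
 show "\<delta> p r <= \<delta> p q + \<delta> q r" if "p : P" "q : P" "r : P" for p q r
 proof (rule dist_leI)
  show "abs (dec i p - dec i r) <= \<delta> p q + \<delta> q r" for i using dist_ge[of p q i] dist_ge[of q r i] that by linarith
 qed (use that in auto)
qed

lemma supp_closed:
 assumes "!!e. 0 < e ==> EX x:supp. ALL i. abs (x i - y i) <= e" shows "y : supp"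
 unfolding supp_def
proof (intro CollectI allI impI)
 fix e :: real assume e: "0 < e"
 obtain x where x: "x : supp" "!!i. abs (x i - y i) <= e / 2" using assms[of "e / 2"] e by auto
 have "0 < Om.prob (tube (e / 2) x)" using x(1) e by (simp add: supp_def)
 also have "... <= Om.prob (tube e y)"
  using tube_mono[of x y "e / 2" "e / 2", OF x(2)] by (intro Om.finite_measure_mono) auto
 finally show "0 < Om.prob (tube e y)" .
qed

lemma mcomplete_P: "mcomplete"
 unfolding mcomplete_def
proof (intro allI impI)
 fix \<sigma> assume \<sigma>: "MCauchy \<sigma>"
 then have \<sigma>P: "\<sigma> n : P" for n by (auto simp: MCauchy_def)
 have C: "EX N. ALL n>=N. ALL m>=N. \<delta> (\<sigma> n) (\<sigma> m) < e" if "0 < e" for e using \<sigma> that unfolding MCauchy_def by meson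
 have "Cauchy (%n. dec i (\<sigma> n))" for i
  unfolding Cauchy_def dist_real_def using C dist_ge[OF \<sigma>P \<sigma>P] by (meson le_less_trans)
 then have "convergent (%n. dec i (\<sigma> n))" for i by (simp add: real_Cauchy_convergent)
 then obtain y where y: "!!i. (%n. dec i (\<sigma> n)) \<longlonglongrightarrow> y i" unfolding convergent_def by metis
 have lim: "EX N. ALL n>=N. ALL i. abs (dec i (\<sigma> n) - y i) <= e" if e: "0 < e" for e
 proof -
  obtain N where N: "!!n m. n >= N ==> m >= N ==> \<delta> (\<sigma> n) (\<sigma> m) < e" using C[OF e] by blast
  have "abs (dec i (\<sigma> n) - y i) <= e" if n: "n >= N" for n i
  proof (rule LIMSEQ_le_const2)
   show "(%m. abs (dec i (\<sigma> n) - dec i (\<sigma> m))) \<longlonglongrightarrow> abs (dec i (\<sigma> n) - y i)"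
    by (intro tendsto_rabs tendsto_diff tendsto_const y)
   show "EX N. ALL m>=N. abs (dec i (\<sigma> n) - dec i (\<sigma> m)) <= e"
    using N[OF n] dist_ge[OF \<sigma>P \<sigma>P, of i n] by (intro exI[of _ N]) (meson le_less_trans less_imp_le)
  qed
  then show ?thesis by blast
 qed
 have "y : supp"
 proof (rule supp_closed)
  fix e :: real assume "0 < e"
  then obtain N where N: "!!n i. n >= N ==> abs (dec i (\<sigma> n) - y i) <= e" using lim by blast
  then show "EX x:supp. ALL i. abs (x i - y i) <= e" by (intro bexI[OF _ dec_supp[OF \<sigma>P[of N]]]) auto
 qed
 have "limitin mtopology \<sigma> (enc y) sequentially"
  unfolding limit_metric_sequentially
 proof (intro conjI allI impI)
  show "enc y : P" by (rule enc_P) fact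
  fix e :: real assume e: "0 < e"
  then obtain N where N: "!!n i. n >= N ==> abs (dec i (\<sigma> n) - y i) <= e / 2" using lim[of "e / 2"] by auto
  have "\<delta> (\<sigma> n) (enc y) <= e / 2" if "n >= N" for n
   using N[OF that] by (intro dist_leI \<sigma>P enc_P `y : supp`) (simp add: dec_enc)
  then show "EX N. ALL n>=N. \<sigma> n : P & \<delta> (\<sigma> n) (enc y) < e" using e \<sigma>P by (intro exI[of _ N]) force
 qed
 then show "EX x. limitin mtopology \<sigma> x sequentially" by blast
qed

text \<open>Outside countably many null tubes, with centres in \<open>D\<close> and radii
  \<open>1 / Suc k\<close>, the value of \<open>z\<close> is close to some element of
  \<open>D\<close> whose tube has positive mass; hence so have all tubes around the value
  itself.\<close>

lemma AE_supp: "AE t in Om. (%i. z i t) : supp"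
proof -
 have "AE t in Om. t ~: tube (1 / Suc k) d" if "Om.prob (tube (1 / Suc k) d) = 0" for d k
  using that Om.prob_eq_0[of "tube (1 / Suc k) d"] by simp
 then have "AE t in Om. Om.prob (tube (1 / Suc k) d) = 0 --> t ~: tube (1 / Suc k) d" for d k
  by (cases "Om.prob (tube (1 / Suc k) d) = 0") auto
 then have "AE t in Om. ALL d:D. ALL k. Om.prob (tube (1 / Suc k) d) = 0 --> t ~: tube (1 / Suc k) d"
  by (simp add: AE_ball_countable[OF D] AE_all_countable)
 then show ?thesis using D_dense AE_space
 proof eventually_elim
  case (elim t)
  show ?case unfolding supp_def
  proof (intro CollectI allI impI)
   fix e :: real assume e: "0 < e"
   obtain k where k: "1 / Suc k < e / 2" using nat_approx_posE[of "e / 2"] e by auto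
   obtain d where d: "d : D" "ALL i. abs (z i t - d i) <= 1 / Suc k" using elim(2)[rule_format, of "1 / Suc k"] by auto
   have t: "t : tube (1 / Suc k) d" using d(2) elim(3) by (simp add: tube_def)
   then have "Om.prob (tube (1 / Suc k) d) ~= 0" using elim(1) d(1) by blast
   then have "0 < Om.prob (tube (1 / Suc k) d)" by (simp add: zero_less_measure_iff)
   also have "... <= Om.prob (tube (1 / Suc k + 1 / Suc k) (%i. z i t))"
    using d(2) by (intro Om.finite_measure_mono tube_mono) (auto simp: abs_minus_commute)
   also have "... <= Om.prob (tube e (%i. z i t))"
    using k by (intro Om.finite_measure_mono tube_le) auto
   finally show "0 < Om.prob (tube e (%i. z i t))" .
  qed
 qed
qed

lemma supp_nonempty: "supp ~= {}"
 using AE_supp Om.not_empty Om.AE_contr by fastforce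

lemma dense_supp: obtains q :: "nat => real" where "range q <= P"
  "ALL x:supp. ALL e>0. EX n. ALL i. abs (x i - dec i (q n)) <= e"
proof -
 define pick where "pick d k = (SOME x. x : supp & (ALL i. abs (x i - d i) <= 1 / Suc k))" for d :: "nat => real" and k
 have pick: "pick d k : supp & (ALL i. abs (pick d k i - d i) <= 1 / Suc k)"
  if "x : supp" "ALL i. abs (x i - d i) <= 1 / Suc k" for x d k
  unfolding pick_def by (rule someI[of _ x]) (use that in blast)
 define S where "S = (%(d,k). pick d k) ` (D \<times> UNIV) Int supp"
 have S: "countable S" unfolding S_def using D by (intro countable_Int1 countable_image countable_SIGMA) auto
 have dS: "EX y:S. ALL i. abs (x i - y i) <= e" if x: "x : supp" and e: "0 < e" for x e
 proof -
  obtain k where k: "1 / Suc k < e / 2" using nat_approx_posE[of "e / 2"] e by auto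
  obtain d where d: "d : D" "ALL i. abs (x i - d i) <= 1 / Suc k" using supp_D_near[OF x, of "1 / Suc k"] by auto
  have p: "pick d k : S" "ALL i. abs (pick d k i - d i) <= 1 / Suc k" using pick[OF x d(2)] d(1) unfolding S_def by force+
  have "abs (x i - pick d k i) <= e" for i using d(2)[rule_format, of i] p(2)[rule_format, of i] k by linarith
  then show ?thesis using p(1) by blast
 qed
 then have "S ~= {}" using supp_nonempty zero_less_one by blast
 then have r: "range (from_nat_into S) = S" using S by (intro range_from_nat_into)
 have "EX n. ALL i. abs (x i - dec i (enc (from_nat_into S n))) <= e" if "x : supp" "0 < e" for x e
  using dS[OF that] r unfolding dec_enc by (metis rangeE)
 moreover have "range (%n. enc (from_nat_into S n)) <= P" using r unfolding S_def P_def by blast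
 ultimately show ?thesis using that by blast
qed

definition "base = enc (SOME x. x : supp)"
text \<open>Sends an outcome to its coded sequence; \<open>base\<close> is a default for the null
  set outside the support.\<close>

definition "T t = (if (%i. z i t) : supp then enc (%i. z i t) else base)"
definition "m = distr Om (sigma P {U. openin mtopology U}) T"

lemma base_P: "base : P"
 unfolding base_def by (rule enc_P) (use supp_nonempty some_in_eq in blast)

lemma T_P: "T t : P" using base_P enc_P by (auto simp: T_def)

lemma supp_sets: "{t:space Om. (%i. z i t) : supp} : sets Om"
proof -
 obtain q :: "nat => real" where q: "range q <= P" "ALL x:supp. ALL e>0. EX n. ALL i. abs (x i - dec i (q n)) <= e"
  by (rule dense_supp)
 have "{t:space Om. (%i. z i t) : supp} = (\<Inter>k. \<Union>n. tube (1 / Suc k) (%i. dec i (q n)))"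
 proof (intro set_eqI iffI)
  fix t assume t: "t : {t:space Om. (%i. z i t) : supp}"
  then have "EX n. ALL i. abs (z i t - dec i (q n)) <= 1 / Suc k" for k using q(2)[rule_format, of "%i. z i t" "1 / Suc k"] by auto
  then show "t : (\<Inter>k. \<Union>n. tube (1 / Suc k) (%i. dec i (q n)))" using t by (auto simp: tube_def)
 next
  fix t assume t: "t : (\<Inter>k. \<Union>n. tube (1 / Suc k) (%i. dec i (q n)))"
  have "(%i. z i t) : supp"
  proof (rule supp_closed)
   fix e :: real assume "0 < e"
   then obtain k where k: "1 / Suc k < e" using nat_approx_posE by blast
   obtain n where n: "t : tube (1 / Suc k) (%i. dec i (q n))" using t by blast
   have "abs (dec i (q n) - z i t) <= e" for i
   proof -
    have "abs (z i t - dec i (q n)) <= 1 / Suc k" using n by (simp add: tube_def)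
    then show ?thesis using k by linarith
   qed
   then show "EX x:supp. ALL i. abs (x i - z i t) <= e" 
    using q(1) by (intro bexI[of _ "%i. dec i (q n)"] dec_supp) auto
  qed
  then show "t : {t:space Om. (%i. z i t) : supp}" using t by (auto simp: tube_def)
 qed
 also have "... : sets Om" by (intro sets.countable_INT sets.countable_UN image_subsetI) auto
 finally show ?thesis .
qed

text \<open>An open set is the union of the countably many closed supremum balls
  \<open>C n k\<close> contained in it, and the preimage of such a ball is a tube, up to the default
  value.\<close>

lemma T_measurable: "T : measurable Om (sigma P {U. openin mtopology U})"
proof (rule measurable_measure_of)
 show "{U. openin mtopology U} <= Pow P" by (auto simp: openin_mtopology)
 show "T : space Om \<rightarrow> P" using T_P by blast
 fix U assume "U : {U. openin mtopology U}"
 then have U: "openin mtopology U" by simp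
 obtain q :: "nat => real" where q: "range q <= P" "ALL x:supp. ALL e>0. EX n. ALL i. abs (x i - dec i (q n)) <= e"
  by (rule dense_supp)
 define C where "C n k = {p:P. ALL i. abs (dec i p - dec i (q n)) <= 1 / Suc k}" for n k
 have Ueq: "p : U \<longleftrightarrow> (EX n k. C n k <= U & p : C n k)" for p
 proof
  assume p: "p : U"
  then obtain r where r: "0 < r" "mball p r <= U" using U unfolding openin_mtopology by blast
  have pP: "p : P" using p U unfolding openin_mtopology by blast
  obtain k where k: "1 / Suc k < r / 2" using nat_approx_posE[of "r / 2"] r by auto
  obtain n where n: "!!i. abs (dec i p - dec i (q n)) <= 1 / Suc k"
   using q(2)[rule_format, OF dec_supp[OF pP], of "1 / Suc k"] by auto
  have "y : U" if y: "y : C n k" for y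
  proof -
   have "\<delta> p y <= 1 / Suc k + 1 / Suc k"
   proof (rule dist_leI[OF pP])
    show "y : P" using y by (simp add: C_def)
    fix i
    have "abs (dec i y - dec i (q n)) <= 1 / Suc k" using y by (simp add: C_def)
    then show "abs (dec i p - dec i y) <= 1 / Suc k + 1 / Suc k" using n[of i] by linarith
   qed
   then have "y : mball p r" using k pP y by (simp add: C_def)
   then show ?thesis using r(2) by blast
  qed
  then show "EX n k. C n k <= U & p : C n k" using n pP unfolding C_def by blast
 qed blast
 have TC: "T -` C n k Int space Om : sets Om" for n k
 proof -
  let ?S = "{t:space Om. (%i. z i t) : supp}"
  have "T -` C n k Int space Om = (?S Int tube (1 / Suc k) (%i. dec i (q n))) Un (if base : C n k then space Om - ?S else {})"
   by (auto simp: T_def C_def tube_def dec_enc enc_P base_P)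
  also have "... : sets Om" by (intro sets.Un sets.Int supp_sets tube_sets) (use supp_sets in auto)
  finally show ?thesis .
 qed
 have "T -` U Int space Om = (\<Union>(n,k)\<in>{(n,k). C n k <= U}. T -` C n k Int space Om)"
 proof (intro set_eqI)
  fix t show "t : T -` U Int space Om \<longleftrightarrow> t : (\<Union>(n,k)\<in>{(n,k). C n k <= U}. T -` C n k Int space Om)"
   using Ueq[of "T t"] by auto
 qed
 also have "... : sets Om" using TC by (intro sets.countable_UN') (auto intro: countable_subset[OF subset_UNIV])
 finally show "T -` U Int space Om : sets Om" .
qed

definition "C = GDS P F m"

lemma pts_C [simp]: "pts C = P" and feat_C [simp]: "feat C = F" and meas_C [simp]: "meas C = m"
 by (auto simp: C_def)

lemma is_gds_C: "is_gds C"
 unfolding is_gds_def is_mm_def pts_C feat_C meas_C mmspace.case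
proof (intro conjI)
 have sub: "{U. openin mtopology U} <= Pow P" by (auto simp: openin_mtopology)
 show "F ~= {}" using coord_F by blast
 show "F <= extensional P" by (auto simp: F_def)
 show "ALL x:P. ALL y:P. bdd_above ((%f. abs (f x - f y)) ` F)" by (intro ballI F_bdd)
 show "Metric_space P \<delta>" by unfold_locales
 show "mcomplete" by (rule mcomplete_P)
 show "separable_space mtopology"
 proof -
  obtain q :: "nat => real" where q: "range q <= P" "ALL x:supp. ALL e>0. EX n. ALL i. abs (x i - dec i (q n)) <= e"
   by (rule dense_supp)
  have "P <= mtopology closure_of range q" unfolding metric_closure_of
  proof (intro subsetI CollectI conjI allI impI)
   fix p and r :: real assume p: "p : P" and r: "0 < r"
   obtain n where n: "!!i. abs (dec i p - dec i (q n)) <= r / 2"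
    using q(2)[rule_format, OF dec_supp[OF p], of "r / 2"] r by auto
   have "\<delta> p (q n) <= r / 2" using q(1) n by (intro dist_leI p) auto
   then show "EX y:range q. y : mball p r" using q(1) p r by (intro bexI[of _ "q n"]) auto
  qed
  then have "mtopology closure_of range q = P" using closure_of_subset_topspace[of mtopology] by auto
  then show ?thesis unfolding separable_space_def using q(1) by (intro exI[of _ "range q"]) auto
 qed
 show "space m = P" by (simp add: m_def space_measure_of sub)
 show "sets m = sigma_sets P {U. openin mtopology U}" by (simp add: m_def sets_measure_of sub)
 show "prob_space m" unfolding m_def by (rule Om.prob_space_distr[OF T_measurable])
 show "ALL U. openin mtopology U & U ~= {} --> 0 < measure m U"
 proof (intro allI impI)
  fix U assume U: "openin mtopology U & U ~= {}"
  then obtain p where p: "p : U" by blast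
  then obtain r where r: "0 < r" "mball p r <= U" using U unfolding openin_mtopology by blast
  have pP: "p : P" using p U unfolding openin_mtopology by blast
  have Us: "U : sets (sigma P {U. openin mtopology U})" using U by (simp add: sets_measure_of sub)
  have "0 < Om.prob (tube (r / 2) (%i. dec i p))" using dec_supp[OF pP] r(1) by (simp add: supp_def)
  also have "... <= Om.prob (T -` U Int space Om)"
  proof (rule Om.finite_measure_mono_AE)
   show "AE t in Om. t : tube (r / 2) (%i. dec i p) --> t : T -` U Int space Om"
    using AE_supp
   proof eventually_elim
    case (elim t)
    show ?case
    proof
     assume t: "t : tube (r / 2) (%i. dec i p)"
     have "\<delta> p (T t) <= r / 2"
      using t elim by (intro dist_leI pP T_P) (auto simp: T_def dec_enc tube_def abs_minus_commute)
     then have "T t : mball p r" using r(1) pP T_P by simp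
     then show "t : T -` U Int space Om" using r(2) t by (auto simp: tube_def)
    qed
   qed
  qed (rule measurable_sets[OF T_measurable Us])
  also have "... = measure m U" unfolding m_def by (rule measure_distr[OF T_measurable Us, symmetric])
  finally show "0 < measure m U" .
 qed
qed

lemma law_coord: "law (meas C) coord = law Om z"
proof -
 interpret C: gds C by rule (rule is_gds_C)
 have cf: "coord i : feat_cl C" for i using coord_F C.feat_subset_cl by auto
 have cm: "coord i : borel_measurable m" for i using C.feat_cl_measurable[OF cf] by simp
 have Tm: "T : measurable Om m" unfolding m_def using T_measurable by (simp cong: measurable_cong_sets)
 have "distr Om m T = m" unfolding m_def by (rule distr_cong) auto
 then have "law m coord = law Om (%i t. coord i (T t))" using law_distr[OF Tm _ cm] by simp
 also have "... = law Om z"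
 proof (rule law_cong_AE)
  show "(%t. coord i (T t)) : borel_measurable Om" for i by (rule measurable_compose[OF Tm cm])
  show "AE t in Om. coord i (T t) = z i t" for i
   using AE_supp
  proof eventually_elim
   case (elim t)
   have "coord i (T t) = dec i (T t)" by (simp add: coord_def T_P)
   then show ?case using elim by (simp add: T_def dec_enc)
  qed
 qed (rule zm)
 finally show ?thesis by simp
qed

end

lemma realize:
 fixes z :: "nat => 'a => real"
 assumes "prob_space Om" "!!i. z i : borel_measurable Om" "countable D"
  "!!x y. x : D ==> y : D ==> EX c. ALL i. abs (x i - y i) <= c"
  "AE t in Om. ALL e>0. EX x:D. ALL i. abs (z i t - x i) <= e" "L <= Lip1_real" "(%x. x) : L"
 obtains C :: "real gds" and c where "is_gds C" "feat C = {compose (pts C) p (c i) | p i. p : L}"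
  "range c <= feat C" "law (meas C) c = law Om z"
proof -
 obtain enc :: "(nat => real) => real" and dec :: "nat => real => real"
  where de: "!!i x. dec i (enc x) = x i" using seq_real_coding by metis
 interpret R: realization Om z D L enc dec
  using assms de by (intro realization.intro realization_axioms.intro) auto
 show ?thesis
  by (rule that[OF R.is_gds_C _ _ R.law_coord]) (use R.coord_F in \<open>auto simp: R.F_def\<close>)
qed

text \<open>The index is clamped to \<open>0\<close> from \<open>n\<close> on, so that finite tuples are treated as sequences.\<close>

definition clamp_index :: "nat => nat => nat" where "clamp_index n i = (if i < n then i else 0)"

text \<open>For finitely many coordinates the rational tuples serve as \<open>D\<close>: they are
  dense everywhere, and any two have finite supremum distance.\<close>

lemma realize_finite:
 fixes z :: "nat => 'a => real"
 assumes "prob_space Om" "!!i. z i : borel_measurable Om" "0 < n" "L <= Lip1_real" "(%x. x) : L"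
 obtains C :: "real gds" and c where "is_gds C" "feat C = {compose (pts C) p (c i) | p i. p : L}"
  "range c <= feat C" "law (meas C) c = law Om (%i. z (clamp_index n i))"
proof -
 define D where "D = (%l :: rat list. (%i. real_of_rat (l ! clamp_index n i))) ` UNIV"
 have cn: "clamp_index n i < n" for i using assms(3) by (simp add: clamp_index_def)
 show ?thesis
 proof (rule realize[of Om "%i. z (clamp_index n i)" D L])
  show "countable D" unfolding D_def by simp
  fix x y assume "x : D" "y : D"
  then obtain l l' where xy: "x = (%i. real_of_rat (l ! clamp_index n i))" "y = (%i. real_of_rat (l' ! clamp_index n i))"
   by (auto simp: D_def)
  have "abs (x i - y i) <= Max ((%j. abs (real_of_rat (l ! j) - real_of_rat (l' ! j))) ` {..<n})" for i
   unfolding xy using cn[of i] by (intro Max_ge) auto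
  then show "EX c. ALL i. abs (x i - y i) <= c" by blast
 next
  have "EX x:D. ALL i. abs (z (clamp_index n i) t - x i) <= e" if "0 < e" for t e
  proof -
   have "EX q. abs (z j t - real_of_rat q) <= e" for j
   proof -
    obtain q where "z j t - e < real_of_rat q" "real_of_rat q < z j t" using of_rat_dense[of "z j t - e" "z j t"] `0 < e` by auto
    then show ?thesis by (intro exI[of _ q]) auto
   qed
   then obtain q where q: "!!j. abs (z j t - real_of_rat (q j)) <= e" by metis
   have "(%i. real_of_rat (map q [0..<n] ! clamp_index n i)) : D" by (simp add: D_def)
   moreover have "abs (z (clamp_index n i) t - real_of_rat (map q [0..<n] ! clamp_index n i)) <= e" for i using q cn[of i] by simp
   ultimately show ?thesis by (intro bexI) auto
  qed
  then show "AE t in Om. ALL e>0. EX x:D. ALL i. abs (z (clamp_index n i) t - x i) <= e" by auto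
 qed (use assms that in auto)
qed

text \<open>A dense sequence that mentions the generators explicitly: even positions carry a dense
  sequence of features \<open>p (c h)\<close>, odd positions the generators \<open>c i\<close>. The
  identity is added to \<open>L\<close> for the odd positions.\<close>

lemma realized_dense_seq:
 assumes C: "is_gds C" "feat C = {compose (pts C) p (c i) | p i. p : L}" "range c <= feat C" "L <= Lip1_real"
 obtains a p h where "gds.dense_seq C a" "!!n. p n : insert (%x. x) L" "!!n. p n : borel_measurable borel"
  "!!n x. x : pts C ==> a n x = p n (c (h n) x)" "!!i x. p (2 * i + 1) x = x" "!!i. h (2 * i + 1) = i"
proof -
 interpret C: gds C by rule fact
 have cf: "c i : feat_cl C" for i using C(3) C.feat_subset_cl by blast
 obtain a where a: "C.dense_seq a" "range a <= feat C" by (rule C.dense_seq_exists)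
 have "ALL k. EX p i. p : L & a k = compose (pts C) p (c i)" using a(2) C(2) by blast
 then obtain p h where ph: "!!k. p k : L" "!!k. a k = compose (pts C) (p k) (c (h k))" by metis
 define a' where "a' n = (if even n then a (n div 2) else c (n div 2))" for n
 have ra: "range a' = range a Un range c"
 proof
  show "range a Un range c <= range a'"
  proof safe
   fix n show "a n : range a'" "c n : range a'"
    by (rule range_eqI[of _ _ "2 * n"], simp add: a'_def) (rule range_eqI[of _ _ "2 * n + 1"], simp add: a'_def)
  qed
 qed (auto simp: a'_def)
 have a': "C.dense_seq a'" using a(1) cf pw_closure_mono[of "range a" "range a'" "pts C"] unfolding C.dense_seq_def ra by blast
 define p' where "p' n = (if even n then p (n div 2) else (%x. x))" for n
 define h' where "h' n = (if even n then h (n div 2) else n div 2)" for n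
 have pm: "p k : borel_measurable borel" for k
 proof -
  have "1-lipschitz_on UNIV (p k)" using ph(1) C(4) by (auto simp: Lip1_real_def)
  then show ?thesis by (intro borel_measurable_continuous_onI lipschitz_on_continuous_on)
 qed
 show ?thesis
 proof (rule that[of a' p' h', OF a'])
  show "a' n x = p' n (c (h' n) x)" if "x : pts C" for n x
   using that ph(2) by (auto simp: a'_def p'_def h'_def compose_def)
 qed (use ph(1) pm in \<open>auto simp: p'_def h'_def\<close>)
qed

text \<open>The law of the generators determines that of every sequence of composites with elements
  of \<open>L\<close>, in particular of a dense sequence. Its odd positions show that the map
  carries \<open>c i\<close> back to \<open>f i\<close>.\<close>

lemma realize_dominated:
 assumes C: "is_gds C" "feat C = {compose (pts C) p (c i) | p i. p : L}" "range c <= feat C" "L <= Lip1_real"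
  and X: "is_gds X" and f: "!!i. f i : feat_cl X" and eq: "law (meas X) f = law (meas C) c"
  and L: "postcomp (pts X) L (feat_cl X) <= feat_cl X"
 obtains psi where "domination X C psi" "!!i x. x : pts X ==> c i (psi x) = f i x"
proof -
 interpret X: gds X by rule fact
 interpret C: gds C by rule fact
 have cf: "c i : feat_cl C" for i using C(3) C.feat_subset_cl by blast
 obtain a p h where a: "C.dense_seq a" and p: "!!n. p n : insert (%x. x) L" "!!n. p n : borel_measurable borel"
  and aq: "!!n x. x : pts C ==> a n x = p n (c (h n) x)" and odd: "!!i x. p (2 * i + 1) x = x" "!!i. h (2 * i + 1) = i"
  by (rule realized_dense_seq[OF C]) blast
 let ?f = "%n. compose (pts X) (p n) (f (h n))"
 have f': "?f n : feat_cl X" for n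
 proof (cases "p n = (%x. x)")
  case True
  then have "?f n = f (h n)" using subsetD[OF pw_closure_extensional f[of "h n"]] by (auto simp: compose_def restrict_def extensional_def)
  then show ?thesis using f by simp
 next
  case False
  then show ?thesis using p(1)[of n] L f unfolding postcomp_def by blast
 qed
 have "law (meas X) ?f = law (meas X) (%n x. p n (f (h n) x))" by (rule law_cong) (simp add: compose_def)
 also have "... = law (meas C) (%n x. p n (c (h n) x))"
  by (rule law_reindex[OF X.feat_cl_measurable[OF f] C.feat_cl_measurable[OF cf] eq p(2)])
 also have "... = law (meas C) a" by (rule law_cong) (simp add: aq)
 finally have eq': "law (meas X) ?f = law (meas C) a" .
 obtain psi where psi: "domination X C psi" "!!i x. x : pts X ==> a i (psi x) = ?f i x"
  by (rule domination_by_law[OF X C(1) a f' eq']) blast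
 have "c i (psi x) = f i x" if x: "x : pts X" for i x
  using psi(2)[OF x, of "2 * i + 1"] aq[OF domination_space[OF X C(1) psi(1) x], of "2 * i + 1"] odd x by (simp add: compose_def)
 then show ?thesis using that psi(1) by blast
qed


section \<open>Isomorphism classes and monoidal families\<close>

lemma iso_class_eq:
 assumes "is_gds X" "is_gds Y" "iso_gds X Y" shows "iso_class X = iso_class Y"
proof -
 have "iso_gds X Z \<longleftrightarrow> iso_gds Y Z" if "is_gds Z" for Z :: "real gds"
  using iso_gds_trans[OF iso_gds_sym[OF assms] _ assms(2,1) that] iso_gds_trans[OF assms(3) _ assms(1,2) that] by blast
 then show ?thesis unfolding iso_class_def by blast
qed

lemma rep_iso_class:
 assumes "is_gds (X :: real gds)"
 shows "is_gds (rep (iso_class X))" "iso_gds X (rep (iso_class X))" "iso_class (rep (iso_class X)) = iso_class X"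
proof -
 have "X : iso_class X" using assms iso_gds_refl by (auto simp: iso_class_def)
 then have "rep (iso_class X) : iso_class X" unfolding rep_def by (rule someI)
 then show *: "is_gds (rep (iso_class X))" "iso_gds X (rep (iso_class X))" by (auto simp: iso_class_def)
 show "iso_class (rep (iso_class X)) = iso_class X" by (rule iso_class_eq[OF assms *, symmetric])
qed

lemma DD_rep: "A : DD ==> is_gds (rep A)" "A : DD ==> iso_class (rep A) = A"
 using rep_iso_class by (auto simp: DD_def)

lemma DD_eqI: "A : DD ==> B : DD ==> iso_gds (rep A) (rep B) ==> A = B"
 using iso_class_eq[of "rep A" "rep B"] DD_rep by metis

lemma dominated_trans:
 "is_gds X ==> is_gds Y ==> is_gds Z ==> dominated Y X ==> dominated Z Y ==> dominated Z X"
 unfolding dominated_def using domination_trans by blast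

lemma iso_gds_dominated: "is_gds X ==> is_gds Y ==> iso_gds X Y ==> dominated X Y & dominated Y X"
 unfolding dominated_def by (rule iso_gds_inverse[of X Y]) auto

lemma dominated_iso_class:
 assumes "is_gds (X :: real gds)" "is_gds Z" "dominated X Z" shows "dominated (rep (iso_class X)) Z"
 using dominated_trans[OF assms(2,1) rep_iso_class(1)[OF assms(1)] assms(3)]
  iso_gds_dominated[OF assms(1) rep_iso_class(1,2)[OF assms(1)]] by blast

lemma domination_dense_range:
 assumes "is_gds X" "is_gds Y" "domination X Y phi" "y : pts Y" "0 < e"
 obtains x where "x : pts X" "gdist Y y (phi x) < e"
proof -
 interpret X: gds X by rule fact
 interpret Y: gds Y by rule fact
 have "0 < measure (distr (meas X) (meas Y) phi) (Y.mball y e)"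
  unfolding domination_distr[OF assms(3)] by (rule Y.mball_pos[OF assms(4,5)])
 also have "... = X.prob (phi -` Y.mball y e Int space (meas X))"
  by (rule measure_distr[OF domination_measurable[OF assms(3)] Y.mball_sets])
 finally have "phi -` Y.mball y e Int space (meas X) ~= {}" by (metis less_irrefl measure_empty)
 then show ?thesis using that by auto
qed

lemma d_KF_le: "near M e f g ==> 0 <= e ==> d_KF M f g <= e"
 unfolding d_KF_def near_def by (rule cInf_lower) (auto simp: bdd_below_def)

lemma (in prob_space) d_KF_set_nonempty:
 "{e. 0 <= e & prob {x : space M. abs (f x - g x) > e} <= e} ~= {}"
 using zero_le_one prob_le_1 by blast

lemma (in prob_space) d_KF_near:
 assumes "f : borel_measurable M" "g : borel_measurable M" "d_KF M f g < e"
 shows "near M e f g"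
proof -
 obtain e' where e': "0 <= e'" "near M e' f g" "e' < e"
  using cInf_lessD[OF d_KF_set_nonempty assms(3)[unfolded d_KF_def]] unfolding near_def by blast
 then show ?thesis using near_mono[OF assms(1,2)] by simp
qed

context gds
begin

text \<open>Maximal in cardinality, which is more than maximal under inclusion: any other packing
  with the same number of elements is then maximal too. Both \<open>self_domination_dense\<close>
  and \<open>d_conc_le_if_approximable\<close> turn on this.\<close>

lemma max_packing:
 assumes "0 < e" "0 <= R" and S: "S <= {f : Lip1_on (pts X) (gdist X). ALL x:pts X. abs (f x) <= R}"
 obtains N where "finite N" "N <= S" "ALL f:N. ALL g:N. f ~= g --> ~ near (meas X) e f g"
  "ALL N'. finite N' & N' <= S & (ALL f:N'. ALL g:N'. f ~= g --> ~ near (meas X) e f g) --> card N' <= card N"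
proof -
 define Q where "Q N \<longleftrightarrow> finite N & N <= S & (ALL f:N. ALL g:N. f ~= g --> ~ near (meas X) e f g)" for N
 obtain n where n: "!!H. finite H ==> H <= {f : Lip1_on (pts X) (gdist X). ALL x:pts X. abs (f x) <= R} ==>
  (!!f g. f : H ==> g : H ==> f ~= g ==> ~ near (meas X) e f g) ==> card H <= n"
  by (rule packing_bound[OF assms(1,2)]) blast
 have "EX N. Q N & (ALL N'. Q N' --> card N' <= card N)"
 proof (rule ex_has_greatest_nat[where P=Q and f=card and k="{}" and b="Suc n"])
  show "Q {}" by (simp add: Q_def)
  show "ALL N. Q N --> card N < Suc n"
  proof (intro allI impI)
   fix N assume N: "Q N"
   show "card N < Suc n" unfolding less_Suc_eq_le
    by (rule n[OF _ order_trans[OF _ S]]) (use N in \<open>auto simp: Q_def\<close>)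
  qed
 qed
 then obtain N where N: "Q N" "ALL N'. Q N' --> card N' <= card N" by (elim exE conjE)
 show ?thesis
 proof (rule that[of N])
  note Q = N(1)[unfolded Q_def]
  show "finite N" by (rule Q[THEN conjunct1])
  show "N <= S" by (rule Q[THEN conjunct2, THEN conjunct1])
  show "ALL f:N. ALL g:N. f ~= g --> ~ near (meas X) e f g" by (rule Q[THEN conjunct2, THEN conjunct2])
 qed (rule N(2)[unfolded Q_def])
qed

lemma max_packing_covers:
 assumes "finite N" "N <= S" "ALL f:N. ALL g:N. f ~= g --> ~ near (meas X) e f g" "0 <= e"
  "ALL N'. finite N' & N' <= S & (ALL f:N'. ALL g:N'. f ~= g --> ~ near (meas X) e f g) --> card N' <= card N"
  and u: "u : S"
 obtains v where "v : N" "near (meas X) e u v"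
proof (cases "EX v:N. near (meas X) e u v")
 case False
 have "near (meas X) e u u" using assms(4) by (simp add: near_def)
 then have "u ~: N" using False by blast
 then have "card (insert u N) = Suc (card N)" using assms(1) by simp
 moreover have "card (insert u N) <= card N"
  using assms(1,2,3,5) u False near_sym[of "meas X" e] by (intro assms(5)[rule_format]) auto
 ultimately show ?thesis by simp
qed (use that in blast)

end

section \<open>Data sets stable under a monoidal family\<close>

locale monoidal_family =
 fixes L :: "(real => real) set"
 assumes L_Lip: "L <= Lip1_real" and L_mon: "monoidal L" and L_TB: "TB <= L"
begin

lemma L_id: "(%x. x) : L" and L_comp: "p : L ==> q : L ==> (%x. p (q x)) : L" and L_closed: "closed L"
 using L_mon by (auto simp: monoidal_def comp_def)

lemma L_Lip1: "p : L ==> abs (p x - p y) <= abs (x - y)"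
 using L_Lip by (auto simp: Lip1_real_def lipschitz_on_def dist_real_def)

lemma L_measurable: "p : L ==> p : borel_measurable borel"
 using L_Lip by (auto simp: Lip1_real_def intro!: borel_measurable_continuous_onI lipschitz_on_continuous_on)

lemma L_shift: "(%x. x + c) : L"
proof -
 have "(%x. x + c) : TB" unfolding TB_def by (intro CollectI exI[of _ c] exI[of _ "-\<infinity>"] exI[of _ \<infinity>]) auto
 then show ?thesis using L_TB by blast
qed

lemma L_trunc: "0 <= R ==> trunc R : L"
proof -
 assume R: "0 <= R"
 have "(%x. real_of_ereal (max (ereal (- R)) (min (ereal (x + 0)) (ereal R)))) : TB"
  unfolding TB_def using R by (intro CollectI exI[of _ 0] exI[of _ "ereal (- R)"] exI[of _ "ereal R"]) auto
 moreover have "(%x. real_of_ereal (max (ereal (- R)) (min (ereal (x + 0)) (ereal R)))) = trunc R"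
  by (auto simp: trunc_def max_def min_def)
 ultimately show ?thesis using L_TB by auto
qed

lemma L_const: "(%x. c) : L"
 using L_comp[OF L_shift L_trunc, of 0 c] by (simp add: trunc_def)

text \<open>The stability condition in \<open>L_compact\<close>; \<open>L_compactI\<close> derives
  the covering numbers from it, so it is the working form of compactness below.\<close>

definition closed_gds :: "'a gds => bool" where
 "closed_gds X \<longleftrightarrow> postcomp (pts X) L (feat_cl X) <= feat_cl X"

lemma closed_gdsD: "closed_gds X ==> p : L ==> f : feat_cl X ==> compose (pts X) p f : feat_cl X"
 unfolding closed_gds_def postcomp_def by blast

lemma closed_gdsI:
 assumes "is_gds X" "!!p f. p : L ==> f : feat X ==> compose (pts X) p f : feat_cl X"
 shows "closed_gds X"
proof -
 interpret X: gds X by rule fact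
 have "compose (pts X) p f : pw_closure (pts X) (feat_cl X)" if p: "p : L" and f: "f : feat_cl X" for p f
 proof (rule pw_closureI[OF pw_closure_extensional])
  show "compose (pts X) p f : extensional (pts X)" by simp
  fix K and e :: real assume K: "finite K" "K <= pts X" "0 < e"
  obtain g where g: "g : feat X" "!!x. x : K ==> abs (f x - g x) < e" by (rule pw_closureD[OF X.feat_ext f K]) blast
  have "abs (p (f x) - p (g x)) < e" if "x : K" for x using L_Lip1[OF p, of "f x" "g x"] g(2)[OF that] by linarith
  then show "EX h:feat_cl X. ALL x:K. abs (compose (pts X) p f x - h x) < e"
   using assms(2)[OF p g(1)] K(2) by (intro bexI[of _ "compose (pts X) p g"]) (auto simp: compose_def)
 qed
 then show ?thesis unfolding closed_gds_def postcomp_def pw_closure_idem by blast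
qed

lemma closed_gds_iso:
 assumes "is_gds X" "is_gds Y" "iso_gds X Y" "closed_gds X" shows "closed_gds Y"
proof -
 obtain psi where psi: "pullback (pts Y) (feat_cl X) psi = feat_cl Y" "bij_betw psi (pts Y) (pts X)"
  by (rule iso_gds_inverse[OF assms(1-3)]) blast
 interpret Y: gds Y by rule fact
 show ?thesis
 proof (rule closed_gdsI[OF assms(2)])
  fix p f assume p: "p : L" and "f : feat Y"
  then have "f : pullback (pts Y) (feat_cl X) psi" using Y.feat_subset_cl psi(1) by blast
  then obtain g where g: "g : feat_cl X" "f = compose (pts Y) g psi" by (auto simp: pullback_def)
  have "compose (pts Y) p f = compose (pts Y) (compose (pts X) p g) psi"
   unfolding g(2) using psi(2) by (auto simp: compose_def bij_betw_def fun_eq_iff)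
  then show "compose (pts Y) p f : feat_cl Y"
   using closed_gdsD[OF assms(4) p g(1)] psi(1) unfolding pullback_def by auto
 qed
qed

text \<open>Centre a feature at \<open>x0\<close> and truncate it at the radius \<open>r\<close> of
  a ball of almost full mass; on that ball nothing is lost. The bounded features have a finite net
  in measure, and translating a net element back is an operation of \<open>L\<close>, so one net
  serves all centring constants.\<close>

lemma L_compactI:
 assumes X: "is_gds X" and cl: "closed_gds X" shows "L_compact L X"
proof -
 interpret X: gds X by rule fact
 have "Cov X (feat_cl X) e L < \<infinity>" if e: "0 < e" for e
 proof -
  obtain x0 r where r: "x0 : pts X" "0 < r" "1 - e / 4 < X.prob (X.mball x0 r)"
   by (rule X.bounded_ball[of "e / 4"]) (use e in auto)
  define S where "S = {f : feat_cl X. ALL x:pts X. abs (f x) <= r}"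
  have S: "S <= {f : Lip1_on (pts X) (gdist X). ALL x:pts X. abs (f x) <= r}" using X.feat_cl_Lip by (auto simp: S_def)
  obtain N where N: "finite N" "N <= S" "ALL f:N. ALL g:N. f ~= g --> ~ near (meas X) (e / 4) f g"
   "ALL N'. finite N' & N' <= S & (ALL f:N'. ALL g:N'. f ~= g --> ~ near (meas X) (e / 4) f g) --> card N' <= card N"
   by (rule X.max_packing[OF _ _ S, of "e / 4"]) (use e r in auto)
  have "feat_cl X <= open_nbhd (d_KF (meas X)) (postcomp (pts X) L N) e"
  proof
   fix f assume f: "f : feat_cl X"
   define q where "q = (%y. trunc r (y + - f x0))"
   define h where "h = compose (pts X) q f"
   have q: "q : L" unfolding q_def using r by (intro L_comp[OF L_trunc L_shift]) auto
   have h: "h : feat_cl X" unfolding h_def by (rule closed_gdsD[OF cl q f])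
   have hS: "h : S" unfolding S_def using h r by (auto simp: h_def q_def compose_def intro!: trunc_bounds)
   have e4: "0 <= e / 4" using e by simp
   obtain v where v: "v : N" "near (meas X) (e / 4) h v"
    by (rule X.max_packing_covers[OF N(1-3) e4 N(4) hS])
   define w where "w = compose (pts X) (%y. y + f x0) v"
   have vf: "v : feat_cl X" using v N by (auto simp: S_def)
   have wP: "w : postcomp (pts X) L N" unfolding w_def postcomp_def using L_shift v by blast
   have w: "w : feat_cl X" unfolding w_def by (rule closed_gdsD[OF cl L_shift vf])
   define h' where "h' = compose (pts X) (%y. y + f x0) h"
   have h': "h' : feat_cl X" unfolding h'_def by (rule closed_gdsD[OF cl L_shift h])
   have 1: "near (meas X) (e / 4) f h'"
   proof (rule X.nearI_subset[OF X.mball_sets])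
    fix x assume x: "x : X.mball x0 r"
    then have "abs (f x - f x0) <= r" using X.feat_clD[OF f, of x x0] r by (auto simp: X.commute)
    then have "f x = h' x" using x by (auto simp: h'_def h_def q_def compose_def trunc_def)
    then show "abs (f x - h' x) <= e / 4" using e by simp
   qed (use r in simp)
   have "{x : space (meas X). e / 4 < abs (h' x - w x)} = {x : space (meas X). e / 4 < abs (h x - v x)}"
    by (auto simp: h'_def w_def compose_def)
   then have 2: "near (meas X) (e / 4) h' w" using v(2) unfolding near_def by simp
   have "near (meas X) (e / 4 + e / 4) f w"
    by (rule X.near_trans[OF X.feat_cl_measurable[OF f] X.feat_cl_measurable[OF h'] X.feat_cl_measurable[OF w] 1 2])
   then have "d_KF (meas X) f w <= e / 4 + e / 4" using e by (intro d_KF_le) auto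
   then show "f : open_nbhd (d_KF (meas X)) (postcomp (pts X) L N) e"
    unfolding open_nbhd_def using wP e by (intro CollectI bexI[of _ w]) auto
  qed
  then have "Cov X (feat_cl X) e L <= enat (card N)"
   unfolding Cov_def using N by (intro INF_lower) (auto simp: S_def)
  then show ?thesis by (metis enat_ord_simps(4) less_infinityE le_less_trans infinity_ileE not_le)
 qed
 then show ?thesis using cl unfolding L_compact_def closed_gds_def by blast
qed

lemma DL_iff: "A : DL L \<longleftrightarrow> A : DD & closed_gds (rep A)"
proof
 assume "A : DL L"
 then obtain X :: "real gds" where X: "is_gds X" "L_compact L X" "A = iso_class X" by (auto simp: DL_def)
 have "closed_gds X" using X(2) by (simp add: L_compact_def closed_gds_def)
 then show "A : DD & closed_gds (rep A)"
  using closed_gds_iso[OF X(1) rep_iso_class(1,2)[OF X(1)]] X(1,3) by (auto simp: DD_def)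
next
 assume A: "A : DD & closed_gds (rep A)"
 then have "A = iso_class (rep A)" "is_gds (rep A)" using DD_rep by auto
 then show "A : DL L" unfolding DL_def using A L_compactI by blast
qed

lemma iso_class_DL: "is_gds (X :: real gds) ==> closed_gds X ==> iso_class X : DL L"
 unfolding DL_def using L_compactI by blast

lemma DL_D: "A : DL L ==> is_gds (rep A)" "A : DL L ==> closed_gds (rep A)" "A : DL L ==> A : DD"
 using DL_iff DD_rep by auto

lemma closed_gds_realized:
 assumes "is_gds C" "feat C = {compose (pts C) p (c i) | p i. p : L}" shows "closed_gds C"
proof (rule closed_gdsI[OF assms(1)])
 interpret C: gds C by rule fact
 fix p f assume p: "p : L" and "f : feat C"
 then obtain q i where q: "q : L" "f = compose (pts C) q (c i)" using assms(2) by blast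
 have "compose (pts C) p f = compose (pts C) (%x. p (q x)) (c i)" unfolding q(2) by (auto simp: compose_def)
 then have "compose (pts C) p f : feat C" unfolding assms(2) using L_comp[OF p q(1)] by blast
 then show "compose (pts C) p f : feat_cl C" using C.feat_subset_cl by blast
qed

section \<open>Antisymmetry of domination\<close>

text \<open>Pulling back along the measure preserving \<open>h\<close> preserves Ky Fan distances,
  so a largest packing of the bounded features is sent to a packing of equal cardinality. This is
  again maximal and hence a net. Centring and truncation reduce arbitrary features to bounded
  ones.\<close>

lemma self_domination_dense:
 assumes X: "is_gds X" and cl: "closed_gds X" and h: "domination X X h" and u: "u : feat_cl X" and e: "0 < e"
 obtains v where "v : feat_cl X" "near (meas X) e u (compose (pts X) v h)"
proof -
 interpret X: gds X by rule fact
 obtain x0 r where r: "x0 : pts X" "0 < r" "1 - e / 2 < X.prob (X.mball x0 r)"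
  by (rule X.bounded_ball[of "e / 2"]) (use e in auto)
 define S where "S = {f : feat_cl X. ALL x:pts X. abs (f x) <= r}"
 have S: "S <= {f : Lip1_on (pts X) (gdist X). ALL x:pts X. abs (f x) <= r}" using X.feat_cl_Lip by (auto simp: S_def)
 obtain N where N: "finite N" "N <= S" "ALL f:N. ALL g:N. f ~= g --> ~ near (meas X) (e / 2) f g"
  "ALL N'. finite N' & N' <= S & (ALL f:N'. ALL g:N'. f ~= g --> ~ near (meas X) (e / 2) f g) --> card N' <= card N"
  by (rule X.max_packing[OF _ _ S, of "e / 2"]) (use e r in auto)
 define H where "H v = compose (pts X) v h" for v :: "'a => real"
 have hp: "h x : pts X" if "x : pts X" for x by (rule domination_space[OF X X h that])
 have Hf: "H v : feat_cl X" if "v : feat_cl X" for v unfolding H_def by (rule domination_feat_cl[OF X X h that])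
 have HS: "H v : S" if "v : S" for v using that Hf hp unfolding S_def by (auto simp: H_def compose_def)
 have near_H: "near (meas X) (e / 2) (H v) (H w) \<longleftrightarrow> near (meas X) (e / 2) v w" if "v : N" "w : N" for v w
 proof -
  have vw: "v : feat_cl X" "w : feat_cl X" using that N(2) by (auto simp: S_def)
  have "near (meas X) (e / 2) (H v) (H w) \<longleftrightarrow> near (meas X) (e / 2) (%x. v (h x)) (%x. w (h x))"
   unfolding near_def H_def by (intro arg_cong[where f="%A. X.prob A <= _"]) (auto simp: compose_def)
  also have "... \<longleftrightarrow> near (meas X) (e / 2) v w"
   by (rule near_distr[OF domination_measurable[OF h] domination_distr[OF h] X.feat_cl_measurable[OF vw(1)] X.feat_cl_measurable[OF vw(2)]])
  finally show ?thesis .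
 qed
 have nref: "near (meas X) (e / 2) f f" for f using e by (simp add: near_def)
 have inj: "inj_on H N"
 proof (rule inj_onI)
  fix v w assume vw: "v : N" "w : N" "H v = H w"
  then have "near (meas X) (e / 2) v w" using near_H[OF vw(1,2)] nref[of "H w"] by simp
  then show "v = w" using N(3) vw by blast
 qed
 have N': "finite (H ` N)" "H ` N <= S" "ALL f:H ` N. ALL g:H ` N. f ~= g --> ~ near (meas X) (e / 2) f g"
  "card (H ` N) = card N"
 proof -
  show "finite (H ` N)" "card (H ` N) = card N" using N(1) card_image[OF inj] by auto
  show "H ` N <= S" using N(2) HS by blast
  show "ALL f:H ` N. ALL g:H ` N. f ~= g --> ~ near (meas X) (e / 2) f g"
  proof (intro ballI impI)
   fix f g assume "f : H ` N" "g : H ` N" "f ~= g"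
   then obtain v w where vw: "v : N" "f = H v" "w : N" "g = H w" by blast
   then have "v ~= w" using `f ~= g` by blast
   then show "~ near (meas X) (e / 2) f g" using N(3) near_H[OF vw(1,3)] vw by simp
  qed
 qed
 define u0 where "u0 = compose (pts X) (%y. trunc r (y + - u x0)) u"
 have "(%y. trunc r (y + - u x0)) : L" using r by (intro L_comp[OF L_trunc L_shift]) auto
 then have u0: "u0 : feat_cl X" unfolding u0_def using closed_gdsD[OF cl _ u] by blast
 have u0S: "u0 : S" unfolding S_def using u0 r by (auto simp: u0_def compose_def intro!: trunc_bounds)
 have e2: "0 <= e / 2" using e by simp
 obtain w where w: "w : H ` N" "near (meas X) (e / 2) u0 w"
  by (rule X.max_packing_covers[OF N'(1-3) e2 _ u0S]) (unfold N'(4), rule N(4))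
 then obtain v where v: "v : N" "w = H v" by blast
 have vf: "v : feat_cl X" using v N by (auto simp: S_def)
 define v' where "v' = compose (pts X) (%y. y + u x0) v"
 have v': "v' : feat_cl X" unfolding v'_def by (rule closed_gdsD[OF cl L_shift vf])
 define u' where "u' = compose (pts X) (%y. y + u x0) u0"
 have u': "u' : feat_cl X" unfolding u'_def by (rule closed_gdsD[OF cl L_shift u0])
 have 1: "near (meas X) (e / 2) u u'"
 proof (rule X.nearI_subset[OF X.mball_sets])
  fix x assume x: "x : X.mball x0 r"
  then have "abs (u x - u x0) <= r" using X.feat_clD[OF u, of x x0] r by (auto simp: X.commute)
  then have "u x = u' x" using x by (auto simp: u'_def u0_def compose_def trunc_def)
  then show "abs (u x - u' x) <= e / 2" using e by simp
 qed (use r in simp)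
 have "{x : space (meas X). e / 2 < abs (u' x - H v' x)} = {x : space (meas X). e / 2 < abs (u0 x - w x)}"
  using hp by (auto simp: u'_def v'_def v(2) H_def compose_def)
 then have 2: "near (meas X) (e / 2) u' (H v')" using w(2) unfolding near_def by simp
 have "near (meas X) (e / 2 + e / 2) u (H v')"
  by (rule X.near_trans[OF X.feat_cl_measurable[OF u] X.feat_cl_measurable[OF u'] X.feat_cl_measurable[OF Hf[OF v']] 1 2])
 then show ?thesis using that[OF v'] unfolding H_def by simp
qed

text \<open>The composite self-domination \<open>h\<close> has a dense set of pulled-back features,
  hence does not contract distances. Both factors being 1-Lipschitz, \<open>f\<close> is an
  isometry; it has dense range by full support and is onto by completeness.\<close>

lemma dominated_antisym:
 assumes X: "is_gds X" and Y: "is_gds Y" and cl: "closed_gds X" and XY: "dominated Y X" and YX: "dominated X Y"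
 shows "iso_gds X Y"
proof -
 interpret X: gds X by rule fact
 interpret Y: gds Y by rule fact
 obtain f g where f: "domination X Y f" and g: "domination Y X g" using XY YX by (auto simp: dominated_def)
 define h where "h = compose (pts X) g f"
 have h: "domination X X h" unfolding h_def by (rule domination_trans[OF X Y X f g])
 have fp: "x : pts X ==> f x : pts Y" for x by (rule domination_space[OF X Y f])
 have hp: "x : pts X ==> h x : pts X" for x by (rule domination_space[OF X X h])
 have iso1: "gdist X x y <= gdist X (h x) (h y)" if xy: "x : pts X" "y : pts X" for x y
 proof (rule X.gdist_leI[OF xy])
  fix u assume "u : feat X"
  then have u: "u : feat_cl X" using X.feat_subset_cl by blast
  let ?G = "pullback (pts X) (feat_cl X) h"
  have G: "?G <= Lip1_on (pts X) (gdist X)"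
   using domination_feat_cl[OF X X h] X.feat_cl_Lip by (auto simp: pullback_def)
  have "u : pw_closure (pts X) ?G"
  proof (rule X.kf_closed[OF _ G])
   fix e :: real assume "0 < e"
   then obtain v where "v : feat_cl X" "near (meas X) e u (compose (pts X) v h)"
    using self_domination_dense[OF X cl h u] by metis
   then show "EX g:?G. near (meas X) e u g" by (auto simp: pullback_def)
  qed (use u X.feat_cl_Lip in blast)
  note cl = this
  show "abs (u x - u y) <= gdist X (h x) (h y)"
  proof (rule field_le_epsilon)
   fix e :: real assume e: "0 < e"
   obtain w where w: "w : ?G" "!!z. z : {x,y} ==> abs (u z - w z) < e / 2"
    by (rule pw_closureD[OF order_trans[OF G Lip1_on_extensional] cl, of "{x,y}" "e / 2"]) (use e xy in auto)
   then obtain v where v: "v : feat_cl X" "w = compose (pts X) v h" by (auto simp: pullback_def)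
   have "abs (w x - w y) <= gdist X (h x) (h y)"
    using X.feat_clD[OF v(1) hp[OF xy(1)] hp[OF xy(2)]] xy by (simp add: v(2) compose_def)
   then show "abs (u x - u y) <= gdist X (h x) (h y) + e"
    using w(2)[of x, OF insertI1] w(2)[of y, OF insertI2[OF insertI1]] by linarith
  qed
 qed
 have iso: "gdist Y (f x) (f y) = gdist X x y" if xy: "x : pts X" "y : pts X" for x y
  using domination_Lip[OF X Y f xy] iso1[OF xy] domination_Lip[OF Y X g fp[OF xy(1)] fp[OF xy(2)]] xy
  by (simp add: h_def compose_def)
 have inj: "inj_on f (pts X)"
  by (rule inj_onI) (metis X.zero Y.zero fp iso)
 have surj: "EX x:pts X. f x = y" if y: "y : pts Y" for y
 proof -
  have "EX x:pts X. gdist Y y (f x) < 1 / Suc k" for k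
   by (rule domination_dense_range[OF X Y f y, of "1 / Suc k"]) auto
  then obtain \<sigma> where \<sigma>: "!!k. \<sigma> k : pts X" "!!k. gdist Y y (f (\<sigma> k)) < 1 / Suc k" by metis
  have small: "EX N. ALL k>=N. gdist Y y (f (\<sigma> k)) < e" if e: "0 < e" for e
  proof -
   obtain N where N: "1 / Suc N < e" using nat_approx_posE[OF e] by auto
   have "gdist Y y (f (\<sigma> k)) < e" if "k >= N" for k
   proof -
    have "1 / real (Suc k) <= 1 / Suc N" using that by (intro frac_le) auto
    then show ?thesis using \<sigma>(2)[of k] N by linarith
   qed
   then show ?thesis by blast
  qed
  have "X.MCauchy \<sigma>" unfolding X.MCauchy_def
  proof (intro conjI allI impI)
   fix e :: real assume "0 < e"
   then obtain N where N: "!!k. k >= N ==> gdist Y y (f (\<sigma> k)) < e / 2" using small[of "e / 2"] by auto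
   have "gdist X (\<sigma> k) (\<sigma> l) < e" if "N <= k" "N <= l" for k l
    using N[OF that(1)] N[OF that(2)] Y.triangle[OF fp[OF \<sigma>(1)] y fp[OF \<sigma>(1)], of k l]
     Y.commute[of y "f (\<sigma> k)"] iso[OF \<sigma>(1) \<sigma>(1), of k l] by linarith
   then show "EX N. ALL n n'. N <= n --> N <= n' --> gdist X (\<sigma> n) (\<sigma> n') < e" by blast
  qed (use \<sigma> in blast)
  then obtain x where x: "limitin X.mtopology \<sigma> x sequentially" using X.complete unfolding X.mcomplete_def by blast
  then have xp: "x : pts X" by (simp add: X.limit_metric_sequentially)
  have "gdist Y y (f x) <= 0"
  proof (rule field_le_epsilon)
   fix e :: real assume e: "0 < e"
   obtain N where N: "!!k. k >= N ==> gdist Y y (f (\<sigma> k)) < e / 2" using small[of "e / 2"] e by auto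
   obtain M where M: "!!k. k >= M ==> gdist X (\<sigma> k) x < e / 2"
    using x e unfolding X.limit_metric_sequentially by (meson half_gt_zero)
   let ?k = "max N M"
   have "gdist Y y (f x) <= gdist Y y (f (\<sigma> ?k)) + gdist Y (f (\<sigma> ?k)) (f x)"
    by (rule Y.triangle[OF y fp[OF \<sigma>(1)] fp[OF xp]])
   also have "gdist Y (f (\<sigma> ?k)) (f x) = gdist X (\<sigma> ?k) x" by (rule iso[OF \<sigma>(1) xp])
   finally show "gdist Y y (f x) <= 0 + e" using N[of ?k] M[of ?k] by simp
  qed
  then have "gdist Y y (f x) = 0" using Y.nonneg[of y "f x"] by linarith
  then show ?thesis using Y.zero[OF y fp[OF xp]] xp by blast
 qed
 have bij: "bij_betw f (pts X) (pts Y)" unfolding bij_betw_def using inj fp surj by blast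
 \<comment> \<open>The transported function \<open>w\<close> with \<open>u = w \<circ> f\<close> is
   approximated in measure by the features \<open>v \<circ> g\<close> of \<open>Y\<close>, where
   \<open>v\<close> is chosen so that its pullback along \<open>h\<close> is near
   \<open>u\<close>.\<close>
 have "feat_cl X <= pullback (pts X) (feat_cl Y) f"
 proof
  fix u assume u: "u : feat_cl X"
  define w where "w = (\<lambda>y\<in>pts Y. u (inv_into (pts X) f y))"
  have wf: "w (f x) = u x" if "x : pts X" for x using that fp inj by (simp add: w_def inv_into_f_f)
  have wL: "w : Lip1_on (pts Y) (gdist Y)"
  proof -
   have "abs (w y - w y') <= gdist Y y y'" if "y : pts Y" "y' : pts Y" for y y'
    using surj[OF that(1)] surj[OF that(2)] wf iso X.feat_clD[OF u] by metis
   then show ?thesis by (auto simp: Lip1_on_def w_def)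
  qed
  have "w : pw_closure (pts Y) (feat_cl Y)"
  proof (rule Y.kf_closed[OF wL Y.feat_cl_Lip])
   fix e :: real assume "0 < e"
   then obtain v where v: "v : feat_cl X" "near (meas X) e u (compose (pts X) v h)"
    using self_domination_dense[OF X cl h u] by metis
   have vg: "compose (pts Y) v g : feat_cl Y" by (rule domination_feat_cl[OF Y X g v(1)])
   have "{x : space (meas X). e < abs (w (f x) - compose (pts Y) v g (f x))} = {x : space (meas X). e < abs (u x - compose (pts X) v h x)}"
    using wf fp by (auto simp: h_def compose_def)
   then have "near (meas X) e (%x. w (f x)) (%x. compose (pts Y) v g (f x))" using v(2) unfolding near_def by simp
   then have "near (meas Y) e w (compose (pts Y) v g)"
    using near_distr[OF domination_measurable[OF f] domination_distr[OF f] Y.Lip1_measurable[OF wL] Y.feat_cl_measurable[OF vg]] by simp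
   then show "EX g:feat_cl Y. near (meas Y) e w g" using vg by blast
  qed
  then have "w : feat_cl Y" by (simp add: pw_closure_idem)
  moreover have "u = compose (pts X) w f"
   using wf subsetD[OF pw_closure_extensional u] by (auto simp: compose_def extensional_def fun_eq_iff)
  ultimately show "u : pullback (pts X) (feat_cl Y) f" by (auto simp: pullback_def)
 qed
 moreover have "pullback (pts X) (feat_cl Y) f <= feat_cl X"
  using domination_feat_cl[OF X Y f] by (auto simp: pullback_def)
 ultimately show ?thesis unfolding iso_gds_def
  using bij domination_measurable[OF f] domination_distr[OF f] by blast
qed

end

section \<open>Finite quotients\<close>

text \<open>The quotient is the data set realising the joint law of an enumeration of
  \<open>G\<close>, with only the identity applied to its coordinates. Dominations out of it are
  produced by comparing laws and are unique because \<open>phi\<close> has dense range.\<close>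

lemma quotient_exists:
 fixes X :: "real gds"
 assumes X: "is_gds X" and G: "finite G" "G ~= {}" "G <= feat_cl X"
 obtains Y where "is_quotient X G Y"
proof -
 interpret X: gds X by rule fact
 define n where "n = card G"
 have n: "0 < n" using G by (simp add: n_def card_gt_0_iff)
 obtain g where g: "bij_betw g {..<n} G" using ex_bij_betw_nat_finite[OF G(1)] by (auto simp: n_def atLeast0LessThan)
 define f where "f i = g (clamp_index n i)" for i
 have fG: "range f = G"
 proof
  show "range f <= G" using g n by (auto simp: f_def clamp_index_def bij_betw_def)
  show "G <= range f"
  proof
   fix u assume "u : G"
   then obtain i where "i < n" "u = g i" using g by (auto simp: bij_betw_def)
   then show "u : range f" by (intro range_eqI[of _ _ i]) (simp add: f_def clamp_index_def)
  qed
 qed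
 then have f: "f i : feat_cl X" for i using G(3) by blast
 define g' where "g' i = (if i < n then g i else g 0)" for i
 have f': "f i = g' (clamp_index n i)" for i using n by (simp add: f_def g'_def clamp_index_def)
 have gm: "g' i : borel_measurable (meas X)" for i
  using X.feat_cl_measurable G(3) g n by (auto simp: g'_def bij_betw_def)
 obtain C :: "real gds" and c where C: "is_gds C" "feat C = {compose (pts C) p (c i) | p i. p : {%x. x}}"
  "range c <= feat C" "law (meas C) c = law (meas X) (%i. g' (clamp_index n i))"
  by (rule realize_finite[where z=g', OF X.prob_space_axioms gm n, of "{%x. x}"]) (auto simp: Lip1_real_def lipschitz_on_def)
 interpret C: gds C by rule fact
 have Cf: "feat C = range c"
 proof -
  have "compose (pts C) (%x. x) (c i) = c i" for i
  proof
   have "c i : extensional (pts C)" using C(3) C.feat_ext by blast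
   then show "compose (pts C) (%x. x) (c i) x = c i x" for x by (simp add: compose_def extensional_def)
  qed
  then show ?thesis using C(2) by auto
 qed
 have cf: "c i : feat_cl C" for i using C(3) C.feat_subset_cl by blast
 have eq: "law (meas X) f = law (meas C) c" using C(4) by (simp add: f'[abs_def])
 have idc: "postcomp (pts X) {%x. x} (feat_cl X) <= feat_cl X"
 proof
  fix u assume "u : postcomp (pts X) {%x. x} (feat_cl X)"
  then obtain v where v: "v : feat_cl X" "u = compose (pts X) (%x. x) v" by (auto simp: postcomp_def)
  then have "u = v" using subsetD[OF pw_closure_extensional v(1)] by (auto simp: compose_def extensional_def fun_eq_iff)
  then show "u : feat_cl X" using v by simp
 qed
 obtain phi where phi: "domination X C phi" "!!i x. x : pts X ==> c i (phi x) = f i x"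
  by (rule realize_dominated[OF C(1-3) _ X f eq idc]) (auto simp: Lip1_real_def lipschitz_on_def)
 have comp: "compose (pts X) (c i) phi = f i" for i
  using phi(2) subsetD[OF pw_closure_extensional f] by (auto simp: compose_def extensional_def fun_eq_iff)
 have pb: "pullback (pts X) (feat C) phi = G" unfolding pullback_def Cf using comp fG by (auto simp: image_image)
 have "is_quotient X G C" unfolding is_quotient_def
 proof (intro conjI exI[of _ phi] allI impI)
  fix Z :: "real gds" and psi
  assume *: "is_gds Z & domination X Z psi & pullback (pts X) (feat Z) psi <= pw_closure (pts X) G"
  then have Z: "is_gds Z" and psi: "domination X Z psi" by auto
  interpret Z: gds Z by rule fact
  \<comment> \<open>A finite family is closed, so every feature of \<open>Z\<close> pulls back to an
    element of \<open>G\<close> itself and therefore corresponds to one of the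
    \<open>c k\<close>.\<close>
  have GG: "pw_closure (pts X) G = G"
   using G pw_closure_extensional by (intro pw_closure_finite) blast+
  obtain a where a: "Z.dense_seq a" "range a <= feat Z" by (rule Z.dense_seq_exists)
  have "compose (pts X) (a i) psi : range f" for i
  proof -
   have "compose (pts X) (a i) psi : pullback (pts X) (feat Z) psi" unfolding pullback_def using a(2) by blast
   then show ?thesis using * unfolding GG fG by blast
  qed
  then have "ALL i. EX k. compose (pts X) (a i) psi = f k" by (simp add: image_iff)
  then obtain k where k: "!!i. compose (pts X) (a i) psi = f (k i)" by metis
  have af: "a i : feat_cl Z" for i using a(2) Z.feat_subset_cl by blast
  have "law (meas C) (%i. c (k i)) = law (meas X) (%i. f (k i))"
   using law_reindex[OF C.feat_cl_measurable[OF cf] X.feat_cl_measurable[OF f] eq[symmetric], of "%_ x. x" k] by simp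
  also have "... = law (meas Z) a" unfolding k[symmetric] by (rule domination_law[OF X Z psi af])
  finally have eqa: "law (meas C) (%i. c (k i)) = law (meas Z) a" .
  obtain psi' where psi': "domination C Z psi'" "!!i y. y : pts C ==> a i (psi' y) = c (k i) y"
   by (rule domination_by_law[OF C(1) Z a(1) _ eqa]) (rule cf, blast)
  have phip: "phi x : pts C" if "x : pts X" for x by (rule domination_space[OF X C(1) phi(1) that])
  have c1: "compose (pts X) psi' phi = psi"
  proof
   fix x show "compose (pts X) psi' phi x = psi x"
   proof (cases "x : pts X")
    case True
    have "psi' (phi x) = psi x"
    proof (rule Z.gdist_eq0[OF a(1)])
     show "psi' (phi x) : pts Z" by (rule domination_space[OF C(1) Z psi'(1) phip[OF True]])
     show "psi x : pts Z" by (rule domination_space[OF X Z psi True])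
     fix i
     have "a i (psi x) = f (k i) x" using fun_cong[OF k[of i], of x] True by (simp add: compose_def)
     then show "a i (psi' (phi x)) = a i (psi x)" using psi'(2)[OF phip[OF True]] phi(2)[OF True] by simp
    qed
    then show ?thesis using True by (simp add: compose_def)
   next
    case False
    then show ?thesis using psi by (simp add: compose_def domination_def extensional_def)
   qed
  qed
  have uniq: "\<zeta> = psi'" if \<zeta>: "domination C Z \<zeta>" "compose (pts X) \<zeta> phi = psi" for \<zeta>
  proof
   fix y show "\<zeta> y = psi' y"
   proof (cases "y : pts C")
    case True
    have p: "\<zeta> y : pts Z" "psi' y : pts Z"
     using domination_space[OF C(1) Z \<zeta>(1) True] domination_space[OF C(1) Z psi'(1) True] by auto
    have "gdist Z (\<zeta> y) (psi' y) <= 0"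
    proof (rule field_le_epsilon)
     fix e :: real assume e: "0 < e"
     obtain x where x: "x : pts X" "gdist C y (phi x) < e / 2"
      by (rule domination_dense_range[OF X C(1) phi(1) True, of "e / 2"]) (use e in auto)
     have eq: "\<zeta> (phi x) = psi' (phi x)" using fun_cong[OF \<zeta>(2), of x] fun_cong[OF c1, of x] x(1) by (simp add: compose_def)
     have q: "psi' (phi x) : pts Z" by (rule domination_space[OF C(1) Z psi'(1) phip[OF x(1)]])
     have "gdist Z (\<zeta> y) (psi' y) <= gdist Z (\<zeta> y) (psi' (phi x)) + gdist Z (psi' (phi x)) (psi' y)"
      by (rule Z.triangle[OF p(1) q p(2)])
     also have "... <= gdist C y (phi x) + gdist C (phi x) y"
      using domination_Lip[OF C(1) Z \<zeta>(1) True phip[OF x(1)]] domination_Lip[OF C(1) Z psi'(1) phip[OF x(1)] True] eq by simp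
     finally show "gdist Z (\<zeta> y) (psi' y) <= 0 + e" using x(2) C.commute[of y] by simp
    qed
    then show ?thesis using Z.nonneg[of "\<zeta> y" "psi' y"] Z.zero[OF p] by simp
   next
    case False
    then show ?thesis using \<zeta>(1) psi'(1) by (simp add: domination_def extensional_def)
   qed
  qed
  show "EX! psi'. domination C Z psi' & compose (pts X) psi' phi = psi"
   by (rule ex1I[of _ psi']) (use psi'(1) c1 uniq in blast)+
 qed (use C(1) phi(1) pb in auto)
 then show ?thesis using that by blast
qed


section \<open>Sequential compactness of feature sets\<close>

lemma diagonal_convergent:
 fixes x :: "nat => nat => real"
 assumes "!!n. EX B. ALL l. abs (x n l) <= B"
 obtains r :: "nat => nat" where "strict_mono r" "!!n. convergent (%l. x n (r l))"
proof -
 define P where "P n s \<longleftrightarrow> convergent (%l. x n (s l))" for n and s :: "nat => nat"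
 have PD: "P n s ==> convergent (%l. x n (s l))" for n s by (simp add: P_def)
 interpret subseqs P
 proof
  fix n and s :: "nat => nat" assume s: "strict_mono s"
  obtain B where "!!l. abs (x n l) <= B" using assms by blast
  then have "bounded (range (%l. x n (s l)))" by (intro boundedI[of _ B]) auto
  then obtain l r where "strict_mono r" "((%l. x n (s l)) \<circ> r) \<longlonglongrightarrow> l"
   using bounded_imp_convergent_subsequence by blast
  then show "EX r. strict_mono r & P n (s \<circ> r)" unfolding P_def comp_def convergent_def by blast
 qed
 have "P n (diagseq \<circ> (+) (Suc n))" for n
 proof (rule diagseq_holds)
  show "P k (s \<circ> r)" if "strict_mono r" "P k s" for r s k
   using convergent_subseq_convergent[OF PD[OF that(2)] that(1)] unfolding P_def comp_def .
 qed
 moreover have "(%l. x n ((diagseq \<circ> (+) (Suc n)) l)) = (%l. x n (diagseq (l + Suc n)))" for n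
  by (rule ext) (simp add: add.commute)
 ultimately have "convergent (%l. x n (diagseq (l + Suc n)))" for n using PD by metis
 then have "convergent (%l. x n (diagseq l))" for n using convergent_ignore_initial_segment[of "%l. x n (diagseq l)" "Suc n"] by simp
 then show ?thesis using that[OF subseq_diagseq] by blast
qed

context gds
begin

lemma Lip_limit_dense:
 assumes c: "range c <= pts X" "ALL x:pts X. ALL e>0. EX n. gdist X x (c n) < e"
  and g: "!!k. g k : feat_cl X" and conv: "!!n. convergent (%k. g k (c n))" and x: "x : pts X"
 shows "convergent (%k. g k x)"
proof -
 have "Cauchy (%k. g k x)"
 proof (rule metric_CauchyI)
  fix e :: real assume e: "0 < e"
  obtain n where n: "gdist X x (c n) < e / 4" using c(2) x e by (meson divide_pos_pos zero_less_numeral)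
  have cn: "c n : pts X" using c(1) by auto
  have "Cauchy (%k. g k (c n))" using conv[of n] by (rule convergent_Cauchy)
  then obtain M where M: "!!k l. k >= M ==> l >= M ==> dist (g k (c n)) (g l (c n)) < e / 4"
   using e unfolding Cauchy_def by (meson divide_pos_pos zero_less_numeral)
  have "dist (g k x) (g l x) < e" if "k >= M" "l >= M" for k l
   using M[OF that] feat_clD[OF g x cn, of k] feat_clD[OF g x cn, of l] n unfolding dist_real_def by linarith
  then show "EX M. ALL m>=M. ALL n>=M. dist (g m x) (g n x) < e" by blast
 qed
 then show ?thesis by (simp add: real_Cauchy_convergent)
qed

lemma feat_cl_limit:
 assumes g: "!!k. g k : feat_cl X" and f: "f : extensional (pts X)" "!!x. x : pts X ==> (%k. g k x) \<longlonglongrightarrow> f x"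
 shows "f : feat_cl X"
proof -
 have "f : pw_closure (pts X) (feat_cl X)"
 proof (rule pw_closureI[OF pw_closure_extensional f(1)])
  fix K and e :: real assume K: "finite K" "K <= pts X" "0 < e"
  have "\<forall>\<^sub>F k in sequentially. ALL x:K. dist (g k x) (f x) < e"
   using K f(2) by (intro eventually_ball_finite[OF K(1)] ballI tendstoD) auto
  then obtain k where "ALL x:K. dist (g k x) (f x) < e" by (auto simp: eventually_sequentially)
  then show "EX g:feat_cl X. ALL x:K. abs (f x - g x) < e"
   using g by (intro bexI[of _ "g k"]) (auto simp: dist_real_def abs_minus_commute)
 qed
 then show ?thesis by (simp add: pw_closure_idem)
qed

text \<open>An Arzela-Ascoli argument for countably many sequences at once: boundedness at one point
  gives boundedness at every point, a diagonal subsequence converges on a dense set, and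
  equicontinuity extends the convergence.\<close>

lemma feat_cl_seq_compact:
 fixes g :: "nat => nat => 'a => real"
 assumes g: "!!k i. g k i : feat_cl X" and bd: "!!i. EX x:pts X. EX B. ALL k. abs (g k i x) <= B"
 obtains r f where "strict_mono (r :: nat => nat)" "!!i. f i : feat_cl X"
  "!!i x. x : pts X ==> (%l. g (r l) i x) \<longlonglongrightarrow> f i x"
proof -
 obtain c :: "nat => 'a" where c: "range c <= pts X" "ALL x:pts X. ALL e>0. EX n. gdist X x (c n) < e"
  by (rule dense_points)
 define y where "y m k = (case prod_decode m of (i, n) => g k i (c n))" for m k
 have "EX B. ALL k. abs (y m k) <= B" for m
 proof -
  obtain i n where m: "prod_decode m = (i, n)" by fastforce
  obtain x B where x: "x : pts X" "!!k. abs (g k i x) <= B" using bd by blast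
  have "abs (y m k) <= B + gdist X x (c n)" for k
  proof -
   have "abs (g k i x - g k i (c n)) <= gdist X x (c n)" using c(1) by (intro feat_clD[OF g x(1)]) auto
   then show ?thesis using x(2)[of k] unfolding y_def m by simp
  qed
  then show ?thesis by blast
 qed
 then obtain r where r: "strict_mono r" "!!m. convergent (%l. y m (r l))" by (rule diagonal_convergent[of y]) blast
 have conv: "convergent (%l. g (r l) i (c n))" for i n using r(2)[of "prod_encode (i, n)"] by (simp add: y_def)
 define f where "f i = (\<lambda>x\<in>pts X. lim (%l. g (r l) i x))" for i
 have lim: "(%l. g (r l) i x) \<longlonglongrightarrow> f i x" if "x : pts X" for i x
  using Lip_limit_dense[OF c g conv that] that by (simp add: f_def convergent_LIMSEQ_iff)
 have "f i : feat_cl X" for i by (rule feat_cl_limit[OF g _ lim]) (unfold f_def, rule restrict_extensional)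
 then show ?thesis using that[OF r(1) _ lim] by blast
qed

text \<open>The product topology over an uncountable carrier need not be metrisable, but Lipschitz
  functions that converge on a countable dense set converge everywhere, so sequences reach the
  closure.\<close>

lemma feat_cl_seq:
 assumes f: "f : feat_cl X"
 obtains s where "!!k. s k : feat X" "!!x. x : pts X ==> (%k. s k x) \<longlonglongrightarrow> f x"
proof -
 obtain c :: "nat => 'a" where c: "range c <= pts X" "ALL x:pts X. ALL e>0. EX n. gdist X x (c n) < e"
  by (rule dense_points)
 have "EX g:feat X. ALL x:c ` {..k}. abs (f x - g x) < 1 / Suc k" for k
  by (rule pw_closureD[OF feat_ext f, of "c ` {..k}" "1 / Suc k"]) (use c(1) in auto)
 then obtain s where s: "!!k. s k : feat X" "!!k n. n <= k ==> abs (f (c n) - s k (c n)) < 1 / Suc k"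
  by (metis atMost_iff imageI)
 have "(%k. s k x) \<longlonglongrightarrow> f x" if x: "x : pts X" for x
 proof (rule LIMSEQ_I)
  fix e :: real assume e: "0 < e"
  obtain n where n: "gdist X x (c n) < e / 4" using c(2) x e by (meson divide_pos_pos zero_less_numeral)
  obtain M where M: "1 / Suc M < e / 2" using nat_approx_posE[of "e / 2"] e by auto
  have cn: "c n : pts X" using c(1) by auto
  have "norm (s k x - f x) < e" if k: "k >= max n M" for k
  proof -
   have "1 / real (Suc k) <= 1 / Suc M" using k by (intro frac_le) auto
   moreover have "s k : feat_cl X" using s(1) feat_subset_cl by blast
   ultimately show ?thesis
    using s(2)[of n k] k M feat_clD[OF f x cn] feat_clD[of "s k" x "c n"] x cn n unfolding real_norm_def by linarith
  qed
  then show "EX no. ALL n>=no. norm (s n x - f x) < e" by blast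
 qed
 then show ?thesis using that s(1) by blast
qed

end

section \<open>Random sequences realising features\<close>

definition feature_rvs :: "'a gds => (nat => real => real) set" where
 "feature_rvs X = {u. rvs u & (EX f. (ALL i. f i : feat_cl X) & law leb u = law (meas X) f)}"

lemma feature_rvs_rvs: "u : feature_rvs X ==> rvs u" by (simp add: feature_rvs_def)

lemma feature_rvsE:
 assumes "u : feature_rvs X"
 obtains f where "!!i. f i : feat_cl X" "law leb u = law (meas X) f" "rvs u"
 using assms by (auto simp: feature_rvs_def)

lemma feature_rvsI: "rvs u ==> (!!i. f i : feat_cl X) ==> law leb u = law (meas X) f ==> u : feature_rvs X"
 by (auto simp: feature_rvs_def)

lemma feature_rvs_exist:
 assumes "is_gds X" "!!i. f i : feat_cl X"
 obtains u where "u : feature_rvs X" "law leb u = law (meas X) f"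
proof -
 interpret X: gds X by rule fact
 have fm: "f i : borel_measurable (meas X)" for i by (rule X.feat_cl_measurable[OF assms(2)])
 obtain u where u: "!!i. u i : borel_measurable leb" "law leb u = law (meas X) f"
  by (rule law_realize[OF prob_space_law[of _ f, OF X.prob_space_axioms fm] sets_law]) blast
 then have "u : feature_rvs X" using assms(2) by (intro feature_rvsI[of u f]) (auto simp: rvs_def)
 then show ?thesis using that u(2) by blast
qed

lemma feature_rvs_law: "u : feature_rvs X ==> rvs v ==> law leb v = law leb u ==> v : feature_rvs X"
 unfolding feature_rvs_def by auto

lemma feature_rvs_mp: "u : feature_rvs X ==> unit_mp \<tau> ==> (%i t. u i (\<tau> t)) : feature_rvs X"
 by (rule feature_rvs_law[OF _ rvs_mp law_mp]) (auto intro: rvsD feature_rvs_rvs)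

lemma feature_rvs_domination:
 assumes X: "is_gds X" and Y: "is_gds Y" and "dominated Y X" shows "feature_rvs Y <= feature_rvs X"
proof
 fix u assume u: "u : feature_rvs Y"
 obtain phi where phi: "domination X Y phi" using assms(3) by (auto simp: dominated_def)
 obtain g where g: "!!i. g i : feat_cl Y" "law leb u = law (meas Y) g" "rvs u"
  by (rule feature_rvsE[OF u]) blast
 show "u : feature_rvs X"
  by (rule feature_rvsI[OF g(3), of "%i. compose (pts X) (g i) phi"])
   (use domination_feat_cl[OF X Y phi g(1)] domination_law[OF X Y phi g(1)] g(2) in auto)
qed

lemma law_compose_reindex:
 assumes X: "is_gds X" and f: "!!i. f i : feat_cl X" and u: "rvs u" "law leb u = law (meas X) f"
  and p: "!!i. p i : borel_measurable borel"
 shows "law leb (%i t. p i (u (k i) t)) = law (meas X) (%i. compose (pts X) (p i) (f (k i)))"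
proof -
 interpret X: gds X by rule fact
 have "law leb (%i t. p i (u (k i) t)) = law (meas X) (%i x. p i (f (k i) x))"
  by (rule law_reindex[OF rvsD[OF u(1)] X.feat_cl_measurable[OF f] u(2) p])
 also have "... = law (meas X) (%i. compose (pts X) (p i) (f (k i)))"
  by (rule law_cong) (simp add: compose_def)
 finally show ?thesis .
qed

lemma rvs_compose: "rvs u ==> (!!i. p i : borel_measurable borel) ==> rvs (%i t. p i (u (k i) t))"
 unfolding rvs_def by (intro allI, rule measurable_compose) auto

lemma params_space: "is_gds X ==> phi : params X ==> t : {0..1} ==> phi t : pts X"
proof -
 assume "is_gds X" "phi : params X" "t : {0..1}"
 then interpret X: gds X by (intro gds.intro)
 show ?thesis using measurable_space[of phi leb "meas X" t] `phi : params X` `t : {0..1}` by (simp add: params_def)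
qed

lemma paramsD:
 assumes "is_gds X" "phi : params X"
 shows "phi : measurable leb (meas X)" "distr leb (meas X) phi = meas X"
  "f : feat_cl X ==> (%t. f (phi t)) : borel_measurable leb"
proof -
 interpret X: gds X by rule fact
 show m: "phi : measurable leb (meas X)" and "distr leb (meas X) phi = meas X" using assms(2) by (auto simp: params_def)
 show "f : feat_cl X ==> (%t. f (phi t)) : borel_measurable leb"
  by (rule measurable_compose[OF m X.feat_cl_measurable])
qed

lemma params_mp:
 assumes X: "is_gds X" and phi: "phi : params X" and \<tau>: "unit_mp \<tau>"
 shows "(%t. phi (\<tau> t)) : params X"
proof -
 note m = paramsD(1,2)[OF X phi]
 have \<tau>m: "\<tau> : measurable leb leb" "distr leb leb \<tau> = leb" using \<tau> by (auto simp: unit_mp_def)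
 have "distr leb (meas X) (%t. phi (\<tau> t)) = distr (distr leb leb \<tau>) (meas X) phi"
  using distr_distr[OF m(1) \<tau>m(1)] by (simp add: comp_def)
 then show ?thesis using measurable_compose[OF \<tau>m(1) m(1)] \<tau>m(2) m(2) by (simp add: params_def)
qed

lemma params_rvs:
 assumes X: "is_gds X" and phi: "phi : params X" and f: "!!i. f i : feat_cl X"
 shows "rvs (%i t. f i (phi t))" "law leb (%i t. f i (phi t)) = law (meas X) f" "(%i t. f i (phi t)) : feature_rvs X"
proof -
 interpret X: gds X by rule fact
 show r: "rvs (%i t. f i (phi t))" unfolding rvs_def using paramsD(3)[OF X phi f] by blast
 show l: "law leb (%i t. f i (phi t)) = law (meas X) f"
  by (rule law_distr[of phi _ _ f, OF paramsD(1,2)[OF X phi] X.feat_cl_measurable[OF f]])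
 show "(%i t. f i (phi t)) : feature_rvs X" by (rule feature_rvsI[of _ f X, OF r f l])
qed

lemma (in monoidal_family) feature_rvs_compose:
 assumes X: "is_gds X" "closed_gds X" and u: "u : feature_rvs X" and p: "!!i. p i : L"
 shows "(%i t. p i (u (k i) t)) : feature_rvs X"
proof -
 obtain f where f: "!!i. f i : feat_cl X" "law leb u = law (meas X) f" "rvs u"
  by (rule feature_rvsE[OF u]) blast
 show ?thesis
  by (rule feature_rvsI[OF rvs_compose[OF f(3) L_measurable[OF p]] _ law_compose_reindex[OF X(1) f(1,3,2) L_measurable[OF p]]])
   (rule closed_gdsD[OF X(2) p f(1)])
qed

lemma lower_box_near:
 fixes f g :: "nat => 'a => real"
 assumes M: "prob_space M" and f: "!!i. f i : borel_measurable M" and g: "!!i. g i : borel_measurable M"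
  and A: "A : sets M" "measure M A <= e'" "!!x i. x : space M - A ==> i < n ==> f i x <= c i ==> g i x <= c' i"
 shows "measure (law M f) (lower_box n c) <= measure (law M g) (lower_box n c') + e'"
proof -
 interpret prob_space M by fact
 let ?F = "{x:space M. (%i. f i x) : lower_box n c}" and ?G = "{x:space M. (%i. g i x) : lower_box n c'}"
 have G: "?G : sets M" using measurable_sets[OF measurable_seq[of g, OF g] lower_box_sets[of n c']] by (simp add: vimage_def Int_def conj_commute)
 have "?F <= ?G Un A" using A(3) unfolding lower_box_def by blast
 then have "prob ?F <= prob (?G Un A)" using G A(1) by (intro finite_measure_mono) auto
 also have "... <= prob ?G + prob A" by (intro measure_Un_le G A(1))
 finally show ?thesis using A(2) by (simp add: law_measure[of f, OF f] law_measure[of g, OF g])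
qed

section \<open>Tightness and laws under approximation\<close>

lemma apx_set_notin: "t : {0..1} ==> t ~: apx_set N e u v ==> i < N ==> abs (trunc N (u i t) - trunc N (v i t)) <= e / 2"
 unfolding apx_set_def by (metis (mono_tags, lifting) mem_Collect_eq not_le)

text \<open>The last hypothesis keeps the thresholds, enlarged by \<open>e\<close>, below the
  truncation level, so a bound on truncated values is a bound on the values themselves.\<close>

lemma lower_box_apx:
 assumes "apx N e u v" "rvs u" "rvs v" "n <= N" "0 < e" "!!i. i < n ==> abs (c i) + e < real N"
 shows "measure (law leb u) (lower_box n c) <= measure (law leb v) (lower_box n (%i. c i + e)) + e"
proof (rule lower_box_near[where A="apx_set N e u v"])
 fix t i assume t: "t : space leb - apx_set N e u v" and i: "i < n" and le: "u i t <= c i"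
 have "abs (trunc N (u i t) - trunc N (v i t)) <= e / 2"
  by (rule apx_set_notin) (use t i assms(4) in auto)
 then show "v i t <= c i + e" using assms(6)[OF i] le `0 < e` unfolding trunc_def by linarith
qed (use assms in \<open>auto simp: rvs_def apx_def leb.prob_space_axioms\<close>)

lemma apx_tail:
 assumes "apx N e u v" "rvs u" "rvs v" "i < N" "0 <= R" "0 <= e" "R + e < real N"
 shows "measure leb {t:{0..1}. abs (v i t) > R + e} <= measure leb {t:{0..1}. abs (u i t) > R} + e"
proof -
 have s: "{t:{0..1}. abs (u i t) > c} : sets leb" if "rvs u" for u c
  using abs_greater_sets[OF rvsD[OF that, of i], of c] by simp
 have "{t:{0..1}. abs (v i t) > R + e} <= {t:{0..1}. abs (u i t) > R} Un apx_set N e u v"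
 proof
  fix t assume t: "t : {t:{0..1}. abs (v i t) > R + e}"
  show "t : {t:{0..1}. abs (u i t) > R} Un apx_set N e u v"
  proof (rule ccontr)
   assume no: "~ ?thesis"
   have 1: "abs (u i t) <= R" using t no by (simp add: not_less)
   have 2: "abs (trunc N (u i t) - trunc N (v i t)) <= e / 2" by (rule apx_set_notin) (use t no assms(4) in auto)
   have 3: "trunc N (u i t) = u i t" by (rule trunc_id) (use 1 assms in linarith)
   have "abs (trunc N (v i t)) < real N" using 1 2 3 assms(6,7) by linarith
   then have "trunc N (v i t) = v i t" unfolding trunc_def by linarith
   moreover have "abs (v i t) > R + e" using t by simp
   ultimately show False using 1 2 3 assms(6) by linarith
  qed
 qed
 then have "measure leb {t:{0..1}. abs (v i t) > R + e} <= measure leb ({t:{0..1}. abs (u i t) > R} Un apx_set N e u v)"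
  by (intro leb.finite_measure_mono sets.Un s apx_set_sets assms)
 also have "... <= measure leb {t:{0..1}. abs (u i t) > R} + measure leb (apx_set N e u v)"
  by (intro measure_Un_le s apx_set_sets assms)
 finally show ?thesis using assms(1) unfolding apx_def by linarith
qed

text \<open>For large \<open>l\<close> the tails of \<open>v l\<close> are controlled by those of
  \<open>u\<close> up to \<open>1 / 2 ^ l\<close>; the finitely many remaining indices are covered
  by taking the maximum \<open>M\<close> of their own bounds.\<close>

lemma tight_if_apx:
 assumes u: "rvs u" and v: "!!l. rvs (v l)" and ap: "!!l. apx l (1 / 2 ^ l) u (v l)" and e: "0 < e"
 shows "EX R. ALL l. measure leb {t:{0..1}. abs (v l i t) > R} <= e"
proof -
 have s: "{t:{0..1}. abs (u i t) > c} : sets leb" if "rvs u" for u c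
  using abs_greater_sets[OF rvsD[OF that, of i], of c] by simp
 have mono: "measure leb {t:{0..1}. abs (w i t) > R'} <= measure leb {t:{0..1}. abs (w i t) > R}" if "R <= R'" "rvs w" for w R R'
  by (rule leb.finite_measure_mono[OF _ s[OF that(2)]]) (use that(1) in auto)
 have "EX R. measure leb {t:{0..1}. abs (w i t) > R} <= e'" if "rvs w" "0 < e'" for w and e' :: real
  using tight_rv[OF leb.prob_space_axioms rvsD[OF that(1)] that(2), of i] by auto
 then obtain R where R: "!!w e'. rvs w ==> 0 < e' ==> measure leb {t:{0..1}. abs (w i t) > R w e'} <= e'" by metis
 obtain n where n: "n >= i + 1" "1 / 2 ^ n <= min (e / 2) 1" using pow2_small[of "min (e/2) 1" "i + 1" 1] e by auto
 define R0 where "R0 = max (R u (e / 2)) 0"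
 obtain m :: nat where m: "R0 + 1 < real m" using reals_Archimedean2 by blast
 define M where "M = Max (insert (R0 + 1) ((%l. R (v l) e) ` {..n + m}))"
 have "measure leb {t:{0..1}. abs (v l i t) > M} <= e" for l
 proof (cases "l <= n + m")
  case True
  then have "R (v l) e <= M" unfolding M_def by (intro Max_ge) auto
  then show ?thesis using mono[OF _ v] R[OF v e] by (meson order_trans)
 next
  case False
  define d where "d = (1 / 2 ^ l :: real)"
  have d: "0 <= d" "d <= min (e/2) 1"
   unfolding d_def by (simp, rule order_trans[OF _ n(2)], intro divide_left_mono power_increasing) (use False in auto)
  have "R0 + d < real l" using m d False by linarith
  have "measure leb {t:{0..1}. abs (v l i t) > M} <= measure leb {t:{0..1}. abs (v l i t) > R0 + d}"
   by (rule mono[OF _ v]) (unfold M_def, rule order_trans[of _ "R0 + 1"], use d in auto)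
  also have "... <= measure leb {t:{0..1}. abs (u i t) > R0} + d"
   by (rule apx_tail[OF ap[of l, folded d_def] u v]) (use n(1) False d `R0 + d < real l` in \<open>auto simp: R0_def\<close>)
  also have "... <= e / 2 + d" using mono[of "R u (e/2)" R0 u] R[OF u, of "e / 2"] u e by (simp add: R0_def)
  finally show ?thesis using d by simp
 qed
 then show ?thesis by blast
qed

lemma law_eq_if_apx:
 assumes u: "rvs u" and v: "rvs v"
  and ap: "!!N e. 0 < e ==> EX u' v'. rvs u' & rvs v' & law leb u' = law leb u & law leb v' = law leb v & apx N e u' v'"
 shows "law leb u = law leb v"
proof (rule law_eqI)
 fix n :: nat and c and e :: real assume e: "0 < e"
 obtain q :: nat where q: "real q > Max (insert 0 ((%i. abs (c i) + e) ` {..<n}))" using reals_Archimedean2 by blast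
 define N where "N = max n q"
 obtain u' v' where uv: "rvs u'" "rvs v'" "law leb u' = law leb u" "law leb v' = law leb v" "apx N e u' v'" using ap[OF e] by blast
 have b: "abs (c i) + e < real N" if "i < n" for i
 proof -
  have "abs (c i) + e < real q" using q that by (auto simp: Max_less_iff)
  then show ?thesis by (simp add: N_def)
 qed
 show "measure (law leb u) (lower_box n c) <= measure (law leb v) (lower_box n (%i. c i + e)) + e"
  using lower_box_apx[OF uv(5,1,2) _ e b, of n] uv(3,4) by (simp add: N_def)
 show "measure (law leb v) (lower_box n c) <= measure (law leb u) (lower_box n (%i. c i + e)) + e"
  using lower_box_apx[OF apx_sym[OF uv(5)] uv(2,1) _ e b, of n] uv(3,4) by (simp add: N_def)
qed (use prob_space_law[OF leb.prob_space_axioms] u v in \<open>auto simp: rvs_def\<close>)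

lemma law_tail:
 assumes "!!i. f i : borel_measurable M" "!!i. g i : borel_measurable M'" "law M f = law M' g"
 shows "measure M {x:space M. abs (f i x) > R} = measure M' {x:space M'. abs (g i x) > R}"
proof -
 let ?B = "{y :: nat => real. abs (y i) > R}"
 have B: "?B : sets borel" by (intro borel_open open_Collect_less continuous_intros continuous_on_product_coordinates)
 show ?thesis using law_measure[of f, OF assms(1) B] law_measure[of g, OF assms(2) B] assms(3) by simp
qed

text \<open>The terms \<open>z l\<close> are only known to have the law of \<open>y (r l)\<close>,
  so a further alignment \<open>\<sigma>\<close> is inserted; the three errors \<open>e / 3\<close>
  come from \<open>u\<close> to \<open>y\<close>, from the alignment, and from the limit.\<close>

lemma law_limit:
 assumes u: "rvs u" and y: "!!l. rvs (y l)" "!!l. apx l (1 / 2 ^ l) u (y l)" and r: "strict_mono (r :: nat => nat)"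
  and z: "!!l. rvs (z l)" "!!l. law leb (z l) = law leb (y (r l))"
  and V: "rvs V" "!!i. AE t in leb. (%l. z l i t) \<longlonglongrightarrow> V i t"
 shows "law leb V = law leb u"
proof (rule sym, rule law_eq_if_apx[OF u V(1)])
 fix N and e :: real assume e: "0 < e"
 then have e3: "0 < e / 3" by simp
 obtain L0 where L0: "!!l. l >= L0 ==> apx N (e / 3) V (z l)" using AE_limit_apx[of z V, OF z(1) V e3] by blast
 obtain n where n: "n >= N" "1 / 2 ^ n <= e / 3" using pow2_small[OF e3, of N 1] by auto
 define l where "l = max L0 n"
 have rl: "n <= r l" using seq_suble[OF r, of l] by (simp add: l_def)
 have "(1 / 2 ^ r l :: real) <= 1 / 2 ^ n" using rl by (intro divide_left_mono power_increasing) auto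
 then have 1: "apx N (e / 3) u (y (r l))" by (intro apx_mono[OF y(2) _ _ u y(1)]) (use n rl in auto)
 obtain \<sigma> where \<sigma>: "unit_mp \<sigma>" "apx N (e / 3) (y (r l)) (%i t. z l i (\<sigma> t))" by (rule law_align[OF y(1) z(1) z(2)[symmetric] e3]) blast
 have 3: "apx N (e / 3) (%i t. z l i (\<sigma> t)) (%i t. V i (\<sigma> t))"
  using apx_mp[OF apx_sym[OF L0] \<sigma>(1) z(1) V(1), of l] by (simp add: l_def)
 note r2 = rvs_mp[OF V(1) \<sigma>(1)]
 have "apx N (e / 3 + (e / 3 + e / 3)) u (%i t. V i (\<sigma> t))"
  by (rule apx_trans[OF u y(1) r2 1 apx_trans[OF y(1) rvs_mp[OF z(1) \<sigma>(1)] r2 \<sigma>(2) 3]])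
 moreover have "law leb (%i t. V i (\<sigma> t)) = law leb V" by (rule law_mp[OF \<sigma>(1) rvsD[OF V(1)]])
 ultimately show "EX u' v'. rvs u' & rvs v' & law leb u' = law leb u & law leb v' = law leb V & apx N e u' v'"
  using u r2 by (intro exI[of _ u] exI[of _ "%i t. V i (\<sigma> t)"]) simp
qed

text \<open>Approximate a dense sequence of \<open>A\<close> by feature sequences of
  \<open>X\<close>. Tightness bounds them at one point, Arzela-Ascoli yields limit features, and
  these have the law of the dense sequence, which amounts to a domination.\<close>

lemma dominated_if_approximable:
 assumes A: "is_gds A" and X: "is_gds X"
  and ap: "!!u N e. u : feature_rvs A ==> 0 < e ==> EX v:feature_rvs X. apx N e u v"
 shows "dominated A X"
proof -
 interpret A: gds A by rule fact
 interpret X: gds X by rule fact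
 obtain a where a: "A.dense_seq a" by (rule A.dense_seq_exists)
 then have af: "a i : feat_cl A" for i unfolding A.dense_seq_def by blast
 obtain u where u: "u : feature_rvs A" "law leb u = law (meas A) a" by (rule feature_rvs_exist[of A a, OF A af]) blast
 have ur: "rvs u" by (rule feature_rvs_rvs[OF u(1)])
 have "EX v g. rvs v & (ALL i. g i : feat_cl X) & law leb v = law (meas X) g & apx n (1 / 2 ^ n) u v" for n
  using ap[OF u(1), of "1 / 2 ^ n" n] by (auto simp: feature_rvs_def)
 then obtain v g where vr: "!!n. rvs (v n)" and g: "!!n i. g n i : feat_cl X"
  and vg: "!!n. law leb (v n) = law (meas X) (g n)" and vu: "!!n. apx n (1 / 2 ^ n) u (v n)" by metis
 have gm: "g n i : borel_measurable (meas X)" for n i by (rule X.feat_cl_measurable[OF g])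
 obtain x0 r0 where x0: "x0 : pts X" "0 < r0" "1 - 1 / 4 < X.prob (X.mball x0 r0)"
  by (rule X.bounded_ball[of "1 / 4"]) auto
 \<comment> \<open>A value at \<open>x0\<close> beyond \<open>R + r0\<close> would force values
   beyond \<open>R\<close> on the whole ball, whose mass exceeds 3/4, whereas tightness allows such
   values on mass at most 1/4.\<close>
 have bd: "EX B. ALL n. abs (g n i x0) <= B" for i
 proof -
  obtain R where R: "!!n. measure leb {t:{0..1}. abs (v n i t) > R} <= 1 / 4" using tight_if_apx[OF ur vr vu, of "1 / 4" i] by auto
  have "abs (g n i x0) <= R + r0" for n
  proof (rule ccontr)
   assume far: "~ ?thesis"
   have "X.prob (X.mball x0 r0) <= X.prob {x:space (meas X). abs (g n i x) > R}"
   proof (rule X.finite_measure_mono)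
    have "abs (g n i x0 - g n i x) < r0" if "x : X.mball x0 r0" for x
     using X.feat_clD[OF g x0(1), of x n i] that by auto
    then show "X.mball x0 r0 <= {x:space (meas X). abs (g n i x) > R}" using far by force
    show "{x:space (meas X). abs (g n i x) > R} : sets (meas X)"
     by (rule abs_greater_sets[OF gm])
   qed
   then show False using x0(3) R[of n] law_tail[OF rvsD[OF vr] gm vg[of n], where i=i and R=R] by simp
  qed
  then show ?thesis by blast
 qed
 obtain r f where r: "strict_mono (r :: nat => nat)" and f: "!!i. f i : feat_cl X"
  and lim: "!!i x. x : pts X ==> (%l. g (r l) i x) \<longlonglongrightarrow> f i x"
  by (rule X.feat_cl_seq_compact[of g]) (use g bd x0(1) in blast)+
 obtain phi where phi: "phi : params X" by (rule X.params_nonempty)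
 note rv = params_rvs[OF X phi]
 have "law leb (%i t. f i (phi t)) = law leb u"
 proof (rule law_limit[OF ur vr vu r, where z="%l i t. g (r l) i (phi t)"])
  show "AE t in leb. (%l. g (r l) i (phi t)) \<longlonglongrightarrow> f i (phi t)" for i
   using lim params_space[OF X phi] by (intro AE_I2) simp
 qed (use rv[of f, OF f] rv[of "g _", OF g] vg in auto)
 then have "law (meas X) f = law (meas A) a" using rv(2)[of f, OF f] u(2) by simp
 then obtain psi where "domination X A psi" by (rule domination_by_law[OF X A a f])
 then show ?thesis unfolding dominated_def by blast
qed


section \<open>The box distance\<close>

lemma hausdorff_dist_sym: "(!!a b. a : A ==> b : B ==> d a b = d' b a) ==> hausdorff_dist d A B = hausdorff_dist d' B A"
 unfolding hausdorff_dist_def by (subst max.commute) (intro arg_cong2[where f=max] SUP_cong INF_cong refl; simp)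

lemma box_dist_sym_le:
 fixes X :: "'a gds" and Y :: "'b gds"
 shows "box_dist X Y <= box_dist Y X"
 unfolding box_dist_def[of Y X]
proof (intro INF_greatest)
 fix \<pi> S assume \<pi>: "\<pi> : couplings (meas Y) (meas X)"
  and S: "S : {S. S ~= {} & closedin (prod_topology (gtop Y) (gtop X)) S}"
 define sw :: "'b \<times> 'a => 'a \<times> 'b" where "sw = (%(x, y). (y, x))"
 define sw' :: "'a \<times> 'b => 'b \<times> 'a" where "sw' = (%(x, y). (y, x))"
 have s\<pi>: "sets \<pi> = sets (meas Y \<Otimes>\<^sub>M meas X)" and d1: "distr \<pi> (meas Y) fst = meas Y" and d2: "distr \<pi> (meas X) snd = meas X"
  using \<pi> by (auto simp: couplings_def)
 have swm: "sw : measurable \<pi> (meas X \<Otimes>\<^sub>M meas Y)"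
  unfolding sw_def using s\<pi> by (simp cong: measurable_cong_sets)
 define \<pi>' where "\<pi>' = distr \<pi> (meas X \<Otimes>\<^sub>M meas Y) sw"
 have "distr \<pi>' (meas X) fst = distr \<pi> (meas X) snd"
  unfolding \<pi>'_def by (subst distr_distr[OF measurable_fst swm]) (auto simp: sw_def comp_def case_prod_beta snd_def[symmetric])
 moreover have "distr \<pi>' (meas Y) snd = distr \<pi> (meas Y) fst"
  unfolding \<pi>'_def by (subst distr_distr[OF measurable_snd swm]) (auto simp: sw_def comp_def case_prod_beta)
 ultimately have \<pi>': "\<pi>' : couplings (meas X) (meas Y)" using d1 d2 by (simp add: couplings_def \<pi>'_def)
 define S' where "S' = sw ` S"
 have pre: "sw -` S' = S" by (auto simp: S'_def sw_def)
 have "homeomorphic_map (prod_topology (gtop Y) (gtop X)) (prod_topology (gtop X) (gtop Y)) sw"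
  unfolding sw_def by (rule homeomorphic_map_swap)
 then have S': "S' ~= {}" "closedin (prod_topology (gtop X) (gtop Y)) S'"
  using S homeomorphic_map_closedness_eq closedin_subset unfolding S'_def by blast+
 \<comment> \<open>The measure of a set outside the sigma-algebra is 0 by convention, so
   non-measurability of the swapped set has to be transferred as well.\<close>
 have m: "measure \<pi>' S' = measure \<pi> S"
 proof (cases "S' : sets (meas X \<Otimes>\<^sub>M meas Y)")
  case True
  have "S <= space \<pi>"
   using sets.sets_into_space[OF True] sets_eq_imp_space_eq[OF s\<pi>] unfolding S'_def sw_def by (auto simp: space_pair_measure)
  then show ?thesis unfolding \<pi>'_def using measure_distr[OF swm True] by (simp add: pre Int_absorb2)
 next
  case False
  have "S ~: sets \<pi>"
  proof
   assume "S : sets \<pi>"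
   then have "S : sets (meas Y \<Otimes>\<^sub>M meas X)" by (simp add: s\<pi>)
   moreover have "sw' : measurable (meas X \<Otimes>\<^sub>M meas Y) (meas Y \<Otimes>\<^sub>M meas X)" unfolding sw'_def by simp
   ultimately have "sw' -` S Int space (meas X \<Otimes>\<^sub>M meas Y) : sets (meas X \<Otimes>\<^sub>M meas Y)" by (rule measurable_sets[rotated])
   moreover have "sw' -` S Int space (meas X \<Otimes>\<^sub>M meas Y) = S'"
    using sets.sets_into_space[OF `S : sets (meas Y \<Otimes>\<^sub>M meas X)`] by (auto simp: sw'_def S'_def sw_def space_pair_measure image_iff)
   ultimately show False using False by simp
  qed
  then show ?thesis using False by (simp add: measure_notin_sets \<pi>'_def)
 qed
 have ds: "d_sup S' (compose (pts X \<times> pts Y) f fst) (compose (pts X \<times> pts Y) g snd)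
   = d_sup S (compose (pts Y \<times> pts X) g fst) (compose (pts Y \<times> pts X) f snd)" for f g
  unfolding d_sup_def S'_def image_image
  by (intro SUP_cong refl) (auto simp: sw_def compose_def abs_minus_commute restrict_def)
 have "hausdorff_dist (d_sup S') (pullback (pts X \<times> pts Y) (feat_cl X) fst) (pullback (pts X \<times> pts Y) (feat_cl Y) snd)
  = hausdorff_dist (d_sup S) (pullback (pts Y \<times> pts X) (feat_cl Y) fst) (pullback (pts Y \<times> pts X) (feat_cl X) snd)"
  unfolding hausdorff_dist_def pullback_def image_image ds by (rule max.commute)
 then have "max (ennreal (1 - measure \<pi>' S')) (2 * hausdorff_dist (d_sup S') (pullback (pts X \<times> pts Y) (feat_cl X) fst) (pullback (pts X \<times> pts Y) (feat_cl Y) snd))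
  = max (ennreal (1 - measure \<pi> S)) (2 * hausdorff_dist (d_sup S) (pullback (pts Y \<times> pts X) (feat_cl Y) fst) (pullback (pts Y \<times> pts X) (feat_cl X) snd))"
  by (simp add: m)
 moreover have "box_dist X Y <= max (ennreal (1 - measure \<pi>' S')) (2 * hausdorff_dist (d_sup S') (pullback (pts X \<times> pts Y) (feat_cl X) fst) (pullback (pts X \<times> pts Y) (feat_cl Y) snd))"
  unfolding box_dist_def by (rule INF_lower2[OF \<pi>'], rule INF_lower) (use S' in blast)
 ultimately show "box_dist X Y <= max (ennreal (1 - measure \<pi> S)) (2 * hausdorff_dist (d_sup S) (pullback (pts Y \<times> pts X) (feat_cl Y) fst) (pullback (pts Y \<times> pts X) (feat_cl X) snd))"
  by simp
qed

lemma box_dist_sym: "box_dist X Y = box_dist Y X"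
 by (rule antisym[OF box_dist_sym_le box_dist_sym_le])

text \<open>Matches for a sequence of features converging to \<open>f\<close> are bounded at a point
  of the nonempty set \<open>S\<close>, so a subsequence of them converges to a match for
  \<open>f\<close>. Hence matches need only be exhibited for \<open>feat\<close>.\<close>

lemma feat_cl_match:
 assumes X: "is_gds X" and Y: "is_gds Y" and S: "S <= pts X \<times> pts Y" "S ~= {}"
  and m: "!!f. f : feat X ==> EX g:feat_cl Y. ALL (x,y):S. abs (f x - g y) <= d" and f: "f : feat_cl X"
 shows "EX g:feat_cl Y. ALL (x,y):S. abs (f x - g y) <= d"
proof -
 interpret X: gds X by rule fact
 interpret Y: gds Y by rule fact
 obtain s where s: "!!k. s k : feat X" "!!x. x : pts X ==> (%k. s k x) \<longlonglongrightarrow> f x" by (rule X.feat_cl_seq[OF f]) blast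
 have "ALL k. EX g:feat_cl Y. ALL (x,y):S. abs (s k x - g y) <= d" using m s(1) by blast
 then obtain g where g: "!!k. g k : feat_cl Y" "!!k x y. (x,y) : S ==> abs (s k x - g k y) <= d" by (metis case_prodD)
 obtain x0 y0 where xy: "(x0, y0) : S" using S(2) by auto
 have "convergent (%k. s k x0)" using s(2)[of x0] S(1) xy by (auto simp: convergent_def)
 then have "Bseq (%k. s k x0)" by (rule convergent_imp_Bseq)
 then obtain B where B: "!!k. abs (s k x0) <= B" unfolding Bseq_def real_norm_def by blast
 have gB: "EX y:pts Y. EX B. ALL k. abs (g k y) <= B"
 proof (intro bexI exI allI)
  show "abs (g k y0) <= B + d" for k using B[of k] g(2)[OF xy, of k] by linarith
  show "y0 : pts Y" using S(1) xy by auto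
 qed
 obtain r h where r: "strict_mono (r :: nat => nat)" and h: "!!i::nat. h i : feat_cl Y"
  "!!i y. y : pts Y ==> (%l. g (r l) y) \<longlonglongrightarrow> h i y"
  by (rule Y.feat_cl_seq_compact[of "%k i. g k", OF g(1) gB]) blast
 have "abs (f x - h 0 y) <= d" if xy: "(x,y) : S" for x y
 proof (rule LIMSEQ_le_const2)
  have p: "x : pts X" "y : pts Y" using S(1) xy by auto
  have "(%l. s (r l) x) \<longlonglongrightarrow> f x" using LIMSEQ_subseq_LIMSEQ[OF s(2)[OF p(1)] r] by (simp add: comp_def)
  then show "(%l. abs (s (r l) x - g (r l) y)) \<longlonglongrightarrow> abs (f x - h 0 y)" by (intro tendsto_rabs tendsto_diff h(2) p)
 qed (use g(2)[OF xy] in blast)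
 then show ?thesis using h(1)[of 0] by blast
qed

lemma d_sup_le: "(!!x. x : S ==> abs (f x - g x) <= d) ==> d_sup S f g <= ennreal d"
 unfolding d_sup_def by (intro SUP_least ennreal_leI)

lemma hausdorff_dist_le:
 assumes "!!a. a : A ==> EX b:B. d a b <= c" "!!b. b : B ==> EX a:A. d a b <= c"
 shows "hausdorff_dist d A B <= c"
 unfolding hausdorff_dist_def
proof (intro max.boundedI SUP_least)
 show "(INF b\<in>B. d a b) <= c" if a: "a : A" for a using assms(1)[OF a] by (auto intro: INF_lower2)
 show "(INF a\<in>A. d a b) <= c" if b: "b : B" for b using assms(2)[OF b] by (auto intro: INF_lower2)
qed

lemma hausdorff_dist_lessD:
 assumes "hausdorff_dist d A B < c"
 shows "a : A ==> EX b:B. d a b < c" "b : B ==> EX a:A. d a b < c"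
proof -
 have 1: "(SUP a\<in>A. INF b\<in>B. d a b) < c" and 2: "(SUP b\<in>B. INF a\<in>A. d a b) < c"
  using assms by (auto simp: hausdorff_dist_def)
 show "EX b:B. d a b < c" if "a : A"
  using le_less_trans[OF SUP_upper[OF that] 1] by (simp add: INF_less_iff)
 show "EX a:A. d a b < c" if "b : B"
  using le_less_trans[OF SUP_upper[OF that] 2] by (simp add: INF_less_iff)
qed

lemma coupling_of_params:
 assumes "is_gds X" "is_gds Y" "phi : params X" "psi : params Y"
 shows "distr leb (meas X \<Otimes>\<^sub>M meas Y) (%t. (phi t, psi t)) : couplings (meas X) (meas Y)"
  "(%t. (phi t, psi t)) : measurable leb (meas X \<Otimes>\<^sub>M meas Y)"
proof -
 have p: "phi : measurable leb (meas X)" "psi : measurable leb (meas Y)"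
  "distr leb (meas X) phi = meas X" "distr leb (meas Y) psi = meas Y"
  using assms(3,4) by (auto simp: params_def)
 show m: "(%t. (phi t, psi t)) : measurable leb (meas X \<Otimes>\<^sub>M meas Y)"
  by (rule measurable_Pair[OF p(1,2)])
 show "distr leb (meas X \<Otimes>\<^sub>M meas Y) (%t. (phi t, psi t)) : couplings (meas X) (meas Y)"
  unfolding couplings_def using p(3,4)
  by (simp add: distr_distr[OF measurable_fst m] distr_distr[OF measurable_snd m] comp_def)
qed

lemma box_dist_leI:
 assumes X: "is_gds X" and Y: "is_gds Y" and phi: "phi : params X" "psi : params Y"
  and S: "closedin (prod_topology (gtop X) (gtop Y)) S" "S : sets (meas X \<Otimes>\<^sub>M meas Y)" "S ~= {}"
  and mS: "1 - measure leb {t:{0..1}. (phi t, psi t) : S} <= e'" "e' <= e" and d: "d <= e / 2"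
  and m1: "!!f. f : feat X ==> EX g:feat_cl Y. ALL (x,y):S. abs (f x - g y) <= d"
  and m2: "!!g. g : feat Y ==> EX f:feat_cl X. ALL (x,y):S. abs (f x - g y) <= d"
 shows "box_dist X Y <= ennreal e"
proof -
 interpret X: gds X by rule fact
 interpret Y: gds Y by rule fact
 have Sp: "S <= pts X \<times> pts Y" using closedin_subset[OF S(1)] by simp
 define \<pi> where "\<pi> = distr leb (meas X \<Otimes>\<^sub>M meas Y) (%t. (phi t, psi t))"
 note \<pi> = coupling_of_params[OF X Y phi, folded \<pi>_def]
 have "measure \<pi> S = measure leb {t:{0..1}. (phi t, psi t) : S}"
  unfolding \<pi>_def by (subst measure_distr[OF \<pi>(2) S(2)]) (auto intro!: arg_cong[where f="measure leb"])
 then have 1: "1 - measure \<pi> S <= e" using mS by simp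
 have "hausdorff_dist (d_sup S) (pullback (pts X \<times> pts Y) (feat_cl X) fst) (pullback (pts X \<times> pts Y) (feat_cl Y) snd) <= ennreal (e / 2)"
 proof (rule hausdorff_dist_le)
  fix a assume "a : pullback (pts X \<times> pts Y) (feat_cl X) fst"
  then obtain f where f: "f : feat_cl X" "a = compose (pts X \<times> pts Y) f fst" by (auto simp: pullback_def)
  obtain g where g: "g : feat_cl Y" "ALL (x,y):S. abs (f x - g y) <= d"
   using feat_cl_match[OF X Y Sp S(3) m1 f(1)] by blast
  have "d_sup S a (compose (pts X \<times> pts Y) g snd) <= ennreal (e / 2)"
   unfolding f(2) using g(2) Sp d by (intro d_sup_le) (force simp: compose_def)
  then show "EX b:pullback (pts X \<times> pts Y) (feat_cl Y) snd. d_sup S a b <= ennreal (e / 2)"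
   using g(1) unfolding pullback_def by blast
 next
  fix b assume "b : pullback (pts X \<times> pts Y) (feat_cl Y) snd"
  then obtain g where g: "g : feat_cl Y" "b = compose (pts X \<times> pts Y) g snd" by (auto simp: pullback_def)
  have "EX f:feat_cl X. ALL (y,x):prod.swap ` S. abs (g y - f x) <= d"
  proof (rule feat_cl_match[OF Y X _ _ _ g(1)])
   show "prod.swap ` S <= pts Y \<times> pts X" "prod.swap ` S ~= {}" using Sp S(3) by auto
   fix g assume "g : feat Y"
   then obtain f where "f : feat_cl X" "ALL (x,y):S. abs (f x - g y) <= d" using m2 by blast
   then show "EX f:feat_cl X. ALL (y,x):prod.swap ` S. abs (g y - f x) <= d"
    by (intro bexI[of _ f]) (auto simp: abs_minus_commute)
  qed
  then obtain f where f: "f : feat_cl X" "ALL (y,x):prod.swap ` S. abs (g y - f x) <= d" by blast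
  have "d_sup S (compose (pts X \<times> pts Y) f fst) b <= ennreal (e / 2)"
   unfolding g(2) using f(2) Sp d by (intro d_sup_le) (force simp: compose_def abs_minus_commute)
  then show "EX a:pullback (pts X \<times> pts Y) (feat_cl X) fst. d_sup S a b <= ennreal (e / 2)"
   using f(1) unfolding pullback_def by blast
 qed
 then have "2 * hausdorff_dist (d_sup S) (pullback (pts X \<times> pts Y) (feat_cl X) fst) (pullback (pts X \<times> pts Y) (feat_cl Y) snd) <= 2 * ennreal (e / 2)"
  by (intro mult_left_mono) auto
 also have "2 * ennreal (e / 2) = ennreal e"
  by (metis (no_types, opaque_lifting) ennreal_mult' ennreal_numeral mult.commute nonzero_eq_divide_eq zero_neq_numeral zero_le_numeral)
 finally have "max (ennreal (1 - measure \<pi> S)) (2 * hausdorff_dist (d_sup S) (pullback (pts X \<times> pts Y) (feat_cl X) fst) (pullback (pts X \<times> pts Y) (feat_cl Y) snd)) <= ennreal e"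
  using 1 by (simp add: ennreal_leI)
 moreover have "box_dist X Y <= max (ennreal (1 - measure \<pi> S)) (2 * hausdorff_dist (d_sup S) (pullback (pts X \<times> pts Y) (feat_cl X) fst) (pullback (pts X \<times> pts Y) (feat_cl Y) snd))"
  unfolding box_dist_def by (rule INF_lower2[OF \<pi>(1)], rule INF_lower) (use S in blast)
 ultimately show ?thesis by (rule order_trans[rotated])
qed

text \<open>The bound \<open>e <= 1\<close> forces \<open>S\<close> to have positive measure, hence
  to be measurable. The strictly smaller \<open>e'\<close> leaves room for an alignment error
  afterwards.\<close>

lemma box_dist_lessE:
 assumes X: "is_gds X" and Y: "is_gds Y" and less: "box_dist X Y < ennreal e" "e <= 1"
 obtains \<pi> S e' where "\<pi> : couplings (meas X) (meas Y)" "S : sets \<pi>" "S <= pts X \<times> pts Y" "0 <= e'" "e' < e" "1 - measure \<pi> S <= e'"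
  "!!f. f : feat_cl X ==> EX g:feat_cl Y. ALL (x,y):S. abs (f x - g y) <= e' / 2"
  "!!g. g : feat_cl Y ==> EX f:feat_cl X. ALL (x,y):S. abs (f x - g y) <= e' / 2"
proof -
 interpret X: gds X by rule fact
 interpret Y: gds Y by rule fact
 let ?A = "pullback (pts X \<times> pts Y) (feat_cl X) fst" and ?B = "pullback (pts X \<times> pts Y) (feat_cl Y) snd"
 obtain \<pi> S where \<pi>: "\<pi> : couplings (meas X) (meas Y)" and S: "closedin (prod_topology (gtop X) (gtop Y)) S"
  and lt: "max (ennreal (1 - measure \<pi> S)) (2 * hausdorff_dist (d_sup S) ?A ?B) < ennreal e"
  using less(1) unfolding box_dist_def INF_less_iff by blast
 obtain r where r: "max (ennreal (1 - measure \<pi> S)) (2 * hausdorff_dist (d_sup S) ?A ?B) < r" "r < ennreal e"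
  using dense[OF lt] by blast
 then have "r < top" using less_le_trans[OF r(2)] top_greatest by (metis top.not_eq_extremum ennreal_less_top less_trans)
 then obtain e' where e': "r = ennreal e'" "0 <= e'" by (cases r) auto
 have e'e: "e' < e" using r(2) e' by (simp add: ennreal_less_iff)
 have 1: "1 - measure \<pi> S < e'"
  using r(1) e' by (cases "0 <= 1 - measure \<pi> S") (auto simp: ennreal_less_iff ennreal_neg)
 have "measure \<pi> S ~= 0" using 1 e'e less(2) by linarith
 then have S\<pi>: "S : sets \<pi>" using measure_notin_sets by blast
 have Sp: "S <= pts X \<times> pts Y" using closedin_subset[OF S] by simp
 have H: "hausdorff_dist (d_sup S) ?A ?B < ennreal (e' / 2)"
 proof (rule ccontr)
  assume "~ ?thesis"
  then have "2 * ennreal (e' / 2) <= 2 * hausdorff_dist (d_sup S) ?A ?B" by (intro mult_left_mono) (auto simp: not_less)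
  also have "... < ennreal e'" using r(1) e' by simp
  finally have "2 * ennreal (e' / 2) < ennreal e'" .
  moreover have "2 * ennreal (e' / 2) = ennreal e'"
   using e'(2) by (metis ennreal_mult' ennreal_numeral mult.commute nonzero_eq_divide_eq zero_neq_numeral zero_le_numeral)
  ultimately show False by simp
 qed
 have pt: "abs (a z - b z) <= e' / 2" if "d_sup S a b < ennreal (e' / 2)" "z : S" for a b z
 proof -
  have "ennreal (abs (a z - b z)) <= d_sup S a b" unfolding d_sup_def by (rule SUP_upper[OF that(2)])
  then have "ennreal (abs (a z - b z)) < ennreal (e' / 2)" using that(1) by (rule le_less_trans)
  then show ?thesis by (simp add: ennreal_less_iff)
 qed
 have m1: "EX g:feat_cl Y. ALL (x,y):S. abs (f x - g y) <= e' / 2" if f: "f : feat_cl X" for f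
 proof -
  have "compose (pts X \<times> pts Y) f fst : ?A" using f by (auto simp: pullback_def)
  from hausdorff_dist_lessD(1)[OF H this] obtain g where g: "g : feat_cl Y"
   "d_sup S (compose (pts X \<times> pts Y) f fst) (compose (pts X \<times> pts Y) g snd) < ennreal (e' / 2)" by (auto simp: pullback_def)
  show ?thesis using pt[OF g(2)] Sp g(1) by (intro bexI[of _ g]) (fastforce simp: compose_def)
 qed
 have m2: "EX f:feat_cl X. ALL (x,y):S. abs (f x - g y) <= e' / 2" if g: "g : feat_cl Y" for g
 proof -
  have "compose (pts X \<times> pts Y) g snd : ?B" using g by (auto simp: pullback_def)
  from hausdorff_dist_lessD(2)[OF H this] obtain f where f: "f : feat_cl X"
   "d_sup S (compose (pts X \<times> pts Y) f fst) (compose (pts X \<times> pts Y) g snd) < ennreal (e' / 2)" by (auto simp: pullback_def)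
  show ?thesis using pt[OF f(2)] Sp f(1) by (intro bexI[of _ f]) (fastforce simp: compose_def)
 qed
 show ?thesis by (rule that[OF \<pi> S\<pi> Sp e'(2) e'e less_imp_le[OF 1] m1 m2])
qed

lemma couplingD:
 assumes "is_gds X" "is_gds Y" "\<pi> : couplings (meas X) (meas Y)"
 shows "fst : measurable \<pi> (meas X)" "snd : measurable \<pi> (meas Y)" "distr \<pi> (meas X) fst = meas X"
  "distr \<pi> (meas Y) snd = meas Y" "prob_space \<pi>" "space \<pi> = pts X \<times> pts Y"
proof -
 interpret X: gds X by rule fact
 interpret Y: gds Y by rule fact
 have s: "sets \<pi> = sets (meas X \<Otimes>\<^sub>M meas Y)" using assms(3) by (simp add: couplings_def)
 show m: "fst : measurable \<pi> (meas X)" "snd : measurable \<pi> (meas Y)" using s by (simp_all cong: measurable_cong_sets)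
 show d: "distr \<pi> (meas X) fst = meas X" "distr \<pi> (meas Y) snd = meas Y" using assms(3) by (auto simp: couplings_def)
 show "prob_space \<pi>" using prob_space_distrD[OF m(1)] d(1) X.prob_space_axioms by simp
 show "space \<pi> = pts X \<times> pts Y" using sets_eq_imp_space_eq[OF s] by (simp add: space_pair_measure)
qed

text \<open>A coupling becomes a random sequence on the interval carrying features of
  \<open>X\<close> and their matches in \<open>Y\<close> jointly; rearranging it towards
  \<open>u\<close> costs the slack \<open>e - e'\<close>. For \<open>e > 1\<close> the mass
  condition in \<open>apx\<close> is void.\<close>

lemma box_dist_apx:
 assumes X: "is_gds X" and Y: "is_gds Y" and less: "box_dist X Y < ennreal e" and u: "u : feature_rvs X"
 obtains v where "v : feature_rvs Y" "apx N e u v"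
proof (cases "e <= 1")
 case False
 interpret Y: gds Y by rule fact
 obtain g where "g : feat_cl Y" using Y.feat_nonempty Y.feat_subset_cl by blast
 then obtain v where v: "v : feature_rvs Y" using feature_rvs_exist[OF Y, of "%_. g"] by metis
 have "measure leb (apx_set N e u v) <= 1" by (rule leb.prob_le_1)
 then have "apx N e u v" unfolding apx_def using False by linarith
 then show ?thesis using that v by blast
next
 case True
 interpret X: gds X by rule fact
 interpret Y: gds Y by rule fact
 obtain f where f: "!!i. f i : feat_cl X" "law leb u = law (meas X) f" and ur: "rvs u"
  by (rule feature_rvsE[OF u]) blast
 obtain \<pi> S e' where \<pi>: "\<pi> : couplings (meas X) (meas Y)" and S: "S : sets \<pi>" "S <= pts X \<times> pts Y"
  and e': "0 <= e'" "e' < e" "1 - measure \<pi> S <= e'"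
  and m1: "!!f. f : feat_cl X ==> EX g:feat_cl Y. ALL (x,y):S. abs (f x - g y) <= e' / 2"
  by (rule box_dist_lessE[OF X Y less True]) blast
 note c = couplingD[OF X Y \<pi>]
 interpret \<pi>: prob_space \<pi> by (rule c(5))
 have "ALL i. EX g:feat_cl Y. ALL (x,y):S. abs (f i x - g y) <= e' / 2" using m1[OF f(1)] by blast
 then obtain g where g: "!!i. g i : feat_cl Y" "!!i x y. (x,y) : S ==> abs (f i x - g i y) <= e' / 2" by (metis case_prodD)
 \<comment> \<open>Interleaving: features of \<open>X\<close> in even positions and their matches in
   odd positions, so that one law records both.\<close>
 define w where "w n z = (if even n then f (n div 2) (fst z) else g (n div 2) (snd z))" for n z
 have fm: "f i : borel_measurable (meas X)" for i by (rule X.feat_cl_measurable[OF f(1)])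
 have gm: "g i : borel_measurable (meas Y)" for i by (rule Y.feat_cl_measurable[OF g(1)])
 have wm: "w n : borel_measurable \<pi>" for n
  unfolding w_def using measurable_compose[OF c(1) fm] measurable_compose[OF c(2) gm] by (cases "even n") auto
 obtain z where z: "!!i. z i : borel_measurable leb" "law leb z = law \<pi> w"
  by (rule law_realize[OF prob_space_law[of \<pi> w, OF c(5) wm] sets_law]) blast
 have zr: "rvs z" using z(1) by (simp add: rvs_def)
 have ze: "rvs (%i. z (2 * i))" "rvs (%i. z (2 * i + 1))" using z(1) by (auto simp: rvs_def)
 have le: "law leb (%i. z (2 * i)) = law (meas X) f"
 proof -
  have "law leb (%i. z (2 * i)) = law \<pi> (%i. w (2 * i))"
   using law_reindex[OF z(1) wm z(2), of "%_ x. x" "%i. 2 * i"] by simp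
  also have "... = law (meas X) f"
   unfolding w_def using law_distr[OF c(1,3), of f] fm by simp
  finally show ?thesis .
 qed
 have lo: "law leb (%i. z (2 * i + 1)) = law (meas Y) g"
 proof -
  have "law leb (%i. z (2 * i + 1)) = law \<pi> (%i. w (2 * i + 1))"
   using law_reindex[OF z(1) wm z(2), of "%_ x. x" "%i. 2 * i + 1"] by simp
  also have "... = law (meas Y) g"
   unfolding w_def using law_distr[OF c(2,4), of g] gm by simp
  finally show ?thesis .
 qed
 have ap: "apx N e' (%i. z (2 * i)) (%i. z (2 * i + 1))"
 proof -
  let ?B = "{y :: nat => real. EX i:{..<N}. abs (y (2 * i) - y (2 * i + 1)) > e' / 2}"
  have "open {y :: nat => real. abs (y (2 * i) - y (2 * i + 1)) > e' / 2}" for i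
   by (intro open_Collect_less continuous_intros continuous_on_product_coordinates)
  then have "open (UN i:{..<N}. {y :: nat => real. abs (y (2 * i) - y (2 * i + 1)) > e' / 2})" by blast
  moreover have "(UN i:{..<N}. {y :: nat => real. abs (y (2 * i) - y (2 * i + 1)) > e' / 2}) = ?B" by auto
  ultimately have B: "?B : sets borel" by simp
  have zB: "{t:space leb. (%i. z i t) : ?B} : sets leb"
   using measurable_sets[OF measurable_seq[of z, OF z(1)] B] by (simp add: vimage_def Int_def conj_commute)
  have "measure leb (apx_set N e' (%i. z (2 * i)) (%i. z (2 * i + 1))) <= measure leb {t:space leb. (%i. z i t) : ?B}"
  proof (rule leb.finite_measure_mono[OF _ zB])
   show "apx_set N e' (%i. z (2 * i)) (%i. z (2 * i + 1)) <= {t:space leb. (%i. z i t) : ?B}"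
    unfolding apx_set_def using less_le_trans[OF _ trunc_lipschitz] by fastforce
  qed
  also have "... = \<pi>.prob {p:space \<pi>. (%i. w i p) : ?B}"
   using law_measure[of z, OF z(1) B] law_measure[of w, OF wm B] z(2) by simp
  also have "... <= \<pi>.prob (space \<pi> - S)"
  proof (rule \<pi>.finite_measure_mono)
   show "{p:space \<pi>. (%i. w i p) : ?B} <= space \<pi> - S"
    using g(2) by (auto simp: w_def not_less[symmetric])
  qed (use S in auto)
  also have "... <= e'" using \<pi>.prob_compl[OF S(1)] e'(3) by simp
  finally show ?thesis unfolding apx_def .
 qed
 obtain \<tau> where \<tau>: "unit_mp \<tau>" "apx N (e - e') u (%i t. z (2 * i) (\<tau> t))"
  by (rule law_align[OF ur ze(1) _ , of "e - e'" N]) (use le f(2) e' in auto)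
 have ap': "apx N e' (%i t. z (2 * i) (\<tau> t)) (%i t. z (2 * i + 1) (\<tau> t))" by (rule apx_mp[OF ap \<tau>(1) ze])
 have "apx N (e - e' + e') u (%i t. z (2 * i + 1) (\<tau> t))"
  by (rule apx_trans[OF ur rvs_mp[OF ze(1) \<tau>(1)] rvs_mp[OF ze(2) \<tau>(1)] \<tau>(2) ap'])
 moreover have "(%i t. z (2 * i + 1) (\<tau> t)) : feature_rvs Y"
  by (rule feature_rvs_mp[OF feature_rvsI[OF ze(2) g(1) lo] \<tau>(1)])
 ultimately show ?thesis using that by simp
qed

text \<open>Transfer a feature \<open>f\<close> to a nearby closed data set, apply \<open>p\<close>
  there, and transfer back; since \<open>p\<close> is 1-Lipschitz the result approximates
  \<open>p \<circ> f\<close> in measure.\<close>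

lemma (in monoidal_family) closed_gds_box_limit:
 assumes A: "is_gds A" and lim: "!!e. 0 < e ==> EX B :: 'b gds. is_gds B & closed_gds B & box_dist A B < ennreal e"
 shows "closed_gds A"
proof (rule closed_gdsI[OF A])
 interpret A: gds A by rule fact
 fix p f assume p: "p : L" and "f : feat A"
 then have f: "f : feat_cl A" using A.feat_subset_cl by blast
 have pf: "compose (pts A) p f : Lip1_on (pts A) (gdist A)"
  using order_trans[OF L_Lip1[OF p] A.feat_clD[OF f]] by (auto simp: Lip1_on_def compose_def)
 have "compose (pts A) p f : pw_closure (pts A) (feat_cl A)"
 proof (rule A.kf_closed[OF pf A.feat_cl_Lip])
  fix e0 :: real assume "0 < e0"
  define e where "e = min e0 1"
  have e: "0 < e" "e <= 1" "e <= e0" using `0 < e0` by (auto simp: e_def)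
  obtain B :: "'b gds" where B: "is_gds B" "closed_gds B" "box_dist A B < ennreal e" using lim[OF e(1)] by blast
  interpret B: gds B by rule fact
  obtain \<pi> S e' where \<pi>: "\<pi> : couplings (meas A) (meas B)" and S: "S : sets \<pi>" "S <= pts A \<times> pts B"
   and e': "0 <= e'" "e' < e" "1 - measure \<pi> S <= e'"
   and m1: "!!f. f : feat_cl A ==> EX g:feat_cl B. ALL (x,y):S. abs (f x - g y) <= e' / 2"
   and m2: "!!g. g : feat_cl B ==> EX f:feat_cl A. ALL (x,y):S. abs (f x - g y) <= e' / 2"
   by (rule box_dist_lessE[OF A B(1,3) e(2)]) blast
  note c = couplingD[OF A B(1) \<pi>]
  interpret \<pi>: prob_space \<pi> by (rule c(5))
  obtain g where g: "g : feat_cl B" "ALL (x,y):S. abs (f x - g y) <= e' / 2" using m1[OF f] by blast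
  have pg: "compose (pts B) p g : feat_cl B" by (rule closed_gdsD[OF B(2) p g(1)])
  obtain h where h: "h : feat_cl A" "ALL (x,y):S. abs (h x - compose (pts B) p g y) <= e' / 2" using m2[OF pg] by blast
  have "near \<pi> e' (%z. compose (pts A) p f (fst z)) (%z. h (fst z))"
  proof (rule \<pi>.nearI_subset[OF S(1) e'(3)])
   fix z assume z: "z : S"
   obtain x y where xy: "z = (x, y)" "x : pts A" "y : pts B" using z S(2) by auto
   have "abs (f x - g y) <= e' / 2" "abs (h x - p (g y)) <= e' / 2" using g(2) h(2) z xy by (auto simp: compose_def)
   then have "abs (p (f x) - h x) <= e'" using L_Lip1[OF p, of "f x" "g y"] by linarith
   then show "abs (compose (pts A) p f (fst z) - h (fst z)) <= e'" using xy by (simp add: compose_def)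
  qed
  then have "near (meas A) e' (compose (pts A) p f) h"
   using near_distr[OF c(1,3) A.Lip1_measurable[OF pf] A.feat_cl_measurable[OF h(1)]] by simp
  then have "near (meas A) e0 (compose (pts A) p f) h"
   by (rule A.near_mono[OF A.Lip1_measurable[OF pf] A.feat_cl_measurable[OF h(1)]]) (use e' e in simp)
  then show "EX g:feat_cl A. near (meas A) e0 (compose (pts A) p f) g" using h(1) by blast
 qed
 then show "compose (pts A) p f : feat_cl A" by (simp add: pw_closure_idem)
qed


section \<open>Measurements\<close>

text \<open>Composites with \<open>p\<close> need not be limits of the given features, so
  truncations are quotients of the data set with all 1-Lipschitz functions. Its metric is unchanged
  because the distance functions to points are among them.\<close>

lemma lip_gds:
 assumes "is_gds X"
 shows "is_gds (GDS (pts X) (Lip1_on (pts X) (gdist X)) (meas X))" (is "is_gds ?X'")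
  and "feat_cl (GDS (pts X) (Lip1_on (pts X) (gdist X)) (meas X)) = Lip1_on (pts X) (gdist X)"
proof -
 interpret X: gds X by rule fact
 let ?F = "Lip1_on (pts X) (gdist X)"
 have bdd: "bdd_above ((%f. abs (f x - f y)) ` ?F)" if "x : pts X" "y : pts X" for x y
  using Lip1_onD[OF _ that] by (intro bdd_aboveI2[where M="gdist X x y"]) auto
 have "(SUP f\<in>?F. abs (f x - f y)) = gdist X x y" if xy: "x : pts X" "y : pts X" for x y
 proof (rule antisym)
  show "(SUP f\<in>?F. abs (f x - f y)) <= gdist X x y"
   by (rule cSUP_least) (use X.feat_Lip X.feat_nonempty Lip1_onD[OF _ xy] in auto)
  have "(\<lambda>z\<in>pts X. gdist X x z) : ?F"
  proof -
   have "abs (gdist X x z - gdist X x z') <= gdist X z z'" if "z : pts X" "z' : pts X" for z z'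
    using X.triangle[OF xy(1) that] X.triangle[OF xy(1) that(2,1)] X.commute[of z z'] by linarith
   then show ?thesis by (auto simp: Lip1_on_def)
  qed
  from cSUP_upper[OF this bdd[OF xy]] show "gdist X x y <= (SUP f\<in>?F. abs (f x - f y))"
   using xy by simp
 qed
 then have "feat_dist (pts X) ?F = gdist X" by (intro ext) (auto simp: feat_dist_def)
 then show "is_gds ?X'"
  using assms bdd X.feat_Lip X.feat_nonempty unfolding is_gds_def by (auto simp: Lip1_on_def)
 show "feat_cl ?X' = ?F" by (simp add: pw_closure_Lip1)
qed

lemma feat_finite: "is_gds X ==> finite (feat X) ==> feat_cl X = feat X"
 by (rule pw_closure_finite) (auto simp: is_gds_def)

lemma domination_pullback_inj:
 assumes X: "is_gds X" and Y: "is_gds Y" and phi: "domination X Y phi" and f: "f : feat_cl Y" and g: "g : feat_cl Y"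
  and eq: "compose (pts X) f phi = compose (pts X) g phi"
 shows "f = g"
proof
 interpret Y: gds Y by rule fact
 fix y show "f y = g y"
 proof (cases "y : pts Y")
  case True
  have "abs (f y - g y) <= 0"
  proof (rule field_le_epsilon)
   fix e :: real assume e: "0 < e"
   obtain x where x: "x : pts X" "gdist Y y (phi x) < e / 2"
    by (rule domination_dense_range[OF X Y phi True, of "e / 2"]) (use e in auto)
   have p: "phi x : pts Y" by (rule domination_space[OF X Y phi x(1)])
   have "f (phi x) = g (phi x)" using fun_cong[OF eq, of x] x(1) by (simp add: compose_def)
   then show "abs (f y - g y) <= 0 + e" using Y.feat_clD[OF f True p] Y.feat_clD[OF g True p] x(2) by linarith
  qed
  then show ?thesis by simp
 next
  case False
  then show ?thesis using subsetD[OF pw_closure_extensional f] subsetD[OF pw_closure_extensional g] by (simp add: extensional_def)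
 qed
qed

text \<open>An enumeration with possible repetitions, continued to a full sequence inside the finite
  family so that \<open>law\<close> applies to it.\<close>

definition listed :: "nat => 'a gds => (nat => 'a => real) => bool" where
 "listed N X c \<longleftrightarrow> is_gds X & feat_cl X = c ` {..<N} & range c <= feat_cl X"

lemma listed_feat: "listed N X c ==> c i : feat_cl X"
 unfolding listed_def by blast

lemma listed_finite: "listed N X c ==> finite (feat_cl X) & card (feat_cl X) <= N"
 unfolding listed_def using card_image_le[of "{..<N}" c] by auto

lemma listed_dense_seq: "listed N X c ==> gds.dense_seq X c"
proof -
 assume l: "listed N X c"
 interpret X: gds X by (rule gds.intro) (use l in \<open>simp add: listed_def\<close>)
 have "feat X <= pw_closure (pts X) (range c)"
  using X.feat_subset_cl pw_closure_subset[of "range c" "pts X"] l pw_closure_extensional unfolding listed_def by blast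
 then show ?thesis using l unfolding X.dense_seq_def listed_def by blast
qed

lemma listed_domination:
 assumes X: "is_gds X" and Y: "is_gds Y" and phi: "domination X Y phi"
  and pb: "pullback (pts X) (feat Y) phi = f ` {..<N}" and f: "range f <= f ` {..<N}" "range f <= feat_cl X"
 obtains y where "listed N Y y" "!!i. compose (pts X) (y i) phi = f i" "law (meas Y) y = law (meas X) f"
proof -
 interpret Y: gds Y by rule fact
 have "EX y:feat Y. compose (pts X) y phi = f i" for i
 proof -
  have "f i : pullback (pts X) (feat Y) phi" using f(1) pb by auto
  then show ?thesis by (auto simp: pullback_def)
 qed
 then obtain y where y: "!!i. y i : feat Y" "!!i. compose (pts X) (y i) phi = f i" by metis
 have ycl: "y i : feat_cl Y" for i using y(1) Y.feat_subset_cl by blast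
 have "feat Y = y ` {..<N}"
 proof
  show "feat Y <= y ` {..<N}"
  proof
   fix h assume h: "h : feat Y"
   then have "compose (pts X) h phi : f ` {..<N}" using pb by (auto simp: pullback_def)
   then obtain i where i: "i < N" "compose (pts X) h phi = f i" by auto
   have "h = y i" by (rule domination_pullback_inj[OF X Y phi]) (use h Y.feat_subset_cl ycl i y(2) in auto)
   then show "h : y ` {..<N}" using i(1) by blast
  qed
 qed (use y(1) in auto)
 then have "feat_cl Y = y ` {..<N}" using feat_finite[OF Y] by simp
 then have "listed N Y y" using ycl Y by (auto simp: listed_def)
 moreover have "law (meas Y) y = law (meas X) f" using domination_law[OF X Y phi ycl] y(2) by simp
 ultimately show ?thesis using that y(2) by blast
qed

lemma listed_rep:
 fixes X :: "real gds"
 assumes l: "listed N X c"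
 obtains c' where "listed N (rep (iso_class X)) c'" "law (meas (rep (iso_class X))) c' = law (meas X) c"
proof -
 have X: "is_gds X" using l by (simp add: listed_def)
 let ?Z = "rep (iso_class X)"
 note Z = rep_iso_class[OF X]
 obtain psi where psi: "domination ?Z X psi" "pullback (pts ?Z) (feat_cl X) psi = feat_cl ?Z"
  by (rule iso_gds_inverse[OF X Z(1,2)]) blast
 have cf: "c i : feat_cl X" for i by (rule listed_feat[OF l])
 have "listed N ?Z (%i. compose (pts ?Z) (c i) psi)"
  unfolding listed_def
 proof (intro conjI image_subsetI Z(1))
  show "feat_cl ?Z = (%i. compose (pts ?Z) (c i) psi) ` {..<N}"
   using l psi(2)[symmetric] by (simp add: listed_def pullback_def image_image)
  show "compose (pts ?Z) (c i) psi : feat_cl ?Z" for i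
   using cf[of i] by (subst psi(2)[symmetric]) (auto simp: pullback_def)
 qed
 moreover have "law (meas ?Z) (%i. compose (pts ?Z) (c i) psi) = law (meas X) c"
  by (rule domination_law[OF Z(1) X psi(1) cf])
 ultimately show ?thesis using that by blast
qed

lemma listed_comp_cls:
 assumes B: "B : DD" "listed N (rep B) b" and p: "p : Lip1_real"
 obtains c where "comp_cls p B : DD" "listed N (rep (comp_cls p B)) c"
  "law (meas (rep (comp_cls p B))) c = law (meas (rep B)) (%i. compose (pts (rep B)) p (b i))"
proof -
 let ?X = "rep B"
 have X: "is_gds ?X" by (rule DD_rep(1)[OF B(1)])
 interpret X: gds ?X by rule (rule X)
 let ?X' = "GDS (pts ?X) (Lip1_on (pts ?X) (gdist ?X)) (meas ?X)"
 note X' = lip_gds[OF X]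
 have fin: "finite (feat_cl ?X)" using listed_finite[OF B(2)] by blast
 then have "finite (feat ?X)" using X.feat_subset_cl finite_subset by blast
 then have ff: "feat ?X = b ` {..<N}" using feat_finite[OF X] B(2) by (simp add: listed_def)
 have bf: "b i : feat_cl ?X" for i by (rule listed_feat[OF B(2)])
 let ?f = "%i. compose (pts ?X) p (b i)"
 have pL: "abs (p x - p y) <= abs (x - y)" for x y using p by (auto simp: Lip1_real_def lipschitz_on_def dist_real_def)
 have fL: "?f i : Lip1_on (pts ?X) (gdist ?X)" for i
  using order_trans[OF pL X.feat_clD[OF bf]] by (auto simp: Lip1_on_def compose_def)
 have pc: "postcomp (pts ?X) {p} (feat ?X) = ?f ` {..<N}" unfolding ff by (auto simp: postcomp_def)
 have rf: "range ?f <= ?f ` {..<N}"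
 proof safe
  fix i have "b i : b ` {..<N}" using bf[of i] B(2) by (simp add: listed_def)
  then show "?f i : ?f ` {..<N}" by auto
 qed
 obtain Y where Y: "is_quotient ?X' (postcomp (pts ?X) {p} (feat ?X)) Y"
  by (rule quotient_exists[OF X'(1), of "postcomp (pts ?X) {p} (feat ?X)"])
   (use pc rf fL X'(2) X.feat_nonempty ff in auto)
 define Z where "Z = (SOME Y. is_quotient ?X' (postcomp (pts ?X) {p} (feat ?X)) Y)"
 have Z: "is_quotient ?X' (postcomp (pts ?X) {p} (feat ?X)) Z" unfolding Z_def by (rule someI) (rule Y)
 have ZC: "comp_cls p B = iso_class Z" by (simp add: comp_cls_def quotient_gds_def Z_def Let_def)
 have Zg: "is_gds Z" using Z by (simp add: is_quotient_def)
 obtain phi where phi: "domination ?X' Z phi" "pullback (pts ?X') (feat Z) phi = ?f ` {..<N}"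
  using Z pc unfolding is_quotient_def by auto
 obtain y where y: "listed N Z y" "law (meas Z) y = law (meas ?X') ?f"
  by (rule listed_domination[OF X'(1) Zg phi rf]) (use fL X'(2) in auto)
 obtain c where c: "listed N (rep (iso_class Z)) c" "law (meas (rep (iso_class Z))) c = law (meas Z) y"
  by (rule listed_rep[OF y(1)]) blast
 have "comp_cls p B : DD" using Zg ZC by (auto simp: DD_def)
 then show ?thesis using that c y(2) ZC by simp
qed

context monoidal_family
begin

lemma trunc_Lip: "0 <= R ==> trunc R : Lip1_real" using L_trunc L_Lip by blast

text \<open>Together with \<open>DM_truncI\<close> this describes truncated measurements by laws: up
  to isomorphism they are the finite data sets whose features have the joint law of truncated
  features of a member of \<open>P\<close>.\<close>

lemma DM_truncD:
 assumes P: "P <= DL L" and C: "C : DM_trunc P N R" and R: "0 <= R"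
 obtains A f c where "A : P" "!!i. f i : feat_cl (rep A)" "C : DD" "listed N (rep C) c"
  "law (meas (rep C)) c = law (meas (rep A)) (%i. compose (pts (rep A)) (trunc R) (f i))"
proof -
 obtain A B where AB: "A : P" "B : DM_of A N" "C = comp_cls (trunc R) B" using C by (auto simp: DM_trunc_def)
 have A: "is_gds (rep A)" using DL_D AB P by blast
 have B: "B : DD" "finite (feat (rep B))" "card (feat (rep B)) <= N" "dominated (rep B) (rep A)"
  using AB(2) by (auto simp: DM_of_def DM_def dom_cls_def)
 have Bg: "is_gds (rep B)" by (rule DD_rep(1)[OF B(1)])
 interpret B: gds "rep B" by rule (rule Bg)
 define k where "k = card (feat (rep B))"
 have k: "0 < k" "k <= N" using B B.feat_nonempty by (auto simp: k_def card_gt_0_iff)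
 obtain g where g: "bij_betw g {..<k} (feat (rep B))"
  using ex_bij_betw_nat_finite[OF B(2)] by (auto simp: k_def atLeast0LessThan)
 define b where "b i = g (clamp_index k i)" for i
 have bi: "b i : feat (rep B)" for i using g k by (auto simp: b_def clamp_index_def bij_betw_def)
 have "feat (rep B) <= b ` {..<N}"
 proof
  fix h assume "h : feat (rep B)"
  then obtain i where "i < k" "h = g i" using g by (auto simp: bij_betw_def)
  then show "h : b ` {..<N}" using k by (intro image_eqI[of _ _ i]) (auto simp: b_def clamp_index_def)
 qed
 then have lb: "listed N (rep B) b" using feat_finite[OF Bg B(2)] bi Bg by (auto simp: listed_def)
 obtain c where c: "C : DD" "listed N (rep C) c"
  "law (meas (rep C)) c = law (meas (rep B)) (%i. compose (pts (rep B)) (trunc R) (b i))"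
  unfolding AB(3) by (rule listed_comp_cls[OF B(1) lb trunc_Lip[OF R]]) blast
 obtain phi where phi: "domination (rep A) (rep B) phi" using B(4) by (auto simp: dominated_def)
 have bcl: "b i : feat_cl (rep B)" for i using bi B.feat_subset_cl by blast
 let ?f = "%i. compose (pts (rep A)) (b i) phi"
 have f: "?f i : feat_cl (rep A)" for i by (rule domination_feat_cl[OF A Bg phi bcl])
 interpret A: gds "rep A" by rule (rule A)
 have "law (meas (rep A)) (%i. compose (pts (rep A)) (trunc R) (?f i)) = law (meas (rep A)) (%i x. trunc R (b i (phi x)))"
  by (rule law_cong) (simp add: compose_def)
 also have "... = law (meas (rep B)) (%i x. trunc R (b i x))"
  by (rule law_distr[OF domination_measurable[OF phi] domination_distr[OF phi], of "%i x. trunc R (b i x)"])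
   (rule measurable_compose[OF B.feat_cl_measurable[OF bcl] trunc_measurable])
 also have "... = law (meas (rep B)) (%i. compose (pts (rep B)) (trunc R) (b i))"
  by (rule law_cong) (simp add: compose_def)
 finally have lf: "law (meas (rep A)) (%i. compose (pts (rep A)) (trunc R) (?f i)) = law (meas (rep B)) (%i. compose (pts (rep B)) (trunc R) (b i))" .
 show ?thesis by (rule that[of A "%i. compose (pts (rep A)) (b i) phi" c, OF AB(1) f c(1,2)]) (simp add: lf c(3))
qed

lemma DM_truncI:
 assumes P: "P <= DL L" and A: "A : P" and f: "!!i. f i : feat_cl (rep A)" and R: "0 <= R" and N: "0 < N"
 obtains C c where "C : DM_trunc P N R" "C : DD" "listed N (rep C) c"
  "law (meas (rep C)) c = law (meas (rep A)) (%i. compose (pts (rep A)) (trunc R) (f (clamp_index N i)))"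
proof -
 have Ag: "is_gds (rep A)" using DL_D A P by blast
 interpret A: gds "rep A" by rule (rule Ag)
 let ?f = "%i. f (clamp_index N i)"
 have cl: "clamp_index N i < N" for i using N by (simp add: clamp_index_def)
 have im: "?f ` {..<N} = f ` {..<N}" by (rule image_cong) (auto simp: clamp_index_def)
 have rf: "range ?f <= ?f ` {..<N}" unfolding im using cl by auto
 obtain Y where Y: "is_quotient (rep A) (f ` {..<N}) Y"
  by (rule quotient_exists[OF Ag, of "f ` {..<N}"]) (use f N in auto)
 have Yg: "is_gds Y" using Y by (simp add: is_quotient_def)
 obtain phi where phi: "domination (rep A) Y phi" "pullback (pts (rep A)) (feat Y) phi = ?f ` {..<N}"
  using Y unfolding is_quotient_def im by auto
 obtain y where y: "listed N Y y" "law (meas Y) y = law (meas (rep A)) ?f"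
  by (rule listed_domination[OF Ag Yg phi rf]) (use f in auto)
 define B where "B = iso_class Y"
 have BD: "B : DD" using Yg by (auto simp: B_def DD_def)
 obtain b where b: "listed N (rep B) b" "law (meas (rep B)) b = law (meas Y) y"
  unfolding B_def by (rule listed_rep[OF y(1)]) blast
 interpret B: gds "rep B" by rule (rule DD_rep(1)[OF BD])
 have fin: "finite (feat (rep B))" using listed_finite[OF b(1)] B.feat_subset_cl finite_subset by blast
 moreover have "card (feat (rep B)) <= N" using listed_finite[OF b(1)] feat_finite[OF DD_rep(1)[OF BD] fin] by simp
 moreover have "dominated (rep B) (rep A)"
  unfolding B_def by (rule dominated_iso_class[OF Yg Ag]) (use phi in \<open>auto simp: dominated_def\<close>)
 ultimately have "B : DM_of A N" using BD by (simp add: DM_of_def DM_def dom_cls_def)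
 then have C: "comp_cls (trunc R) B : DM_trunc P N R" using A by (auto simp: DM_trunc_def)
 obtain c where c: "comp_cls (trunc R) B : DD" "listed N (rep (comp_cls (trunc R) B)) c"
  "law (meas (rep (comp_cls (trunc R) B))) c = law (meas (rep B)) (%i. compose (pts (rep B)) (trunc R) (b i))"
  by (rule listed_comp_cls[OF BD b(1) trunc_Lip[OF R]]) blast
 have bcl: "b i : feat_cl (rep B)" for i by (rule listed_feat[OF b(1)])
 have "law (meas (rep B)) (%i. compose (pts (rep B)) (trunc R) (b i)) = law (meas (rep B)) (%i x. trunc R (b i x))"
  by (rule law_cong) (simp add: compose_def)
 also have "... = law (meas (rep A)) (%i x. trunc R (?f i x))"
  using law_reindex[of b "meas (rep B)" ?f "meas (rep A)" "%_. trunc R" "%i. i"]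
   B.feat_cl_measurable[OF bcl] A.feat_cl_measurable[OF f] b(2) y(2) by simp
 also have "... = law (meas (rep A)) (%i. compose (pts (rep A)) (trunc R) (?f i))"
  by (rule law_cong) (simp add: compose_def)
 finally show ?thesis using that[OF C c(1,2)] c(3) by simp
qed

end

section \<open>Estimating the box distance through finitely many features\<close>

lemma closedin_feature_match:
 assumes X: "is_gds X" and Y: "is_gds Y" and K: "closedin (gtop X) K"
  and c: "!!i. c i : feat_cl X" and c': "!!i. c' i : feat_cl Y"
 shows "closedin (prod_topology (gtop X) (gtop Y)) {(x,y). x : K & y : pts Y & (ALL i<(N::nat). abs (c i x - c' i y) <= d)}"
  "{(x,y). x : K & y : pts Y & (ALL i<N. abs (c i x - c' i y) <= d)} : sets (meas X \<Otimes>\<^sub>M meas Y)"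
proof -
 interpret X: gds X by rule fact
 interpret Y: gds Y by rule fact
 have KX: "K <= pts X" using closedin_subset[OF K] by simp
 let ?S = "{(x,y). x : K & y : pts Y & (ALL i<N. abs (c i x - c' i y) <= d)}"
 have "EX U V. openin (gtop X) U & openin (gtop Y) V & x : U & y : V & U \<times> V <= (pts X \<times> pts Y) - ?S"
  if xy: "(x, y) : (pts X \<times> pts Y) - ?S" for x y
 proof (cases "x : K")
  case False
  have "openin (gtop X) (pts X - K)" using K by (simp add: closedin_def)
  then show ?thesis using xy False by (intro exI[of _ "pts X - K"] exI[of _ "pts Y"]) auto
 next
  case True
  then obtain i where i: "i < N" "abs (c i x - c' i y) > d" using xy by (auto simp: not_le)
  define r where "r = (abs (c i x - c' i y) - d) / 2"
  have r: "0 < r" using i by (simp add: r_def)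
  have p: "x : pts X" "y : pts Y" using xy by auto
  have "X.mball x r \<times> Y.mball y r <= (pts X \<times> pts Y) - ?S"
  proof
   fix z assume "z : X.mball x r \<times> Y.mball y r"
   then obtain x' y' where z: "z = (x', y')" "x' : pts X" "y' : pts Y" "gdist X x x' < r" "gdist Y y y' < r" by auto
   have "abs (c i x' - c' i y') > d"
    using X.feat_clD[OF c p(1) z(2), of i] Y.feat_clD[OF c' p(2) z(3), of i] z(4,5) unfolding r_def by argo
   then show "z : (pts X \<times> pts Y) - ?S" using z i(1) by (auto simp: not_le)
  qed
  then show ?thesis using p r by (intro exI[of _ "X.mball x r"] exI[of _ "Y.mball y r"]) auto
 qed
 then show "closedin (prod_topology (gtop X) (gtop Y)) ?S"
  unfolding closedin_def openin_prod_topology_alt using KX by auto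
 have "?S = {z:space (meas X \<Otimes>\<^sub>M meas Y). ALL i:{..<N}. abs (c i (fst z) - c' i (snd z)) <= d} Int (K \<times> pts Y)"
  using KX by (auto simp: space_pair_measure)
 also have "... : sets (meas X \<Otimes>\<^sub>M meas Y)"
 proof (rule sets.Int)
  have "{z:space (meas X \<Otimes>\<^sub>M meas Y). abs (c i (fst z) - c' i (snd z)) <= d} : sets (meas X \<Otimes>\<^sub>M meas Y)" for i
   by (intro borel_measurable_le borel_measurable_abs borel_measurable_diff borel_measurable_const
     measurable_compose[OF measurable_fst X.feat_cl_measurable[OF c]] measurable_compose[OF measurable_snd Y.feat_cl_measurable[OF c']])
  then show "{z:space (meas X \<Otimes>\<^sub>M meas Y). ALL i:{..<N}. abs (c i (fst z) - c' i (snd z)) <= d} : sets (meas X \<Otimes>\<^sub>M meas Y)"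
   by (intro sets.sets_Collect_finite_All) auto
  show "K \<times> pts Y : sets (meas X \<Otimes>\<^sub>M meas Y)"
   using X.closedin_sets[OF K] sets.top[of "meas Y"] by (intro pair_measureI) auto
 qed
 finally show "?S : sets (meas X \<Otimes>\<^sub>M meas Y)" .
qed

lemma params_lift:
 assumes "is_gds X" "gds.dense_seq X a" "!!i. w i : borel_measurable leb" "law leb w = law (meas X) a"
 obtains phi where "phi : params X" "AE t in leb. ALL i. a i (phi t) = w i t"
proof -
 interpret X: gds X by rule fact
 obtain phi where "phi : measurable leb (meas X)" "distr leb (meas X) phi = meas X" "AE t in leb. ALL i. a i (phi t) = w i t"
  by (rule X.lift[OF assms(2) leb.prob_space_axioms assms(3,4)])
 then show ?thesis using that by (simp add: params_def)
qed

text \<open>The set \<open>S\<close> consists of all pairs of points whose first \<open>N\<close>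
  coordinates differ by at most \<open>d\<close>. It matches the features by construction, and
  parametrisations of the two data sets give it the required mass.\<close>

lemma listed_box_le:
 assumes c: "listed N X c" and c': "listed N Y c'" and phi: "phi : params X" "psi : params Y"
  and ne: "EX x:pts X. EX y:pts Y. ALL i<N. abs (c i x - c' i y) <= d" and d: "d <= e / 2"
  and w: "rvs w" "rvs w'" "AE t in leb. ALL i. c i (phi t) = w i t" "AE t in leb. ALL i. c' i (psi t) = w' i t"
  and m: "measure leb {t:{0..1}. EX i<N. abs (w i t - w' i t) > d} <= e"
 shows "box_dist X Y <= ennreal e"
proof -
 have X: "is_gds X" and Y: "is_gds Y" using c c' by (auto simp: listed_def)
 interpret X: gds X by rule (rule X)
 interpret Y: gds Y by rule (rule Y)
 note cf = listed_feat[OF c] and c'f = listed_feat[OF c']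
 let ?S = "{(x,y). x : pts X & y : pts Y & (ALL i<N. abs (c i x - c' i y) <= d)}"
 have Kc: "closedin (gtop X) (pts X)" using closedin_topspace[of "gtop X"] by simp
 note S = closedin_feature_match[OF X Y Kc cf c'f, where N=N and d=d]
 let ?A = "{t:{0..1}. EX i<N. abs (w i t - w' i t) > d}"
 have A: "?A : sets leb"
 proof -
  have "?A = {t:space leb. EX i:{..<N}. abs (w i t - w' i t) > d}" by auto
  also have "... : sets leb" by (rule sets.sets_Collect_finite_Ex[OF near_sets[OF rvsD[OF w(1)] rvsD[OF w(2)]]]) simp
  finally show ?thesis .
 qed
 have pm: "(%t. (phi t, psi t)) : measurable leb (meas X \<Otimes>\<^sub>M meas Y)" by (rule coupling_of_params(2)[OF X Y phi])
 have Bs: "{t:{0..1}. (phi t, psi t) : ?S} : sets leb"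
  using measurable_sets[OF pm S(2)] by (simp add: vimage_def Int_def conj_commute)
 have "leb.prob (space leb - ?A) <= leb.prob {t:{0..1}. (phi t, psi t) : ?S}"
 proof (rule leb.finite_measure_mono_AE[OF _ Bs])
  show "AE t in leb. t : space leb - ?A --> t : {t:{0..1}. (phi t, psi t) : ?S}"
   using w(3,4)
  proof eventually_elim
   case (elim t)
   show ?case
   proof
    assume t: "t : space leb - ?A"
    then have t1: "t : {0..1}" by simp
    have "abs (c i (phi t) - c' i (psi t)) <= d" if "i < N" for i
     using elim that t unfolding not_less[symmetric] by auto
    then show "t : {t:{0..1}. (phi t, psi t) : ?S}"
     using t1 params_space[OF X phi(1) t1] params_space[OF Y phi(2) t1] by simp
   qed
  qed
 qed
 then have mS: "1 - leb.prob {t:{0..1}. (phi t, psi t) : ?S} <= e" using leb.prob_compl[OF A] m by simp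
 show ?thesis
 proof (rule box_dist_leI[OF X Y phi S _ mS order_refl d])
  show "?S ~= {}" using ne by blast
  fix f assume "f : feat X"
  then have "f : c ` {..<N}" using X.feat_subset_cl c by (auto simp: listed_def)
  then obtain i where "i < N" "f = c i" by auto
  then show "EX g:feat_cl Y. ALL (x,y):?S. abs (f x - g y) <= d" using c'f by (intro bexI[of _ "c' i"]) auto
 next
  fix g assume "g : feat Y"
  then have "g : c' ` {..<N}" using Y.feat_subset_cl c' by (auto simp: listed_def)
  then obtain i where "i < N" "g = c' i" by auto
  then show "EX f:feat_cl X. ALL (x,y):?S. abs (f x - g y) <= d" using cf by (intro bexI[of _ "c i"]) auto
 qed
qed

section \<open>Measurements and approximation of families\<close>

definition family_rvs :: "gds_class set => (nat => real => real) set" where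
 "family_rvs P = (UN A:P. feature_rvs (rep A))"

definition approx :: "nat => real => gds_class set => gds_class set => bool" where
 "approx N e P Q \<longleftrightarrow> (ALL u:family_rvs P. EX v:family_rvs Q. apx N e u v)"

lemma family_rvs_rvs: "u : family_rvs P ==> rvs u"
 by (auto simp: family_rvs_def feature_rvs_rvs)

lemma approx_mono: "approx N e P Q ==> N' <= N ==> e <= e' ==> approx N' e' P Q"
 unfolding approx_def using apx_mono family_rvs_rvs by blast

lemma approx_trans: "approx N e P Q ==> approx N e' Q R ==> approx N (e + e') P R"
 unfolding approx_def using apx_trans family_rvs_rvs by metis

lemma AE_unit_exists: "AE t in leb. Q t ==> EX t:{0..1}. Q t"
proof (rule ccontr)
 assume Q: "AE t in leb. Q t" and "~ (EX t:{0..1}. Q t)"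
 from Q AE_space[of leb] have "AE t in leb. False" by eventually_elim (use `~ _` in auto)
 then show False by simp
qed

context monoidal_family
begin

lemma DM_trunc_rvsD:
 assumes P: "P <= DL L" and C: "C : DM_trunc P N R" and R: "0 <= R"
 obtains u c phi where "u : family_rvs P" "listed N (rep C) c" "phi : params (rep C)"
  "AE t in leb. ALL i. c i (phi t) = trunc R (u i t)"
proof -
 obtain A f c where A: "A : P" "!!i. f i : feat_cl (rep A)" and CD: "C : DD" "listed N (rep C) c"
  and lc: "law (meas (rep C)) c = law (meas (rep A)) (%i. compose (pts (rep A)) (trunc R) (f i))"
  by (rule DM_truncD[OF P C R]) blast
 have Ag: "is_gds (rep A)" using DL_D A(1) P by blast
 obtain u where u: "u : feature_rvs (rep A)" "law leb u = law (meas (rep A)) f"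
  by (rule feature_rvs_exist[of "rep A" f, OF Ag A(2)]) blast
 have ur: "rvs u" by (rule feature_rvs_rvs[OF u(1)])
 have wr: "rvs (%i t. trunc R (u i t))" using rvs_compose[OF ur, of "%_. trunc R" "%i. i"] trunc_measurable by simp
 have lw: "law leb (%i t. trunc R (u i t)) = law (meas (rep C)) c"
  using law_compose_reindex[of "rep A" f u "%_. trunc R" "%i. i", OF Ag A(2) ur u(2)] lc trunc_measurable by simp
 obtain phi where phi: "phi : params (rep C)" "AE t in leb. ALL i. c i (phi t) = trunc R (u i t)"
  by (rule params_lift[OF DD_rep(1)[OF CD(1)] listed_dense_seq[OF CD(2)] rvsD[OF wr] lw]) blast
 have "u : family_rvs P" using u(1) A(1) by (auto simp: family_rvs_def)
 then show ?thesis using that CD(2) phi by blast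
qed

lemma DM_trunc_rvsI:
 assumes P: "P <= DL L" and u: "u : family_rvs P" and R: "0 <= R" and N: "0 < N"
 obtains C c phi where "C : DM_trunc P N R" "listed N (rep C) c" "phi : params (rep C)"
  "AE t in leb. ALL i. c i (phi t) = trunc R (u (clamp_index N i) t)"
  "(%i t. trunc R (u (clamp_index N i) t)) : feature_rvs (rep C)"
proof -
 obtain A where A: "A : P" "u : feature_rvs (rep A)" using u by (auto simp: family_rvs_def)
 have Ag: "is_gds (rep A)" using DL_D A(1) P by blast
 obtain f where f: "!!i. f i : feat_cl (rep A)" "law leb u = law (meas (rep A)) f" and ur: "rvs u"
  by (rule feature_rvsE[OF A(2)]) blast
 obtain C c where C: "C : DM_trunc P N R" "C : DD" "listed N (rep C) c"
  "law (meas (rep C)) c = law (meas (rep A)) (%i. compose (pts (rep A)) (trunc R) (f (clamp_index N i)))"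
  by (rule DM_truncI[of P A f R N, OF P A(1) f(1) R N]) blast
 have wr: "rvs (%i t. trunc R (u (clamp_index N i) t))" using rvs_compose[OF ur, of "%_. trunc R" "clamp_index N"] trunc_measurable by simp
 have lw: "law leb (%i t. trunc R (u (clamp_index N i) t)) = law (meas (rep C)) c"
  using law_compose_reindex[of "rep A" f u "%_. trunc R" "clamp_index N", OF Ag f(1) ur f(2)] C(4) trunc_measurable by simp
 obtain phi where phi: "phi : params (rep C)" "AE t in leb. ALL i. c i (phi t) = trunc R (u (clamp_index N i) t)"
  by (rule params_lift[OF DD_rep(1)[OF C(2)] listed_dense_seq[OF C(3)] rvsD[OF wr] lw]) blast
 show ?thesis using that C(1,3) phi feature_rvsI[OF wr listed_feat[OF C(3)] lw] by blast
qed

text \<open>Truncation belongs to \<open>L\<close>, so the truncated features are again features of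
  the member of \<open>P\<close> from which the measurement was taken.\<close>

lemma DM_trunc_feature_rvs:
 assumes P: "P <= DL L" and C: "C : DM_trunc P N R" and R: "0 <= R"
 shows "feature_rvs (rep C) <= family_rvs P"
proof
 fix w assume "w : feature_rvs (rep C)"
 then obtain h where h: "!!i. h i : feat_cl (rep C)" "law leb w = law (meas (rep C)) h" "rvs w"
  by (rule feature_rvsE) blast
 obtain A f c where A: "A : P" "!!i. f i : feat_cl (rep A)" and CD: "C : DD" "listed N (rep C) c"
  and lc: "law (meas (rep C)) c = law (meas (rep A)) (%i. compose (pts (rep A)) (trunc R) (f i))"
  by (rule DM_truncD[OF P C R]) blast
 have A': "is_gds (rep A)" "closed_gds (rep A)" using DL_D A(1) P by blast+
 interpret A: gds "rep A" by rule (rule A')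
 interpret C: gds "rep C" by rule (rule DD_rep(1)[OF CD(1)])
 have "EX j. h i = c j" for i using h(1)[of i] CD(2) by (auto simp: listed_def)
 then obtain j where "ALL i. h i = c (j i)" by metis
 then have j: "h = (%i. c (j i))" by blast
 have tf: "compose (pts (rep A)) (trunc R) (f i) : feat_cl (rep A)" for i
  by (rule closed_gdsD[OF A'(2) L_trunc[OF R] A(2)])
 have "law (meas (rep C)) h = law (meas (rep A)) (%i. compose (pts (rep A)) (trunc R) (f (j i)))"
  using law_reindex[of c "meas (rep C)" "%i. compose (pts (rep A)) (trunc R) (f i)" "meas (rep A)" "%_ x. x" j]
   C.feat_cl_measurable[OF listed_feat[OF CD(2)]] A.feat_cl_measurable[OF tf] lc by (simp add: j)
 then have "w : feature_rvs (rep A)" using feature_rvsI[OF h(3), of "%i. compose (pts (rep A)) (trunc R) (f (j i))" "rep A"] tf h(2) by simp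
 then show "w : family_rvs P" using A(1) by (auto simp: family_rvs_def)
qed

lemma const_rvs:
 assumes P: "P <= DL L" and A: "A : P" 
 shows "(%i t. k i) : family_rvs P"
proof -
 have A': "is_gds (rep A)" "closed_gds (rep A)" using DL_D A P by blast+
 interpret A: gds "rep A" by rule (rule A')
 obtain h where h: "h : feat_cl (rep A)" using A.feat_nonempty A.feat_subset_cl by blast
 obtain u where u: "u : feature_rvs (rep A)" by (rule feature_rvs_exist[of "rep A" "%_. h", OF A'(1) h]) blast
 have "(%i t. (%_. k i) (u i t)) : feature_rvs (rep A)"
  by (rule feature_rvs_compose[OF A' u, of "%i _. k i" "%i. i"]) (rule L_const)
 then show ?thesis using A by (auto simp: family_rvs_def)
qed

text \<open>At distance 1 the mass condition is void and only a nonempty matching set has to be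
  found. Constants belong to \<open>L\<close>, so \<open>Q\<close> contains the constant sequence
  with the values of \<open>u\<close> at one point \<open>t0\<close>.\<close>

lemma DM_trunc_box_one:
 assumes P: "P <= DL L" and Q: "Q <= DL L" "Q ~= {}" and C: "C : DM_trunc P N R" and N: "0 < N" and R: "0 <= R"
 shows "EX C':DM_trunc Q N R. box_cls C C' <= ennreal 1"
proof -
 obtain u c phi where u: "u : family_rvs P" and c: "listed N (rep C) c" and phi: "phi : params (rep C)"
  "AE t in leb. ALL i. c i (phi t) = trunc R (u i t)" by (rule DM_trunc_rvsD[OF P C R]) blast
 obtain t0 where t0: "t0 : {0..1}" "!!i. c i (phi t0) = trunc R (u i t0)" using AE_unit_exists[OF phi(2)] by blast
 obtain B where B: "B : Q" using Q(2) by blast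
 have v: "(%i t. u i t0) : family_rvs Q" by (rule const_rvs[OF Q(1) B])
 obtain C' c' psi where C': "C' : DM_trunc Q N R" "listed N (rep C') c'" "psi : params (rep C')"
  "AE t in leb. ALL i. c' i (psi t) = trunc R (u (clamp_index N i) t0)"
  by (rule DM_trunc_rvsI[OF Q(1) v R N]) blast
 obtain t1 where t1: "t1 : {0..1}" "!!i. c' i (psi t1) = trunc R (u (clamp_index N i) t0)" using AE_unit_exists[OF C'(4)] by blast
 have g: "is_gds (rep C)" "is_gds (rep C')" using c C'(2) by (auto simp: listed_def)
 have "box_dist (rep C) (rep C') <= ennreal 1"
 proof (rule listed_box_le[OF c C'(2) phi(1) C'(3), where d=0])
  show "EX x:pts (rep C). EX y:pts (rep C'). ALL i<N. abs (c i x - c' i y) <= 0"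
   using params_space[OF g(1) phi(1) t0(1)] params_space[OF g(2) C'(3) t1(1)] t0(2) t1(2)
   by (intro bexI[of _ "phi t0"] bexI[of _ "psi t1"]) (auto simp: clamp_index_def)
  show "rvs (%i t. trunc R (u i t))"
   using rvs_compose[OF family_rvs_rvs[OF u], of "%_. trunc R" "%i. i"] trunc_measurable by simp
  show "rvs (%i t. trunc R (u (clamp_index N i) t0))" by (simp add: rvs_def)
  show "AE t in leb. ALL i. c i (phi t) = trunc R (u i t)" by (rule phi(2))
  show "AE t in leb. ALL i. c' i (psi t) = trunc R (u (clamp_index N i) t0)" by (rule C'(4))
 qed auto
 then show ?thesis using C'(1) by (auto simp: box_cls_def)
qed

text \<open>The bound \<open>e < 1\<close> guarantees a parameter \<open>t\<close> outside the
  exceptional set, hence a nonempty matching set.\<close>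

lemma DM_trunc_box_approx:
 assumes P: "P <= DL L" and Q: "Q <= DL L" and ap: "approx N e P Q" and C: "C : DM_trunc P N (real N)" and N: "0 < N" and e: "0 < e" "e < 1"
 shows "EX C':DM_trunc Q N (real N). box_cls C C' <= ennreal e"
proof -
 have R: "0 <= real N" by simp
 obtain u c phi where u: "u : family_rvs P" and c: "listed N (rep C) c" and phi: "phi : params (rep C)"
  "AE t in leb. ALL i. c i (phi t) = trunc N (u i t)" by (rule DM_trunc_rvsD[OF P C R]) blast
 obtain v where v: "v : family_rvs Q" "apx N e u v" using ap u by (auto simp: approx_def)
 obtain C' c' psi where C': "C' : DM_trunc Q N N" "listed N (rep C') c'" "psi : params (rep C')"
  "AE t in leb. ALL i. c' i (psi t) = trunc N (v (clamp_index N i) t)"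
  by (rule DM_trunc_rvsI[OF Q v(1) R N]) blast
 have g: "is_gds (rep C)" "is_gds (rep C')" using c C'(2) by (auto simp: listed_def)
 have m: "measure leb (apx_set N e u v) <= e" using v(2) by (simp add: apx_def)
 have As: "apx_set N e u v : sets leb" by (rule apx_set_sets[OF family_rvs_rvs[OF u] family_rvs_rvs[OF v(1)]])
 have "EX t:{0..1}. t ~: apx_set N e u v & (ALL i. c i (phi t) = trunc N (u i t)) & (ALL i. c' i (psi t) = trunc N (v (clamp_index N i) t))"
 proof (rule ccontr)
  assume no: "~ ?thesis"
  have "AE t in leb. t : apx_set N e u v"
   using phi(2) C'(4) AE_space[of leb] by eventually_elim (use no in auto)
  then have "leb.prob (apx_set N e u v) = 1" using leb.prob_eq_1[OF As] by simp
  then show False using m e by simp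
 qed
 then obtain t where t: "t : {0..1}" "t ~: apx_set N e u v" "!!i. c i (phi t) = trunc N (u i t)"
  "!!i. c' i (psi t) = trunc N (v (clamp_index N i) t)" by blast
 have "box_dist (rep C) (rep C') <= ennreal e"
 proof (rule listed_box_le[OF c C'(2) phi(1) C'(3), where d="e/2"])
  have "abs (c i (phi t) - c' i (psi t)) <= e / 2" if "i < N" for i
   using apx_set_notin[OF t(1,2) that] t(3,4) that by (simp add: clamp_index_def)
  then show "EX x:pts (rep C). EX y:pts (rep C'). ALL i<N. abs (c i x - c' i y) <= e / 2"
   using params_space[OF g(1) phi(1) t(1)] params_space[OF g(2) C'(3) t(1)] by blast
  show "rvs (%i t. trunc N (u i t))"
   using rvs_compose[OF family_rvs_rvs[OF u], of "%_. trunc N" "%i. i"] trunc_measurable by simp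
  show "rvs (%i t. trunc N (v (clamp_index N i) t))"
   using rvs_compose[OF family_rvs_rvs[OF v(1)], of "%_. trunc N" "clamp_index N"] trunc_measurable by simp
  show "AE t in leb. ALL i. c i (phi t) = trunc N (u i t)" by (rule phi(2))
  show "AE t in leb. ALL i. c' i (psi t) = trunc N (v (clamp_index N i) t)" by (rule C'(4))
  have "{t:{0..1}. EX i<N. abs (trunc N (u i t) - trunc N (v (clamp_index N i) t)) > e / 2} = apx_set N e u v"
   by (auto simp: apx_set_def clamp_index_def)
  then show "leb.prob {t:{0..1}. EX i<N. e / 2 < abs (trunc N (u i t) - trunc N (v (clamp_index N i) t))} <= e" using m by simp
 qed simp
 then show ?thesis using C'(1) by (auto simp: box_cls_def)
qed

lemma box_cls_sym: "box_cls A B = box_cls B A"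
 unfolding box_cls_def by (rule box_dist_sym)

lemma hausdorff_le_if_approx:
 assumes P: "P <= DL L" and Q: "Q <= DL L" and ap: "approx N e P Q" "approx N e Q P" and N: "0 < N" and e: "0 < e" "e < 1"
 shows "hausdorff_dist box_cls (DM_trunc P N (real N)) (DM_trunc Q N (real N)) <= ennreal e"
proof (rule hausdorff_dist_le)
 fix C assume "C : DM_trunc P N (real N)"
 then show "EX C':DM_trunc Q N (real N). box_cls C C' <= ennreal e" by (rule DM_trunc_box_approx[OF P Q ap(1) _ N e])
next
 fix C assume "C : DM_trunc Q N (real N)"
 then show "EX C':DM_trunc P N (real N). box_cls C' C <= ennreal e"
  unfolding box_cls_sym[of _ C] by (rule DM_trunc_box_approx[OF Q P ap(2) _ N e])
qed

lemma hausdorff_le_one: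
 assumes P: "P <= DL L" "P ~= {}" and Q: "Q <= DL L" "Q ~= {}" and N: "0 < N" and R: "0 <= R"
 shows "hausdorff_dist box_cls (DM_trunc P N R) (DM_trunc Q N R) <= ennreal 1"
proof (rule hausdorff_dist_le)
 fix C assume "C : DM_trunc P N R"
 then show "EX C':DM_trunc Q N R. box_cls C C' <= ennreal 1" by (rule DM_trunc_box_one[OF P(1) Q _ N R])
next
 fix C assume "C : DM_trunc Q N R"
 then show "EX C':DM_trunc P N R. box_cls C' C <= ennreal 1"
  unfolding box_cls_sym[of _ C] by (rule DM_trunc_box_one[OF Q(1) P _ N R])
qed

text \<open>The measurement represents \<open>u\<close> truncated at \<open>N\<close> with its
  indices clamped to the first \<open>N\<close>, and \<open>apx N\<close> depends on nothing else of
  \<open>u\<close>.\<close>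

lemma approx_if_hausdorff:
 assumes P: "P <= DL L" and Q: "Q <= DL L" and N: "0 < N"
  and less: "hausdorff_dist box_cls (DM_trunc P N (real N)) (DM_trunc Q N (real N)) < ennreal e"
 shows "approx N e P Q"
 unfolding approx_def
proof
 fix u assume u: "u : family_rvs P"
 have R: "0 <= real N" by simp
 obtain C c phi where C: "C : DM_trunc P N N" "listed N (rep C) c" "phi : params (rep C)"
  "AE t in leb. ALL i. c i (phi t) = trunc N (u (clamp_index N i) t)"
  and uC: "(%i t. trunc N (u (clamp_index N i) t)) : feature_rvs (rep C)"
  by (rule DM_trunc_rvsI[OF P u R N]) blast
 obtain C' where C': "C' : DM_trunc Q N N" "box_cls C C' < ennreal e" using hausdorff_dist_lessD(1)[OF less C(1)] by blast
 obtain v c' psi where c': "listed N (rep C') c'" by (rule DM_trunc_rvsD[OF Q C'(1) R]) blast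
 have g: "is_gds (rep C)" "is_gds (rep C')" using C(2) c'(1) by (auto simp: listed_def)
 obtain w where w: "w : feature_rvs (rep C')" "apx N e (%i t. trunc N (u (clamp_index N i) t)) w"
  by (rule box_dist_apx[OF g C'(2)[unfolded box_cls_def] uC]) blast
 have "w : family_rvs Q" using DM_trunc_feature_rvs[OF Q C'(1) R] w(1) by blast
 moreover have "apx N e u w"
  by (rule apx_cong[OF _ feature_rvs_rvs[OF uC] feature_rvs_rvs[OF w(1)] w(2)]) (simp add: clamp_index_def trunc_trunc)
 ultimately show "EX v:family_rvs Q. apx N e u v" by blast
qed

end


section \<open>The metric on pyramids\<close>

lemma hausdorff_cls_sym: "hausdorff_dist box_cls A B = hausdorff_dist box_cls B A"
 by (rule hausdorff_dist_sym, unfold box_cls_def, rule box_dist_sym)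

text \<open>The factor of the series for \<open>rho\<close> belonging to \<open>N = Suc n\<close>.
  For pyramids the Hausdorff distance is at most 1, so no value is lost in passing to the
  reals.\<close>

definition DM_dist :: "nat => gds_class set => gds_class set => real" where
 "DM_dist n P Q = enn2real (hausdorff_dist box_cls (DM_trunc P (Suc n) (real (Suc n))) (DM_trunc Q (Suc n) (real (Suc n))))"

definition rho_weight :: "nat => real" where "rho_weight n = 1 / (2 * real (Suc n) * 2 ^ Suc n)"

lemma rho_weight_pos: "0 < rho_weight n" and rho_weight_le: "rho_weight n <= (1 / 2) ^ Suc n"
proof -
 show "0 < rho_weight n" by (simp add: rho_weight_def)
 have "1 * 2 ^ Suc n <= 2 * real (Suc n) * 2 ^ Suc n" by (rule mult_right_mono) auto
 then show "rho_weight n <= (1 / 2) ^ Suc n" unfolding rho_weight_def power_divide power_one by (intro divide_left_mono) auto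
qed

lemma DM_dist_sym: "DM_dist n P Q = DM_dist n Q P"
 unfolding DM_dist_def by (subst hausdorff_cls_sym) (rule refl)

context monoidal_family
begin

lemma pyramidD:
 assumes "P : pyramids L"
 shows "P <= DL L" "P ~= {}" "!!A B. A : DL L ==> B : P ==> A \<preceq> B ==> A : P"
  "!!A B. A : P ==> B : P ==> EX C:P. A \<preceq> C & B \<preceq> C" "box_closed P"
 using assms by (auto simp: pyramids_def is_pyramid_def)

lemma DM_dist_bounds: "0 <= DM_dist n P Q" "P : pyramids L ==> Q : pyramids L ==> DM_dist n P Q <= 1"
 and hausdorff_DM_dist: "P : pyramids L ==> Q : pyramids L ==>
  hausdorff_dist box_cls (DM_trunc P (Suc n) (real (Suc n))) (DM_trunc Q (Suc n) (real (Suc n))) = ennreal (DM_dist n P Q)"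
proof -
 show "0 <= DM_dist n P Q" by (simp add: DM_dist_def)
 assume P: "P : pyramids L" and Q: "Q : pyramids L"
 let ?h = "hausdorff_dist box_cls (DM_trunc P (Suc n) (real (Suc n))) (DM_trunc Q (Suc n) (real (Suc n)))"
 have h: "?h <= ennreal 1" by (rule hausdorff_le_one[OF pyramidD(1,2)[OF P] pyramidD(1,2)[OF Q]]) auto
 then have "?h < top" using ennreal_less_top order.strict_trans1 by blast
 then show "?h = ennreal (DM_dist n P Q)" by (simp add: DM_dist_def)
 then have "ennreal (DM_dist n P Q) <= ennreal 1" using h by metis
 then show "DM_dist n P Q <= 1" by (simp del: ennreal_1)
qed

lemma DM_dist_le_if_approx:
 assumes "P : pyramids L" "Q : pyramids L" "approx (Suc n) e P Q" "approx (Suc n) e Q P" "0 < e"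
 shows "DM_dist n P Q <= e"
proof (cases "e < 1")
 case True
 have "ennreal (DM_dist n P Q) <= ennreal e"
  using hausdorff_le_if_approx[OF pyramidD(1)[OF assms(1)] pyramidD(1)[OF assms(2)] assms(3,4) _ assms(5) True]
  unfolding hausdorff_DM_dist[OF assms(1,2)] by simp
 then show ?thesis using assms(5) by simp
next
 case False
 then show ?thesis using DM_dist_bounds(2)[OF assms(1,2), of n] by simp
qed

lemma approx_if_DM_dist:
 assumes "P : pyramids L" "Q : pyramids L" "DM_dist n P Q < e"
 shows "approx (Suc n) e P Q"
 by (rule approx_if_hausdorff[OF pyramidD(1)[OF assms(1)] pyramidD(1)[OF assms(2)]])
  (use assms hausdorff_DM_dist DM_dist_bounds(1)[of n P Q] in \<open>simp_all add: ennreal_less_iff\<close>)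

lemma DM_dist_triangle:
 assumes "P : pyramids L" "Q : pyramids L" "R : pyramids L"
 shows "DM_dist n P R <= DM_dist n P Q + DM_dist n Q R"
proof (rule field_le_epsilon)
 fix e :: real assume e: "0 < e"
 define a b where "a = DM_dist n P Q + e / 2" and "b = DM_dist n Q R + e / 2"
 have ab: "DM_dist n P Q < a" "DM_dist n Q R < b" "DM_dist n R Q < b" "DM_dist n Q P < a" "0 < a" "0 < b"
  using e DM_dist_bounds(1)[of n P Q] DM_dist_bounds(1)[of n Q R] DM_dist_sym[of n P Q] DM_dist_sym[of n Q R] by (auto simp: a_def b_def)
 have "DM_dist n P R <= a + b"
 proof (rule DM_dist_le_if_approx[OF assms(1,3)])
  show "approx (Suc n) (a + b) P R" by (rule approx_trans[OF approx_if_DM_dist approx_if_DM_dist]) (use assms ab in auto)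
  have "approx (Suc n) (b + a) R P" by (rule approx_trans[OF approx_if_DM_dist approx_if_DM_dist]) (use assms ab in auto)
  then show "approx (Suc n) (a + b) R P" by (simp add: add.commute)
 qed (use ab in simp)
 then show "DM_dist n P R <= DM_dist n P Q + DM_dist n Q R + e" by (simp add: a_def b_def)
qed

lemma rho_sums:
 assumes "P : pyramids L" "Q : pyramids L"
 shows "summable (%n. rho_weight n * DM_dist n P Q)" "rho P Q = (\<Sum>n. rho_weight n * DM_dist n P Q)"
proof -
 have nn: "0 <= rho_weight n * DM_dist n P Q" for n using rho_weight_pos[of n] DM_dist_bounds(1)[of n P Q] by simp
 show s: "summable (%n. rho_weight n * DM_dist n P Q)"
 proof (rule summable_comparison_test')
  show "summable (%n. (1 / 2) ^ Suc n :: real)" using power_half_series by (rule sums_summable)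
  fix n show "norm (rho_weight n * DM_dist n P Q) <= (1 / 2) ^ Suc n"
   using nn[of n] mult_mono[OF rho_weight_le DM_dist_bounds(2)[OF assms], of n n] DM_dist_bounds(1)[of n P Q] by simp
 qed
 have "rho P Q = enn2real (\<Sum>n. ennreal (rho_weight n * DM_dist n P Q))"
  unfolding rho_def Let_def hausdorff_DM_dist[OF assms] ennreal_mult[OF less_imp_le[OF rho_weight_pos] DM_dist_bounds(1)]
  by (simp only: rho_weight_def)
 also have "... = (\<Sum>n. rho_weight n * DM_dist n P Q)"
  unfolding suminf_ennreal2[OF nn s] by (rule enn2real_ennreal[OF suminf_nonneg[OF s nn]])
 finally show "rho P Q = (\<Sum>n. rho_weight n * DM_dist n P Q)" .
qed

lemma rho_nonneg: "0 <= rho P Q" by (simp add: rho_def)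

lemma rho_sym: "rho P Q = rho Q P"
 unfolding rho_def Let_def by (subst hausdorff_cls_sym) (rule refl)

lemma rho_triangle:
 assumes "P : pyramids L" "Q : pyramids L" "R : pyramids L"
 shows "rho P R <= rho P Q + rho Q R"
proof -
 have "rho P R <= (\<Sum>n. rho_weight n * DM_dist n P Q + rho_weight n * DM_dist n Q R)"
  unfolding rho_sums(2)[OF assms(1,3)]
 proof (rule suminf_le[OF _ rho_sums(1)[OF assms(1,3)] summable_add[OF rho_sums(1)[OF assms(1,2)] rho_sums(1)[OF assms(2,3)]]])
  show "rho_weight n * DM_dist n P R <= rho_weight n * DM_dist n P Q + rho_weight n * DM_dist n Q R" for n
   using mult_left_mono[OF DM_dist_triangle[OF assms] less_imp_le[OF rho_weight_pos]] by (simp add: distrib_left)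
 qed
 then show ?thesis using suminf_add[OF rho_sums(1)[OF assms(1,2)] rho_sums(1)[OF assms(2,3)]] rho_sums(2) assms by simp
qed

text \<open>A single term bounds the series from below; the term with index \<open>N\<close>
  concerns level \<open>Suc N\<close>, which is more than level \<open>N\<close>.\<close>

lemma approx_if_rho:
 assumes P: "P : pyramids L" and Q: "Q : pyramids L" and less: "rho P Q < rho_weight N * e"
 shows "approx N e P Q" "approx N e Q P"
proof -
 have "rho_weight N * DM_dist N P Q <= rho P Q" unfolding rho_sums(2)[OF P Q]
  using sum_le_suminf[OF rho_sums(1)[OF P Q], of "{N}"] rho_weight_pos DM_dist_bounds(1) by (simp add: less_imp_le)
 then have "DM_dist N P Q < e" using less rho_weight_pos[of N] by (metis mult_less_cancel_left_pos order.strict_trans1)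
 then show "approx N e P Q" "approx N e Q P"
  using approx_if_DM_dist P Q DM_dist_sym[of N P Q] approx_mono[of "Suc N" e _ _ N e] by simp_all
qed

text \<open>The first \<open>K\<close> terms are bounded by \<open>e\<close> times weights of total
  at most 1; in the remaining ones \<open>DM_dist\<close> is at most 1 and the weights are dominated
  by a geometric series with sum \<open>(1 / 2) ^ K\<close>.\<close>

lemma rho_le_if_approx:
 assumes PQ: "P : pyramids L" "Q : pyramids L" and ap: "approx K e P Q" "approx K e Q P" and e: "0 < e"
 shows "rho P Q <= e + (1 / 2) ^ K"
proof -
 let ?f = "%n. (1 / 2) ^ Suc n :: real" and ?a = "%n. rho_weight n * DM_dist n P Q"
 have f: "summable ?f" "suminf ?f = 1" using power_half_series sums_unique sums_summable by force+
 have le: "?a n <= ?f n" for n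
  using mult_mono[OF rho_weight_le DM_dist_bounds(2)[OF PQ], of n n] DM_dist_bounds(1)[of n P Q] by simp
 have sh: "(%i. ?f (i + K)) sums ((1 / 2) ^ K)"
  using sums_mult[OF power_half_series, of "(1 / 2) ^ K"] by (simp add: power_add mult_ac)
 have "(\<Sum>i. ?a (i + K)) <= (\<Sum>i. ?f (i + K))"
  by (rule suminf_le[OF le summable_ignore_initial_segment[OF rho_sums(1)[OF PQ]] sums_summable[OF sh]])
 moreover have "(\<Sum>i<K. ?a i) <= (\<Sum>i<K. ?f i * e)"
 proof (rule sum_mono)
  fix i assume i: "i : {..<K}"
  have "DM_dist i P Q <= e"
   by (rule DM_dist_le_if_approx[OF PQ]) (use ap approx_mono[of K e _ _ "Suc i" e] i e in auto)
  then show "?a i <= ?f i * e" by (intro mult_mono rho_weight_le) (use DM_dist_bounds(1)[of i P Q] in auto)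
 qed
 moreover have "(\<Sum>i<K. ?f i) <= suminf ?f" by (rule sum_le_suminf[OF f(1)]) auto
 then have "(\<Sum>i<K. ?f i) * e <= 1 * e" unfolding f(2) using e by (intro mult_right_mono) auto
 then have "(\<Sum>i<K. ?f i * e) <= e" unfolding sum_distrib_right by simp
 ultimately show ?thesis
  using suminf_split_initial_segment[OF rho_sums(1)[OF PQ], of K] rho_sums(2)[OF PQ] sums_unique[OF sh] by simp
qed

end

section \<open>Approximable data sets belong to the pyramid\<close>

text \<open>Replaces a random sequence known only through its law by actual features along a
  parametrisation, at the price of an alignment error.\<close>

lemma feature_rvs_params:
 assumes Y: "is_gds Y" and v: "v : feature_rvs Y" and e: "0 < e"
 obtains g psi where "psi : params Y" "!!i. g i : feat_cl Y" "apx N e v (%i t. g i (psi t))"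
proof -
 interpret Y: gds Y by rule fact
 obtain g where g: "!!i. g i : feat_cl Y" "law leb v = law (meas Y) g" and vr: "rvs v" by (rule feature_rvsE[OF v]) blast
 obtain psi where psi: "psi : params Y" by (rule Y.params_nonempty)
 note G = params_rvs[of Y psi g, OF Y psi g(1)]
 have l: "law leb v = law leb (%i t. g i (psi t))" using g(2) G(2) by simp
 obtain \<tau> where \<tau>: "unit_mp \<tau>" "apx N e v (%i t. g i (psi (\<tau> t)))" by (rule law_align[OF vr G(1) l e, of N]) blast
 show ?thesis by (rule that[of "%t. psi (\<tau> t)" g, OF params_mp[OF Y psi \<tau>(1)] g(1) \<tau>(2)])
qed

lemma params_domination:
 assumes X: "is_gds X" and f: "domination X Y f" and phi: "phi : params X"
 shows "(%t. f (phi t)) : params Y"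
proof -
 note m = paramsD(1,2)[OF X phi] domination_measurable[OF f]
 have "distr leb (meas Y) (%t. f (phi t)) = distr (distr leb (meas X) phi) (meas Y) f"
  using distr_distr[OF m(3,1)] by (simp add: comp_def)
 then show ?thesis using measurable_compose[OF m(1,3)] m(2) domination_distr[OF f] by (simp add: params_def)
qed

lemma finite_net_at_points:
 fixes H :: "('a => real) set"
 assumes K: "finite K" and e: "0 < e" and R: "ALL h:H. ALL x:K. abs (h x) <= R"
 obtains H' where "finite H'" "H' <= H" "!!h. h : H ==> EX h':H'. ALL x:K. abs (h x - h' x) <= e"
proof -
 define q where "q h = (\<lambda>x\<in>K. (floor (h x / e)))" for h :: "'a => real"
 have "q ` H <= PiE K (%_. {(floor (- R / e))..(floor (R / e))})"
 proof (rule image_subsetI)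
  fix h assume h: "h : H"
  have "(floor (- R / e)) <= (floor (h x / e)) & (floor (h x / e)) <= (floor (R / e))" if "x : K" for x
   using bspec[OF bspec[OF R h] that] e by (intro conjI floor_mono divide_right_mono) auto
  then show "q h : PiE K (%_. {(floor (- R / e))..(floor (R / e))})" by (auto simp: q_def)
 qed
 then have fin: "finite (q ` H)" by (rule finite_subset) (simp add: finite_PiE K)
 have "ALL y:q ` H. EX h:H. q h = y" by auto
 then obtain s where s: "!!y. y : q ` H ==> s y : H & q (s y) = y" by metis
 show ?thesis
 proof (rule that[of "s ` q ` H"])
  fix h assume h: "h : H"
  have "abs (h x - s (q h) x) <= e" if x: "x : K" for x
  proof -
   have "q (s (q h)) x = q h x" using s h by simp
   then have "(floor (h x / e)) = (floor (s (q h) x / e))" using x by (simp add: q_def)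
   then have "abs (h x / e - s (q h) x / e) <= 1" by linarith
   then show ?thesis using e by (simp add: diff_divide_distrib[symmetric] divide_simps)
  qed
  then show "EX h':s ` q ` H. ALL x:K. abs (h x - h' x) <= e" using h by blast
 qed (use fin s in auto)
qed

lemma finite_family_seq:
 assumes "finite H" "H ~= {}"
 obtains h n where "0 < (n::nat)" "H = h ` {..<n}" "range h <= H"
proof -
 obtain g where g: "bij_betw g {..<card H} H" using ex_bij_betw_nat_finite[OF assms(1)] by (auto simp: atLeast0LessThan)
 have n: "0 < card H" using assms by (simp add: card_gt_0_iff)
 let ?h = "%i. g (clamp_index (card H) i)"
 have "g ` {..<card H} = H" using g by (simp add: bij_betw_def)
 moreover have "?h ` {..<card H} = g ` {..<card H}" by (rule image_cong) (auto simp: clamp_index_def)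
 moreover have "?h i : g ` {..<card H}" for i by (rule imageI) (use n in \<open>simp add: clamp_index_def\<close>)
 ultimately show ?thesis using that[of "card H" ?h] n by auto
qed

lemma (in gds) feat_cl_eq_if_AE:
 assumes f: "f : feat_cl X" and g: "g : feat_cl X" and eq: "AE x in meas X. f x = g x" and x: "x : pts X"
 shows "f x = g x"
proof (rule ccontr)
 assume "f x ~= g x"
 define r where "r = abs (f x - g x) / 2"
 have r: "0 < r" using `f x ~= g x` by (simp add: r_def)
 have "f y ~= g y" if y: "y : mball x r" for y
  using feat_clD[OF f x, of y] feat_clD[OF g x, of y] y r_def by auto
 then have "AE y in meas X. y ~: mball x r" using eq by auto
 then have "prob (mball x r) = 0" using prob_eq_0[OF mball_sets] by simp
 then show False using mball_pos[OF x r] by simp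
qed

text \<open>Coincidence of two coordinates almost everywhere is a property of the joint law.\<close>

lemma law_coords_eq:
 assumes "prob_space M" "!!i. f i : borel_measurable M" "!!i. g i : borel_measurable M'" "law M f = law M' g" "g i = g j"
 shows "AE x in M. f i x = f j x"
proof -
 interpret prob_space M by fact
 have "law M (%_ x. f i x - f j x) = law M' (%_ x. g i x - g j x)"
  using law_map[OF assms(2-4), of "%_ x. x i - x j"] by simp
 then have eq: "law M (%_ x. f i x - f j x) = law M' (%_ x. 0)" using assms(5) by simp
 have B: "{x. x 0 = (0::real)} : sets (borel :: (nat => real) measure)" by measurable
 have "AE x in law M (%_ x. f i x - f j x). x 0 = 0" unfolding eq unfolding law_def by (subst AE_distr_iff) (use B in auto)
 then have "AE x in M. f i x - f j x = 0" unfolding law_def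
  by (rule AE_distrD[rotated]) (intro measurable_seq borel_measurable_diff assms(2))
 then show ?thesis by simp
qed

context monoidal_family
begin

text \<open>On a finite union \<open>K\<close> of closed balls carrying most of the mass, finitely many truncated
 features \<open>h i\<close> are uniformly dense in the features up to additive constants. The data set
 generated by approximants of the \<open>h i\<close> found in the pyramid is then box-close to \<open>A\<close>.\<close>

lemma approximable_in_pyramid:
 assumes P: "P : pyramids L" and A: "A : DL L" and ap: "!!N e. 0 < e ==> approx N e {A} P"
 shows "A : P"
proof -
 let ?X = "rep A"
 note X = DL_D(1,2)[OF A]
 interpret X: gds ?X by rule (rule X)
 have box: "EX B:P. box_cls A B <= ennreal d" if d: "0 < d" "d < 1" for d
 proof -
  \<comment> \<open>The coupling set will lose mass less than \<open>3 * r\<close> and match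
    features up to \<open>4 * r\<close>; the choice ensures \<open>3 * r <= d\<close> and
    \<open>4 * r <= d / 2\<close>.\<close>
  define r where "r = d / 16"
  have r: "0 < r" using d by (simp add: r_def)
  obtain K0 where K0: "finite K0" "K0 <= pts ?X" "K0 ~= {}" "1 - r < X.prob (UN x:K0. X.mball x r)"
   by (rule X.finite_ball_cover[OF r r])
  define K where "K = (UN x:K0. X.mcball x r)"
  have Kc: "closedin (gtop ?X) K" unfolding K_def by (rule closedin_Union) (use K0(1) in auto)
  have KX: "K <= pts ?X" by (auto simp: K_def)
  have Ks: "K : sets (meas ?X)" by (rule X.closedin_sets[OF Kc])
  have "X.prob (UN x:K0. X.mball x r) <= X.prob K"
   by (rule X.finite_measure_mono[OF _ Ks]) (auto simp: K_def)
  then have mK: "1 - r < X.prob K" using K0(4) by simp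
  obtain x0 where x0: "x0 : K0" using K0(3) by blast
  have x0p: "x0 : pts ?X" using x0 K0(2) by blast
  obtain R0 where R0: "!!x. x : K0 ==> gdist ?X x0 x <= R0" 
   using bdd_above.I finite_imageI[OF K0(1), of "gdist ?X x0"] bdd_above_finite unfolding bdd_above_def by (metis imageI)
  define R where "R = max R0 0 + r"
  have R: "0 <= R" using r by (simp add: R_def)
  have KR: "gdist ?X x0 x <= R" "EX y:K0. gdist ?X y x <= r" if x: "x : K" for x
  proof -
   obtain y where y: "y : K0" "y : pts ?X" "x : pts ?X" "gdist ?X y x <= r" using x by (auto simp: K_def)
   show "gdist ?X x0 x <= R" using X.triangle[OF x0p y(2,3)] R0[OF y(1)] y(4) by (auto simp: R_def)
   show "EX y:K0. gdist ?X y x <= r" using y by blast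
  qed
  define H where "H = {h : feat_cl ?X. ALL x:pts ?X. abs (h x) <= R}"
  \<comment> \<open>Centres at \<open>x0\<close> and truncates at \<open>R\<close>; since
    \<open>R\<close> bounds the distances from \<open>x0\<close> within \<open>K\<close>, on
    \<open>K\<close> this is merely subtraction of \<open>f x0\<close>.\<close>
  define T where "T f = compose (pts ?X) (%z. trunc R (z + (- f x0))) f" for f
  have TH: "T f : H" if "f : feat_cl ?X" for f
   unfolding H_def T_def using closed_gdsD[OF X(2) L_comp[OF L_trunc[OF R] L_shift] that] trunc_bounds(3)[OF R]
   by (simp add: compose_def del: add_uminus_conv_diff)
  have Teq: "T f x = f x - f x0" if "f : feat_cl ?X" "x : K" for f x
  proof -
   have x: "x : pts ?X" using that(2) KX by blast
   have "abs (f x0 - f x) <= R" using X.feat_clD[OF that(1) x0p x] KR(1)[OF that(2)] by linarith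
   then have "trunc R (f x - f x0) = f x - f x0" by (intro trunc_id) linarith
   then show ?thesis using x by (simp add: T_def compose_def)
  qed
  have bnd: "ALL h:H. ALL x:K0. abs (h x) <= R" using K0(2) unfolding H_def by blast
  obtain H' where H': "finite H'" "H' <= H" "!!h. h : H ==> EX h':H'. ALL x:K0. abs (h x - h' x) <= r"
   by (rule finite_net_at_points[OF K0(1) r bnd]) (rule that)
  have "H' ~= {}" using H'(3) TH X.feat_nonempty X.feat_subset_cl by blast
  then obtain h n where h: "0 < (n::nat)" "H' = h ` {..<n}" "range h <= H'" by (rule finite_family_seq[OF H'(1)])
  have hH: "h i : H" for i using h(3) H'(2) by blast
  then have hcl: "h i : feat_cl ?X" and hR: "!!x. x : pts ?X ==> abs (h i x) <= R" for i by (auto simp: H_def)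
  have net: "EX i<n. ALL x:K. abs (f x - (h i x + f x0)) <= 3 * r" if f: "f : feat_cl ?X" for f
  proof -
   obtain i where i: "i < n" "!!x. x : K0 ==> abs (T f x - h i x) <= r" using H'(3)[OF TH[OF f]] h(2) by auto
   have "abs (f x - (h i x + f x0)) <= 3 * r" if x: "x : K" for x
   proof -
    obtain y where y: "y : K0" "gdist ?X y x <= r" using KR(2)[OF x] by blast
    have p: "x : pts ?X" "y : pts ?X" using x y KX K0(2) by auto
    have "T f : feat_cl ?X" using TH[OF f] by (simp add: H_def)
    then show ?thesis
     using X.feat_clD[OF _ p(2,1), of "T f"] X.feat_clD[OF hcl p(2,1), of i] i(2)[OF y(1)] y(2) Teq[OF f x]
     unfolding abs_le_iff by linarith
   qed
   then show ?thesis using i(1) by blast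
  qed
  obtain phi where phi: "phi : params ?X" by (rule X.params_nonempty)
  define u where "u i t = h i (phi t)" for i t
  have u: "u : feature_rvs ?X" unfolding u_def[abs_def] by (rule params_rvs(3)[of ?X phi h, OF X(1) phi hcl])
  obtain N0 where N0: "R <= real N0" using real_arch_simple by blast
  define N where "N = max n N0"
  have N: "n <= N" "R <= real N" using N0 by (auto simp: N_def)
  have "EX v:family_rvs P. apx N r u v" using ap[OF r, of N] u unfolding approx_def family_rvs_def by blast
  then obtain v where v: "v : family_rvs P" "apx N r u v" by blast
  obtain B0 where B0: "B0 : P" "v : feature_rvs (rep B0)" using v(1) by (auto simp: family_rvs_def)
  have B0L: "B0 : DL L" using pyramidD(1)[OF P] B0(1) by blast
  note Z = DL_D(1,2)[OF B0L]
  interpret Z: gds "rep B0" by rule (rule Z)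
  obtain y psi where psi: "psi : params (rep B0)" and y: "!!i. y i : feat_cl (rep B0)" and vy: "apx N r v (%i t. y i (psi t))"
   by (rule feature_rvs_params[OF Z(1) B0(2) r, of N]) (rule that)
  define w where "w i t = y i (psi t)" for i t
  have w: "rvs w" unfolding w_def[abs_def] by (rule params_rvs(1)[of "rep B0" psi y, OF Z(1) psi y])
  have uw: "apx N (2 * r) u w"
   using apx_trans[OF feature_rvs_rvs[OF u] family_rvs_rvs[OF v(1)] w v(2) vy[folded w_def]] by simp
  let ?y = "%i. compose (pts (rep B0)) (trunc R) (y i)"
  have yc: "?y i : feat_cl (rep B0)" for i by (rule closed_gdsD[OF Z(2) L_trunc[OF R] y])
  \<comment> \<open>The data set generated by the truncated approximants under \<open>L\<close>. It
    is dominated by the member \<open>B0\<close>, so its class belongs to the pyramid.\<close>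
  obtain C :: "real gds" and c where C: "is_gds C" "feat C = {compose (pts C) p (c i) | p i. p : L}" "range c <= feat C"
   "law (meas C) c = law (meas (rep B0)) (%i. ?y (clamp_index n i))"
   by (rule realize_finite[OF Z.prob_space_axioms Z.feat_cl_measurable[OF yc] h(1) L_Lip L_id]) (rule that)
  interpret C: gds C by rule (rule C)
  have ccl: "c i : feat_cl C" for i using C(3) C.feat_subset_cl by blast
  have Ccl: "closed_gds C" by (rule closed_gds_realized[OF C(1,2)])
  obtain \<chi>' where \<chi>': "domination (rep B0) C \<chi>'" "!!i z. z : pts (rep B0) ==> c i (\<chi>' z) = ?y (clamp_index n i) z"
   by (rule realize_dominated[OF C(1-3) L_Lip Z(1), of "%i. ?y (clamp_index n i)"]) (use yc C(4) Z(2) closed_gds_def in auto)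
  from \<chi>'(1) have "dominated C (rep B0)" by (auto simp: dominated_def)
  then have "iso_class C \<preceq> B0" unfolding dom_cls_def by (rule dominated_iso_class[OF C(1) Z(1)])
  then have BP: "iso_class C : P" by (rule pyramidD(3)[OF P iso_class_DL[OF C(1) Ccl] B0(1)])
  let ?Y = "rep (iso_class C)"
  note Y = DL_D(1,2)[OF iso_class_DL[OF C(1) Ccl]]
  interpret Y: gds ?Y by rule (rule Y)
  obtain \<theta>' \<theta> where \<theta>': "domination C ?Y \<theta>'" and \<theta>: "domination ?Y C \<theta>" "pullback (pts ?Y) (feat_cl C) \<theta> = feat_cl ?Y"
   "!!z. z : pts C ==> \<theta> (\<theta>' z) = z"
   by (rule iso_gds_inverse[OF C(1) rep_iso_class(1,2)[OF C(1)]]) blast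
  define c' where "c' i = compose (pts ?Y) (c i) \<theta>" for i
  have c'cl: "c' i : feat_cl ?Y" for i unfolding c'_def by (rule domination_feat_cl[OF Y(1) C(1) \<theta>(1) ccl])
  define psi' where "psi' t = \<theta>' (\<chi>' (psi t))" for t
  have psi': "psi' : params ?Y"
   unfolding psi'_def[abs_def] by (rule params_domination[OF C(1) \<theta>' params_domination[OF Z(1) \<chi>'(1) psi]])
  have c'psi': "c' i (psi' t) = trunc R (w i t)" if "t : {0..1}" "i < n" for i t
  proof -
   have z: "psi t : pts (rep B0)" by (rule params_space[OF Z(1) psi that(1)])
   have s: "\<chi>' (psi t) : pts C" by (rule domination_space[OF Z(1) C(1) \<chi>'(1) z])
   show ?thesis using domination_space[OF C(1) Y(1) \<theta>' s] \<theta>(3)[OF s] \<chi>'(2)[OF z] z that(2)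
    by (simp add: c'_def psi'_def compose_def w_def clamp_index_def)
  qed
  let ?S = "{(x,y). x : K & y : pts ?Y & (ALL i<n. abs (h i x - c' i y) <= r)}"
  note S = closedin_feature_match[OF X(1) Y(1) Kc hcl c'cl, where N=n and d=r]
  let ?B = "apx_set N (2 * r) u w"
  have Bs: "?B : sets leb" by (rule apx_set_sets[OF feature_rvs_rvs[OF u] w])
  have phiKs: "{t:{0..1}. phi t : K} : sets leb" using measurable_sets[OF paramsD(1)[OF X(1) phi] Ks] by (simp add: vimage_def Int_def conj_commute)
  have "X.prob K = leb.prob {t:{0..1}. phi t : K}"
   by (subst paramsD(2)[OF X(1) phi, symmetric], subst measure_distr[OF paramsD(1)[OF X(1) phi] Ks]) (auto intro!: arg_cong[where f="measure leb"])
  then have m1: "1 - 3 * r < leb.prob ({t:{0..1}. phi t : K} - ?B)"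
   using leb.finite_measure_Diff'[OF phiKs Bs] leb.finite_measure_mono[OF Int_lower2 Bs, of "{t:{0..1}. phi t : K}"] uw mK
   unfolding apx_def by linarith
  have SBs: "{t:{0..1}. (phi t, psi' t) : ?S} : sets leb"
   using measurable_sets[OF coupling_of_params(2)[OF X(1) Y(1) phi psi'] S(2)] by (simp add: vimage_def Int_def conj_commute)
  have "leb.prob ({t:{0..1}. phi t : K} - ?B) <= leb.prob {t:{0..1}. (phi t, psi' t) : ?S}"
  proof (rule leb.finite_measure_mono[OF _ SBs], rule subsetI)
   fix t assume "t : {t:{0..1}. phi t : K} - ?B"
   then have t1: "t : {0..1}" "phi t : K" "t ~: ?B" by auto
   have "abs (h i (phi t) - c' i (psi' t)) <= r" if i: "i < n" for i
   proof -
    have "abs (trunc N (u i t) - trunc N (w i t)) <= r" using apx_set_notin[OF t1(1,3), of i] i N by simp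
    then have "abs (trunc R (u i t) - trunc R (w i t)) <= r" using trunc_mono_diff[OF R N(2), of "u i t" "w i t"] by linarith
    moreover have "trunc R (u i t) = h i (phi t)"
     unfolding u_def by (rule trunc_id[OF hR[OF subsetD[OF KX t1(2)]]])
    ultimately show ?thesis using c'psi'[OF t1(1) i] by simp
   qed
   then show "t : {t:{0..1}. (phi t, psi' t) : ?S}" using t1 params_space[OF Y(1) psi' t1(1)] by simp
  qed
  then have mS: "1 - leb.prob {t:{0..1}. (phi t, psi' t) : ?S} < 3 * r" using m1 by linarith
  have Sne: "?S ~= {}"
  proof
   assume "?S = {}"
   then have "{t:{0..1}. (phi t, psi' t) : ?S} = {}" by blast
   then have "leb.prob {t:{0..1}. (phi t, psi' t) : ?S} = 0" by (simp only: measure_empty)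
   then show False using mS d unfolding r_def by linarith
  qed
  have mS': "1 - leb.prob {t:{0..1}. (phi t, psi' t) : ?S} <= d" using mS d unfolding r_def by linarith
  have "box_dist ?X ?Y <= ennreal d"
  proof (rule box_dist_leI[OF X(1) Y(1) phi psi' S Sne mS' order_refl, where d="4 * r"])
   show "4 * r <= d / 2" using d by (simp add: r_def)
   fix f assume "f : feat ?X"
   then have "f : feat_cl ?X" using X.feat_subset_cl by blast
   then obtain i where i: "i < n" "ALL x:K. abs (f x - (h i x + f x0)) <= 3 * r" using net by blast
   have "compose (pts ?Y) (%z. z + f x0) (c' i) : feat_cl ?Y" by (rule closed_gdsD[OF Y(2) L_shift c'cl])
   moreover have "abs (f x - compose (pts ?Y) (%z. z + f x0) (c' i) y) <= 4 * r" if "(x, y) : ?S" for x y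
   proof -
    have "x : K" "y : pts ?Y" "abs (h i x - c' i y) <= r" using that i(1) by auto
    then show ?thesis using bspec[OF i(2), of x] by (simp add: compose_def)
   qed
   ultimately show "EX g:feat_cl ?Y. ALL (x,y):?S. abs (f x - g y) <= 4 * r" by blast
  next
   fix g assume "g : feat ?Y"
   then obtain g0 where g0: "g0 : feat_cl C" "g = compose (pts ?Y) g0 \<theta>" using Y.feat_subset_cl \<theta>(2) unfolding pullback_def by blast
   let ?W = "{(z,x). x : K & z : pts C & (ALL i<n. abs (h i x - c i z) <= r)}"
   have S0: "(\<theta> y, x) : ?W" if "(x, y) : ?S" for x y
   proof -
    have y: "y : pts ?Y" using that by blast
    show ?thesis using that y domination_space[OF Y(1) C(1) \<theta>(1) y] by (simp add: c'_def compose_def)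
   qed
   have "EX f:feat_cl ?X. ALL (z,x):?W. abs (g0 z - f x) <= 4 * r"
   proof (rule feat_cl_match[OF C(1) X(1) _ _ _ g0(1)])
    show "?W <= pts C \<times> pts ?X" using KX by auto
    obtain z where "z : ?S" using Sne by blast
    then have "(fst z, snd z) : ?S" by simp
    from S0[OF this] show "?W ~= {}" unfolding ex_in_conv[symmetric] by (rule exI)
    fix q assume "q : feat C"
    then obtain p i where p: "p : L" "q = compose (pts C) p (c i)" using C(2) by blast
    let ?j = "clamp_index n i"
    have j: "?j < n" using h(1) by (simp add: clamp_index_def)
    \<comment> \<open>The matching set controls the coordinates below \<open>n\<close> only. The
      remaining generators of \<open>C\<close> repeat the coordinate 0, which is visible in the law
      and hence true at every point.\<close>
    have "AE z in meas C. c i z = c ?j z"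
     by (rule law_coords_eq[OF C.prob_space_axioms C.feat_cl_measurable[OF ccl] Z.feat_cl_measurable[OF yc] C(4)]) (simp add: clamp_index_def)
    then have ci: "c i z = c ?j z" if "z : pts C" for z using C.feat_cl_eq_if_AE[OF ccl ccl _ that] by blast
    have "compose (pts ?X) p (h ?j) : feat_cl ?X" by (rule closed_gdsD[OF X(2) p(1) hcl])
    moreover have "abs (q z - compose (pts ?X) p (h ?j) x) <= 4 * r" if "(z, x) : ?W" for z x
    proof -
     have "x : pts ?X" "z : pts C" "abs (h ?j x - c ?j z) <= r" using that j KX by auto
     then show ?thesis using L_Lip1[OF p(1), of "c ?j z" "h ?j x"] ci r unfolding p(2) compose_def by simp
    qed
    ultimately show "EX f:feat_cl ?X. ALL (z,x):?W. abs (q z - f x) <= 4 * r" by blast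
   qed
   then obtain f where f: "f : feat_cl ?X" "!!z x. (z, x) : ?W ==> abs (g0 z - f x) <= 4 * r" by blast
   have "abs (f x - g y) <= 4 * r" if "(x, y) : ?S" for x y
   proof -
    have y: "y : pts ?Y" using that by blast
    show ?thesis using f(2)[OF S0[OF that]] y g0(2) by (simp add: compose_def abs_minus_commute)
   qed
   then show "EX f:feat_cl ?X. ALL (x,y):?S. abs (f x - g y) <= 4 * r" using f(1) by blast
  qed
  then show ?thesis using BP unfolding box_cls_def by blast
 qed
 have "EX B:P. box_cls A B < e" if e: "0 < e" for e :: ennreal
 proof -
  obtain x where x: "0 < x" "x < min e 1" using dense[of 0 "min e 1"] e by auto
  then obtain d where d: "x = ennreal d" "0 <= d" by (cases x) auto
  then have "0 < d" "d < 1" "ennreal d < e" using x by (auto simp: ennreal_less_one_iff)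
  then show ?thesis using box[of d] by (meson order.strict_trans1)
 qed
 then have "ALL e>0. EX B:P. box_cls A B < e" by simp
 with pyramidD(5)[OF P, unfolded box_closed_def, rule_format, OF DL_D(3)[OF A]] show ?thesis by simp
qed

end


section \<open>Pyramids of data sets\<close>

context monoidal_family
begin

lemma dominated_refl: "is_gds X ==> dominated X X"
 using iso_gds_dominated[OF _ _ iso_gds_refl] by blast

lemma family_rvs_pyramid_of:
 assumes "A : DL L" shows "family_rvs (pyramid_of L A) = feature_rvs (rep A)"
proof
 show "family_rvs (pyramid_of L A) <= feature_rvs (rep A)"
  unfolding family_rvs_def pyramid_of_def dom_cls_def
  using feature_rvs_domination[OF DL_D(1)[OF assms] DL_D(1)] by blast
 show "feature_rvs (rep A) <= family_rvs (pyramid_of L A)"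
  unfolding family_rvs_def pyramid_of_def dom_cls_def
  using dominated_refl[OF DL_D(1)[OF assms]] assms by blast
qed

lemma box_limit_approximable:
 assumes P: "P <= DL L" and B: "B : DD" and lim: "ALL eps>0. EX C:P. box_cls B C < eps"
 shows "B : DL L" "u : feature_rvs (rep B) ==> 0 < e ==> EX v:family_rvs P. apx N e u v"
proof -
 have ex: "EX C:P. is_gds (rep C) & closed_gds (rep C) & box_dist (rep B) (rep C) < ennreal e" if e: "0 < e" for e
 proof -
  have "0 < ennreal e" using e by simp
  then obtain C where "C : P" "box_cls B C < ennreal e" using lim by blast
  then show ?thesis using P DL_D unfolding box_cls_def by blast
 qed
 then show "B : DL L" unfolding DL_iff by (intro conjI B closed_gds_box_limit[OF DD_rep(1)[OF B]]) blast
 assume u: "u : feature_rvs (rep B)" and "0 < e"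
 then obtain C where C: "C : P" "is_gds (rep C)" "box_dist (rep B) (rep C) < ennreal e" using ex by blast
 obtain v where "v : feature_rvs (rep C)" "apx N e u v" by (rule box_dist_apx[OF DD_rep(1)[OF B] C(2,3) u]) blast
 then show "EX v:family_rvs P. apx N e u v" using C(1) unfolding family_rvs_def by blast
qed

text \<open>The substantial point is box-closedness: a box limit of data sets dominated by
  \<open>A\<close> has all its feature sequences approximable by those of \<open>A\<close>, hence is
  dominated by \<open>A\<close>.\<close>

lemma pyramid_of_in_pyramids:
 assumes A: "A : DL L" shows "pyramid_of L A : pyramids L"
 unfolding pyramids_def is_pyramid_def mem_Collect_eq
proof (intro conjI ballI impI)
 note g = DL_D(1)[OF A]
 have AA: "A : pyramid_of L A" using A dominated_refl[OF g] by (simp add: pyramid_of_def dom_cls_def)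
 then show "pyramid_of L A ~= {}" by blast
 show sub: "pyramid_of L A <= DL L" by (auto simp: pyramid_of_def)
 show "B : pyramid_of L A" if "B : DL L" "C : pyramid_of L A" "B \<preceq> C" for B C
  using that dominated_trans[OF g, of "rep C" "rep B"] DL_D(1) by (simp add: pyramid_of_def dom_cls_def)
 show "EX D:pyramid_of L A. B \<preceq> D & C \<preceq> D" if "B : pyramid_of L A" "C : pyramid_of L A" for B C
  using that AA by (auto simp: pyramid_of_def)
 show "box_closed (pyramid_of L A)"
  unfolding box_closed_def
 proof (intro ballI impI)
  fix B assume B: "B : DD" and lim: "ALL eps>0. EX C:pyramid_of L A. box_cls B C < eps"
  note B' = box_limit_approximable[OF sub B lim, unfolded family_rvs_pyramid_of[OF A]]
  have "dominated (rep B) (rep A)" by (rule dominated_if_approximable[OF DD_rep(1)[OF B] g B'(2)])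
  then show "B : pyramid_of L A" using B'(1) by (simp add: pyramid_of_def dom_cls_def)
 qed
qed

end

section \<open>Approximation of random sequences\<close>

lemma near_apx:
 assumes "!!i. i < N ==> near leb d (u i) (v i)" "rvs u" "rvs v" "real N * d <= e" "d <= e / 2"
 shows "apx N e u v"
proof -
 have s: "{t:{0..1}. abs (u i t - v i t) > d} : sets leb" for i using near_sets[OF rvsD[OF assms(2)] rvsD[OF assms(3)], of d i i] by simp
 have "apx_set N e u v <= (\<Union>i<N. {t:{0..1}. abs (u i t - v i t) > d})"
 proof
  fix t assume t: "t : apx_set N e u v"
  then obtain i where i: "i < N" "t : {0..1}" "abs (trunc N (u i t) - trunc N (v i t)) > e / 2" by (auto simp: apx_set_def)
  then have "abs (u i t - v i t) > d" using trunc_lipschitz[of N "u i t" "v i t"] assms(5) by linarith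
  then show "t : (\<Union>i<N. {t:{0..1}. abs (u i t - v i t) > d})" using i by blast
 qed
 then have "measure leb (apx_set N e u v) <= measure leb (\<Union>i<N. {t:{0..1}. abs (u i t - v i t) > d})"
  by (intro leb.finite_measure_mono sets.finite_UN s) auto
 also have "... <= (\<Sum>i<N. measure leb {t:{0..1}. abs (u i t - v i t) > d})"
  by (rule leb.finite_measure_subadditive_finite) (use s in auto)
 also have "... <= (\<Sum>i<N. d)" by (rule sum_mono) (use assms(1) in \<open>auto simp: near_def\<close>)
 finally show ?thesis using assms(4) by (simp add: apx_def)
qed

text \<open>Truncation and \<open>p\<close> do not commute, so \<open>N'\<close> and
  \<open>e'\<close> depend on \<open>u\<close>: outside a set of small mass the relevant coordinates
  of \<open>u\<close> are bounded, and at a sufficiently high level \<open>N'\<close> truncation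
  changes neither \<open>u\<close> nor the nearby \<open>v\<close>.\<close>

lemma apx_compose:
 assumes u: "rvs u" and p: "!!i x y. abs (p i x - p i y) <= abs (x - y)" and e: "0 < e"
 obtains N' e' where "0 < e'" "!!v. rvs v ==> apx N' e' u v ==> rvs (%i t. p i (u (k i) t)) ==> rvs (%i t. p i (v (k i) t)) ==>
  apx N e (%i t. p i (u (k i) t)) (%i t. p i (v (k i) t))"
proof -
 define M where "M = Suc (Max (insert 0 (k ` {..<N})))"
 have kM: "k i < M" if "i < N" for i unfolding M_def using that by (intro le_imp_less_Suc Max_ge) auto
 define d where "d = e / (2 * real M)"
 have M: "0 < M" by (simp add: M_def)
 then have d: "0 < d" using e by (simp add: d_def)
 have s: "{t:{0..1}. abs (u i t) > c} : sets leb" for c i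
  using abs_greater_sets[OF rvsD[OF u, of i], of c] by simp
 have "EX R. measure leb {t:{0..1}. abs (u i t) > R} <= d" for i
  using tight_rv[OF leb.prob_space_axioms rvsD[OF u] d, of i] by auto
 then obtain R where R: "!!i. measure leb {t:{0..1}. abs (u i t) > R i} <= d" by metis
 obtain q :: nat where q: "real q > Max (R ` {..<M}) + 1" using reals_Archimedean2 by blast
 define N' where "N' = max M q"
 define e' where "e' = min (e / 2) 1"
 have Rq: "R i + 1 < real N'" if "i < M" for i
 proof -
  have "R i <= Max (R ` {..<M})" using that by (intro Max_ge) auto
  then show ?thesis using q by (simp add: N'_def)
 qed
 show ?thesis
 proof (rule that[of e' N'])
  show "0 < e'" using e by (simp add: e'_def)
  fix v assume v: "rvs v" and ap: "apx N' e' u v" and r: "rvs (%i t. p i (u (k i) t))" "rvs (%i t. p i (v (k i) t))"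
  let ?B = "(\<Union>i<M. {t:{0..1}. abs (u i t) > R i}) Un apx_set N' e' u v"
  have "apx_set N e (%i t. p i (u (k i) t)) (%i t. p i (v (k i) t)) <= ?B"
  proof (rule subsetI, rule ccontr)
   fix t assume t: "t : apx_set N e (%i t. p i (u (k i) t)) (%i t. p i (v (k i) t))" and no: "t ~: ?B"
   obtain i where i: "i < N" "t : {0..1}" "abs (trunc N (p i (u (k i) t)) - trunc N (p i (v (k i) t))) > e / 2"
    using t by (auto simp: apx_set_def)
   have 1: "abs (u (k i) t) <= R (k i)" using no kM[OF i(1)] i(2) by (auto simp: not_less)
   have 2: "abs (trunc N' (u (k i) t) - trunc N' (v (k i) t)) <= e' / 2"
    by (rule apx_set_notin) (use i(2) no kM[OF i(1)] in \<open>auto simp: N'_def\<close>)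
   have 3: "trunc N' (u (k i) t) = u (k i) t" by (rule trunc_id) (use 1 Rq[OF kM[OF i(1)]] in linarith)
   have e': "e' <= e / 2" "e' <= 1" by (auto simp: e'_def)
   have "abs (trunc N' (v (k i) t)) < real N'" using 1 2 3 e'(2) Rq[OF kM[OF i(1)]] by linarith
   then have 4: "trunc N' (v (k i) t) = v (k i) t" unfolding trunc_def by linarith
   have "abs (p i (u (k i) t) - p i (v (k i) t)) <= e' / 2" using p[of i "u (k i) t" "v (k i) t"] 2 3 4 by linarith
   then show False using i(3) trunc_lipschitz[of N "p i (u (k i) t)" "p i (v (k i) t)"] e'(1) e by linarith
  qed
  then have "measure leb (apx_set N e (%i t. p i (u (k i) t)) (%i t. p i (v (k i) t))) <= measure leb ?B"
   by (intro leb.finite_measure_mono sets.Un sets.finite_UN s apx_set_sets u v) auto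
  also have "... <= measure leb (\<Union>i<M. {t:{0..1}. abs (u i t) > R i}) + measure leb (apx_set N' e' u v)"
   by (intro measure_Un_le sets.finite_UN s apx_set_sets u v) auto
  also have "measure leb (\<Union>i<M. {t:{0..1}. abs (u i t) > R i}) <= (\<Sum>i<M. measure leb {t:{0..1}. abs (u i t) > R i})"
   by (rule leb.finite_measure_subadditive_finite) (use s in auto)
  also have "... <= (\<Sum>i<M. d)" by (rule sum_mono) (rule R)
  also have "(\<Sum>i<M. d) = e / 2" using M by (simp add: d_def)
  also have "measure leb (apx_set N' e' u v) <= e / 2" using ap by (simp add: apx_def e'_def)
  finally show "apx N e (%i t. p i (u (k i) t)) (%i t. p i (v (k i) t))" by (simp add: apx_def)
 qed
qed

section \<open>Limits of pyramids\<close>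

lemma feature_rvs_iso_class:
 fixes C :: "real gds"
 assumes C: "is_gds C" shows "feature_rvs (rep (iso_class C)) = feature_rvs C"
 using iso_gds_dominated[OF C rep_iso_class(1,2)[OF C]] feature_rvs_domination[OF C rep_iso_class(1)[OF C]]
  feature_rvs_domination[OF rep_iso_class(1)[OF C] C] by blast

lemma (in monoidal_family) family_rvs_compose:
 assumes "P <= DL L" "u : family_rvs P" "!!i. p i : L"
 shows "(%i t. p i (u (k i) t)) : family_rvs P"
proof -
 obtain A where A: "A : P" "u : feature_rvs (rep A)" using assms(2) by (auto simp: family_rvs_def)
 then have "(%i t. p i (u (k i) t)) : feature_rvs (rep A)"
  using feature_rvs_compose[of "rep A" u p k] DL_D assms(1,3) by blast
 then show ?thesis using A(1) by (auto simp: family_rvs_def)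
qed

lemma family_rvs_mp: "u : family_rvs P ==> unit_mp \<tau> ==> (%i t. u i (\<tau> t)) : family_rvs P"
 unfolding family_rvs_def using feature_rvs_mp by blast

text \<open>Both sequences become feature sequences of a common upper bound \<open>F\<close>, where
  they acquire a joint law; \<open>z\<close> interleaves them.\<close>

lemma (in monoidal_family) family_rvs_pair:
 assumes P: "P : pyramids L" and v: "v : family_rvs P" and w: "w : family_rvs P"
 obtains z where "z : family_rvs P" "law leb (%i. z (2 * i)) = law leb v" "law leb (%i. z (2 * i + 1)) = law leb w"
proof -
 obtain D E where DE: "D : P" "v : feature_rvs (rep D)" "E : P" "w : feature_rvs (rep E)" using v w by (auto simp: family_rvs_def)
 obtain F where F: "F : P" "D \<preceq> F" "E \<preceq> F" using pyramidD(4)[OF P DE(1,3)] by blast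
 have g: "is_gds (rep D)" "is_gds (rep E)" "is_gds (rep F)" using pyramidD(1)[OF P] DE F DL_D by blast+
 interpret F: gds "rep F" by rule (rule g)
 have vF: "v : feature_rvs (rep F)" "w : feature_rvs (rep F)"
  using feature_rvs_domination[OF g(3,1)] feature_rvs_domination[OF g(3,2)] DE F by (auto simp: dom_cls_def)
 obtain f where f: "!!i. f i : feat_cl (rep F)" "law leb v = law (meas (rep F)) f" by (rule feature_rvsE[OF vF(1)]) blast
 obtain f' where f': "!!i. f' i : feat_cl (rep F)" "law leb w = law (meas (rep F)) f'" by (rule feature_rvsE[OF vF(2)]) blast
 define h where "h n = (if even n then f (n div 2) else f' (n div 2))" for n
 have h: "h n : feat_cl (rep F)" for n using f(1) f'(1) by (simp add: h_def)
 obtain z where z: "z : feature_rvs (rep F)" "law leb z = law (meas (rep F)) h" by (rule feature_rvs_exist[of "rep F" h, OF g(3) h]) blast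
 have zr: "rvs z" by (rule feature_rvs_rvs[OF z(1)])
 have "law leb (%i. z (k i)) = law (meas (rep F)) (%i. h (k i))" for k
  using law_reindex[of z leb h "meas (rep F)" "%_ x. x" k] rvsD[OF zr] F.feat_cl_measurable[OF h] z(2) by simp
 from this[of "%i. 2 * i"] this[of "%i. 2 * i + 1"] show ?thesis
  using that[of z] z(1) F(1) f(2) f'(2) by (auto simp: h_def family_rvs_def)
qed

text \<open>Every sequence of pyramids has such a subsequence, since there are finitely many quantised
types at each level \<open>n\<close> and random sequences of equal type can be aligned up to \<open>2 / 2 ^ n\<close>.\<close>

locale pyramid_sequence = monoidal_family +
 fixes Q :: "nat => gds_class set"
 assumes Q: "!!l. Q l : pyramids L"
  and agree: "!!n l m. n <= l ==> n <= m ==> approx n (2 / 2 ^ n) (Q l) (Q m)"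
begin

text \<open>Approximation is required for arbitrarily large \<open>l\<close> only; since the
  pyramids agree ever better, it then holds for all large \<open>l\<close>, see
  \<open>limit_rvs_eventually\<close>.\<close>

definition limit_rvs :: "(nat => real => real) set" where
 "limit_rvs = {u. rvs u & (ALL N e m. 0 < e --> (EX l>=m. EX v:family_rvs (Q l). apx N e u v))}"

lemma limit_rvs_rvs: "u : limit_rvs ==> rvs u" by (simp add: limit_rvs_def)

lemma limit_rvsD: "u : limit_rvs ==> 0 < e ==> EX l>=m. EX v:family_rvs (Q l). apx N e u v"
 by (simp add: limit_rvs_def)

lemma limit_rvs_apx:
 assumes u: "u : limit_rvs" and "n <= j" "0 < e"
 shows "EX v:family_rvs (Q j). apx n (e + 2 / 2 ^ n) u v"
proof -
 obtain l w where w: "n <= l" "w : family_rvs (Q l)" "apx n e u w" using limit_rvsD[OF u assms(3), of n n] by auto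
 obtain v where v: "v : family_rvs (Q j)" "apx n (2 / 2 ^ n) w v" using agree[OF w(1) assms(2)] w(2) unfolding approx_def by blast
 then show ?thesis using apx_trans[OF limit_rvs_rvs[OF u] family_rvs_rvs[OF w(2)] family_rvs_rvs[OF v(1)] w(3)] by blast
qed

lemma limit_rvs_eventually:
 assumes u: "u : limit_rvs" and e: "0 < e"
 shows "EX J. ALL j>=J. EX v:family_rvs (Q j). apx N e u v"
proof -
 obtain n where n: "n >= N" "2 / 2 ^ n <= e / 2" using pow2_small[of "e / 2" N 2] e by auto
 have "EX v:family_rvs (Q j). apx N e u v" if "j >= n" for j
  using limit_rvs_apx[OF u that, of "e / 2"] apx_mono[OF _ n(1), of "e / 2 + 2 / 2 ^ n" u _ e] limit_rvs_rvs[OF u] family_rvs_rvs n(2) e by fastforce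
 then show ?thesis by blast
qed

lemma limit_rvs_closed:
 assumes u: "rvs u" and ap: "!!N e. 0 < e ==> EX v:limit_rvs. apx N e u v"
 shows "u : limit_rvs"
 unfolding limit_rvs_def mem_Collect_eq
proof (intro conjI u allI impI)
 fix N m and e :: real assume "0 < e"
 then have e: "0 < e / 2" by simp
 obtain v where v: "v : limit_rvs" "apx N (e / 2) u v" using ap[OF e] by blast
 obtain l w where w: "l >= m" "w : family_rvs (Q l)" "apx N (e / 2) v w" using limit_rvsD[OF v(1) e] by blast
 have "apx N (e / 2 + e / 2) u w" by (rule apx_trans[OF u limit_rvs_rvs[OF v(1)] family_rvs_rvs[OF w(2)] v(2) w(3)])
 then show "EX l>=m. EX v:family_rvs (Q l). apx N e u v" using w by auto
qed

lemma limit_rvs_law: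
 assumes v: "v : limit_rvs" and u: "rvs u" and eq: "law leb u = law leb v"
 shows "u : limit_rvs"
 unfolding limit_rvs_def mem_Collect_eq
proof (intro conjI u allI impI)
 fix N m and e :: real assume "0 < e"
 then have e: "0 < e / 2" by simp
 have vr: "rvs v" by (rule limit_rvs_rvs[OF v])
 obtain \<tau> where \<tau>: "unit_mp \<tau>" "apx N (e / 2) u (%i t. v i (\<tau> t))" by (rule law_align[OF u vr eq e]) blast
 obtain l w where w: "l >= m" "w : family_rvs (Q l)" "apx N (e / 2) v w" using limit_rvsD[OF v e] by blast
 have wr: "rvs w" by (rule family_rvs_rvs[OF w(2)])
 have "apx N (e / 2 + e / 2) u (%i t. w i (\<tau> t))"
  by (rule apx_trans[OF u rvs_mp[OF vr \<tau>(1)] rvs_mp[OF wr \<tau>(1)] \<tau>(2) apx_mp[OF w(3) \<tau>(1) vr wr]])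
 then show "EX l>=m. EX v:family_rvs (Q l). apx N e u v" using w(1) family_rvs_mp[OF w(2) \<tau>(1)] by auto
qed

lemma limit_rvs_compose:
 assumes v: "v : limit_rvs" and p: "!!i. p i : L"
 shows "(%i t. p i (v (k i) t)) : limit_rvs"
 unfolding limit_rvs_def mem_Collect_eq
proof (intro conjI allI impI)
 have vr: "rvs v" by (rule limit_rvs_rvs[OF v])
 note pm = L_measurable[OF p]
 show r: "rvs (%i t. p i (v (k i) t))" by (rule rvs_compose[of v p k, OF vr pm])
 fix N m and e :: real assume e: "0 < e"
 obtain N' e' where ne: "0 < e'" "!!w. rvs w ==> apx N' e' v w ==> rvs (%i t. p i (v (k i) t)) ==> rvs (%i t. p i (w (k i) t)) ==>
  apx N e (%i t. p i (v (k i) t)) (%i t. p i (w (k i) t))"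
  by (rule apx_compose[where u=v and p=p and k=k and N=N, OF vr L_Lip1[OF p] e]) (rule that)
 obtain l w where w: "l >= m" "w : family_rvs (Q l)" "apx N' e' v w" using limit_rvsD[OF v ne(1)] by blast
 have wr: "rvs w" by (rule family_rvs_rvs[OF w(2)])
 have "apx N e (%i t. p i (v (k i) t)) (%i t. p i (w (k i) t))"
  by (rule ne(2)[OF wr w(3) r rvs_compose[of w p k, OF wr pm]])
 then show "EX l>=m. EX w:family_rvs (Q l). apx N e (%i t. p i (v (k i) t)) w"
  using w(1) family_rvs_compose[of "Q l" w p k, OF pyramidD(1)[OF Q] w(2) p] by blast
qed

text \<open>Every feature of \<open>C\<close> is near some \<open>p \<circ> c k\<close> in measure,
  so a feature sequence is approximated by sequences \<open>p i \<circ> c (k i)\<close>, whose law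
  is that of a composite of \<open>v\<close> with elements of \<open>L\<close>.\<close>

lemma feature_rvs_realized:
 assumes C: "is_gds C" "feat C = {compose (pts C) p (c i) | p i. p : L}" "range c <= feat C"
  and v: "v : limit_rvs" "law (meas C) c = law leb v"
 shows "feature_rvs C <= limit_rvs"
proof
 interpret C: gds C by rule fact
 have ccl: "c i : feat_cl C" for i using C(3) C.feat_subset_cl by blast
 fix u assume "u : feature_rvs C"
 then obtain f where f: "!!i. f i : feat_cl C" "law leb u = law (meas C) f" and ur: "rvs u" by (rule feature_rvsE) blast
 obtain phi where phi: "phi : params C" by (rule C.params_nonempty)
 note r = params_rvs(1)[OF C(1) phi] and lw = params_rvs(2)[OF C(1) phi]
 have "(%i t. f i (phi t)) : limit_rvs"
 proof (rule limit_rvs_closed[OF r[of f, OF f(1)]])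
  fix N and e :: real assume e: "0 < e"
  define d where "d = min (e / 2) (e / (real N + 1))"
  have d: "0 < d" "d <= e / 2" "d <= e / (real N + 1)"
   unfolding d_def by (simp add: e, rule min.cobounded1, rule min.cobounded2)
  have "(real N + 1) * d <= (real N + 1) * (e / (real N + 1))" by (rule mult_left_mono[OF d(3)]) simp
  also have "... = e" by simp
  finally have Nd: "real N * d <= e" using d(1) by (simp add: distrib_right)
  have "EX g:feat C. near (meas C) d (f i) g" for i
   by (rule C.pw_closure_near[OF C.feat_Lip f(1) d(1)]) blast
  then obtain g where g: "!!i. g i : feat C" "!!i. near (meas C) d (f i) (g i)" by metis
  have "EX p k. p : L & g i = compose (pts C) p (c k)" for i using g(1)[of i] C(2) by blast
  then obtain p k where p: "!!i. p i : L" and gp: "!!i. g i = compose (pts C) (p i) (c (k i))" by metis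
  have gcl: "g i : feat_cl C" for i using g(1) C.feat_subset_cl by blast
  have "apx N e (%i t. f i (phi t)) (%i t. g i (phi t))"
  proof (rule near_apx[OF _ r[of f, OF f(1)] r[of g, OF gcl] Nd d(2)])
   show "near leb d (%t. f i (phi t)) (%t. g i (phi t))" for i
    using near_distr[OF paramsD(1,2)[OF C(1) phi] C.feat_cl_measurable[OF f(1)] C.feat_cl_measurable[OF gcl], of d i i] g(2) by simp
  qed
  moreover have "(%i t. g i (phi t)) : limit_rvs"
  proof (rule limit_rvs_law[OF limit_rvs_compose[of v p k, OF v(1) p] r[of g, OF gcl]])
   have "law leb (%i t. p i (v (k i) t)) = law (meas C) g"
    using law_compose_reindex[of C c v p k, OF C(1) ccl limit_rvs_rvs[OF v(1)] v(2)[symmetric] L_measurable[OF p]] by (simp add: gp[abs_def])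
   then show "law leb (%i t. g i (phi t)) = law leb (%i t. p i (v (k i) t))" using lw[of g, OF gcl] by simp
  qed
  ultimately show "EX v:limit_rvs. apx N e (%i t. f i (phi t)) v" by blast
 qed
 then show "u : limit_rvs" by (rule limit_rvs_law[OF _ ur]) (use lw[of f, OF f(1)] f(2) in simp)
qed

definition limit_pyramid :: "gds_class set" where
 "limit_pyramid = {A : DL L. feature_rvs (rep A) <= limit_rvs}"

lemma realized_in_limit:
 assumes C: "is_gds (C :: real gds)" "feat C = {compose (pts C) p (c i) | p i. p : L}" "range c <= feat C"
  and v: "v : limit_rvs" "law (meas C) c = law leb v"
 shows "iso_class C : limit_pyramid"
 unfolding limit_pyramid_def
 using iso_class_DL[OF C(1) closed_gds_realized[OF C(1,2)]] feature_rvs_realized[OF C v] feature_rvs_iso_class[OF C(1)] by blast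

lemma family_rvs_limit: "family_rvs limit_pyramid <= limit_rvs"
 unfolding family_rvs_def limit_pyramid_def by blast

text \<open>Starting from \<open>w\<close> truncated at \<open>l\<close>, follow approximants
  through the later pyramids. The steps \<open>2 / 2 ^ (l + k)\<close> add up to at most
  \<open>4 / 2 ^ l\<close>, and one more \<open>1 / 2 ^ l\<close> reaches the almost everywhere
  limit, whence the constant 5.\<close>

lemma approx_limit:
 assumes w: "w : family_rvs (Q l)"
 shows "EX A:limit_pyramid. EX u:feature_rvs (rep A). apx l (5 / 2 ^ l) w u"
proof -
 let ?t = "trunc (real l)"
 define w0 where "w0 i t = ?t (w i t)" for i t
 have tr: "(%i t. ?t (y i t)) : family_rvs (Q m)" if "y : family_rvs (Q m)" for y m
  using family_rvs_compose[of "Q m" y "%_. ?t" "%i. i", OF pyramidD(1)[OF Q] that] L_trunc by simp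
 have w0: "w0 : family_rvs (Q l)" using tr[OF w] by (simp add: w0_def[abs_def])
 \<comment> \<open>Each new term is truncated at the fixed level \<open>l\<close> again. This does
   not spoil closeness, because the previous term is already bounded by \<open>l\<close>, and it
   makes tightness of the chain immediate.\<close>
 have "EX W. ALL k. (W k : family_rvs (Q (l + k)) & (ALL i t. abs (W k i t) <= real l) & (k = 0 --> W k = w0)) &
   apx (l + k) (2 / 2 ^ (l + k)) (W k) (W (Suc k))"
 proof (rule dependent_nat_choice)
  show "EX x. x : family_rvs (Q (l + 0)) & (ALL i t. abs (x i t) <= real l) & (0 = (0::nat) --> x = w0)"
   using w0 trunc_bounds(3)[of "real l"] by (intro exI[of _ w0]) (simp add: w0_def)
  fix x k assume x: "x : family_rvs (Q (l + k)) & (ALL i t. abs (x i t) <= real l) & (k = 0 --> x = w0)"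
  obtain y where y: "y : family_rvs (Q (l + Suc k))" "apx (l + k) (2 / 2 ^ (l + k)) x y"
   using agree[of "l + k" "l + k" "l + Suc k"] x unfolding approx_def by auto
  have "apx (l + k) (2 / 2 ^ (l + k)) x (%i t. ?t (y i t))"
  proof (rule apx_cong[OF _ family_rvs_rvs[OF conjunct1[OF x]] family_rvs_rvs[OF y(1)] y(2)])
   fix i t
   let ?T = "trunc (real (l + k))"
   have "abs (x i t) <= real l" using x by blast
   then have "?T (x i t) = ?t (?T (x i t))" using order_trans[of "abs (x i t)" "real l" "real (l + k)"] by (simp add: trunc_trunc trunc_id)
   moreover have "?T (?t (y i t)) = ?t (?T (y i t))"
    using trunc_bounds(3)[of "real l" "y i t"] by (simp add: trunc_trunc trunc_id)
   ultimately show "abs (?T (x i t) - ?T (?t (y i t))) <= abs (?T (x i t) - ?T (y i t))"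
    using trunc_lipschitz[of "real l" "?T (x i t)" "?T (y i t)"] by simp
  qed
  then show "EX y. (y : family_rvs (Q (l + Suc k)) & (ALL i t. abs (y i t) <= real l) & (Suc k = 0 --> y = w0)) & apx (l + k) (2 / 2 ^ (l + k)) x y"
   using tr[OF y(1)] trunc_bounds(3)[of "real l"] by (intro exI[of _ "%i t. ?t (y i t)"]) simp
 qed
 then obtain W where W: "!!k. W k : family_rvs (Q (l + k))" "!!k i t. abs (W k i t) <= real l" "W 0 = w0"
  and step: "!!k. apx (l + k) (2 / 2 ^ (l + k)) (W k) (W (Suc k))" by blast
 have Wr: "rvs (W k)" for k by (rule family_rvs_rvs[OF W(1)])
 have total: "apx l ((4 - 4 / 2 ^ k) / 2 ^ l) w0 (W k)" for k
 proof (induction k)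
  case 0
  then show ?case using apx_refl[of 0 l w0] W(3) by simp
 next
  case (Suc k)
  have "apx l (2 / 2 ^ (l + k)) (W k) (W (Suc k))" by (rule apx_mono[OF step _ order_refl Wr Wr]) simp
  from apx_trans[OF family_rvs_rvs[OF w0] Wr Wr Suc this] show ?case by (simp add: power_add field_simps)
 qed
 define w' where "w' k = W (k - l)" for k
 obtain v where v: "rvs v" "!!i. AE t in leb. (%k. w' k i t) \<longlonglongrightarrow> v i t"
 proof (rule chain_limit[of w'])
  show "rvs (w' k)" for k using Wr by (simp add: w'_def)
  show "apx k (2 / 2 ^ k) (w' k) (w' (Suc k))" for k
   using step[of "k - l"] apx_refl[of "2 / 2 ^ k" k "W 0"] by (cases "l <= k") (auto simp: w'_def Suc_diff_le)
  show "EX R. ALL k. leb.prob {t : {0..1}. R < abs (w' k i t)} <= e" if "0 < e" for i and e :: real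
  proof -
   have "{t : {0..1}. real l < abs (w' k i t)} = {}" for k using W(2) by (auto simp: w'_def not_less)
   then have "leb.prob {t : {0..1}. real l < abs (w' k i t)} <= e" for k using that by (simp only: measure_empty)
   then show ?thesis by blast
  qed
 qed (rule that)
 have lim: "EX k0. ALL k>=k0. apx N e v (w' k)" if "0 < e" for N e
  by (rule AE_limit_apx[OF _ v that]) (use Wr in \<open>simp add: w'_def\<close>)
 have vl: "v : limit_rvs" unfolding limit_rvs_def mem_Collect_eq
 proof (intro conjI v(1) allI impI)
  fix N m and e :: real assume "0 < e"
  then obtain k0 where k0: "!!k. k >= k0 ==> apx N e v (w' k)" using lim by blast
  define k where "k = max k0 (max m l)"
  have "w' k : family_rvs (Q k)" using W(1)[of "k - l"] by (simp add: w'_def k_def)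
  then show "EX l>=m. EX w:family_rvs (Q l). apx N e v w" using k0[of k] by (intro exI[of _ k]) (auto simp: k_def)
 qed
 have vw: "apx l (5 / 2 ^ l) w0 v"
 proof -
  obtain k0 where k0: "!!k. k >= k0 ==> apx l (1 / 2 ^ l) v (w' k)" using lim[of "1 / 2 ^ l" l] by auto
  have "apx l (1 / 2 ^ l) v (W k0)" using k0[of "k0 + l"] by (simp add: w'_def)
  from apx_trans[OF family_rvs_rvs[OF w0] Wr v(1) total apx_sym[OF this]]
  have "apx l ((4 - 4 / 2 ^ k0) / 2 ^ l + 1 / 2 ^ l) w0 v" .
  moreover have "(4 - 4 / 2 ^ k0) / 2 ^ l + 1 / 2 ^ l <= (5 / 2 ^ l :: real)"
   unfolding add_divide_distrib[symmetric] by (intro divide_right_mono) auto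
  ultimately show ?thesis by (rule apx_mono[OF _ order_refl _ family_rvs_rvs[OF w0] v(1)])
 qed
 \<comment> \<open>Finitely many coordinates can be realised without further conditions.
   \<open>Suc l\<close> keeps their number positive when \<open>l = 0\<close>.\<close>
 define v' where "v' i = v (clamp_index (Suc l) i)" for i
 have v'l: "v' : limit_rvs" using limit_rvs_compose[of v "%_ x. x" "clamp_index (Suc l)", OF vl L_id] by (simp add: v'_def[abs_def])
 obtain C :: "real gds" and c where C: "is_gds C" "feat C = {compose (pts C) p (c i) | p i. p : L}" "range c <= feat C"
  "law (meas C) c = law leb (%i. v (clamp_index (Suc l) i))"
  by (rule realize_finite[OF leb.prob_space_axioms rvsD[OF v(1)] zero_less_Suc L_Lip L_id]) (rule that)
 have CP: "iso_class C : limit_pyramid" by (rule realized_in_limit[OF C(1-3) v'l]) (simp add: C(4) v'_def[abs_def])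
 interpret C: gds C by rule (rule C)
 have ccl: "c i : feat_cl C" for i using C(3) C.feat_subset_cl by blast
 have "v' : feature_rvs C"
  by (rule feature_rvsI[of v' c C, OF limit_rvs_rvs[OF v'l] ccl]) (simp add: C(4) v'_def[abs_def])
 then have "v' : feature_rvs (rep (iso_class C))" using feature_rvs_iso_class[OF C(1)] by simp
 moreover have "apx l (5 / 2 ^ l) w v'"
  by (rule apx_cong[OF _ family_rvs_rvs[OF w0] v(1) vw]) (simp add: w0_def v'_def clamp_index_def trunc_trunc)
 ultimately show ?thesis using CP by blast
qed

text \<open>Dense sequences of \<open>A\<close> and \<open>B\<close> are approximated within the
  same \<open>Q m\<close>, where directedness supplies a joint sequence \<open>z\<close>. These
  joint sequences are tight because their halves are; the even and odd parts of a limit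
  \<open>V\<close> have exactly the two given laws, and a realisation of \<open>V\<close> dominates
  both data sets.\<close>

lemma limit_directed:
 assumes A: "A : limit_pyramid" and B: "B : limit_pyramid"
 shows "EX C:limit_pyramid. A \<preceq> C & B \<preceq> C"
proof -
 have Ag: "is_gds (rep A)" and Bg: "is_gds (rep B)" using A B DL_D by (auto simp: limit_pyramid_def)
 interpret A: gds "rep A" by rule (rule Ag)
 interpret B: gds "rep B" by rule (rule Bg)
 obtain a where a: "A.dense_seq a" by (rule A.dense_seq_exists)
 obtain b where b: "B.dense_seq b" by (rule B.dense_seq_exists)
 have af: "a i : feat_cl (rep A)" and bf: "b i : feat_cl (rep B)" for i
  using a b unfolding A.dense_seq_def B.dense_seq_def by blast+
 obtain ua where ua: "ua : limit_rvs" "law leb ua = law (meas (rep A)) a"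
  using feature_rvs_exist[of "rep A" a, OF Ag af] A by (auto simp: limit_pyramid_def)
 obtain ub where ub: "ub : limit_rvs" "law leb ub = law (meas (rep B)) b"
  using feature_rvs_exist[of "rep B" b, OF Bg bf] B by (auto simp: limit_pyramid_def)
 have "EX m z v w. l <= m & z : family_rvs (Q m) & rvs v & rvs w & law leb (%i. z (2 * i)) = law leb v &
  law leb (%i. z (2 * i + 1)) = law leb w & apx l (1 / 2 ^ l) ua v & apx l (1 / 2 ^ l) ub w" for l
 proof -
  obtain J where J: "!!j. j >= J ==> EX v:family_rvs (Q j). apx l (1 / 2 ^ l) ua v" using limit_rvs_eventually[OF ua(1), of "1 / 2 ^ l" l] by auto
  obtain J' where J': "!!j. j >= J' ==> EX v:family_rvs (Q j). apx l (1 / 2 ^ l) ub v" using limit_rvs_eventually[OF ub(1), of "1 / 2 ^ l" l] by auto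
  define m where "m = max l (max J J')"
  have m: "l <= m" "J <= m" "J' <= m" by (auto simp: m_def)
  obtain v where v: "v : family_rvs (Q m)" "apx l (1 / 2 ^ l) ua v" using J[OF m(2)] by blast
  obtain w where w: "w : family_rvs (Q m)" "apx l (1 / 2 ^ l) ub w" using J'[OF m(3)] by blast
  obtain z where z: "z : family_rvs (Q m)" "law leb (%i. z (2 * i)) = law leb v" "law leb (%i. z (2 * i + 1)) = law leb w"
   by (rule family_rvs_pair[OF Q v(1) w(1)]) blast
  show ?thesis
   by (rule exI[of _ m], rule exI[of _ z], rule exI[of _ v], rule exI[of _ w])
    (use z v w family_rvs_rvs m(1) in auto)
 qed
 then obtain m z v w where m: "!!l. l <= m l" and z: "!!l. z l : family_rvs (Q (m l))" and vr: "!!l. rvs (v l)" and wr: "!!l. rvs (w l)"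
  and zv: "!!l. law leb (%i. z l (2 * i)) = law leb (v l)" and zw: "!!l. law leb (%i. z l (2 * i + 1)) = law leb (w l)"
  and av: "!!l. apx l (1 / 2 ^ l) ua (v l)" and bw: "!!l. apx l (1 / 2 ^ l) ub (w l)" by metis
 have zr: "rvs (z l)" for l by (rule family_rvs_rvs[OF z])
 have tz: "EX R. ALL l. measure leb {t:{0..1}. abs (z l i t) > R} <= e" if e: "0 < e" for i and e :: real
 proof (cases "even i")
  case True
  then obtain j where "i = 2 * j" by blast
  then show ?thesis using tight_if_apx[OF limit_rvs_rvs[OF ua(1)] vr av e, of j] law_tail[OF rvsD[OF zr] rvsD[OF vr] zv, where i=j] by simp
 next
  case False
  then obtain j where "i = 2 * j + 1" by (rule oddE)
  then show ?thesis using tight_if_apx[OF limit_rvs_rvs[OF ub(1)] wr bw e, of j] law_tail[OF rvsD[OF zr] rvsD[OF wr] zw, where i=j] by simp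
 qed
 obtain r \<tau> V where r: "strict_mono (r :: nat => nat)" and \<tau>: "!!l. unit_mp (\<tau> l)" and V: "rvs V"
  "!!i. AE t in leb. (%l. z (r l) i (\<tau> l t)) \<longlonglongrightarrow> V i t"
  by (rule tight_subsequence[of z, OF zr tz]) (assumption, rule that)
 have Vr: "rvs (%i. V (k i))" for k using V(1) by (simp add: rvs_def)
 have half: "law leb (%i. V (k i)) = law leb u"
  if u: "rvs u" and y: "!!l. rvs (y l)" "!!l. law leb (%i. z l (k i)) = law leb (y l)" "!!l. apx l (1 / 2 ^ l) u (y l)" for u y k
 proof (rule law_limit[OF u y(1,3) r _ _ Vr V(2)])
  have zk: "rvs (%i. z l (k i))" for l using zr by (simp add: rvs_def)
  show "rvs (%i t. z (r l) (k i) (\<tau> l t))" for l by (rule rvs_mp[OF zk \<tau>])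
  show "law leb (%i t. z (r l) (k i) (\<tau> l t)) = law leb (y (r l))" for l
   using law_mp[OF \<tau>, of "%i. z (r l) (k i)" l, OF rvsD[OF zr]] y(2) by simp
 qed
 have lA: "law leb (%i. V (2 * i)) = law (meas (rep A)) a"
  using half[OF limit_rvs_rvs[OF ua(1)] vr zv av] ua(2) by simp
 have lB: "law leb (%i. V (2 * i + 1)) = law (meas (rep B)) b"
  using half[OF limit_rvs_rvs[OF ub(1)] wr zw bw] ub(2) by simp
 have VL: "V : limit_rvs" unfolding limit_rvs_def mem_Collect_eq
 proof (intro conjI V(1) allI impI)
  fix N q and e :: real assume e: "0 < e"
  let ?z = "%l i t. z (r l) i (\<tau> l t)"
  obtain L0 where L0: "!!l. l >= L0 ==> apx N e V (?z l)"
   using AE_limit_apx[where w="?z" and v=V and N=N and e=e, OF rvs_mp[OF zr \<tau>] V e] by blast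
  define l where "l = max L0 q"
  have "q <= m (r l)" using seq_suble[OF r, of l] m[of "r l"] by (simp add: l_def)
  then show "EX l>=q. EX v:family_rvs (Q l). apx N e V v"
   using family_rvs_mp[OF z \<tau>, of "r l" l] L0[of l] by (intro exI[of _ "m (r l)"]) (auto simp: l_def)
 qed
 obtain \<alpha> where \<alpha>: "\<alpha> : params (rep A)" "AE t in leb. ALL i. a i (\<alpha> t) = V (2 * i) t"
  by (rule params_lift[OF Ag a rvsD[OF V(1)] lA]) blast
 obtain \<beta> where \<beta>: "\<beta> : params (rep B)" "AE t in leb. ALL i. b i (\<beta> t) = V (2 * i + 1) t"
  by (rule params_lift[OF Bg b rvsD[OF V(1)] lB]) blast
 obtain x :: "nat => real" where x: "range x <= pts (rep A)" "ALL p:pts (rep A). ALL e>0. EX n. gdist (rep A) p (x n) < e" by (rule A.dense_points)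
 obtain y :: "nat => real" where y: "range y <= pts (rep B)" "ALL p:pts (rep B). ALL e>0. EX n. gdist (rep B) p (y n) < e" by (rule B.dense_points)
 define mix where "mix p q n = (if even n then a (n div 2) p else b (n div 2) q)" for p q n
 \<comment> \<open>Interleaved coordinates of points from countable dense sets of \<open>A\<close>
   and \<open>B\<close>: they have finite mutual supremum distance and approximate almost every
   value of \<open>V\<close>, as realising infinitely many coordinates requires.\<close>
 define D where "D = (%(i, j). mix (x i) (y j)) ` (UNIV :: (nat \<times> nat) set)"
 have mix_le: "abs (mix p q n - mix p' q' n) <= gdist (rep A) p p' + gdist (rep B) q q'"
  if "p : pts (rep A)" "p' : pts (rep A)" "q : pts (rep B)" "q' : pts (rep B)" for p p' q q' n
  using A.feat_clD[OF af that(1,2), of "n div 2"] B.feat_clD[OF bf that(3,4), of "n div 2"]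
   A.nonneg[of p p'] B.nonneg[of q q'] by (cases "even n") (simp_all add: mix_def)
 have near: "AE t in leb. ALL e>0. EX d:D. ALL i. abs (V i t - d i) <= e"
  using \<alpha>(2) \<beta>(2) AE_space[of leb]
 proof eventually_elim
  case (elim t)
  have t: "\<alpha> t : pts (rep A)" "\<beta> t : pts (rep B)" using params_space[OF Ag \<alpha>(1)] params_space[OF Bg \<beta>(1)] elim(3) by auto
  have Vm: "V n t = mix (\<alpha> t) (\<beta> t) n" for n
  proof (cases "even n")
   case True
   then show ?thesis using spec[OF elim(1), of "n div 2"] by (simp add: mix_def)
  next
   case False
   then have "2 * (n div 2) + 1 = n" by presburger
   then show ?thesis using spec[OF elim(2), of "n div 2"] False by (simp add: mix_def)
  qed
  show ?case
  proof (intro allI impI)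
   fix e :: real assume "0 < e"
   then have e: "0 < e / 2" by simp
   obtain i where i: "gdist (rep A) (\<alpha> t) (x i) < e / 2" using x(2) t(1) e by blast
   obtain j where j: "gdist (rep B) (\<beta> t) (y j) < e / 2" using y(2) t(2) e by blast
   have "abs (V n t - mix (x i) (y j) n) <= e" for n
    using mix_le[OF t(1) _ t(2), of "x i" "y j" n] x(1) y(1) i j Vm[of n] by force
   moreover have "mix (x i) (y j) : D" by (auto simp: D_def)
   ultimately show "EX d:D. ALL i. abs (V i t - d i) <= e" by blast
  qed
 qed
 obtain C :: "real gds" and c where C: "is_gds C" "feat C = {compose (pts C) p (c i) | p i. p : L}" "range c <= feat C"
  "law (meas C) c = law leb V"
 proof (rule realize[OF leb.prob_space_axioms rvsD[OF V(1)] _ _ near L_Lip L_id])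
  show "countable D" by (auto simp: D_def)
  fix d d' assume "d : D" "d' : D"
  then obtain i j i' j' where d: "d = mix (x i) (y j)" "d' = mix (x i') (y j')" by (auto simp: D_def)
  show "EX c. ALL i. abs (d i - d' i) <= c" unfolding d using mix_le x(1) y(1) by blast
 qed (rule that)
 interpret C: gds C by rule (rule C)
 have CP: "iso_class C : limit_pyramid" by (rule realized_in_limit[OF C(1-3) VL C(4)])
 have ccl: "c i : feat_cl C" for i using C(3) C.feat_subset_cl by blast
 have sub: "law (meas C) (%i. c (k i)) = law leb (%i. V (k i))" for k
  using law_reindex[of c "meas C" V leb "%_ x. x" k] C.feat_cl_measurable[OF ccl] rvsD[OF V(1)] C(4) by simp
 obtain psi where "domination C (rep A) psi"
  by (rule domination_by_law[OF C(1) Ag a, of "%i. c (2 * i)"]) (use ccl sub lA in auto)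
 moreover obtain psi' where "domination C (rep B) psi'"
  by (rule domination_by_law[OF C(1) Bg b, of "%i. c (2 * i + 1)"]) (use ccl sub lB in auto)
 ultimately have d: "dominated (rep A) C" "dominated (rep B) C" by (auto simp: dominated_def)
 have iso: "dominated C (rep (iso_class C))" using iso_gds_dominated[OF C(1) rep_iso_class(1,2)[OF C(1)]] by blast
 have "A \<preceq> iso_class C" "B \<preceq> iso_class C"
  unfolding dom_cls_def using dominated_trans[OF rep_iso_class(1)[OF C(1)] C(1)] Ag Bg iso d by blast+
 then show ?thesis using CP by blast
qed

lemma limit_pyramid_in_pyramids: "limit_pyramid : pyramids L"
 unfolding pyramids_def is_pyramid_def mem_Collect_eq
proof (intro conjI ballI impI)
 show sub: "limit_pyramid <= DL L" by (auto simp: limit_pyramid_def)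
 show "A : limit_pyramid" if "A : DL L" "B : limit_pyramid" "A \<preceq> B" for A B
  using that feature_rvs_domination[of "rep B" "rep A"] DL_D(1) unfolding limit_pyramid_def dom_cls_def by blast
 show "EX C:limit_pyramid. A \<preceq> C & B \<preceq> C" if "A : limit_pyramid" "B : limit_pyramid" for A B
  by (rule limit_directed[OF that])
 obtain A where "A : Q 0" using pyramidD(2)[OF Q] by blast
 then show "limit_pyramid ~= {}" using approx_limit[OF const_rvs[OF pyramidD(1)[OF Q]]] by blast
 show "box_closed limit_pyramid"
  unfolding box_closed_def
 proof (intro ballI impI)
  fix B assume B: "B : DD" and lim: "ALL eps>0. EX C:limit_pyramid. box_cls B C < eps"
  note B' = box_limit_approximable[OF sub B lim]
  have "feature_rvs (rep B) <= limit_rvs"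
  proof
   fix u assume u: "u : feature_rvs (rep B)"
   show "u : limit_rvs"
    by (rule limit_rvs_closed[OF feature_rvs_rvs[OF u]]) (use B'(2)[OF u] family_rvs_limit in blast)
  qed
  then show "B : limit_pyramid" using B'(1) by (simp add: limit_pyramid_def)
 qed
qed

lemma limit_approx_eventually:
 assumes e: "0 < e"
 shows "EX J. ALL j>=J. approx N e (Q j) limit_pyramid & approx N e limit_pyramid (Q j)"
proof -
 obtain n where n: "n >= N" "5 / 2 ^ n <= e / 2" using pow2_small[of "e / 2" N 5] e by auto
 have "approx N e (Q j) limit_pyramid & approx N e limit_pyramid (Q j)" if j: "n <= j" for j
 proof
  have "(5 / 2 ^ j :: real) <= 5 / 2 ^ n" using j by (intro divide_left_mono power_increasing) auto
  then have "approx j e (Q j) limit_pyramid" unfolding approx_def family_rvs_def[of limit_pyramid]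
   using approx_limit[of _ j] apx_mono[of j "5 / 2 ^ j" _ _ j e] family_rvs_rvs feature_rvs_rvs n(2) e by fastforce
  then show "approx N e (Q j) limit_pyramid" using approx_mono j n(1) by (metis order_refl order_trans)
  have "approx n e limit_pyramid (Q j)" unfolding approx_def
  proof
   fix u assume "u : family_rvs limit_pyramid"
   then have u: "u : limit_rvs" using family_rvs_limit by blast
   obtain v where v: "v : family_rvs (Q j)" "apx n (e / 2 + 2 / 2 ^ n) u v" using limit_rvs_apx[OF u j, of "e / 2"] e by auto
   have "(2 / 2 ^ n :: real) <= 5 / 2 ^ n" by (intro divide_right_mono) auto
   then have "apx n e u v" by (intro apx_mono[OF v(2) order_refl _ limit_rvs_rvs[OF u] family_rvs_rvs[OF v(1)]]) (use n(2) in linarith)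
   then show "EX v:family_rvs (Q j). apx n e u v" using v(1) by blast
  qed
  then show "approx N e limit_pyramid (Q j)" using approx_mono n(1) by (metis order_refl)
 qed
 then show ?thesis by blast
qed

end

context monoidal_family
begin

lemma pyramids_seq_compact:
 fixes Q :: "nat => gds_class set"
 assumes Q: "!!l. Q l : pyramids L"
 obtains r P where "strict_mono (r :: nat => nat)" "P : pyramids L" "(%j. rho (Q (r j)) P) \<longlonglongrightarrow> 0"
proof -
 \<comment> \<open>All level \<open>n\<close> types occurring in \<open>Q j\<close>. As a subset of
   a fixed finite set, \<open>T n j\<close> takes finitely many values when \<open>j\<close>
   varies.\<close>
 define T where "T n j = (%u. law_type n (law leb u)) ` family_rvs (Q j)" for n j
 have ty: "law_type n (law leb u) : law_type n ` {\<mu>. prob_space \<mu>}" if "u : family_rvs P" for n u P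
  by (rule imageI) (simp add: prob_space_law[of leb u, OF leb.prob_space_axioms rvsD[OF family_rvs_rvs[OF that]]])
 have T: "finite (range (T n))" for n
 proof (rule finite_subset)
  show "range (T n) <= Pow (law_type n ` {\<mu>. prob_space \<mu>})"
   unfolding T_def using ty by blast
 qed (simp add: finite_law_types)
 obtain r where r: "strict_mono (r :: nat => nat)" "!!n l. n <= l ==> T n (r l) = T n (r n)"
  by (rule diagonal_stabilize[of T, OF T]) (rule that)
 interpret pyramid_sequence L "%j. Q (r j)"
 proof
  show "Q (r l) : pyramids L" for l by (rule Q)
  fix n l m :: nat assume nl: "n <= l" "n <= m"
  show "approx n (2 / 2 ^ n) (Q (r l)) (Q (r m))"
   unfolding approx_def
  proof
   fix u assume u: "u : family_rvs (Q (r l))"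
   have "T n (r l) = T n (r m)" using r(2)[OF nl(1)] r(2)[OF nl(2)] by simp
   then obtain w where w: "w : family_rvs (Q (r m))" "law_type n (law leb u) = law_type n (law leb w)"
    using u unfolding T_def by blast
   obtain \<tau> where "unit_mp \<tau>" "apx n (2 / 2 ^ n) u (%i t. w i (\<tau> t))"
    by (rule law_type_align[OF family_rvs_rvs[OF u] family_rvs_rvs[OF w(1)] w(2)]) blast
   then show "EX v:family_rvs (Q (r m)). apx n (2 / 2 ^ n) u v" using family_rvs_mp[OF w(1)] by blast
  qed
 qed
 have "(%j. rho (Q (r j)) limit_pyramid) \<longlonglongrightarrow> 0"
 proof (rule LIMSEQ_I)
  fix e :: real assume e: "0 < e"
  obtain N where N: "1 / 2 ^ N <= e / 3" using pow2_small[of "e / 3" 0 1] e by auto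
  obtain J where "!!j. j >= J ==> approx N (e / 3) (Q (r j)) limit_pyramid & approx N (e / 3) limit_pyramid (Q (r j))"
   using limit_approx_eventually[of "e / 3" N] e by auto
  then have "rho (Q (r j)) limit_pyramid < e" if "j >= J" for j
   using rho_le_if_approx[OF Q[of j] limit_pyramid_in_pyramids, of N "e / 3"] that N e by (fastforce simp: power_one_over)
  then show "EX J. ALL j>=J. norm (rho (Q (r j)) limit_pyramid - 0) < e" using rho_nonneg by auto
 qed
 then show ?thesis using that r(1) limit_pyramid_in_pyramids by blast
qed

end


section \<open>Data sets of metric measure spaces\<close>

text \<open>The metric induced by the features agrees with the given one on the carrier only, while
  a distance function is defined on the whole type.\<close>

lemma is_mm_cong:
 assumes X: "is_mm (MM P d M)" and eq: "!!x y. x : P ==> y : P ==> d' x y = d x y" and d': "Metric_space P d'"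
 shows "is_mm (MM P d' M)"
proof -
 interpret A: Metric_space P d using X by (simp add: is_mm_def)
 interpret B: Metric_space P d' by (rule d')
 have b: "B.mball = A.mball" using eq by (intro ext) (auto simp: A.mball_def B.mball_def)
 have t: "B.mtopology = A.mtopology" unfolding A.mtopology_def B.mtopology_def A.mopen_def B.mopen_def b ..
 have c: "B.MCauchy = A.MCauchy"
 proof
  fix s :: "nat => 'a"
  have "d' (s m) (s n) = d (s m) (s n)" if "range s <= P" for m n using that eq by blast
  then show "B.MCauchy s = A.MCauchy s" unfolding A.MCauchy_def B.MCauchy_def by auto
 qed
 have "B.mcomplete = A.mcomplete" unfolding A.mcomplete_def B.mcomplete_def c t ..
 then show ?thesis using X d' unfolding is_mm_def mmspace.case t by simp
qed

context monoidal_family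
begin

text \<open>All features are 1-Lipschitz for \<open>d\<close>, and the feature \<open>d x y\<close>
  as a function of \<open>x\<close> attains the distance to \<open>y\<close>; so the metric of the
  data set is the original one. Stability under \<open>L\<close> is closure under
  composition.\<close>

lemma mm_gds:
 assumes X: "is_mm X"
 shows "is_gds (mm_gds L X)" "closed_gds (mm_gds L X)"
proof -
 obtain P d M where XP: "X = MM P d M" by (cases X)
 interpret Metric_space P d using X unfolding XP is_mm_def by simp
 let ?F = "{\<lambda>x\<in>P. p (d x y) | p y. p : L & y : P}"
 have G: "mm_gds L X = GDS P ?F M" by (simp add: mm_gds_def XP)
 have ne: "P ~= {}" using X prob_space.not_empty unfolding XP is_mm_def by fastforce
 have FL: "abs (f x - f x') <= d x x'" if f: "f : ?F" and x: "x : P" "x' : P" for f x x'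
 proof -
  obtain p y where p: "p : L" "y : P" "f = (\<lambda>x\<in>P. p (d x y))" using f by blast
  have "abs (d x y - d x' y) <= d x x'"
   using triangle[OF x p(2)] triangle[OF x(2,1) p(2)] commute[of x x'] by linarith
  then show ?thesis using L_Lip1[OF p(1), of "d x y" "d x' y"] x by (simp add: p(3))
 qed
 have bdd: "bdd_above ((%f. abs (f x - f y)) ` ?F)" if "x : P" "y : P" for x y
  using FL[OF _ that] by (intro bdd_aboveI2[where M="d x y"]) blast
 have idF: "(\<lambda>x\<in>P. d x y) : ?F" if "y : P" for y
  unfolding mem_Collect_eq by (rule exI[of _ "%z. z"], rule exI[of _ y]) (use L_id that in simp)
 have eq: "feat_dist P ?F x y = d x y" if "x : P" "y : P" for x y
 proof -
  have "(SUP f\<in>?F. abs (f x - f y)) = d x y"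
  proof (rule antisym)
   show "(SUP f\<in>?F. abs (f x - f y)) <= d x y" by (rule cSUP_least) (use idF ne FL that in blast)+
   show "d x y <= (SUP f\<in>?F. abs (f x - f y))" using cSUP_upper[OF idF[OF that(2)] bdd[OF that]] that by simp
  qed
  then show ?thesis using that by (simp add: feat_dist_def)
 qed
 have "Metric_space P (feat_dist P ?F)"
 proof
  show "0 <= feat_dist P ?F x y" for x y using eq[of x y] by (cases "x : P & y : P") (auto simp: feat_dist_def)
  show "feat_dist P ?F x y = feat_dist P ?F y x" for x y by (rule feat_dist_sym)
  show "feat_dist P ?F x y = 0 \<longleftrightarrow> x = y" if "x : P" "y : P" for x y using eq[OF that] that by simp
  show "feat_dist P ?F x z <= feat_dist P ?F x y + feat_dist P ?F y z" if "x : P" "y : P" "z : P" for x y z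
   using eq that triangle by simp
 qed
 then have "is_mm (MM P (feat_dist P ?F) M)" using is_mm_cong[OF X[unfolded XP] eq] by blast
 then show g: "is_gds (mm_gds L X)" unfolding G is_gds_def gds.sel
 proof (intro conjI ballI)
  show "?F ~= {}" using idF ne by blast
  show "?F <= extensional P" by (intro subsetI) (elim CollectE exE conjE, simp)
 qed (rule bdd, assumption+)
 show "closed_gds (mm_gds L X)"
 proof (rule closed_gdsI[OF g])
  interpret G: gds "mm_gds L X" by rule (rule g)
  fix q f assume q: "q : L" and "f : feat (mm_gds L X)"
  then obtain p y where p: "p : L" "y : P" "f = (\<lambda>x\<in>P. p (d x y))" unfolding G gds.sel by blast
  have "compose P q f = (\<lambda>x\<in>P. (%z. q (p z)) (d x y))" by (auto simp: p(3) compose_def)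
  then have "compose P q f : ?F"
   unfolding mem_Collect_eq by (intro exI[of _ "%z. q (p z)"] exI[of _ y]) (use L_comp[OF q p(1)] p(2) in simp)
  then show "compose (pts (mm_gds L X)) q f : feat_cl (mm_gds L X)" using G.feat_subset_cl unfolding G gds.sel by blast
 qed
qed

lemma Dcirc_subset: "Dcirc L <= DL L"
 unfolding Dcirc_def using iso_class_DL mm_gds by blast

end

section \<open>The observable distance\<close>

lemma params_near:
 assumes "is_gds X" "phi : params X" "f : feat_cl X" "g : feat_cl X"
 shows "near leb e (%t. f (phi t)) (%t. g (phi t)) \<longleftrightarrow> near (meas X) e f g"
proof -
 interpret X: gds X by rule fact
 show ?thesis by (rule near_distr[OF paramsD(1,2)[OF assms(1,2)]]) (use assms X.feat_cl_measurable in auto)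
qed

text \<open>One half of the Hausdorff estimate in \<open>d_conc\<close> for fixed parametrisations,
  formulated with closures of features so that no density argument recurs.\<close>

definition obs_close :: "real => 'a gds => (real => 'a) => 'b gds => (real => 'b) => bool" where
 "obs_close e X phi Y psi \<longleftrightarrow> (ALL f:feat_cl X. EX g:feat_cl Y. near leb e (%t. f (phi t)) (%t. g (psi t)))"

lemma d_KF_sym: "d_KF M f g = d_KF M g f"
 unfolding d_KF_def by (simp add: abs_minus_commute)

lemma d_KF_le_one: "prob_space M ==> d_KF M f g <= 1"
 by (rule d_KF_le) (simp_all add: near_def prob_space.prob_le_1)

lemma d_KF_compose:
 "d_KF leb (compose {0..1} f phi) (compose {0..1} g psi) = d_KF leb (%t. f (phi t)) (%t. g (psi t))"
proof -
 have "{t:space leb. abs (compose {0..1} f phi t - compose {0..1} g psi t) > e} = {t:space leb. abs (f (phi t) - g (psi t)) > e}" for e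
  by (auto simp: compose_def)
 then show ?thesis unfolding d_KF_def by simp
qed

lemma hausdorff_pullback_le:
 assumes X: "is_gds X" and Y: "is_gds Y" and phi: "phi : params X" "psi : params Y"
  and c: "obs_close e X phi Y psi" "obs_close e Y psi X phi" and e: "0 <= e" "e < e'"
 shows "hausdorff_dist (%f g. ennreal (d_KF leb f g)) (pullback {0..1} (feat X) phi) (pullback {0..1} (feat Y) psi) <= ennreal e'"
proof -
 have one: "EX g:feat Y. ennreal (d_KF leb (compose {0..1} f phi) (compose {0..1} g psi)) <= ennreal e'"
  if X: "is_gds X" and Y: "is_gds Y" and phi: "phi : params X" "psi : params Y" and c: "obs_close e X phi Y psi" and f: "f : feat X"
  for X :: "'c gds" and Y :: "'d gds" and phi psi f
 proof -
  interpret X: gds X by rule (rule X)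
  interpret Y: gds Y by rule (rule Y)
  have fc: "f : feat_cl X" using f X.feat_subset_cl by blast
  obtain g where g: "g : feat_cl Y" "near leb e (%t. f (phi t)) (%t. g (psi t))" using c fc unfolding obs_close_def by blast
  obtain g' where g': "g' : feat Y" "near (meas Y) (e' - e) g g'" by (rule Y.pw_closure_near[OF Y.feat_Lip g(1), of "e' - e"]) (use e in auto)
  have g'c: "g' : feat_cl Y" using g'(1) Y.feat_subset_cl by blast
  have "near leb (e' - e) (%t. g (psi t)) (%t. g' (psi t))" using params_near[OF Y phi(2) g(1) g'c] g'(2) by simp
  then have "near leb (e + (e' - e)) (%t. f (phi t)) (%t. g' (psi t))"
   by (rule leb.near_trans[OF paramsD(3)[OF X phi(1) fc] paramsD(3)[OF Y phi(2) g(1)] paramsD(3)[OF Y phi(2) g'c] g(2)])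
  then have "d_KF leb (%t. f (phi t)) (%t. g' (psi t)) <= e'" by (intro d_KF_le) (use e in auto)
  then show ?thesis using g'(1) unfolding d_KF_compose by (meson ennreal_leI)
 qed
 show ?thesis
 proof (rule hausdorff_dist_le)
  fix a assume "a : pullback {0..1} (feat X) phi"
  then obtain f where f: "f : feat X" "a = compose {0..1} f phi" by (auto simp: pullback_def)
  show "EX b:pullback {0..1} (feat Y) psi. ennreal (d_KF leb a b) <= ennreal e'"
   using one[OF X Y phi c(1) f(1)] unfolding f(2) pullback_def by blast
 next
  fix b assume "b : pullback {0..1} (feat Y) psi"
  then obtain g where g: "g : feat Y" "b = compose {0..1} g psi" by (auto simp: pullback_def)
  show "EX a:pullback {0..1} (feat X) phi. ennreal (d_KF leb a b) <= ennreal e'"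
   using one[OF Y X phi(2,1) c(2) g(1)] unfolding g(2) pullback_def d_KF_sym[of leb "compose {0..1} g psi"] by blast
 qed
qed

lemma d_conc_leI:
 assumes X: "is_gds X" and Y: "is_gds Y" and phi: "phi : params X" "psi : params Y"
  and c: "obs_close e X phi Y psi" "obs_close e Y psi X phi" and e: "0 <= e"
 shows "d_conc X Y <= e"
proof (rule field_le_epsilon)
 fix d :: real assume d: "0 < d"
 have "(INF phi\<in>params X. INF psi\<in>params Y. hausdorff_dist (%f g. ennreal (d_KF leb f g))
   (pullback {0..1} (feat X) phi) (pullback {0..1} (feat Y) psi)) <= ennreal (e + d)"
  by (rule INF_lower2[OF phi(1)], rule INF_lower2[OF phi(2)], rule hausdorff_pullback_le[OF X Y phi c e]) (use d in simp)
 then show "d_conc X Y <= e + d" unfolding d_conc_def by (rule enn2real_leI[rotated]) (use e d in simp)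
qed

lemma d_conc_lessE:
 assumes X: "is_gds X" and Y: "is_gds Y" and less: "d_conc X Y < e"
 obtains phi psi where "phi : params X" "psi : params Y" "obs_close e X phi Y psi" "obs_close e Y psi X phi"
proof -
 interpret X: gds X by rule fact
 interpret Y: gds Y by rule fact
 let ?H = "%phi psi. hausdorff_dist (%f g. ennreal (d_KF leb f g)) (pullback {0..1} (feat X) phi) (pullback {0..1} (feat Y) psi)"
 let ?I = "INF phi\<in>params X. INF psi\<in>params Y. ?H phi psi"
 obtain phi0 where phi0: "phi0 : params X" by (rule X.params_nonempty)
 obtain psi0 where psi0: "psi0 : params Y" by (rule Y.params_nonempty)
 have "?H phi0 psi0 <= ennreal 1"
 proof (rule hausdorff_dist_le)
  have le: "ennreal (d_KF leb a b) <= ennreal 1" for a b by (intro ennreal_leI d_KF_le_one leb.prob_space_axioms)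
  show "EX b:pullback {0..1} (feat Y) psi0. ennreal (d_KF leb a b) <= ennreal 1" for a
   using le Y.feat_nonempty unfolding pullback_def by blast
  show "EX a:pullback {0..1} (feat X) phi0. ennreal (d_KF leb a b) <= ennreal 1" for b
   using le X.feat_nonempty unfolding pullback_def by blast
 qed
 then have "?I <= ennreal 1" using INF_lower2[OF phi0] INF_lower2[OF psi0] by meson
 then have fin: "?I < top" using ennreal_less_top order.strict_trans1 by blast
 then obtain e' where e': "d_conc X Y < e'" "e' < e" using less dense by blast
 have e0: "0 <= d_conc X Y" by (simp add: d_conc_def)
 have "?I = ennreal (d_conc X Y)" using fin by (simp add: d_conc_def)
 then have "?I < ennreal e'" using e' e0 by (simp add: ennreal_less_iff)
 then obtain phi psi where phi: "phi : params X" "psi : params Y" "?H phi psi < ennreal e'" unfolding INF_less_iff by blast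
 have one: "obs_close e X phi Y psi" if X: "is_gds X" and Y: "is_gds Y" and phi: "phi : params X" "psi : params Y"
  and ex: "!!f. f : feat X ==> EX g:feat Y. d_KF leb (%t. f (phi t)) (%t. g (psi t)) < e'"
  for X :: "'c gds" and Y :: "'d gds" and phi psi
  unfolding obs_close_def
 proof
  interpret V: gds X by rule (rule X)
  interpret W: gds Y by rule (rule Y)
  fix f assume f: "f : feat_cl X"
  obtain f' where f': "f' : feat X" "near (meas X) (e - e') f f'" by (rule V.pw_closure_near[OF V.feat_Lip f, of "e - e'"]) (use e' in auto)
  have f'c: "f' : feat_cl X" using f'(1) V.feat_subset_cl by blast
  obtain g where g: "g : feat Y" "d_KF leb (%t. f' (phi t)) (%t. g (psi t)) < e'" using ex[OF f'(1)] by blast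
  have gc: "g : feat_cl Y" using g(1) W.feat_subset_cl by blast
  have n1: "near leb (e - e') (%t. f (phi t)) (%t. f' (phi t))" using params_near[OF X phi(1) f f'c] f'(2) by simp
  have n2: "near leb e' (%t. f' (phi t)) (%t. g (psi t))"
   by (rule leb.d_KF_near[OF paramsD(3)[OF X phi(1) f'c] paramsD(3)[OF Y phi(2) gc] g(2)])
  have "near leb (e - e' + e') (%t. f (phi t)) (%t. g (psi t))"
   by (rule leb.near_trans[OF paramsD(3)[OF X phi(1) f] paramsD(3)[OF X phi(1) f'c] paramsD(3)[OF Y phi(2) gc] n1 n2])
  then show "EX g:feat_cl Y. near leb e (%t. f (phi t)) (%t. g (psi t))" using gc by auto
 qed
 have lt: "x < e'" if "ennreal x < ennreal e'" for x using that by (meson ennreal_leI leD le_less_linear)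
 have "obs_close e X phi Y psi"
 proof (rule one[OF X Y phi(1,2)])
  fix f assume "f : feat X"
  then have "compose {0..1} f phi : pullback {0..1} (feat X) phi" by (simp add: pullback_def)
  from hausdorff_dist_lessD(1)[OF phi(3) this] show "EX g:feat Y. d_KF leb (%t. f (phi t)) (%t. g (psi t)) < e'"
   unfolding pullback_def using lt by (auto simp: d_KF_compose)
 qed
 moreover have "obs_close e Y psi X phi"
 proof (rule one[OF Y X phi(2,1)])
  fix g assume "g : feat Y"
  then have "compose {0..1} g psi : pullback {0..1} (feat Y) psi" by (simp add: pullback_def)
  from hausdorff_dist_lessD(2)[OF phi(3) this] show "EX f:feat X. d_KF leb (%t. g (psi t)) (%t. f (phi t)) < e'"
   unfolding pullback_def using lt by (auto simp: d_KF_compose d_KF_sym[of leb "%t. g (psi t)"])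
 qed
 ultimately show ?thesis using that phi(1,2) by blast
qed

section \<open>Pseudometric properties of the observable distance\<close>

lemma d_conc_nonneg: "0 <= d_conc X Y" by (simp add: d_conc_def)

lemma d_conc_sym: "d_conc X Y = d_conc Y X"
proof -
 have "hausdorff_dist (%f g. ennreal (d_KF leb f g)) A B = hausdorff_dist (%f g. ennreal (d_KF leb f g)) B A" for A B
  by (rule hausdorff_dist_sym) (simp add: d_KF_sym)
 then show ?thesis unfolding d_conc_def by (subst INF_commute) simp
qed

lemma d_conc_refl:
 assumes X: "is_gds X" shows "d_conc X X = 0"
proof -
 interpret X: gds X by rule fact
 obtain phi where phi: "phi : params X" by (rule X.params_nonempty)
 have "obs_close 0 X phi X phi" unfolding obs_close_def by (intro ballI, rule bexI) (auto simp: near_def)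
 then have "d_conc X X <= 0" by (intro d_conc_leI[OF X X phi phi]) auto
 then show ?thesis using d_conc_nonneg[of X X] by simp
qed

text \<open>One rearrangement serves all features at once: aligning the distances to the finitely
  many centres of a ball cover brings the points \<open>psi t\<close> and
  \<open>psi' (\<sigma> t)\<close> themselves within \<open>3 * d = e\<close>, and features are
  1-Lipschitz.\<close>

lemma params_align:
 assumes Y: "is_gds Y" and psi: "psi : params Y" "psi' : params Y" and e: "0 < e"
 obtains \<sigma> where "unit_mp \<sigma>" "ALL g:feat_cl Y. near leb e (%t. g (psi t)) (%t. g (psi' (\<sigma> t)))"
proof -
 interpret Y: gds Y by rule fact
 define d where "d = e / 3"
 have d: "0 < d" using e by (simp add: d_def)
 obtain K where K: "finite K" "K <= pts Y" "K ~= {}" "1 - d < Y.prob (UN x:K. Y.mball x d)" by (rule Y.finite_ball_cover[OF d d])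
 obtain k n where k: "0 < (n::nat)" "K = k ` {..<n}" "range k <= K" by (rule finite_family_seq[OF K(1,3)])
 have kp: "k i : pts Y" for i using k(3) K(2) by blast
 let ?a = "%i. \<lambda>y\<in>pts Y. gdist Y (k i) y"
 have aL: "?a i : Lip1_on (pts Y) (gdist Y)" for i
 proof -
  have "abs (gdist Y (k i) y - gdist Y (k i) z) <= gdist Y y z" if "y : pts Y" "z : pts Y" for y z
   using Y.triangle[OF kp that] Y.triangle[OF kp that(2,1)] Y.commute[of y z] by (simp add: abs_le_iff) (smt (verit))
  then show ?thesis by (simp add: Lip1_on_def)
 qed
 have r: "rvs (%i t. ?a i (\<chi>' t))" if "\<chi>' : params Y" for \<chi>'
  unfolding rvs_def using measurable_compose[OF paramsD(1)[OF Y that] Y.Lip1_measurable[OF aL]] by blast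
 have l: "law leb (%i t. ?a i (\<chi>' t)) = law (meas Y) ?a" if "\<chi>' : params Y" for \<chi>'
  by (rule law_distr[of \<chi>' leb "meas Y" ?a, OF paramsD(1,2)[OF Y that] Y.Lip1_measurable[OF aL]])
 \<comment> \<open>A truncation level above \<open>2 * d\<close> recognises whether a distance is
   below \<open>2 * d\<close>.\<close>
 obtain q :: nat where q: "2 * d < real q" using reals_Archimedean2 by blast
 define N where "N = max n q"
 obtain \<sigma> where \<sigma>: "unit_mp \<sigma>" "apx N d (%i t. ?a i (psi t)) (%i t. ?a i (psi' (\<sigma> t)))"
  by (rule law_align[OF r[OF psi(1)] r[OF psi(2)] _ d, of N]) (use l psi in auto)
 have psis: "(%t. psi' (\<sigma> t)) : params Y" by (rule params_mp[OF Y psi(2) \<sigma>(1)])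
 let ?U = "UN x:K. Y.mball x d"
 have Us: "?U : sets (meas Y)" by (rule sets.finite_UN[OF K(1)]) simp
 let ?V = "{t:{0..1}. psi t : ?U}" and ?B = "apx_set N d (%i t. ?a i (psi t)) (%i t. ?a i (psi' (\<sigma> t)))"
 have Vs: "?V : sets leb" using measurable_sets[OF paramsD(1)[OF Y psi(1)] Us] by (simp add: vimage_def Int_def conj_commute)
 have Bs: "?B : sets leb" by (rule apx_set_sets[OF r[OF psi(1)] r[OF psis]])
 have "Y.prob ?U = leb.prob ?V"
  by (subst paramsD(2)[OF Y psi(1), symmetric], subst measure_distr[OF paramsD(1)[OF Y psi(1)] Us]) (auto intro!: arg_cong[where f="measure leb"])
 then have m: "1 - leb.prob (?V - ?B) <= e"
  using leb.finite_measure_Diff'[OF Vs Bs] leb.finite_measure_mono[OF Int_lower2 Bs, of ?V] K(4) \<sigma>(2) d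
  unfolding apx_def d_def by linarith
 show ?thesis
 proof (rule that[OF \<sigma>(1)], rule ballI)
  fix g assume g: "g : feat_cl Y"
  show "near leb e (%t. g (psi t)) (%t. g (psi' (\<sigma> t)))"
  proof (rule leb.nearI_subset[OF sets.Diff[OF Vs Bs] m])
   fix t assume t: "t : ?V - ?B"
   then have t1: "t : {0..1}" "psi t : ?U" "t ~: ?B" by auto
   obtain i where i: "i < n" "psi t : Y.mball (k i) d" using t1(2) k(2) by blast
   have p: "psi t : pts Y" "psi' (\<sigma> t) : pts Y" using params_space[OF Y psi(1) t1(1)] params_space[OF Y psis t1(1)] by auto
   have "abs (trunc N (gdist Y (k i) (psi t)) - trunc N (gdist Y (k i) (psi' (\<sigma> t)))) <= d / 2"
    using apx_set_notin[OF t1(1,3), of i] i(1) p by (simp add: N_def)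
   moreover have b: "gdist Y (k i) (psi t) < d" using i(2) by simp
   moreover have "trunc N (gdist Y (k i) (psi t)) = gdist Y (k i) (psi t)"
    by (rule trunc_id) (use b q d Y.nonneg[of "k i" "psi t"] in \<open>simp add: N_def\<close>)
   ultimately have tr: "trunc N (gdist Y (k i) (psi' (\<sigma> t))) < 2 * d" using d by linarith
   have "gdist Y (k i) (psi' (\<sigma> t)) < 2 * d"
   proof (rule ccontr)
    assume "~ ?thesis"
    moreover have "2 * d < real N" using q by (simp add: N_def)
    ultimately have "2 * d <= trunc N (gdist Y (k i) (psi' (\<sigma> t)))" by (simp add: trunc_def)
    then show False using tr by simp
   qed
   then have "gdist Y (psi t) (psi' (\<sigma> t)) <= e"
    using Y.triangle[OF p(1) kp p(2), of i] b Y.commute[of "k i" "psi t"] by (simp add: d_def)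
   then show "abs (g (psi t) - g (psi' (\<sigma> t))) <= e" using Y.feat_clD[OF g p] by linarith
  qed
 qed
qed

lemma obs_close_trans:
 assumes X: "is_gds X" and Y: "is_gds Y" and Z: "is_gds Z" and p: "phi : params X" "psi : params Y" "psi' : params Y" "\<chi>' : params Z"
  and c: "obs_close a X phi Y psi" "obs_close b Y psi' Z \<chi>'" and n: "ALL g:feat_cl Y. near leb d (%t. g (psi t)) (%t. g (psi' t))"
 shows "obs_close (a + (d + b)) X phi Z \<chi>'"
 unfolding obs_close_def
proof
 fix f assume f: "f : feat_cl X"
 obtain g where g: "g : feat_cl Y" "near leb a (%t. f (phi t)) (%t. g (psi t))" using c(1) f unfolding obs_close_def by blast
 obtain h where h: "h : feat_cl Z" "near leb b (%t. g (psi' t)) (%t. h (\<chi>' t))" using c(2) g(1) unfolding obs_close_def by blast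
 note m = paramsD(3)[OF X p(1) f] paramsD(3)[OF Y p(2) g(1)] paramsD(3)[OF Y p(3) g(1)] paramsD(3)[OF Z p(4) h(1)]
 have "near leb (d + b) (%t. g (psi t)) (%t. h (\<chi>' t))" using leb.near_trans[OF m(2,3,4) _ h(2)] n g(1) by blast
 from leb.near_trans[OF m(1,2,4) g(2) this] show "EX h:feat_cl Z. near leb (a + (d + b)) (%t. f (phi t)) (%t. h (\<chi>' t))"
  using h(1) by blast
qed

lemma obs_close_mp:
 assumes X: "is_gds X" and Y: "is_gds Y" and p: "phi : params X" "psi : params Y" and c: "obs_close e X phi Y psi" and \<tau>: "unit_mp \<tau>"
 shows "obs_close e X (%t. phi (\<tau> t)) Y (%t. psi (\<tau> t))"
 unfolding obs_close_def
proof
 fix f assume f: "f : feat_cl X"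
 obtain g where g: "g : feat_cl Y" "near leb e (%t. f (phi t)) (%t. g (psi t))" using c f unfolding obs_close_def by blast
 have "near leb e (%t. f (phi (\<tau> t))) (%t. g (psi (\<tau> t)))"
  using near_distr[of \<tau> leb leb "%t. f (phi t)" "%t. g (psi t)" e] \<tau> paramsD(3)[OF X p(1) f] paramsD(3)[OF Y p(2) g(1)] g(2)
  by (simp add: unit_mp_def)
 then show "EX g:feat_cl Y. near leb e (%t. f (phi (\<tau> t))) (%t. g (psi (\<tau> t)))" using g(1) by blast
qed

text \<open>The two estimates use different parametrisations of \<open>Y\<close>. Aligning these up
  to \<open>e / 3\<close> takes the place of gluing couplings.\<close>

lemma d_conc_triangle:
 assumes X: "is_gds X" and Y: "is_gds Y" and Z: "is_gds Z"
 shows "d_conc X Z <= d_conc X Y + d_conc Y Z"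
proof (rule field_le_epsilon)
 fix e :: real assume "0 < e"
 then have e: "0 < e / 3" by simp
 define a b where "a = d_conc X Y + e / 3" and "b = d_conc Y Z + e / 3"
 have ab: "d_conc X Y < a" "d_conc Y Z < b" "0 <= a" "0 <= b" using e d_conc_nonneg[of X Y] d_conc_nonneg[of Y Z] unfolding a_def b_def by linarith+
 obtain phi psi where p: "phi : params X" "psi : params Y" and c: "obs_close a X phi Y psi" "obs_close a Y psi X phi"
  by (rule d_conc_lessE[OF X Y ab(1)]) (rule that)
 obtain psi' \<chi>' where p': "psi' : params Y" "\<chi>' : params Z" and c': "obs_close b Y psi' Z \<chi>'" "obs_close b Z \<chi>' Y psi'"
  by (rule d_conc_lessE[OF Y Z ab(2)]) (rule that)
 obtain \<sigma> where \<sigma>: "unit_mp \<sigma>" "ALL g:feat_cl Y. near leb (e / 3) (%t. g (psi t)) (%t. g (psi' (\<sigma> t)))"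
  by (rule params_align[OF Y p(2) p'(1) e]) (rule that)
 note ps = params_mp[OF Y p'(1) \<sigma>(1)] params_mp[OF Z p'(2) \<sigma>(1)]
 have "d_conc X Z <= a + (e / 3 + b)"
 proof (rule d_conc_leI[OF X Z p(1) ps(2)])
  show "obs_close (a + (e / 3 + b)) X phi Z (%t. \<chi>' (\<sigma> t))"
   by (rule obs_close_trans[OF X Y Z p ps c(1) obs_close_mp[OF Y Z p' c'(1) \<sigma>(1)] \<sigma>(2)])
  have "obs_close (b + (e / 3 + a)) Z (%t. \<chi>' (\<sigma> t)) X phi"
   by (rule obs_close_trans[OF Z Y X ps(2,1) p(2,1) obs_close_mp[OF Z Y p'(2,1) c'(2) \<sigma>(1)] c(2)]) (use \<sigma>(2) near_sym in blast)
  then show "obs_close (a + (e / 3 + b)) Z (%t. \<chi>' (\<sigma> t)) X phi" by (simp add: add.commute add.left_commute)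
 qed (use ab e in simp)
 then show "d_conc X Z <= d_conc X Y + d_conc Y Z + e" unfolding a_def b_def by simp
qed

text \<open>Half of \<open>e\<close> pays for the alignment of laws. With
  \<open>d = e / (4 * (N + 1))\<close> the \<open>N\<close> exceptional sets of mass
  \<open>d\<close> fit into the other half, as do the deviations.\<close>

lemma approximable_if_d_conc:
 assumes X: "is_gds X" and Y: "is_gds Y" and e: "0 < e" and less: "d_conc X Y < e / (4 * (real N + 1))" and u: "u : feature_rvs X"
 shows "EX v:feature_rvs Y. apx N e u v"
proof -
 define d where "d = e / (4 * (real N + 1))"
 have d0: "0 < e / (4 * (real N + 1))" using e by simp
 interpret X: gds X by rule (rule X)
 interpret Y: gds Y by rule (rule Y)
 obtain phi psi where p: "phi : params X" "psi : params Y" and c: "obs_close d X phi Y psi"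
  by (rule d_conc_lessE[OF X Y less[folded d_def]]) (rule that)
 obtain f where f: "!!i. f i : feat_cl X" "law leb u = law (meas X) f" and ur: "rvs u" by (rule feature_rvsE[OF u]) blast
 have "ALL i. EX g. g : feat_cl Y & near leb d (%t. f i (phi t)) (%t. g (psi t))" using c f(1) unfolding obs_close_def by blast
 then obtain g where g: "!!i. g i : feat_cl Y" "!!i. near leb d (%t. f i (phi t)) (%t. g i (psi t))" by metis
 note F = params_rvs[of X phi f, OF X p(1) f(1)] and G = params_rvs[of Y psi g, OF Y p(2) g(1)]
 note r = F(1) G(1)
 have "4 * (real N + 1) * d = e" "0 < d" using d0 by (simp_all add: d_def add_nonneg_eq_0_iff)
 then have "4 * (real N * d) + 4 * d = e" "0 <= real N * d" "0 < d" by (simp_all add: algebra_simps)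
 then have d: "real N * d <= e / 2" "d <= e / 2 / 2" by linarith+
 have e2: "0 < e / 2" using e by simp
 obtain \<tau> where \<tau>: "unit_mp \<tau>" "apx N (e / 2) u (%i t. f i (phi (\<tau> t)))"
  by (rule law_align[OF ur r(1) _ e2, of N]) (use F(2) f(2) in auto)
 have r': "rvs (%i t. f i (phi (\<tau> t)))" "rvs (%i t. g i (psi (\<tau> t)))"
  using rvs_mp[OF r(1) \<tau>(1)] rvs_mp[OF r(2) \<tau>(1)] by simp_all
 have "apx N (e / 2) (%i t. f i (phi (\<tau> t))) (%i t. g i (psi (\<tau> t)))"
  using apx_mp[OF near_apx[OF g(2) r d] \<tau>(1) r] by simp
 from apx_trans[OF ur r' \<tau>(2) this] have ap: "apx N e u (%i t. g i (psi (\<tau> t)))" by simp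
 from feature_rvs_mp[OF G(3) \<tau>(1)] ap show "EX v:feature_rvs Y. apx N e u v" by blast
qed


section \<open>Approximation of features bounds the observable distance\<close>

text \<open>The strict inequality survives a small increase of the threshold, by continuity from
  below; a finite packing thus has a positive margin.\<close>

lemma (in prob_space) not_near_strict:
 assumes f: "f : borel_measurable M" and g: "g : borel_measurable M" and n: "~ near M e f g"
 shows "EX d>0. ~ near M (e + d) f g"
proof -
 let ?S = "%c. {x:space M. abs (f x - g x) > c}"
 define m where "m = prob (?S e)"
 have m: "m > e" using n by (simp add: near_def m_def)
 have S: "?S c : events" for c by (rule near_sets[OF f g])
 define c where "c k = 1 / real (Suc k)" for k
 have c: "0 < c k" "i <= j ==> c j <= c i" for i j k unfolding c_def by (auto intro!: divide_left_mono)
 have "(%k. prob (?S (e + c k))) \<longlonglongrightarrow> prob (\<Union>k. ?S (e + c k))"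
 proof (rule finite_Lim_measure_incseq)
  show "incseq (%k. ?S (e + c k))" unfolding incseq_def using c(2) by (force intro: order.strict_trans1)
 qed (use S in auto)
 moreover have "(\<Union>k. ?S (e + c k)) = ?S e"
 proof
  show "?S e <= (\<Union>k. ?S (e + c k))"
  proof
   fix x assume x: "x : ?S e"
   then obtain k where "c k < abs (f x - g x) - e" using nat_approx_posE[of "abs (f x - g x) - e"] by (auto simp: c_def)
   then have "x : ?S (e + c k)" using x by auto
   then show "x : (\<Union>k. ?S (e + c k))" by blast
  qed
  show "(\<Union>k. ?S (e + c k)) <= ?S e"
  proof (rule UN_least)
   show "?S (e + c k) <= ?S e" for k using c(1)[of k] by auto
  qed
 qed
 ultimately have lim: "(%k. prob (?S (e + c k))) \<longlonglongrightarrow> m" by (simp add: m_def)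
 have "\<forall>\<^sub>F k in sequentially. (m + e) / 2 < prob (?S (e + c k))" by (rule order_tendstoD(1)[OF lim]) (use m in simp)
 moreover have "\<forall>\<^sub>F k in sequentially. c k < (m - e) / 2"
  unfolding c_def by (rule order_tendstoD(2)[OF LIMSEQ_Suc[OF lim_1_over_n]]) (use m in simp)
 ultimately have "\<forall>\<^sub>F k in sequentially. e + c k < prob (?S (e + c k))"
 proof eventually_elim
  case (elim k)
  have "e + c k < (m + e) / 2" using elim(2) by (simp add: field_simps)
  then show ?case using elim(1) by (rule order.strict_trans)
 qed
 then obtain k where "e + c k < prob (?S (e + c k))" by (auto simp: eventually_sequentially)
 then show ?thesis using c(1) by (intro exI[of _ "c k"]) (simp add: near_def not_le)
qed

text \<open>A median up to an error of 1, found as the last step of a unit grid before the upper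
  tail drops below 1/2.\<close>

lemma (in prob_space) integer_median:
 assumes f: "f : borel_measurable M"
 obtains c :: real where "prob {x:space M. f x >= c} >= 1 / 2" "prob {x:space M. f x < c + 1} >= 1 / 2"
proof -
 obtain R where R: "prob {x:space M. abs (f x) > R} <= 1 / 4" by (rule tight_rv[OF prob_space_axioms f, of "1 / 4"]) auto
 have S: "{x:space M. c <= f x} : events" "{x:space M. f x < c} : events" "{x:space M. abs (f x) > c} : events" for c
  by (rule borel_measurable_le[OF borel_measurable_const f], rule borel_measurable_less[OF f borel_measurable_const],
    rule abs_greater_sets[OF f])
 have compl: "prob {x:space M. f x < c} = 1 - prob {x:space M. c <= f x}" for c
 proof -
  have "{x:space M. f x < c} = space M - {x:space M. c <= f x}" by auto
  then show ?thesis using prob_compl[OF S(1)] by simp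
 qed
 let ?p = "%k::nat. prob {x:space M. real k - abs R - 1 <= f x}"
 obtain q :: nat where q: "2 * abs R + 2 < real q" using reals_Archimedean2 by blast
 have pq: "?p q < 1 / 2"
 proof -
  have "?p q <= prob {x:space M. abs (f x) > R}" by (rule finite_measure_mono[OF _ S(3)]) (use q in auto)
  then show ?thesis using R by simp
 qed
 have p0: "~ ?p 0 < 1 / 2"
 proof -
  have "prob {x:space M. f x < - abs R - 1} <= prob {x:space M. abs (f x) > R}" by (rule finite_measure_mono[OF _ S(3)]) auto
  then show ?thesis using R compl[of "- abs R - 1"] by simp
 qed
 define k where "k = (LEAST k. ?p k < 1 / 2)"
 have k: "?p k < 1 / 2" unfolding k_def by (rule LeastI[of "%k. ?p k < 1 / 2", OF pq])
 then obtain j where j: "k = Suc j" using p0 by (cases k) auto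
 have "~ ?p j < 1 / 2" by (rule not_less_Least) (use j in \<open>simp add: k_def\<close>)
 moreover have "prob {x:space M. f x < (real j - abs R - 1) + 1} >= 1 / 2" using k compl[of "real j - abs R"] unfolding j by (simp add: algebra_simps)
 ultimately show ?thesis using that[of "real j - abs R - 1"] by simp
qed

lemma apx_near:
 assumes "apx N e u v" "rvs u" "rvs v" "i < N" "0 <= R" "R <= real N" "0 <= e"
 shows "near leb e (%t. trunc R (u i t)) (%t. trunc R (v i t))"
proof -
 have "{t:space leb. abs (trunc R (u i t) - trunc R (v i t)) > e} <= apx_set N e u v"
 proof
  fix t assume t: "t : {t:space leb. abs (trunc R (u i t) - trunc R (v i t)) > e}"
  then have "e / 2 < abs (trunc N (u i t) - trunc N (v i t))"
   using trunc_mono_diff[OF assms(5,6), of "u i t" "v i t"] assms(7) by simp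
  then show "t : apx_set N e u v" using t assms(4) unfolding apx_set_def by auto
 qed
 from leb.finite_measure_mono[OF this apx_set_sets[OF assms(2,3)]] show ?thesis
  using assms(1) by (simp add: near_def apx_def)
qed

definition approximable :: "nat => real => 'a gds => 'b gds => bool" where
 "approximable N e X Y \<longleftrightarrow> (ALL u:feature_rvs X. EX v:feature_rvs Y. apx N e u v)"

lemma approximable_params:
 assumes ap: "approximable N e X Y" and X: "is_gds X" and Y: "is_gds Y" and e: "0 < e"
  and phi: "phi : params X" and f: "!!i. f i : feat_cl X"
 obtains g psi where "psi : params Y" "!!i. g i : feat_cl Y" "apx N (2 * e) (%i t. f i (phi t)) (%i t. g i (psi t))"
  "rvs (%i t. f i (phi t))" "rvs (%i t. g i (psi t))"
proof -
 note F = params_rvs[of X phi f, OF X phi f]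
 obtain v where v: "v : feature_rvs Y" "apx N e (%i t. f i (phi t)) v" using ap F(3) unfolding approximable_def by blast
 obtain g psi where g: "psi : params Y" "!!i. g i : feat_cl Y" "apx N e v (%i t. g i (psi t))"
  by (rule feature_rvs_params[OF Y v(1) e, of N]) (rule that)
 note G = params_rvs(1)[of Y psi g, OF Y g(1,2)]
 show ?thesis
  by (rule that[OF g(1,2) _ F(1) G]) (use apx_trans[OF F(1) feature_rvs_rvs[OF v(1)] G v(2) g(3)] in simp)
qed

context monoidal_family
begin

lemma shift_feat:
 assumes "is_gds X" "closed_gds X" "f : feat_cl X"
 obtains g where "g : feat_cl X" "!!x. x : pts X ==> g x = f x + c"
 using closed_gdsD[OF assms(2) L_shift assms(3), of c] that by (auto simp: compose_def)

lemma trunc_feat: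
 assumes "is_gds X" "closed_gds X" "f : feat_cl X" "0 <= R"
 obtains g where "g : feat_cl X" "!!x. x : pts X ==> g x = trunc R (f x)"
 using closed_gdsD[OF assms(2) L_trunc[OF assms(4)] assms(3)] that by (auto simp: compose_def)

lemma shift_match:
 assumes Y: "is_gds Y" "closed_gds Y" and psi: "psi : params Y" and k: "k : feat_cl Y"
  and b: "!!t. t : {0..1} ==> b t = f t - c" and n: "near leb e b (%t. k (psi t))"
 shows "EX g:feat_cl Y. near leb e f (%t. g (psi t))"
proof -
 obtain g where g: "g : feat_cl Y" "!!y. y : pts Y ==> g y = k y + c" by (rule shift_feat[OF Y k]) (rule that)
 have "near leb e f (%t. g (psi t))"
  using n g(2)[OF params_space[OF Y(1) psi]] b unfolding near_def by (auto simp: algebra_simps cong: conj_cong)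
 then show ?thesis using g(1) by blast
qed

text \<open>Truncating the counterparts in \<open>Y\<close> at \<open>R\<close> leaves the already
  bounded features of \<open>X\<close> alone and does not increase differences. All \<open>N\<close>
  features share a single parametrisation of \<open>Y\<close>.\<close>

lemma bounded_match:
 assumes ap: "approximable N e X Y" and X: "is_gds X" and Y: "is_gds Y" "closed_gds Y" and e: "0 < e" and phi: "phi : params X"
  and f: "!!i. f i : feat_cl X" and fR: "!!i x. i < N ==> x : pts X ==> abs (f i x) <= R" and R: "0 <= R" "R <= real N"
 obtains g psi where "psi : params Y" "!!i. g i : feat_cl Y" "!!i y. y : pts Y ==> abs (g i y) <= R"
  "!!i. i < N ==> near leb (2 * e) (%t. f i (phi t)) (%t. g i (psi t))"
proof -
 obtain k psi where psi: "psi : params Y" and k: "!!i. k i : feat_cl Y" and fk: "apx N (2 * e) (%i t. f i (phi t)) (%i t. k i (psi t))"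
  and r: "rvs (%i t. f i (phi t))" "rvs (%i t. k i (psi t))"
  by (rule approximable_params[OF ap X Y(1) e phi f]) (rule that)
 have "EX g. g : feat_cl Y & (ALL y:pts Y. g y = trunc R (k i y))" for i by (rule trunc_feat[OF Y k R(1), of i]) blast
 then obtain g where g: "!!i. g i : feat_cl Y" "!!i y. y : pts Y ==> g i y = trunc R (k i y)" by metis
 show ?thesis
 proof (rule that[OF psi g(1)])
  show "abs (g i y) <= R" if "y : pts Y" for i y using g(2)[OF that] trunc_bounds(3)[OF R(1)] by simp
  show "near leb (2 * e) (%t. f i (phi t)) (%t. g i (psi t))" if i: "i < N" for i
  proof -
   have "near leb (2 * e) (%t. trunc R (f i (phi t))) (%t. trunc R (k i (psi t)))"
    by (rule apx_near[OF fk r i R]) (use e in simp)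
   moreover have "trunc R (f i (phi t)) = f i (phi t)" "trunc R (k i (psi t)) = g i (psi t)" if "t : {0..1}" for t
    using trunc_id[OF fR[OF i params_space[OF X phi that]]] g(2)[OF params_space[OF Y(1) psi that]] by simp_all
   ultimately show ?thesis unfolding near_def by (auto cong: conj_cong)
  qed
 qed
qed

text \<open>A feature \<open>q\<close> of \<open>Y\<close> with median near 0 is close to a feature \<open>k\<close> of \<open>X\<close>, whose oscillation on
 the ball of radius \<open>r\<close> is at most \<open>2 * r\<close>: so \<open>q\<close> is bounded up to small measure.\<close>

lemma median_feature_bounded:
 assumes X: "is_gds X" and Y: "is_gds Y" and ap: "approximable N e Y X" and e: "0 < e" "e <= 1 / 16"
  and ball: "x0 : pts X" "0 < r" "1 - d < measure (meas X) (Metric_space.mball (pts X) (gdist X) x0 r)" "d <= 1 / 8"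
  and N: "2 * r + 3 < real N" and q: "q : feat_cl Y"
  and med: "measure (meas Y) {y:space (meas Y). q y >= 0} >= 1 / 2" "measure (meas Y) {y:space (meas Y). q y < 1} >= 1 / 2"
 shows "measure (meas Y) {y:space (meas Y). abs (q y) > 2 * r + 3} <= d + 2 * e"
proof -
 interpret X: gds X by rule fact
 interpret Y: gds Y by rule fact
 obtain psi where psi: "psi : params Y" by (rule Y.params_nonempty)
 obtain k phi where phi: "phi : params X" and k: "!!i. k i : feat_cl X"
  and ap2: "apx N (2 * e) (%i t. q (psi t)) (%i t. k i (phi t))" and r: "rvs (%i t. q (psi t))" "rvs (%i t. k i (phi t))"
  by (rule approximable_params[where f="%_. q", OF ap Y X e(1) psi q]) (rule that)
 have N0: "0 < N" using N ball(2) by (cases N) auto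
 let ?B = "apx_set N (2 * e) (%i t. q (psi t)) (%i t. k i (phi t))"
 have B: "?B : sets leb" "leb.prob ?B <= 2 * e" using apx_set_sets[OF r] ap2 by (auto simp: apx_def)
 have cl: "abs (trunc N (q (psi t)) - trunc N (k 0 (phi t))) <= e" if "t : {0..1}" "t ~: ?B" for t
  using apx_set_notin[OF that N0] by simp
 have Ys: "{t:{0..1}. psi t : A} : sets leb" "leb.prob {t:{0..1}. psi t : A} = Y.prob A" if "A : sets (meas Y)" for A
  using measurable_sets[OF paramsD(1)[OF Y psi] that] measure_distr[OF paramsD(1)[OF Y psi] that]
  by (simp_all add: paramsD(2)[OF Y psi] vimage_def Int_def conj_commute)
 let ?U = "X.mball x0 r"
 have Us: "{t:{0..1}. phi t : ?U} : sets leb" "leb.prob {t:{0..1}. phi t : ?U} = X.prob ?U"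
  using measurable_sets[OF paramsD(1)[OF X phi] X.mball_sets] measure_distr[OF paramsD(1)[OF X phi] X.mball_sets]
  by (simp_all add: paramsD(2)[OF X phi] vimage_def Int_def conj_commute)
 \<comment> \<open>Failure of either the approximation or of \<open>phi t\<close> lying in the ball.
   The mass is below \<open>d + 2 * e <= 1 / 4\<close>, so every set of mass at least 1/2 meets the
   complement.\<close>
 let ?C = "?B Un (space leb - {t:{0..1}. phi t : ?U})"
 have Cs: "?C : sets leb" by (rule sets.Un[OF B(1) sets.compl_sets[OF Us(1)]])
 have "leb.prob ?C <= leb.prob ?B + leb.prob (space leb - {t:{0..1}. phi t : ?U})"
  by (rule measure_Un_le[OF B(1) sets.compl_sets[OF Us(1)]])
 then have C: "leb.prob ?C < d + 2 * e" using B(2) leb.prob_compl[OF Us(1)] Us(2) ball(3) by linarith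
 have hit: "EX t:{0..1}. t ~: ?B & phi t : ?U & psi t : A" if A: "A : sets (meas Y)" "Y.prob A >= 1 / 2" for A
 proof (rule ccontr)
  assume no: "~ ?thesis"
  have "{t:{0..1}. psi t : A} <= ?C" using no by auto
  from leb.finite_measure_mono[OF this Cs] show False using Ys(2)[OF A(1)] A(2) C e(2) ball(4) by linarith
 qed
 have meas: "{y:space (meas Y). q y >= 0} : sets (meas Y)" "{y:space (meas Y). q y < 1} : sets (meas Y)"
  by (rule borel_measurable_le[OF borel_measurable_const Y.feat_cl_measurable[OF q]],
    rule borel_measurable_less[OF Y.feat_cl_measurable[OF q] borel_measurable_const])
 have osc: "abs (k 0 x0 - k 0 x) <= r" if "x : ?U" for x using X.feat_clD[OF k ball(1), of x 0] that by auto
 obtain t where t: "t : {0..1}" "t ~: ?B" "phi t : ?U" "q (psi t) >= 0" using hit[OF meas(1) med(1)] by auto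
 have N1: "real N > 3" using N ball(2) by linarith
 have "k 0 (phi t) >= - 1"
 proof (rule ccontr)
  assume "~ ?thesis"
  then have "trunc N (k 0 (phi t)) <= - 1" "0 <= trunc N (q (psi t))" using t(4) N1 by (auto simp: trunc_def)
  then show False using cl[OF t(1,2)] e(2) by linarith
 qed
 then have lo: "k 0 x0 >= - 1 - r" using osc[OF t(3)] by linarith
 obtain s where s: "s : {0..1}" "s ~: ?B" "phi s : ?U" "q (psi s) < 1" using hit[OF meas(2) med(2)] by auto
 have "k 0 (phi s) <= 2"
 proof (rule ccontr)
  assume "~ ?thesis"
  then have "trunc N (k 0 (phi s)) >= 2" "trunc N (q (psi s)) <= 1" using s(4) N1 by (auto simp: trunc_def)
  then show False using cl[OF s(1,2)] e(2) by linarith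
 qed
 then have hi: "k 0 x0 <= 2 + r" using osc[OF s(3)] by linarith
 \<comment> \<open>Outside \<open>?C\<close> the feature \<open>k 0\<close> differs by at most
   \<open>r\<close> from \<open>k 0 x0\<close>, which lies between \<open>- 1 - r\<close> and
   \<open>2 + r\<close>; so \<open>k 0\<close> is bounded by \<open>2 * r + 2\<close> there, and
   \<open>q\<close> by \<open>2 * r + 3\<close>.\<close>
 let ?T = "{y:space (meas Y). abs (q y) > 2 * r + 3}"
 have T: "?T : sets (meas Y)" by (rule abs_greater_sets[OF Y.feat_cl_measurable[OF q]])
 have "{t:{0..1}. psi t : ?T} <= ?C"
 proof (rule subsetI, rule ccontr)
  fix t assume t: "t : {t:{0..1}. psi t : ?T}" "t ~: ?C"
  then have t': "t : {0..1}" "t ~: ?B" "phi t : ?U" "abs (q (psi t)) > 2 * r + 3" by auto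
  have "abs (k 0 (phi t)) <= 2 * r + 2" using osc[OF t'(3)] lo hi by linarith
  moreover from this have "trunc N (k 0 (phi t)) = k 0 (phi t)" by (intro trunc_id) (use N in linarith)
  moreover have "abs (trunc N (q (psi t))) > 2 * r + 3" using t'(4) N ball(2) by (auto simp: trunc_def)
  ultimately show False using cl[OF t'(1,2)] e(2) by linarith
 qed
 from leb.finite_measure_mono[OF this Cs] show ?thesis using Ys(2)[OF T] C by linarith
qed

text \<open>The features \<open>h i\<close> form a maximal packing of the features of \<open>X\<close> bounded by \<open>R\<close>, and \<open>g i\<close> are their
 counterparts in \<open>Y\<close>. A feature of \<open>Y\<close> far from all \<open>g i\<close> would give a larger packing in \<open>X\<close>.\<close>

lemma d_conc_le_if_approximable:
 assumes X: "is_gds X" "closed_gds X" and eps: "0 < eps"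
 obtains N e where "0 < e" "!!Y :: 'b gds. is_gds Y ==> closed_gds Y ==> approximable N e X Y ==> approximable N e Y X ==> d_conc X Y <= eps"
proof -
 interpret X: gds X by rule (rule X)
 define eps' where "eps' = min (eps / 3) (1 / 8)"
 have eps': "0 < eps'" "3 * eps' <= eps" "eps' <= 1 / 8" using eps by (auto simp: eps'_def)
 obtain x0 r where ball: "x0 : pts X" "0 < r" "1 - eps' < X.prob (X.mball x0 r)" by (rule X.bounded_ball[OF eps'(1)])
 define R where "R = 2 * r + 3"
 have R: "0 <= R" "r <= R" using ball(2) by (auto simp: R_def)
 define S where "S = {f : feat_cl X. ALL x:pts X. abs (f x) <= R}"
 have SL: "S <= {f : Lip1_on (pts X) (gdist X). ALL x:pts X. abs (f x) <= R}" using X.feat_cl_Lip by (auto simp: S_def)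
 obtain H where H: "finite H" "H <= S" "ALL f:H. ALL g:H. f ~= g --> ~ near (meas X) eps' f g"
  and max: "ALL N'. finite N' & N' <= S & (ALL f:N'. ALL g:N'. f ~= g --> ~ near (meas X) eps' f g) --> card N' <= card H"
  by (rule X.max_packing[OF eps'(1) R(1) SL]) (rule that)
 define n where "n = card H"
 obtain h where h: "bij_betw h {..<n} H" using ex_bij_betw_nat_finite[OF H(1)] by (auto simp: n_def atLeast0LessThan)
 have hH: "h i : H" if "i < n" for i using h that by (auto simp: bij_betw_def)
 have hc: "h i : feat_cl X" and hR: "x : pts X ==> abs (h i x) <= R" if "i < n" for i x using hH[OF that] H(2) by (auto simp: S_def)
 \<comment> \<open>The margin by which the packing is separated; transferring to \<open>Y\<close>
   and back must cost less than this.\<close>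
 have "EX d>0. ALL f:H. ALL g:H. f ~= g --> ~ near (meas X) (eps' + d) f g"
 proof -
  have "EX d>0. f ~= g --> ~ near (meas X) (eps' + d) f g" if "f : H" "g : H" for f g
   using X.not_near_strict[of f g eps'] X.feat_cl_measurable that H(2,3) zero_less_one unfolding S_def by blast
  then obtain D where D: "!!f g. f : H ==> g : H ==> 0 < D f g & (f ~= g --> ~ near (meas X) (eps' + D f g) f g)" by metis
  define d where "d = Min (insert 1 ((%(f, g). D f g) ` (H \<times> H)))"
  have d: "0 < d" "!!f g. f : H ==> g : H ==> d <= D f g" unfolding d_def using H(1) D by (auto intro!: Min_le)
  have "~ near (meas X) (eps' + d) f g" if "f : H" "g : H" "f ~= g" for f g
  proof
   have m: "f : borel_measurable (meas X)" "g : borel_measurable (meas X)" using that(1,2) H(2) X.feat_cl_measurable unfolding S_def by blast+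
   assume "near (meas X) (eps' + d) f g"
   from X.near_mono[OF m this, of "eps' + D f g"] show False using d(2) D that by simp
  qed
  then show ?thesis using d(1) by blast
 qed
 then obtain \<eta> where \<eta>: "0 < \<eta>" "!!f g. f : H ==> g : H ==> f ~= g ==> ~ near (meas X) (eps' + \<eta>) f g" by blast
 \<comment> \<open>Going from \<open>X\<close> to \<open>Y\<close>, back to \<open>X\<close> and
   comparing pairs costs \<open>8 * e\<close> altogether, to be absorbed both by the margin
   \<open>\<eta>\<close> and by one copy of \<open>eps'\<close>.\<close>
 define e where "e = min (\<eta> / 8) (eps' / 8)"
 have e: "0 < e" "8 * e <= \<eta>" "8 * e <= eps'" "e <= 1 / 16" using \<eta>(1) eps' by (auto simp: e_def)
 obtain q :: nat where q: "R < real q" using reals_Archimedean2 by blast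
 \<comment> \<open>Besides the \<open>n\<close> packing elements one further feature has to be
   compared, so more than \<open>n\<close> coordinates are needed.\<close>
 define N where "N = max (Suc n) q"
 have N: "n < N" "R <= real N" "2 * r + 3 < real N" using q by (auto simp: N_def R_def)
 show ?thesis
 proof (rule that[OF e(1)])
  fix Y :: "'b gds" assume Y: "is_gds Y" "closed_gds Y" and ap: "approximable N e X Y" "approximable N e Y X"
  interpret Y: gds Y by rule (rule Y)
  obtain f0 where f0: "f0 : feat_cl X" using X.feat_nonempty X.feat_subset_cl by blast
  obtain z where z: "z : feat_cl X" "!!x. x : pts X ==> z x = trunc 0 (f0 x)" by (rule trunc_feat[OF X f0, of 0]) (use that in auto)
  \<comment> \<open>The finite packing is prolonged by the zero feature \<open>z\<close> to a
    sequence of bounded features.\<close>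
  define h' where "h' i = (if i < n then h i else z)" for i
  have h'c: "h' i : feat_cl X" for i using hc z(1) by (simp add: h'_def)
  obtain phi where phi: "phi : params X" by (rule X.params_nonempty)
  have h'R: "abs (h' i x) <= R" if "x : pts X" for i x using hR[OF _ that] R(1) z(2)[OF that] by (simp add: h'_def trunc_def)
  obtain g psi where psi: "psi : params Y" and g: "!!i. g i : feat_cl Y" and gR: "!!i y. y : pts Y ==> abs (g i y) <= R"
   and h'g: "!!i. i < N ==> near leb (2 * e) (%t. h' i (phi t)) (%t. g i (psi t))"
   by (rule bounded_match[where f=h' and R=R, OF ap(1) X(1) Y e(1) phi h'c h'R R(1) N(2)]) (assumption, rule that)
  have near_hg: "near leb (2 * e) (%t. h i (phi t)) (%t. g i (psi t))" if "i < n" for i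
   using h'g[of i] that N(1) by (simp add: h'_def)
  have X_to_Y: "EX k:feat_cl Y. near leb eps (%t. f (phi t)) (%t. k (psi t))" if f: "f : feat_cl X" for f
  proof -
   obtain b where b: "b : feat_cl X" "!!x. x : pts X ==> b x = f x + (- f x0)" by (rule shift_feat[OF X f]) (rule that)
   obtain s where s: "s : feat_cl X" "!!x. x : pts X ==> s x = trunc R (b x)" by (rule trunc_feat[OF X b(1) R(1)]) (rule that)
   have "s : S" using s trunc_bounds(3)[OF R(1)] by (simp add: S_def)
   then obtain k where k: "k : H" "near (meas X) eps' s k"
    by (rule X.max_packing_covers[OF H less_imp_le[OF eps'(1)] max]) (rule that)
   obtain i where i: "i < n" "k = h i" using h k(1) by (auto simp: bij_betw_def)
   have bs: "near (meas X) eps' b s"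
   proof (rule X.nearI_subset[OF X.mball_sets])
    show "1 - X.prob (X.mball x0 r) <= eps'" using ball(3) by simp
    fix x assume "x : X.mball x0 r"
    then have x: "x : pts X" "gdist X x0 x < r" by auto
    have "abs (b x) <= R" using X.feat_clD[OF f ball(1) x(1)] x R(2) b(2)[OF x(1)] by linarith
    then show "abs (b x - s x) <= eps'" using s(2)[OF x(1)] trunc_id eps'(1) by simp
   qed
   have "near (meas X) (eps' + eps') b (h i)"
    by (rule X.near_trans[OF _ _ _ bs k(2)[unfolded i(2)]]) (use b(1) s(1) hc[OF i(1)] X.feat_cl_measurable in auto)
   then have "near leb (eps' + eps') (%t. b (phi t)) (%t. h i (phi t))" using params_near[OF X(1) phi b(1) hc[OF i(1)]] by simp
   from leb.near_trans[OF paramsD(3)[OF X(1) phi b(1)] paramsD(3)[OF X(1) phi hc[OF i(1)]] paramsD(3)[OF Y(1) psi g] this near_hg[OF i(1)]]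
   have n: "near leb (eps' + eps' + 2 * e) (%t. b (phi t)) (%t. g i (psi t))" .
   have "near leb eps (%t. b (phi t)) (%t. g i (psi t))"
    by (rule leb.near_mono[OF paramsD(3)[OF X(1) phi b(1)] paramsD(3)[OF Y(1) psi g] n]) (use e eps' in linarith)
   then show ?thesis by (rule shift_match[OF Y psi g, rotated]) (use b(2)[OF params_space[OF X(1) phi]] in simp)
  qed
  \<comment> \<open>If \<open>s\<close> were far from all \<open>g i\<close>, the counterparts in
    \<open>X\<close> of \<open>g 0\<close>, ..., \<open>g (n - 1)\<close>, \<open>s\<close> would be
    \<open>n + 1\<close> bounded features that are pairwise not near, contradicting the maximal
    cardinality \<open>n\<close>. The \<open>g i\<close> remain separated among themselves by the
    margin \<open>\<eta>\<close>.\<close>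
  have packed: "EX i<n. near (meas Y) (eps' + 4 * e) s (g i)" if s: "s : feat_cl Y" "!!y. y : pts Y ==> abs (s y) <= R" for s
  proof (rule ccontr)
   assume far: "~ ?thesis"
   define a where "a i = (if i < n then g i else s)" for i
   have a: "a i : feat_cl Y" "y : pts Y ==> abs (a i y) <= R" for i y using g gR s by (auto simp: a_def)
   obtain b phi' where phi': "phi' : params X" and b: "!!i. b i : feat_cl X" "!!i x. x : pts X ==> abs (b i x) <= R"
    and near_ab: "!!i. i < N ==> near leb (2 * e) (%t. a i (psi t)) (%t. b i (phi' t))"
    by (rule bounded_match[where f=a and R=R, OF ap(2) Y(1) X e(1) psi a(1) a(2) R(1) N(2)]) (assumption, rule that)
   have am: "(%t. a i (psi t)) : borel_measurable leb" and bm: "(%t. b i (phi' t)) : borel_measurable leb" for i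
    by (rule paramsD(3)[OF Y(1) psi a(1)], rule paramsD(3)[OF X(1) phi' b(1)])
   have sep: "~ near (meas X) eps' (b i) (b j)" if ij: "i <= n" "j <= n" "i < j" for i j
   proof
    have iN: "i < N" "j < N" using ij N(1) by auto
    assume "near (meas X) eps' (b i) (b j)"
    then have "near leb eps' (%t. b i (phi' t)) (%t. b j (phi' t))" using params_near[OF X(1) phi' b(1) b(1)] by simp
    from leb.near_trans[OF am bm am near_ab[OF iN(1)] leb.near_trans[OF bm bm am this near_sym[OF near_ab[OF iN(2)]]]]
    have n1: "near leb (eps' + 4 * e) (%t. a i (psi t)) (%t. a j (psi t))" by (simp add: algebra_simps)
    then have n2: "near (meas Y) (eps' + 4 * e) (a i) (a j)" using params_near[OF Y(1) psi a(1) a(1)] by simp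
    have i: "i < n" using ij by simp
    show False
    proof (cases "j < n")
     case False
     then show False using far i near_sym[OF n2] by (auto simp: a_def)
    next
     case True
     note m = paramsD(3)[OF X(1) phi hc[OF i]] paramsD(3)[OF Y(1) psi g, of i] paramsD(3)[OF Y(1) psi g, of j] paramsD(3)[OF X(1) phi hc[OF True]]
     have n1': "near leb (eps' + 4 * e) (%t. g i (psi t)) (%t. g j (psi t))" using n1 i True by (simp add: a_def)
     from leb.near_trans[OF m(1,2,4) near_hg[OF i] leb.near_trans[OF m(2,3,4) n1' near_sym[OF near_hg[OF True]]]]
     have n3: "near leb (eps' + 8 * e) (%t. h i (phi t)) (%t. h j (phi t))" by (simp add: algebra_simps)
     have "near leb (eps' + \<eta>) (%t. h i (phi t)) (%t. h j (phi t))"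
      by (rule leb.near_mono[OF m(1,4) n3]) (use e(2) in simp)
     then have "near (meas X) (eps' + \<eta>) (h i) (h j)" using params_near[OF X(1) phi hc[OF i] hc[OF True]] by simp
     moreover have "h i ~= h j" using h i True ij(3) by (auto simp: bij_betw_def inj_on_def)
     ultimately show False using \<eta>(2) hH[OF i] hH[OF True] by blast
    qed
   qed
   then have sep': "~ near (meas X) eps' (b i) (b j)" if "i <= n" "j <= n" "i ~= j" for i j
    using that near_sym by (metis linorder_neqE_nat)
   have "near (meas X) eps' (b i) (b i)" for i using eps'(1) by (simp add: near_def)
   then have inj: "inj_on b {..n}" using sep' unfolding inj_on_def by (metis atMost_iff)
   have bS: "b ` {..n} <= S" using b by (auto simp: S_def)
   have "card (b ` {..n}) <= card H" using max bS sep' by (auto simp: image_iff)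
   then show False using card_image[OF inj] by (simp add: n_def)
  qed
  \<comment> \<open>No ball of large mass in \<open>Y\<close> is at hand to centre the feature, so
    it is centred at an approximate median; \<open>median_feature_bounded\<close> then shows that
    truncation at \<open>R\<close> changes it only on small mass.\<close>
  have Y_to_X: "EX k:feat_cl X. near leb eps (%t. f (psi t)) (%t. k (phi t))" if f: "f : feat_cl Y" for f
  proof -
   obtain c where c: "Y.prob {y:space (meas Y). f y >= c} >= 1 / 2" "Y.prob {y:space (meas Y). f y < c + 1} >= 1 / 2"
    by (rule Y.integer_median[OF Y.feat_cl_measurable[OF f]])
   obtain b where b: "b : feat_cl Y" "!!y. y : pts Y ==> b y = f y + (- c)" by (rule shift_feat[OF Y f]) (rule that)
   have "{y:space (meas Y). b y >= 0} = {y:space (meas Y). f y >= c}" "{y:space (meas Y). b y < 1} = {y:space (meas Y). f y < c + 1}"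
    using b(2) by auto
   then have bd: "Y.prob {y:space (meas Y). abs (b y) > R} <= eps' + 2 * e"
    unfolding R_def by (intro median_feature_bounded[OF X(1) Y(1) ap(2) e(1,4) ball eps'(3) N(3) b(1)]) (use c in simp_all)
   obtain s where s: "s : feat_cl Y" "!!y. y : pts Y ==> s y = trunc R (b y)" by (rule trunc_feat[OF Y b(1) R(1)]) (rule that)
   have bs: "near (meas Y) (eps' + 2 * e) b s"
   proof -
    have "{y:space (meas Y). abs (b y - s y) > eps' + 2 * e} <= {y:space (meas Y). abs (b y) > R}"
    proof (rule subsetI, rule ccontr)
     fix y assume y: "y : {y:space (meas Y). abs (b y - s y) > eps' + 2 * e}" "y ~: {y:space (meas Y). abs (b y) > R}"
     then have "s y = b y" using s(2)[of y] trunc_id[of "b y" R] by (simp add: not_less)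
     then show False using y(1) eps'(1) e(1) by simp
    qed
    from Y.finite_measure_mono[OF this abs_greater_sets[OF Y.feat_cl_measurable[OF b(1)]]]
    show ?thesis using bd unfolding near_def by linarith
   qed
   obtain i where i: "i < n" "near (meas Y) (eps' + 4 * e) s (g i)" using packed[OF s(1)] s(2) trunc_bounds(3)[OF R(1)] by auto
   have "near (meas Y) (eps' + 2 * e + (eps' + 4 * e)) b (g i)"
    by (rule Y.near_trans[OF _ _ _ bs i(2)]) (use b(1) s(1) g Y.feat_cl_measurable in auto)
   then have "near leb (eps' + 2 * e + (eps' + 4 * e)) (%t. b (psi t)) (%t. g i (psi t))" using params_near[OF Y(1) psi b(1) g] by simp
   from leb.near_trans[OF paramsD(3)[OF Y(1) psi b(1)] paramsD(3)[OF Y(1) psi g] paramsD(3)[OF X(1) phi hc[OF i(1)]] this near_sym[OF near_hg[OF i(1)]]]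
   have n: "near leb (eps' + 2 * e + (eps' + 4 * e) + 2 * e) (%t. b (psi t)) (%t. h i (phi t))" .
   have "near leb eps (%t. b (psi t)) (%t. h i (phi t))"
    by (rule leb.near_mono[OF paramsD(3)[OF Y(1) psi b(1)] paramsD(3)[OF X(1) phi hc[OF i(1)]] n]) (use e eps' in linarith)
   then show ?thesis by (rule shift_match[OF X phi hc[OF i(1)], rotated]) (use b(2)[OF params_space[OF Y(1) psi]] in simp)
  qed
  show "d_conc X Y <= eps"
   by (rule d_conc_leI[OF X(1) Y(1) phi psi]) (use X_to_Y Y_to_X eps in \<open>auto simp: obs_close_def\<close>)
 qed
qed

end


section \<open>The compactification\<close>

lemma metric_embedding_map:
 assumes A: "Metric_space A d" and B: "Metric_space B r" and im: "f ` A <= B"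
  and cont: "!!a eps. a : A ==> 0 < eps ==> EX \<delta>>0. ALL x:A. d a x < \<delta> --> r (f a) (f x) < eps"
  and inv: "!!a eps. a : A ==> 0 < eps ==> EX \<delta>>0. ALL x:A. r (f a) (f x) < \<delta> --> d a x < eps"
 shows "embedding_map (Metric_space.mtopology A d) (Metric_space.mtopology B r) f"
proof -
 interpret A: Metric_space A d by (rule A)
 interpret B: Metric_space B r by (rule B)
 interpret S: Submetric B r "f ` A" by unfold_locales (rule im)
 have inj: "inj_on f A"
 proof (rule inj_onI, rule ccontr)
  fix a x assume ax: "a : A" "x : A" "f a = f x" "a ~= x"
  then obtain \<delta> where "\<delta> > 0" "!!y. y : A ==> r (f a) (f y) < \<delta> ==> d a y < d a x" using inv[of a "d a x"] by auto
  from this(2)[OF ax(2)] show False using ax im `\<delta> > 0` B.mdist_zero[of "f x"] by auto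
 qed
 have "homeomorphic_maps A.mtopology S.sub.mtopology f (inv_into A f)"
  unfolding homeomorphic_maps_def
 proof (intro conjI)
  show "continuous_map A.mtopology S.sub.mtopology f"
   unfolding A.metric_continuous_map[OF S.sub.Metric_space_axioms] using cont by blast
  show "continuous_map S.sub.mtopology A.mtopology (inv_into A f)"
   unfolding S.sub.metric_continuous_map[OF A]
  proof (intro conjI ballI allI impI)
   show "inv_into A f ` f ` A <= A" using inj by simp
   fix y and eps :: real assume "y : f ` A" and eps: "0 < eps"
   then obtain a where a: "a : A" "y = f a" by blast
   obtain \<delta> where "\<delta> > 0" "ALL x:A. r (f a) (f x) < \<delta> --> d a x < eps" using inv[OF a(1) eps] by blast
   then show "EX \<delta>>0. ALL x. x : f ` A & r y x < \<delta> --> d (inv_into A f y) (inv_into A f x) < eps"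
    using a inj by (intro exI[of _ \<delta>]) auto
  qed
 qed (use inj in auto)
 then show ?thesis unfolding embedding_map_def homeomorphic_map_maps A.topspace_mtopology S.mtopology_submetric by blast
qed

context monoidal_family
begin

lemma approx_pyramid_of:
 assumes "A : DL L" "B : DL L"
 shows "approx N e (pyramid_of L A) (pyramid_of L B) \<longleftrightarrow> approximable N e (rep A) (rep B)"
 by (simp add: approx_def approximable_def family_rvs_pyramid_of assms)

text \<open>Distance zero makes every member of one pyramid approximable by the other at all levels,
  and \<open>approximable_in_pyramid\<close> turns this into membership.\<close>

lemma pyramids_metric: "Metric_space (pyramids L) rho"
proof
 show "0 <= rho P Q" for P Q by (rule rho_nonneg)
 show "rho P Q = rho Q P" for P Q by (rule rho_sym)
 show "rho P R <= rho P Q + rho Q R" if "P : pyramids L" "Q : pyramids L" "R : pyramids L" for P Q R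
  by (rule rho_triangle[OF that])
 fix P Q assume P: "P : pyramids L" and Q: "Q : pyramids L"
 have le: "P <= Q" if P: "P : pyramids L" and Q: "Q : pyramids L" and zero: "rho P Q = 0" for P Q
 proof
  fix A assume A: "A : P"
  show "A : Q"
  proof (rule approximable_in_pyramid[OF Q])
   show "A : DL L" using pyramidD(1)[OF P] A by blast
   fix N and e :: real assume "0 < e"
   then have "approx N e P Q" using approx_if_rho(1)[OF P Q, of N e] zero rho_weight_pos by simp
   then show "approx N e {A} Q" using A unfolding approx_def family_rvs_def by blast
  qed
 qed
 show "rho P Q = 0 \<longleftrightarrow> P = Q"
 proof
  assume "rho P Q = 0"
  then show "P = Q" using le[OF P Q] le[OF Q P] rho_sym by (metis subset_antisym)
 next
  assume PQ: "P = Q"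
  have "rho P P <= 0 + eps" if eps: "0 < eps" for eps
  proof -
   obtain K where K: "1 / 2 ^ K <= eps / 2" using pow2_small[of "eps / 2" 0 1] eps by auto
   have "approx K (eps / 2) P P" unfolding approx_def using apx_refl[of "eps / 2" K] eps by (meson half_gt_zero less_imp_le)
   from rho_le_if_approx[OF P P this this] show ?thesis using eps K by (simp add: power_one_over)
  qed
  then have "rho P P <= 0" by (rule field_le_epsilon)
  then show "rho P Q = 0" using rho_nonneg[of P P] PQ by simp
 qed
qed

lemma pyramids_compact: "compact_space (Metric_space.mtopology (pyramids L) rho)"
proof -
 interpret Metric_space "pyramids L" rho by (rule pyramids_metric)
 show ?thesis unfolding compact_space_sequentially
 proof (intro allI impI)
  fix Q :: "nat => gds_class set" assume Q: "range Q <= pyramids L"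
  obtain r P where r: "strict_mono (r :: nat => nat)" and P: "P : pyramids L" and lim: "(%j. rho (Q (r j)) P) \<longlonglongrightarrow> 0"
   by (rule pyramids_seq_compact[of Q]) (use Q in blast)+
  have "limitin mtopology (Q \<circ> r) P sequentially"
   unfolding limitin_metric
  proof (intro conjI P allI impI)
   fix eps :: real assume "0 < eps"
   then have "\<forall>\<^sub>F j in sequentially. rho (Q (r j)) P < eps" by (rule order_tendstoD(2)[OF lim])
   then show "\<forall>\<^sub>F j in sequentially. (Q \<circ> r) j : pyramids L & rho ((Q \<circ> r) j) P < eps" by eventually_elim (use Q in auto)
  qed
  then show "EX l r. l : pyramids L & strict_mono r & limitin mtopology (Q \<circ> r) l sequentially" using r P by blast
 qed
qed

text \<open>Distance zero gives mutual approximability, hence mutual domination, and antisymmetry of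
  domination for closed data sets identifies the classes.\<close>

lemma Dcirc_metric: "Metric_space (Dcirc L) d_conc_cls"
proof
 show "0 <= d_conc_cls A B" for A B by (simp add: d_conc_cls_def d_conc_nonneg)
 show "d_conc_cls A B = d_conc_cls B A" for A B unfolding d_conc_cls_def by (rule d_conc_sym)
 have g: "is_gds (rep A)" "closed_gds (rep A)" "A : DD" if "A : Dcirc L" for A
  using DL_D[OF subsetD[OF Dcirc_subset that]] .
 show "d_conc_cls A C <= d_conc_cls A B + d_conc_cls B C" if "A : Dcirc L" "B : Dcirc L" "C : Dcirc L" for A B C
  unfolding d_conc_cls_def by (rule d_conc_triangle[OF g(1)[OF that(1)] g(1)[OF that(2)] g(1)[OF that(3)]])
 have dom: "dominated (rep A) (rep B)" if A: "A : Dcirc L" and B: "B : Dcirc L" and zero: "d_conc (rep A) (rep B) = 0" for A B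
 proof (rule dominated_if_approximable[OF g(1)[OF A] g(1)[OF B]])
  fix u N and e :: real assume u: "u : feature_rvs (rep A)" and e: "0 < e"
  show "EX v:feature_rvs (rep B). apx N e u v"
   by (rule approximable_if_d_conc[OF g(1)[OF A] g(1)[OF B] e _ u]) (use zero e in simp)
 qed
 fix A B assume A: "A : Dcirc L" and B: "B : Dcirc L"
 show "d_conc_cls A B = 0 \<longleftrightarrow> A = B"
 proof
  assume "d_conc_cls A B = 0"
  then have z: "d_conc (rep A) (rep B) = 0" "d_conc (rep B) (rep A) = 0"
   using d_conc_sym[of "rep B" "rep A"] by (simp_all add: d_conc_cls_def)
  show "A = B"
   by (rule DD_eqI[OF g(3)[OF A] g(3)[OF B]], rule dominated_antisym[OF g(1)[OF A] g(1)[OF B] g(2)[OF A] dom[OF B A z(2)] dom[OF A B z(1)]])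
 qed (simp add: d_conc_cls_def d_conc_refl g(1) B)
qed

text \<open>The modulus for the inverse depends on the base point \<open>A\<close>, since the
  packing is chosen in \<open>A\<close>. Pointwise moduli in both directions suffice for a
  homeomorphism onto the image.\<close>

lemma pyramid_of_embedding:
 "embedding_map (Metric_space.mtopology (Dcirc L) d_conc_cls) (Metric_space.mtopology (pyramids L) rho) (pyramid_of L)"
proof (rule metric_embedding_map[OF Dcirc_metric pyramids_metric])
 have P: "pyramid_of L A : pyramids L" if "A : Dcirc L" for A using pyramid_of_in_pyramids Dcirc_subset that by blast
 then show "pyramid_of L ` Dcirc L <= pyramids L" by blast
 fix A and eps :: real assume A: "A : Dcirc L" and eps: "0 < eps"
 have AL: "A : DL L" using A Dcirc_subset by blast
 show "EX \<delta>>0. ALL B:Dcirc L. d_conc_cls A B < \<delta> --> rho (pyramid_of L A) (pyramid_of L B) < eps"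
 proof -
  define e where "e = eps / 3"
  have e: "0 < e" using eps by (simp add: e_def)
  obtain N where N: "1 / 2 ^ N <= e" using pow2_small[OF e, of 0 1] by auto
  let ?d = "e / (4 * (real N + 1))"
  have "rho (pyramid_of L A) (pyramid_of L B) < eps" if B: "B : Dcirc L" and less: "d_conc_cls A B < ?d" for B
  proof -
   have BL: "B : DL L" using B Dcirc_subset by blast
   have "approximable N e (rep A) (rep B)" "approximable N e (rep B) (rep A)"
    unfolding approximable_def
    using approximable_if_d_conc[OF DL_D(1)[OF AL] DL_D(1)[OF BL] e] approximable_if_d_conc[OF DL_D(1)[OF BL] DL_D(1)[OF AL] e]
     less d_conc_sym[of "rep A" "rep B"] unfolding d_conc_cls_def by metis+
   then have "rho (pyramid_of L A) (pyramid_of L B) <= e + (1 / 2) ^ N"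
    by (intro rho_le_if_approx[OF P[OF A] P[OF B] _ _ e]) (simp_all add: approx_pyramid_of AL BL)
   then show ?thesis using N eps by (simp add: e_def power_one_over)
  qed
  moreover have "0 < ?d" using e by simp
  ultimately show ?thesis by blast
 qed
 show "EX \<delta>>0. ALL B:Dcirc L. rho (pyramid_of L A) (pyramid_of L B) < \<delta> --> d_conc_cls A B < eps"
 proof -
  have eps2: "0 < eps / 2" using eps by simp
  obtain N e where e: "0 < e" "!!Y :: real gds. is_gds Y ==> closed_gds Y ==> approximable N e (rep A) Y ==> approximable N e Y (rep A) ==> d_conc (rep A) Y <= eps / 2"
   by (rule d_conc_le_if_approximable[OF DL_D(1,2)[OF AL] eps2]) (rule that)
  have "d_conc_cls A B < eps" if B: "B : Dcirc L" and less: "rho (pyramid_of L A) (pyramid_of L B) < rho_weight N * e" for B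
  proof -
   have BL: "B : DL L" using B Dcirc_subset by blast
   have "d_conc (rep A) (rep B) <= eps / 2"
    by (rule e(2)[OF DL_D(1,2)[OF BL]]) (use approx_if_rho[OF P[OF A] P[OF B] less] approx_pyramid_of AL BL in auto)
   then show ?thesis using eps by (simp add: d_conc_cls_def)
  qed
  moreover have "0 < rho_weight N * e" using e(1) rho_weight_pos by simp
  ultimately show ?thesis by blast
 qed
qed

end


theorem corollary8p3:
  fixes L :: "(real \<Rightarrow> real) set"
  assumes "L \<subseteq> Lip1_real" and "monoidal L" and "TB \<subseteq> L"
  shows "Metric_space (pyramids L) rho \<and>
    compactification (Dcirc L) d_conc_cls
      (let T = Metric_space.mtopology (pyramids L) rho
       in subtopology T (T closure_of (pyramid_of L ` Dcirc L)))
      (pyramid_of L)"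
proof -
 interpret monoidal_family L by unfold_locales (rule assms)+
 interpret Metric_space "pyramids L" rho by (rule pyramids_metric)
 let ?S = "pyramid_of L ` Dcirc L"
 have S: "?S <= mtopology closure_of ?S"
  by (rule closure_of_subset) (use pyramid_of_in_pyramids Dcirc_subset in auto)
 have "compact_space (subtopology mtopology (mtopology closure_of ?S))"
  by (intro compact_space_subtopology closedin_compact_space pyramids_compact closedin_closure_of)
 moreover have "embedding_map (Metric_space.mtopology (Dcirc L) d_conc_cls) (subtopology mtopology (mtopology closure_of ?S)) (pyramid_of L)"
  unfolding embedding_map_in_subtopology
  using pyramid_of_embedding S Metric_space.topspace_mtopology[OF Dcirc_metric] by simp
 moreover have "subtopology mtopology (mtopology closure_of ?S) closure_of ?S = topspace (subtopology mtopology (mtopology closure_of ?S))"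
  using S closure_of_subset_topspace[of mtopology ?S] by (simp add: closure_of_subtopology Int_absorb1 Int_absorb2 Int_commute)
 ultimately show ?thesis
  unfolding compactification_def Let_def using Dcirc_metric Metric_space_axioms by blast
qed

end
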